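(* For all integers $n,k\ge1$ there exists an $O(\log k)$-stretch correlated sampling algorithm for $\Delta_{n,k}$ (implied constant independent of $n,k$) which, in a dynamic setting where the input vector changes one coordinate at a time and the output $\mathcal{A}(\mathbf{x})$ for the current input must be maintained, has update time $O(\log n\cdot\log^* n)$ per change.
   Context: $\Delta_{n,k}=\{\mathbf{x}\in[0,1]^n:\|\mathbf{x}\|_1\le k\}$. A correlated sampling algorithm for $\Delta_{n,k}$ is a distribution $\mathcal{D}$ over deterministic maps $\mathcal{A}:\Delta_{n,k}\to2^{[n]}$, drawn once and applied to all inputs; it has stretch $\alpha$ if for all $\mathbf{x},\mathbf{y}\in\Delta_{n,k}$: (P1) $|\mathcal{A}(\mathbf{x})|\in\{\lfloor\|\mathbf{x}\|_1\rfloor,\lceil\|\mathbf{x}\|_1\rceil\}$ for all $\mathcal{A}$ in the support; (P2) $\Pr[i\in\mathcal{A}(\mathbf{x})]=x_i$ for all $i$; (P3) $\mathbb{E}|\mathcal{A}(\mathbf{x})\oplus\mathcal{A}(\mathbf{y})|\le\alpha\|\mathbf{x}-\mathbf{y}\|_1$. $\log^* n=\min\{i:\log^{(i)}n\le1\}$ where $\log^{(i)}$ is the $i$-fold iterated base-2 logarithm. *)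

theory Defs
  imports "HOL-Probability.Probability"
begin

section \<open>Correlated sampling\<close>

definition l1_norm :: "nat \<Rightarrow> (nat \<Rightarrow> real) \<Rightarrow> real" where
  "l1_norm n x = (\<Sum>i = 1..n. \<bar>x i\<bar>)"

text \<open>Since \<open>n\<close> is quantified inside the statement, a vector in \<open>\<real>\<^sup>n\<close> is an extensional function
  on \<open>{1..n}\<close>.\<close>

definition Delta :: "nat \<Rightarrow> nat \<Rightarrow> (nat \<Rightarrow> real) set" where
  "Delta n k = {x \<in> {1..n} \<rightarrow>\<^sub>E {0..1}. l1_norm n x \<le> real k}"

text \<open>A distribution over deterministic maps is a probability space whose points are such maps. Its
  \<open>\<sigma>\<close>-algebra may be any one containing the events that appear in the definition of stretch; the
  support is the whole space.\<close>

definition correlated_sampling_algorithm ::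
    "nat \<Rightarrow> nat \<Rightarrow> ((nat \<Rightarrow> real) \<Rightarrow> nat set) measure \<Rightarrow> bool" where
  "correlated_sampling_algorithm n k D \<longleftrightarrow>
     prob_space D \<and>
     space D \<subseteq> (Delta n k \<rightarrow>\<^sub>E Pow {1..n}) \<and>
     (\<forall>x \<in> Delta n k. \<forall>i \<in> {1..n}. {A \<in> space D. i \<in> A x} \<in> sets D)"

definition has_stretch ::
    "nat \<Rightarrow> nat \<Rightarrow> ((nat \<Rightarrow> real) \<Rightarrow> nat set) measure \<Rightarrow> real \<Rightarrow> bool" where
  "has_stretch n k D \<alpha> \<longleftrightarrow>
     (\<forall>x \<in> Delta n k. \<forall>y \<in> Delta n k.
        (\<forall>A \<in> space D. int (card (A x)) \<in> {\<lfloor>l1_norm n x\<rfloor>, \<lceil>l1_norm n x\<rceil>}) \<and>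
        (\<forall>i \<in> {1..n}. measure D {A \<in> space D. i \<in> A x} = x i) \<and>
        (\<integral>A. real (card (sym_diff (A x) (A y))) \<partial>D) \<le> \<alpha> * l1_norm n (\<lambda>i. x i - y i))"

text \<open>Once an iterate is at most 1, later ones may lie outside the domain of the logarithm; they
  do not affect the minimum.\<close>

definition log_star :: "nat \<Rightarrow> nat" where
  "log_star n = (LEAST i. ((log 2) ^^ i) (real n) \<le> 1)"


section \<open>A real RAM and its running time\<close>

text \<open>The machine is the usual real RAM: a memory of \<open>w\<close>-bit words, a separate memory of exact real
  numbers, and unit-cost operations on single cells. Addresses are words, and reals can only be
  combined arithmetically and compared: there is no rounding and no conversion from reals to words.
  In addition the machine maintains an explicit output set, changed one element per step.

  In the instructions below the arguments are addresses, except the second argument of \<open>WConst\<close>.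
  Constant addresses and constants belong to the fixed program text.\<close>

record state =
  words :: "nat \<Rightarrow> nat"
  reals :: "nat \<Rightarrow> real"
  outset :: "nat set"

datatype arith_op = Plus | Minus | Times | Divide | Modulo

datatype real_op = RPlus | RMinus | RTimes | RDivide

primrec word_arith :: "arith_op \<Rightarrow> nat \<Rightarrow> nat \<Rightarrow> nat" where
  "word_arith Plus a b = a + b"
| "word_arith Minus a b = a - b"
| "word_arith Times a b = a * b"
| "word_arith Divide a b = a div b"
| "word_arith Modulo a b = a mod b"

primrec real_arith :: "real_op \<Rightarrow> real \<Rightarrow> real \<Rightarrow> real" where
  "real_arith RPlus a b = a + b"
| "real_arith RMinus a b = a - b"
| "real_arith RTimes a b = a * b"
| "real_arith RDivide a b = a / b"

datatype instr =
    WConst nat nat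
  | WArith nat arith_op nat nat
  | WLoad nat nat
  | WStore nat nat
  | ROfWord nat nat
  | RArith nat real_op nat nat
  | RLoad nat nat
  | RStore nat nat
  | OutInsert nat
  | OutDelete nat

primrec step :: "nat \<Rightarrow> instr \<Rightarrow> state \<Rightarrow> state" where
  "step w (WConst a c) s = s\<lparr>words := (words s)(a := c mod 2 ^ w)\<rparr>"
| "step w (WArith a f b c) s =
     s\<lparr>words := (words s)(a := word_arith f (words s b) (words s c) mod 2 ^ w)\<rparr>"
| "step w (WLoad a b) s = s\<lparr>words := (words s)(a := words s (words s b))\<rparr>"
| "step w (WStore a b) s = s\<lparr>words := (words s)(words s a := words s b)\<rparr>"
| "step w (ROfWord a b) s = s\<lparr>reals := (reals s)(a := real (words s b))\<rparr>"
| "step w (RArith a f b c) s =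
     s\<lparr>reals := (reals s)(a := real_arith f (reals s b) (reals s c))\<rparr>"
| "step w (RLoad a b) s = s\<lparr>reals := (reals s)(a := reals s (words s b))\<rparr>"
| "step w (RStore a b) s = s\<lparr>reals := (reals s)(words s a := reals s b)\<rparr>"
| "step w (OutInsert a) s = s\<lparr>outset := insert (words s a) (outset s)\<rparr>"
| "step w (OutDelete a) s = s\<lparr>outset := outset s - {words s a}\<rparr>"

datatype test = WLess nat nat | WEq nat nat | RLess nat nat

primrec holds :: "test \<Rightarrow> state \<Rightarrow> bool" where
  "holds (WLess a b) s \<longleftrightarrow> words s a < words s b"
| "holds (WEq a b) s \<longleftrightarrow> words s a = words s b"
| "holds (RLess a b) s \<longleftrightarrow> reals s a < reals s b"

datatype program =
    Skip
  | Instr instr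
  | Seq program program
  | Cond test program program
  | While test program

text \<open>\<open>exec w P s t s'\<close>: with word size \<open>w\<close>, program \<open>P\<close> started in \<open>s\<close> terminates in \<open>s'\<close> after
  exactly \<open>t\<close> steps, where every instruction and every test counts as one step.\<close>

inductive exec :: "nat \<Rightarrow> program \<Rightarrow> state \<Rightarrow> nat \<Rightarrow> state \<Rightarrow> bool" for w where
  Skip: "exec w Skip s 1 s"
| Instr: "exec w (Instr c) s 1 (step w c s)"
| Seq: "exec w P s t s' \<Longrightarrow> exec w Q s' u s'' \<Longrightarrow> exec w (Seq P Q) s (t + u) s''"
| CondTrue: "holds b s \<Longrightarrow> exec w P s t s' \<Longrightarrow> exec w (Cond b P Q) s (1 + t) s'"
| CondFalse: "\<not> holds b s \<Longrightarrow> exec w Q s t s' \<Longrightarrow> exec w (Cond b P Q) s (1 + t) s'"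
| WhileFalse: "\<not> holds b s \<Longrightarrow> exec w (While b P) s 1 s"
| WhileTrue: "holds b s \<Longrightarrow> exec w P s t s' \<Longrightarrow> exec w (While b P) s' u s'' \<Longrightarrow>
    exec w (While b P) s (1 + t + u) s''"

lemma exec_deterministic:
  assumes "exec w P s t s'" and "exec w P s u s''"
  shows "u = t \<and> s'' = s'"
  using assms
proof (induction arbitrary: u s'' rule: exec.induct)
  case (Skip s) then show ?case by cases auto
next
  case (Instr c s) then show ?case by cases auto
next
  case (Seq P s t s' Q v r)
  from Seq.prems obtain t1 r1 v1
    where "u = t1 + v1" "exec w P s t1 r1" "exec w Q r1 v1 s''" by cases
  with Seq.IH show ?case by metis
next
  case (CondTrue b s P t s' Q)
  from CondTrue.prems CondTrue.hyps obtain t1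
    where "u = 1 + t1" "exec w P s t1 s''" by cases auto
  with CondTrue.IH show ?case by metis
next
  case (CondFalse b s Q t s' P)
  from CondFalse.prems CondFalse.hyps obtain t1
    where "u = 1 + t1" "exec w Q s t1 s''" by cases auto
  with CondFalse.IH show ?case by metis
next
  case (WhileFalse b s P)
  from WhileFalse.prems WhileFalse.hyps show ?case by cases auto
next
  case (WhileTrue b s P t s' v r)
  from WhileTrue.prems WhileTrue.hyps obtain t1 r1 v1
    where "u = 1 + t1 + v1" "exec w P s t1 r1" "exec w (While b P) r1 v1 s''" by cases auto
  with WhileTrue.IH show ?case by metis
qed


section \<open>Dynamic maintenance of the sample\<close>

text \<open>The change of coordinate \<open>i\<close> to the value \<open>v\<close> is passed to the update program in the cells
  with address 0.\<close>

definition pass_change :: "nat \<Rightarrow> real \<Rightarrow> state \<Rightarrow> state" where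
  "pass_change i v s = s\<lparr>words := (words s)(0 := i), reals := (reals s)(0 := v)\<rparr>"

text \<open>\<open>maintains w P T n k A cs x s\<close>: if \<open>s\<close> is the machine state for the current input \<open>x\<close>, then
  throughout the sequence \<open>cs\<close> of changes (up to the first one that leaves the domain) the output
  is the value of \<open>A\<close> at the current input, and each single change takes at most \<open>T\<close> steps.\<close>

primrec maintains :: "nat \<Rightarrow> program \<Rightarrow> real \<Rightarrow> nat \<Rightarrow> nat \<Rightarrow> ((nat \<Rightarrow> real) \<Rightarrow> nat set) \<Rightarrow>
    (nat \<times> real) list \<Rightarrow> (nat \<Rightarrow> real) \<Rightarrow> state \<Rightarrow> bool" where
  "maintains w P T n k A [] x s \<longleftrightarrow> outset s = A x"
| "maintains w P T n k A (c # cs) x s \<longleftrightarrow>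
     outset s = A x \<and>
     (case c of (i, v) \<Rightarrow>
        i \<in> {1..n} \<longrightarrow> x(i := v) \<in> Delta n k \<longrightarrow>
        (\<exists>t s'. exec w P (pass_change i v s) t s' \<and> real t \<le> T \<and>
                maintains w P T n k A cs (x(i := v)) s'))"

text \<open>The map \<open>A\<close> is drawn once, so the contents of the memory before the first change may depend
  on it; preparing this state is not charged to the updates. All later coins are already part of
  \<open>A\<close>, hence updates are deterministic and the bound is a worst-case one.\<close>

definition has_update_time :: "nat \<Rightarrow> program \<Rightarrow> nat \<Rightarrow> nat \<Rightarrow>
    ((nat \<Rightarrow> real) \<Rightarrow> nat set) measure \<Rightarrow> real \<Rightarrow> bool" where
  "has_update_time w P n k D T \<longleftrightarrow>
     (\<forall>A \<in> space D. \<forall>x \<in> Delta n k.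
        \<exists>s. (\<forall>a. words s a < 2 ^ w) \<and> (\<forall>cs. maintains w P T n k A cs x s))"

text \<open>Words have \<open>O(log n)\<close> bits: a constant multiple of the length of \<open>n\<close> in binary.\<close>

definition word_size :: "nat \<Rightarrow> nat \<Rightarrow> nat" where
  "word_size c n = c * nat \<lceil>log 2 (real n + 1)\<rceil>"

end

theory Submission
  imports Defs "HOL-Combinatorics.Permutations"
begin

text \<open>The coordinates are placed by a random permutation on the leaves of a complete binary tree, and the
  sample is drawn by pivotal rounding: going up, each node keeps one representative leaf whose
  inclusion is still undecided, with the fractional part of the mass below as its probability, and the
  two representatives of the children compete, the loser being decided. An update recomputes
  one path, which takes \<open>O(log n)\<close> steps.

  With independent coins at all nodes every level would contribute a constant to the stretch, so two things are
  done differently. At light nodes (mass below a random \<open>\<theta>\<close> close to 1) the winner is the leaf with the largest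
  value of \<open>- y / ln u\<close>, an exponential race: there the effect of a change by \<open>\<delta>\<close> is \<open>O(\<delta>)\<close> in total
  rather than per level. A coordinate that could make a node heavy on its own is put on a second set of leaves as soon as it
  exceeds a random threshold \<open>\<tau>\<close> in \<open>[1/2, 3/4]\<close>, so only nodes at which the other coordinates of the
  subtree have mass at least \<open>1/8\<close> cost anything. A block of \<open>2\<^sup>j\<close> among \<open>2\<^sup>L\<close> positions contains expected
  mass at most \<open>k 2\<^sup>j / 2\<^sup>L\<close> from the others, so by Markov's inequality only \<open>log k + O(1)\<close> levels are expected to count.\<close>

section \<open>Rounding to an adjacent integer\<close>

text \<open>The tournament suits the machine, but its error is analysed top-down with the same
  coins. A node of mass \<open>s\<close> that holds \<open>N\<close> elements, \<open>N\<close> a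
  rounding of \<open>s\<close>, hands each child a rounding of the conditional mean
  \<open>mu\<close>. Averaging over \<open>N\<close> restores the plain rounding of the child mass
  (\<open>lin_mu\<close>), so costs add along one path instead of growing; and as parent and path
  child move by the same amount, the averaged change of \<open>mu\<close> is at most twice the
  change of the input. Two discontinuities shape the rest. A node that passes \<theta> changes its
  rule and may exchange two elements however small the move is; a coordinate that passes \<tau>
  leaves one leaf and reappears at another. Random thresholds make both events as rare as the move
  is short. The range of \<theta> begins at 7/8, which is 1/8 above the range of \<tau>: this is the
  mass that the other leaves must supply before a node above a light leaf can reach \<theta>. All
  estimates are first made for moves so small that no node mass is pushed across an integer, and are
  then glued along the whole interval.\<close>

declare frac_eq_0_iff [simp del] frac_gt_0_iff [simp del]

text \<open>Exactly the floor and the ceiling of \<open>s\<close> qualify; the inequality is strict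
  so that an integral \<open>s\<close> admits only itself.\<close>

definition valid :: "int \<Rightarrow> real \<Rightarrow> bool" where
  "valid N s \<longleftrightarrow> \<bar>of_int N - s\<bar> < 1"

text \<open>If a node of mass \<open>s\<close> receives \<open>N\<close> elements, then a child of mass \<open>a\<close> receives
  \<open>mu N s a\<close> of them in expectation.\<close>

definition mu :: "int \<Rightarrow> real \<Rightarrow> real \<Rightarrow> real" where
  "mu N s a = of_int \<lfloor>a\<rfloor> +
     (if s \<le> of_int N then min 1 (frac a / (1 - (of_int N - s)))
      else max 0 ((frac a - (s - of_int N)) / (1 - (s - of_int N))))"

text \<open>The expectation of \<open>h \<lceil>x - u\<rceil>\<close> for uniform \<open>u\<close>.\<close>

definition lin :: "(int \<Rightarrow> real) \<Rightarrow> real \<Rightarrow> real" where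
  "lin h x = (1 - frac x) * h \<lfloor>x\<rfloor> + frac x * h (\<lfloor>x\<rfloor> + 1)"

text \<open>The fractional part taken in \<open>(0, 1]\<close> for positive \<open>s\<close>.\<close>

definition lofrac :: "real \<Rightarrow> real" where
  "lofrac s = (if s = 0 then 0 else s - of_int \<lceil>s\<rceil> + 1)"

text \<open>\<open>lin\<close> and \<open>mu\<close> are continuous at the right end of a unit
  interval although the floor jumps there. Stating their formulas on closed intervals allows two
  nearby reals to be treated with one common \<open>F\<close>.\<close>

lemma floor_cases:
  fixes F :: int
  assumes "of_int F \<le> a" "a \<le> of_int F + 1"
  obtains "\<lfloor>a\<rfloor> = F" "frac a = a - of_int F" | "a = of_int F + 1" "\<lfloor>a\<rfloor> = F + 1" "frac a = 0"
proof (cases "a = of_int F + 1")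
  case True
  then have "\<lfloor>a\<rfloor> = F + 1" by (simp add: floor_eq_iff)
  then show ?thesis using that(2) True by (simp add: frac_def)
next
  case False
  then have "\<lfloor>a\<rfloor> = F" using assms by (simp add: floor_eq_iff)
  then show ?thesis using that(1) by (simp add: frac_def)
qed

lemma lin_eq:
  fixes F :: int
  assumes "of_int F \<le> x" "x \<le> of_int F + 1"
  shows "lin h x = (1 - (x - of_int F)) * h F + (x - of_int F) * h (F + 1)"
  using assms by (rule floor_cases) (auto simp: lin_def)

text \<open>For non-integral \<open>s\<close>, let one uniform number round both \<open>s\<close>
  and \<open>a\<close>, each going up iff the number is below its fractional part. The two formulas
  for \<open>mu\<close> are the conditional means of the rounding of \<open>a\<close>, given that
  \<open>s\<close> went up or down.\<close>

lemma mu_up: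
  fixes F :: int
  assumes "of_int F \<le> a" "a \<le> of_int F + 1" "s \<le> of_int N" "of_int N - s < 1"
  shows "mu N s a = of_int F + min 1 ((a - of_int F) / (1 - (of_int N - s)))"
  using assms(1,2)
proof (rule floor_cases)
  assume "a = of_int F + 1" "\<lfloor>a\<rfloor> = F + 1" "frac a = 0"
  moreover have "1 / (1 - (of_int N - s)) \<ge> 1"
    using assms(3,4) by (simp add: field_simps)
  ultimately show ?thesis using assms by (simp add: mu_def)
qed (use assms in \<open>simp add: mu_def\<close>)

lemma mu_down:
  fixes F :: int
  assumes "of_int F \<le> a" "a \<le> of_int F + 1" "of_int N \<le> s" "s - of_int N < 1"
  shows "mu N s a = of_int F + max 0 ((a - of_int F - (s - of_int N)) / (1 - (s - of_int N)))"
  using assms(1,2)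
proof (rule floor_cases)
  assume *: "a = of_int F + 1" "\<lfloor>a\<rfloor> = F + 1" "frac a = 0"
  have "(1 - (s - of_int N)) / (1 - (s - of_int N)) = 1" using assms by simp
  moreover have "- (s - of_int N) / (1 - (s - of_int N)) \<le> 0"
    using assms by (simp add: divide_nonpos_pos)
  ultimately show ?thesis using * assms(3) by (auto simp: mu_def)
next
  assume *: "\<lfloor>a\<rfloor> = F" "frac a = a - of_int F"
  have "min 1 (a - of_int F) = max 0 (a - of_int F)" if "s = of_int N" using assms(1,2) by simp
  then show ?thesis using * assms(3) by (auto simp: mu_def)
qed

lemma mu_int: "mu N (of_int N) a = a"
proof -
  have "of_int \<lfloor>a\<rfloor> \<le> a" "a \<le> of_int \<lfloor>a\<rfloor> + 1" by linarith+
  then show ?thesis using mu_up[of "\<lfloor>a\<rfloor>" a "of_int N" N] by (simp add: min_def) linarith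
qed

lemma valid_cases:
  assumes "valid N s"
  obtains "N = \<lfloor>s\<rfloor>" | "N = \<lfloor>s\<rfloor> + 1" "frac s > 0"
proof -
  have "N = \<lfloor>s\<rfloor> \<or> N = \<lfloor>s\<rfloor> + 1 \<and> frac s > 0"
    using assms unfolding valid_def frac_def by linarith
  then show ?thesis using that by blast
qed

lemma valid_floor: "valid \<lfloor>s\<rfloor> s"
  unfolding valid_def by linarith

lemma valid_floor_Suc: "frac s > 0 \<Longrightarrow> valid (\<lfloor>s\<rfloor> + 1) s"
  unfolding valid_def frac_def by linarith

text \<open>At an integral \<open>s\<close> the upper term of \<open>lin\<close> has weight 0, so
  only values of \<open>h\<close> at roundings of \<open>s\<close> matter.\<close>

lemma lin_mono:
  assumes "\<And>N. valid N s \<Longrightarrow> h N \<le> h' N"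
  shows "lin h s \<le> lin h' s"
proof -
  have "(1 - frac s) * h \<lfloor>s\<rfloor> \<le> (1 - frac s) * h' \<lfloor>s\<rfloor>"
    by (intro mult_left_mono assms valid_floor) (use frac_lt_1[of s] in simp)
  moreover have "frac s * h (\<lfloor>s\<rfloor> + 1) \<le> frac s * h' (\<lfloor>s\<rfloor> + 1)"
    by (cases "frac s = 0") (use valid_floor_Suc[of s] frac_ge_0[of s] in \<open>auto intro!: mult_left_mono assms\<close>)
  ultimately show ?thesis by (simp add: lin_def)
qed

lemma lin_cong:
  assumes "\<And>N. valid N s \<Longrightarrow> h N = h' N"
  shows "lin h s = lin h' s"
  by (intro antisym lin_mono) (use assms in auto)

lemma lin_add: "lin (\<lambda>N. h N + h' N) s = lin h s + lin h' s"
  by (simp add: lin_def algebra_simps)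

lemma lin_cmult: "lin (\<lambda>N. c * h N) s = c * lin h s"
  by (simp add: lin_def algebra_simps)

lemma lin_const [simp]: "lin (\<lambda>N. c) s = c"
  by (simp add: lin_def algebra_simps)

lemma lin_id [simp]: "lin of_int x = x"
  by (simp add: lin_def frac_def algebra_simps)

lemma mu_bounds:
  fixes F :: int
  assumes "valid N s" "of_int F \<le> a" "a \<le> of_int F + 1"
  shows "of_int F \<le> mu N s a" "mu N s a \<le> of_int F + 1"
proof -
  have "of_int F \<le> mu N s a \<and> mu N s a \<le> of_int F + 1"
  proof (cases "s \<le> of_int N")
    case True
    then have "of_int N - s < 1" using assms(1) by (simp add: valid_def)
    then show ?thesis using mu_up[OF assms(2,3) True] assms(2) by (auto simp: min_def)
  next
    case False
    then have *: "s - of_int N < 1" using assms(1) by (simp add: valid_def)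
    have "(a - of_int F - (s - of_int N)) / (1 - (s - of_int N)) \<le> 1"
      using * assms(3) by (simp add: field_simps)
    then show ?thesis using mu_down[OF assms(2,3) _ *] False by auto
  qed
  then show "of_int F \<le> mu N s a" "mu N s a \<le> of_int F + 1" by auto
qed

text \<open>The tower property: \<open>mu N s a\<close> is the mean of the rounding of
  \<open>a\<close> given that \<open>s\<close> was rounded to \<open>N\<close>. It holds for every
  \<open>h\<close> because \<open>mu N s a\<close> stays in the unit interval of \<open>a\<close>,
  on which \<open>lin h\<close> is affine.\<close>

lemma lin_mu: "lin (\<lambda>N. lin h (mu N s a)) s = lin h a"
proof (cases "frac s = 0")
  case True
  then have "s = of_int \<lfloor>s\<rfloor>" by (simp add: frac_def)
  then have "mu \<lfloor>s\<rfloor> s a = a" using mu_int[of "\<lfloor>s\<rfloor>" a] by simp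
  then show ?thesis using True by (simp add: lin_def[of _ s])
next
  case False
  let ?F = "\<lfloor>a\<rfloor>" and ?\<phi> = "frac s" and ?f = "frac a"
  have \<phi>: "0 < ?\<phi>" "?\<phi> < 1" using False frac_ge_0[of s] frac_lt_1[of s] by linarith+
  have F: "of_int ?F \<le> a" "a \<le> of_int ?F + 1" by linarith+
  have s: "s = of_int \<lfloor>s\<rfloor> + ?\<phi>" by (simp add: frac_def)
  have f: "?f = a - of_int ?F" by (simp add: frac_def)
  have 1: "mu \<lfloor>s\<rfloor> s a = of_int ?F + max 0 ((?f - ?\<phi>) / (1 - ?\<phi>))"
    using mu_down[OF F, of "\<lfloor>s\<rfloor>" s] \<phi> by (simp add: f frac_def)
  have 2: "mu (\<lfloor>s\<rfloor> + 1) s a = of_int ?F + min 1 (?f / ?\<phi>)"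
    using mu_up[OF F, of s "\<lfloor>s\<rfloor> + 1"] \<phi> by (simp add: f frac_def)
  have L: "lin h (mu N s a) = (1 - (mu N s a - of_int ?F)) * h ?F + (mu N s a - of_int ?F) * h (?F + 1)"
    if "valid N s" for N
    by (intro lin_eq mu_bounds that F)
  \<comment> \<open>The two conditional probabilities must average to \<open>frac a\<close>; which
    terms of \<open>min\<close> and \<open>max\<close> are active depends on whether
    \<open>frac a\<close> exceeds \<open>frac s\<close>.\<close>
  have m: "(1 - ?\<phi>) * (mu \<lfloor>s\<rfloor> s a - of_int ?F) + ?\<phi> * (mu (\<lfloor>s\<rfloor> + 1) s a - of_int ?F) = ?f"
  proof (cases "?f \<le> ?\<phi>")
    case True
    then have "(?f - ?\<phi>) / (1 - ?\<phi>) \<le> 0" "?f / ?\<phi> \<le> 1"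
      using \<phi> by (simp_all add: divide_nonpos_pos)
    then show ?thesis unfolding 1 2 using \<phi> by simp
  next
    case False
    then have "(?f - ?\<phi>) / (1 - ?\<phi>) \<ge> 0" "?f / ?\<phi> \<ge> 1" using \<phi> by simp_all
    then show ?thesis unfolding 1 2 using \<phi> by simp
  qed
  have "lin (\<lambda>N. lin h (mu N s a)) s =
      (1 - ?\<phi>) * ((1 - (mu \<lfloor>s\<rfloor> s a - of_int ?F)) * h ?F + (mu \<lfloor>s\<rfloor> s a - of_int ?F) * h (?F + 1))
      + ?\<phi> * ((1 - (mu (\<lfloor>s\<rfloor> + 1) s a - of_int ?F)) * h ?F + (mu (\<lfloor>s\<rfloor> + 1) s a - of_int ?F) * h (?F + 1))"
    by (simp add: lin_def[of _ s] L valid_floor valid_floor_Suc \<phi>)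
  also have "\<dots> = (1 - ((1 - ?\<phi>) * (mu \<lfloor>s\<rfloor> s a - of_int ?F) + ?\<phi> * (mu (\<lfloor>s\<rfloor> + 1) s a - of_int ?F))) * h ?F
      + ((1 - ?\<phi>) * (mu \<lfloor>s\<rfloor> s a - of_int ?F) + ?\<phi> * (mu (\<lfloor>s\<rfloor> + 1) s a - of_int ?F)) * h (?F + 1)"
    by (simp add: algebra_simps)
  also have "\<dots> = lin h a" unfolding m by (simp add: lin_def)
  finally show ?thesis .
qed

text \<open>Nothing is lost in a split: on average the sibling of mass \<open>s - a\<close> gets
  what is left of \<open>N\<close>. One coin can therefore serve both children, the right one taking
  the remainder.\<close>

lemma mu_sym:
  assumes "valid N s"
  shows "mu N s a + mu N s (s - a) = of_int N"
proof -
  define b where "b = s - a"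
  let ?A = "\<lfloor>a\<rfloor>" and ?B = "\<lfloor>b\<rfloor>" and ?f = "a - of_int \<lfloor>a\<rfloor>" and ?g = "b - of_int \<lfloor>b\<rfloor>"
  have A: "of_int ?A \<le> a" "a \<le> of_int ?A + 1" and B: "of_int ?B \<le> b" "b \<le> of_int ?B + 1"
    by linarith+
  have fg: "0 \<le> ?f" "?f < 1" "0 \<le> ?g" "?g < 1" by linarith+
  \<comment> \<open>The number of elements to be placed beyond the floors of the two children.
    Together with the side of \<open>s\<close> on which \<open>N\<close> lies it decides which terms
    of \<open>min\<close> and \<open>max\<close> are active.\<close>
  define d where "d = N - ?A - ?B"
  have sN: "of_int N = real_of_int d + of_int ?A + of_int ?B" by (simp add: d_def)
  have s: "s = of_int ?A + of_int ?B + ?f + ?g" by (simp add: b_def)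
  have dd: "real_of_int d - (?f + ?g) = of_int N - s" unfolding sN by (simp add: s)
  have "d = 0 \<or> d = 1 \<or> d = 2" if "s \<le> of_int N"
  proof -
    have "real_of_int d < 3" "real_of_int d > -1"
      using dd fg assms that unfolding valid_def by linarith+
    then show ?thesis by linarith
  qed
  moreover have "d = 0 \<or> d = 1" if "of_int N < s"
  proof -
    have "real_of_int d < 2" "real_of_int d > -1"
      using dd fg assms that unfolding valid_def by linarith+
    then show ?thesis by linarith
  qed
  ultimately consider "s \<le> of_int N" "d = 0" | "s \<le> of_int N" "d = 1" | "s \<le> of_int N" "d = 2"
    | "of_int N < s" "d = 0" | "of_int N < s" "d = 1" by linarith
  then have "mu N s a + mu N s b = of_int N"
  proof cases
    case 1
    have N: "of_int N - s < 1" using assms by (simp add: valid_def)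
    have "?f = 0" "?g = 0" using dd 1 fg by linarith+
    then show ?thesis using mu_up[OF A 1(1) N] mu_up[OF B 1(1) N] 1 sN by simp
  next
    case 2
    have N: "of_int N - s < 1" using assms by (simp add: valid_def)
    have c: "1 - (of_int N - s) = ?f + ?g" using dd 2 by simp
    then have p: "?f + ?g > 0" using N by simp
    have "?f / (?f + ?g) \<le> 1" "?g / (?f + ?g) \<le> 1" using p fg by simp_all
    moreover have "?f / (?f + ?g) + ?g / (?f + ?g) = 1" using p by (simp add: add_divide_distrib[symmetric])
    ultimately show ?thesis using mu_up[OF A 2(1) N] mu_up[OF B 2(1) N] 2 sN unfolding c by simp
  next
    case 3
    have N: "of_int N - s < 1" using assms by (simp add: valid_def)
    have c: "1 - (of_int N - s) = ?f + ?g - 1" using dd 3 by simp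
    then have p: "?f + ?g - 1 > 0" using N by simp
    have "?f / (?f + ?g - 1) \<ge> 1" "?g / (?f + ?g - 1) \<ge> 1" using p fg by simp_all
    then show ?thesis using mu_up[OF A 3(1) N] mu_up[OF B 3(1) N] 3 sN unfolding c by simp
  next
    case 4
    have N: "s - of_int N < 1" using assms by (simp add: valid_def)
    have c: "s - of_int N = ?f + ?g" using dd 4 by simp
    then have p: "?f + ?g < 1" using N by simp
    have "(?f - (?f + ?g)) / (1 - (?f + ?g)) \<le> 0" "(?g - (?f + ?g)) / (1 - (?f + ?g)) \<le> 0"
      using p fg by (auto intro!: divide_nonpos_pos)
    then show ?thesis using mu_down[OF A _ N] mu_down[OF B _ N] 4 sN unfolding c by simp
  next
    case 5
    have N: "s - of_int N < 1" using assms by (simp add: valid_def)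
    have c: "s - of_int N = ?f + ?g - 1" using dd 5 by simp
    then have p: "?f + ?g - 1 < 1" using N by simp
    have "(?f - (?f + ?g - 1)) / (1 - (?f + ?g - 1)) \<ge> 0" "(?g - (?f + ?g - 1)) / (1 - (?f + ?g - 1)) \<ge> 0"
      using p fg by (auto intro!: divide_nonneg_pos)
    moreover have "(?f - (?f + ?g - 1)) / (1 - (?f + ?g - 1)) + (?g - (?f + ?g - 1)) / (1 - (?f + ?g - 1)) = 1"
      using p by (simp add: add_divide_distrib[symmetric])
    ultimately show ?thesis using mu_down[OF A _ N] mu_down[OF B _ N] 5 sN unfolding c by simp
  qed
  then show ?thesis by (simp add: b_def)
qed

text \<open>Every count that \<open>s\<close> may receive must be possible for \<open>s'\<close>
  too, so that both inputs can be handed the same \<open>N\<close>. The relation is not symmetric: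
  an integer is near reals on either side of it, but no non-integral \<open>s\<close> is near an
  integer.\<close>

definition near :: "real \<Rightarrow> real \<Rightarrow> bool" where
  "near s s' \<longleftrightarrow> (\<forall>N. valid N s \<longrightarrow> valid N s')"

lemma near_exists: "\<exists>d>0. \<forall>s'. \<bar>s' - s\<bar> < d \<longrightarrow> near s s'"
proof (cases "frac s = 0")
  case True
  then have s: "s = of_int \<lfloor>s\<rfloor>" by (simp add: frac_def)
  have "near s s'" if "\<bar>s' - s\<bar> < 1" for s'
    unfolding near_def
  proof (intro allI impI)
    fix N assume "valid N s"
    then have "N = \<lfloor>s\<rfloor>" using True by (elim valid_cases) auto
    then show "valid N s'" using that s by (simp add: valid_def)
  qed
  then show ?thesis by (intro exI[of _ 1]) auto
next
  case False
  define d where "d = min (frac s) (1 - frac s)"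
  have "frac s > 0" using False frac_ge_0[of s] by linarith
  then have "d > 0" using frac_lt_1[of s] by (auto simp: d_def)
  moreover have "near s s'" if "\<bar>s' - s\<bar> < d" for s'
    unfolding near_def
  proof (intro allI impI)
    fix N assume "valid N s"
    then show "valid N s'" using that unfolding d_def frac_def
      by (elim valid_cases) (auto simp: valid_def min_def split: if_splits)
  qed
  ultimately show ?thesis by blast
qed

lemma near_interval:
  assumes "near s s'"
  obtains F :: int where "of_int F \<le> s" "s \<le> of_int F + 1" "of_int F \<le> s'" "s' \<le> of_int F + 1"
proof (cases "frac s = 0")
  case True
  then have s: "s = of_int \<lfloor>s\<rfloor>" by (simp add: frac_def)
  have "valid \<lfloor>s\<rfloor> s'" using assms valid_floor by (simp add: near_def)
  then have "\<bar>of_int \<lfloor>s\<rfloor> - s'\<bar> < 1" by (simp add: valid_def)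
  then show ?thesis using that[of "\<lfloor>s\<rfloor>"] that[of "\<lfloor>s\<rfloor> - 1"] s by (cases "s' \<ge> s") auto
next
  case False
  then have "valid \<lfloor>s\<rfloor> s'" "valid (\<lfloor>s\<rfloor> + 1) s'"
    using assms valid_floor valid_floor_Suc[of s] frac_ge_0[of s] unfolding near_def by auto
  then show ?thesis using that[of "\<lfloor>s\<rfloor>"] by (auto simp: valid_def)
qed

text \<open>The factor \<open>W = 1 - |N - s|\<close> is the probability of rounding
  \<open>s\<close> to \<open>N\<close>. Only one child changes, so parent and child move by the same
  amount and the numerator \<open>c\<close> of the non-constant part of \<open>mu\<close> stays the
  same. The change of \<open>c / W\<close> blows up as \<open>W\<close> tends to 0, and the weight
  compensates exactly for that.\<close>

lemma mu_lipschitz: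
  assumes "near s s'" "near a a'" "s' - s = a' - a" "valid N s"
  shows "(1 - \<bar>of_int N - s\<bar>) * \<bar>mu N s' a' - mu N s a\<bar> \<le> \<bar>s' - s\<bar>"
proof -
  obtain F :: int where F: "of_int F \<le> a" "a \<le> of_int F + 1" "of_int F \<le> a'" "a' \<le> of_int F + 1"
    using near_interval[OF assms(2)] .
  have v': "valid N s'" using assms by (simp add: near_def)
  \<comment> \<open>Being near, \<open>s\<close> and \<open>s'\<close> share a closed unit interval
    with \<open>N\<close> outside its interior, so both use the same branch of
    \<open>mu\<close>.\<close>
  have side: "s \<le> of_int N \<and> s' \<le> of_int N \<or> of_int N \<le> s \<and> of_int N \<le> s'"
  proof -
    obtain G :: int where "of_int G \<le> s" "s \<le> of_int G + 1" "of_int G \<le> s'" "s' \<le> of_int G + 1"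
      using near_interval[OF assms(1)] .
    moreover have "N \<le> G \<or> N \<ge> G + 1" by linarith
    then have "real_of_int N \<le> of_int G \<or> real_of_int N \<ge> of_int G + 1"
      by (metis of_int_1 of_int_add of_int_le_iff)
    ultimately show ?thesis by linarith
  qed
  define W where "W = 1 - \<bar>of_int N - s\<bar>"
  define W' where "W' = 1 - \<bar>of_int N - s'\<bar>"
  have W: "W > 0" "W' > 0" using v' assms(4) by (auto simp: W_def W'_def valid_def)
  \<comment> \<open>The left side equals \<open>|c| * |W' - W| / W'\<close>, and the bound on
    \<open>|c|\<close> removes the last denominator.\<close>
  have gen: "W * \<bar>c / W' - c / W\<bar> \<le> \<bar>s' - s\<bar>"
    if "\<bar>c\<bar> \<le> W'" "\<bar>W' - W\<bar> = \<bar>s' - s\<bar>" for c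
  proof -
    have "W * (c / W' - c / W) = c * (W - W') / W'" using W by (simp add: field_simps)
    then have "W * \<bar>c / W' - c / W\<bar> = \<bar>c\<bar> * \<bar>W' - W\<bar> / W'"
      using W by (metis abs_mult abs_of_pos abs_divide abs_minus_commute)
    also have "\<dots> \<le> W' * \<bar>W' - W\<bar> / W'"
      using W that(1) by (intro divide_right_mono mult_right_mono) auto
    also have "\<dots> = \<bar>s' - s\<bar>" using W that(2) by simp
    finally show ?thesis .
  qed
  from side show ?thesis
  proof
    assume up: "s \<le> of_int N \<and> s' \<le> of_int N"
    have Weq: "W = 1 - (of_int N - s)" "W' = 1 - (of_int N - s')" using up by (auto simp: W_def W'_def)
    define f where "f = a - of_int F"
    define f' where "f' = a' - of_int F"
    have \<kappa>: "f' - W' = f - W" using assms(3) by (simp add: f_def f'_def Weq)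
    have m: "mu N s a = of_int F + min 1 (f / W)" "mu N s' a' = of_int F + min 1 (f' / W')"
      using mu_up[OF F(1,2), of s N] mu_up[OF F(3,4), of s' N] up W by (auto simp: Weq f_def f'_def)
    have f: "0 \<le> f" "0 \<le> f'" using F by (auto simp: f_def f'_def)
    show ?thesis
    proof (cases "f \<ge> W")
      case True
      then have "f / W \<ge> 1" "f' / W' \<ge> 1" using \<kappa> W by simp_all
      then show ?thesis unfolding m by simp
    next
      case False
      then have "f / W \<le> 1" "f' / W' \<le> 1" using \<kappa> W by simp_all
      moreover have "f / W = 1 + (f - W) / W" "f' / W' = 1 + (f - W) / W'"
        using W \<kappa> by (simp_all add: field_simps)
      ultimately have "mu N s' a' - mu N s a = (f - W) / W' - (f - W) / W" unfolding m by simp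
      then show ?thesis using gen[of "f - W"] False f \<kappa> unfolding W_def[symmetric] by (simp add: Weq)
    qed
  next
    assume down: "of_int N \<le> s \<and> of_int N \<le> s'"
    have Weq: "W = 1 - (s - of_int N)" "W' = 1 - (s' - of_int N)" using down by (auto simp: W_def W'_def)
    define f where "f = 1 - (a - of_int F)"
    define f' where "f' = 1 - (a' - of_int F)"
    have \<kappa>: "f' - W' = f - W" using assms(3) by (simp add: f_def f'_def Weq)
    have m: "mu N s a = of_int F + max 0 ((W - f) / W)" "mu N s' a' = of_int F + max 0 ((W' - f') / W')"
      using mu_down[OF F(1,2), of N s] mu_down[OF F(3,4), of N s'] down W
      by (auto simp: Weq f_def f'_def algebra_simps)
    have f: "0 \<le> f" "0 \<le> f'" using F by (auto simp: f_def f'_def)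
    show ?thesis
    proof (cases "f \<ge> W")
      case True
      then have "(W - f) / W \<le> 0" "(W' - f') / W' \<le> 0" using \<kappa> W by (auto intro!: divide_nonpos_pos)
      then show ?thesis unfolding m by simp
    next
      case False
      then have "(W - f) / W \<ge> 0" "(W' - f') / W' \<ge> 0" using \<kappa> W by simp_all
      moreover have "W' - f' = W - f" using \<kappa> by simp
      ultimately have "mu N s' a' - mu N s a = (W - f) / W' - (W - f) / W" unfolding m by simp
      then show ?thesis using gen[of "W - f"] False f \<kappa> unfolding W_def[symmetric] by (simp add: Weq)
    qed
  qed
qed

text \<open>Each of the two roundings contributes at most \<open>|s' - s|\<close>, since its weight
  in \<open>lin\<close> is the factor in \<open>mu_lipschitz\<close>.\<close>

lemma lin_mu_lipschitz:
  assumes "near s s'" "near a a'" "s' - s = a' - a"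
  shows "lin (\<lambda>N. \<bar>mu N s' a' - mu N s a\<bar>) s \<le> 2 * \<bar>s' - s\<bar>"
proof -
  have "(1 - frac s) * \<bar>mu \<lfloor>s\<rfloor> s' a' - mu \<lfloor>s\<rfloor> s a\<bar> \<le> \<bar>s' - s\<bar>"
  proof -
    have "1 - \<bar>of_int \<lfloor>s\<rfloor> - s\<bar> = 1 - frac s" unfolding frac_def by linarith
    then show ?thesis using mu_lipschitz[OF assms valid_floor] by simp
  qed
  moreover have "frac s * \<bar>mu (\<lfloor>s\<rfloor> + 1) s' a' - mu (\<lfloor>s\<rfloor> + 1) s a\<bar> \<le> \<bar>s' - s\<bar>"
  proof (cases "frac s = 0")
    case False
    then have "frac s > 0" using frac_ge_0[of s] by linarith
    moreover have "1 - \<bar>of_int (\<lfloor>s\<rfloor> + 1) - s\<bar> = frac s" unfolding frac_def by linarith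
    ultimately show ?thesis using mu_lipschitz[OF assms valid_floor_Suc] by simp
  qed simp
  ultimately show ?thesis by (simp add: lin_def)
qed

section \<open>Arithmetic of the fractional part in (0, 1]\<close>

lemma lofrac_range: "0 \<le> s \<Longrightarrow> 0 \<le> lofrac s \<and> lofrac s \<le> 1"
  unfolding lofrac_def by (auto; linarith)

lemma lofrac_pos: "0 < s \<Longrightarrow> 0 < lofrac s"
  unfolding lofrac_def by (auto; linarith)

lemma lofrac_unique:
  fixes F :: int
  assumes "s = of_int F + f" "0 < f" "f \<le> 1" "0 \<le> F"
  shows "lofrac s = f" "\<lceil>s\<rceil> = F + 1"
proof -
  show "\<lceil>s\<rceil> = F + 1" using assms by (simp add: ceiling_eq_iff)
  then show "lofrac s = f" using assms by (simp add: lofrac_def)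
qed

lemma lofrac_int:
  assumes "0 \<le> s"
  obtains F :: int where "0 \<le> F" "s = of_int F + lofrac s" "\<lceil>s\<rceil> = (if s = 0 then 0 else F + 1)"
proof (cases "s = 0")
  case True
  then show ?thesis using that[of 0] by (simp add: lofrac_def)
next
  case False
  then show ?thesis using that[of "\<lceil>s\<rceil> - 1"] assms by (auto simp: lofrac_def)
qed

lemma lofrac_small: "0 \<le> s \<Longrightarrow> s \<le> 1 \<Longrightarrow> lofrac s = s"
  using lofrac_unique(1)[of s 0 s] by (cases "s = 0") (auto simp: lofrac_def)

text \<open>The machine cannot round, and this carry rule is how it obtains the fractional part of a
  node from those of its children. A positive integral mass has fractional part 1, so every nonempty
  subtree keeps an undecided representative.\<close>

lemma lofrac_add:
  assumes "0 \<le> a" "0 \<le> b"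
  shows "lofrac (a + b) = (if lofrac a + lofrac b \<le> 1 then lofrac a + lofrac b else lofrac a + lofrac b - 1)"
proof (cases "a = 0 \<or> b = 0")
  case True
  then show ?thesis using lofrac_range assms by (auto simp: lofrac_def)
next
  case False
  obtain F G :: int where "0 \<le> F" "a = of_int F + lofrac a" "0 \<le> G" "b = of_int G + lofrac b"
    using lofrac_int[OF assms(1)] lofrac_int[OF assms(2)] by metis
  moreover have "0 < lofrac a" "0 < lofrac b" "lofrac a \<le> 1" "lofrac b \<le> 1"
    using lofrac_pos lofrac_range assms False by auto
  ultimately show ?thesis
    using lofrac_unique(1)[of "a + b" "F + G" "lofrac a + lofrac b"]
      lofrac_unique(1)[of "a + b" "F + G + 1" "lofrac a + lofrac b - 1"] by auto
qed

section \<open>Pivotal sampling along a binary tree\<close>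

text \<open>Heap numbering: the root is 1, the children of \<open>v\<close> are \<open>2 * v\<close> and \<open>2 * v + 1\<close>, and the leaves are
  \<open>{M..<2 * M}\<close>. The coin of node \<open>v\<close> is \<open>u v\<close>; node 0 holds the coin that decides the last representative.\<close>

function sm :: "nat \<Rightarrow> (nat \<Rightarrow> real) \<Rightarrow> nat \<Rightarrow> real" where
  "sm M y v = (if 0 < v \<and> v < M then sm M y (2 * v) + sm M y (2 * v + 1) else y v)"
  by auto
termination by (relation "Wellfounded.measure (\<lambda>(M, y, v). M - v)") auto

function leaves :: "nat \<Rightarrow> nat \<Rightarrow> nat set" where
  "leaves M v = (if 0 < v \<and> v < M then leaves M (2 * v) \<union> leaves M (2 * v + 1) else {v})"
  by auto
termination by (relation "Wellfounded.measure (\<lambda>(M, v). M - v)") auto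

text \<open>For uniform \<open>r\<close>, \<open>- ln r\<close> is exponential of mean 1; so
  \<open>y * gain r\<close> is the reciprocal of an exponential time of rate \<open>y\<close>, and
  the largest key belongs to the earliest arrival. Separated from the factor \<open>y\<close>, the
  value can be stored once per leaf by a machine without logarithms.\<close>

definition gain :: "real \<Rightarrow> real" where
  "gain r = - 1 / ln r"

function key :: "nat \<Rightarrow> (nat \<Rightarrow> real) \<Rightarrow> (nat \<Rightarrow> real) \<Rightarrow> nat \<Rightarrow> real" where
  "key M y u v = (if 0 < v \<and> v < M then max (key M y u (2 * v)) (key M y u (2 * v + 1))
     else y v * gain (u v))"
  by auto
termination by (relation "Wellfounded.measure (\<lambda>(M, y, u, v). M - v)") auto

text \<open>Each child has one undecided representative, whose probability is its
  \<open>lofrac\<close>. If the two exceed 1 together, one is settled as selected and the other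
  keeps the excess; otherwise one is rejected and the other keeps the sum.\<close>

definition crossing :: "nat \<Rightarrow> (nat \<Rightarrow> real) \<Rightarrow> nat \<Rightarrow> bool" where
  "crossing M y v \<longleftrightarrow> 1 < lofrac (sm M y (2 * v)) + lofrac (sm M y (2 * v + 1))"

text \<open>With \<open>f\<close> and \<open>g\<close> the fractional parts of the children, the
  left representative survives with probability \<open>f / (f + g)\<close> if nothing crosses; at a
  crossing it is the one settled, with probability \<open>(1 - g) / (2 - f - g)\<close>. These are
  the values that preserve both marginals in pivotal rounding, and multiplying out avoids division
  by 0. A light node compares keys and uses no coin of its own.\<close>

definition left_first :: "nat \<Rightarrow> real \<Rightarrow> (nat \<Rightarrow> real) \<Rightarrow> (nat \<Rightarrow> real) \<Rightarrow> nat \<Rightarrow> bool" where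
  "left_first M \<theta> y u v =
    (if sm M y v < \<theta> then key M y u (2 * v + 1) < key M y u (2 * v)
     else if crossing M y v then
       u v * (2 - lofrac (sm M y (2 * v)) - lofrac (sm M y (2 * v + 1))) < 1 - lofrac (sm M y (2 * v + 1))
     else u v * (lofrac (sm M y (2 * v)) + lofrac (sm M y (2 * v + 1))) < lofrac (sm M y (2 * v)))"

function rep :: "nat \<Rightarrow> real \<Rightarrow> (nat \<Rightarrow> real) \<Rightarrow> (nat \<Rightarrow> real) \<Rightarrow> nat \<Rightarrow> nat" where
  "rep M \<theta> y u v = (if 0 < v \<and> v < M then
      if left_first M \<theta> y u v = crossing M y v then rep M \<theta> y u (2 * v + 1) else rep M \<theta> y u (2 * v)
    else v)"
  by auto
termination by (relation "Wellfounded.measure (\<lambda>(M, \<theta>, y, u, v). M - v)") auto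

definition loser :: "nat \<Rightarrow> real \<Rightarrow> (nat \<Rightarrow> real) \<Rightarrow> (nat \<Rightarrow> real) \<Rightarrow> nat \<Rightarrow> nat" where
  "loser M \<theta> y u v =
    (if left_first M \<theta> y u v = crossing M y v then rep M \<theta> y u (2 * v) else rep M \<theta> y u (2 * v + 1))"

function settled :: "nat \<Rightarrow> real \<Rightarrow> (nat \<Rightarrow> real) \<Rightarrow> (nat \<Rightarrow> real) \<Rightarrow> nat \<Rightarrow> nat set" where
  "settled M \<theta> y u v = (if 0 < v \<and> v < M then
      settled M \<theta> y u (2 * v) \<union> settled M \<theta> y u (2 * v + 1) \<union>
        (if crossing M y v then {loser M \<theta> y u v} else {})
    else {})"
  by auto
termination by (relation "Wellfounded.measure (\<lambda>(M, \<theta>, y, u, v). M - v)") auto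

text \<open>Top-down view of the same process: \<open>sel M \<theta> y u v N\<close> is what is selected below \<open>v\<close> if \<open>N\<close>
  elements are assigned to \<open>v\<close>, and \<open>nl M \<theta> y u v N\<close> of these go to the left child.\<close>

definition sel :: "nat \<Rightarrow> real \<Rightarrow> (nat \<Rightarrow> real) \<Rightarrow> (nat \<Rightarrow> real) \<Rightarrow> nat \<Rightarrow> int \<Rightarrow> nat set" where
  "sel M \<theta> y u v N =
    settled M \<theta> y u v \<union> (if \<lceil>sm M y v\<rceil> \<le> N \<and> 0 < sm M y v then {rep M \<theta> y u v} else {})"

definition sample :: "nat \<Rightarrow> real \<Rightarrow> (nat \<Rightarrow> real) \<Rightarrow> (nat \<Rightarrow> real) \<Rightarrow> nat set" where
  "sample M \<theta> y u = sel M \<theta> y u 1 \<lceil>sm M y 1 - u 0\<rceil>"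

definition nl :: "nat \<Rightarrow> real \<Rightarrow> (nat \<Rightarrow> real) \<Rightarrow> (nat \<Rightarrow> real) \<Rightarrow> nat \<Rightarrow> int \<Rightarrow> int" where
  "nl M \<theta> y u v N = (if sm M y v < \<theta> then (if left_first M \<theta> y u v then N else 0)
     else \<lceil>mu N (sm M y v) (sm M y (2 * v)) - u v\<rceil>)"

declare sm.simps [simp del] leaves.simps [simp del] key.simps [simp del] rep.simps [simp del]
  settled.simps [simp del]

section \<open>Structure of the tree: leaves, masses and locality\<close>

lemma heap_induct [case_names leaf inner]:
  fixes v :: nat
  assumes "\<And>v. \<not> (0 < v \<and> v < M) \<Longrightarrow> P v"
    and "\<And>v. 0 < v \<Longrightarrow> v < M \<Longrightarrow> P (2 * v) \<Longrightarrow> P (2 * v + 1) \<Longrightarrow> P v"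
  shows "P v"
proof (induction v rule: measure_induct_rule[of "\<lambda>v. M - v"])
  case (less v)
  then show ?case using assms by (cases "0 < v \<and> v < M") auto
qed

lemma tree_inner:
  assumes "0 < v" "v < M"
  shows "sm M y v = sm M y (2 * v) + sm M y (2 * v + 1)"
    and "leaves M v = leaves M (2 * v) \<union> leaves M (2 * v + 1)"
    and "key M y u v = max (key M y u (2 * v)) (key M y u (2 * v + 1))"
    and "rep M \<theta> y u v =
      (if left_first M \<theta> y u v = crossing M y v then rep M \<theta> y u (2 * v + 1) else rep M \<theta> y u (2 * v))"
    and "settled M \<theta> y u v = settled M \<theta> y u (2 * v) \<union> settled M \<theta> y u (2 * v + 1) \<union>
        (if crossing M y v then {loser M \<theta> y u v} else {})"
  using assms
  by (simp_all add: sm.simps[of M y v] leaves.simps[of M v] key.simps[of M y u v]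
      rep.simps[of M \<theta> y u v] settled.simps[of M \<theta> y u v])

lemma tree_leaf:
  assumes "\<not> (0 < v \<and> v < M)"
  shows "sm M y v = y v" "leaves M v = {v}" "key M y u v = y v * gain (u v)"
    "rep M \<theta> y u v = v" "settled M \<theta> y u v = {}"
  using assms
  by (auto simp: sm.simps[of M y v] leaves.simps[of M v] key.simps[of M y u v]
      rep.simps[of M \<theta> y u v] settled.simps[of M \<theta> y u v])

lemma finite_leaves [simp]: "finite (leaves M v)"
  by (induction v rule: heap_induct[of M]) (simp_all add: tree_inner tree_leaf)

lemma leaves_imp_div: "l \<in> leaves M v \<Longrightarrow> \<exists>j. l div 2 ^ j = v"
proof (induction v rule: heap_induct[of M])
  case (leaf v)
  then show ?case by (auto simp: tree_leaf intro: exI[of _ 0])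
next
  case (inner v)
  have *: "\<exists>j. l div 2 ^ j = v" if "l div 2 ^ j = 2 * v \<or> l div 2 ^ j = 2 * v + 1" for j
    by (rule exI[of _ "Suc j"]) (use that in \<open>auto simp: div_mult2_eq mult.commute[of 2]\<close>)
  show ?case using inner * by (auto simp: tree_inner)
qed

lemma leaves_range: "l \<in> leaves M v \<Longrightarrow> 0 < v \<Longrightarrow> v < 2 * M \<Longrightarrow> M \<le> l \<and> l < 2 * M \<and> v \<le> l"
  by (induction v rule: heap_induct[of M]) (auto simp: tree_inner tree_leaf)

text \<open>A common leaf would have both siblings among its shifts \<open>l div 2 ^ i\<close>, and
  the one with the larger exponent would be a shift of the other. But a shift of
  \<open>2 * v\<close> is at most \<open>2 * v\<close>, and a proper shift of
  \<open>2 * v + 1\<close> is at most \<open>v\<close>.\<close>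

lemma leaves_disjoint:
  assumes "0 < v"
  shows "leaves M (2 * v) \<inter> leaves M (2 * v + 1) = {}"
proof (rule ccontr)
  assume "\<not> ?thesis"
  then obtain l i j where l: "l div 2 ^ i = 2 * v" "l div 2 ^ j = 2 * v + 1"
    using leaves_imp_div by blast
  have shift: "l div 2 ^ (a + b) = (l div 2 ^ a) div 2 ^ b" for a b
    by (simp add: power_add div_mult2_eq)
  consider "i \<le> j" | "j < i" by linarith
  then show False
  proof cases
    case 1
    then have "2 * v + 1 = (2 * v) div 2 ^ (j - i)" using shift[of i "j - i"] l by simp
    also have "\<dots> \<le> 2 * v" by simp
    finally show False by simp
  next
    case 2
    then obtain k where k: "i = j + Suc k" using less_imp_Suc_add by auto
    have "2 * v = (2 * v + 1) div 2 div 2 ^ k" using shift[of j "Suc k"] l k by (simp add: div_mult2_eq)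
    also have "\<dots> \<le> (2 * v + 1) div 2" by (rule div_le_dividend)
    also have "\<dots> = v" by simp
    finally show False using assms by simp
  qed
qed

lemma sm_eq_sum: "sm M y v = (\<Sum>l\<in>leaves M v. y l)"
  by (induction v rule: heap_induct[of M])
    (simp_all add: tree_inner tree_leaf sum.union_disjoint leaves_disjoint[simplified])

lemma sm_nonneg: "(\<And>l. 0 \<le> y l) \<Longrightarrow> 0 \<le> sm M y v"
  by (simp add: sm_eq_sum sum_nonneg)

lemma leaf_in_ancestor:
  assumes "M \<le> l" "l < 2 * M" "0 < l div 2 ^ j"
  shows "l \<in> leaves M (l div 2 ^ j)"
  using assms(3)
proof (induction j)
  case 0
  then show ?case using assms by (simp add: tree_leaf)
next
  case (Suc j)
  define v where "v = l div 2 ^ Suc j"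
  define w where "w = l div 2 ^ j"
  have v: "v = w div 2" by (simp add: v_def w_def div_mult2_eq mult.commute[of 2])
  have "0 < v" using Suc.prems by (simp add: v_def)
  moreover have "v \<le> l div 2" unfolding v using div_le_mono[OF div_le_dividend[of l "2 ^ j"], of 2]
    by (simp add: w_def)
  then have "v < M" using assms by linarith
  moreover have "l \<in> leaves M w" using Suc \<open>0 < v\<close> by (simp add: w_def v div_greater_zero_iff)
  moreover have "w = 2 * v \<or> w = 2 * v + 1" using v by linarith
  ultimately show ?case unfolding v_def[symmetric] by (auto simp: tree_inner)
qed

text \<open>Heap numbers grow towards the leaves, so the coins read below \<open>v\<close> have
  numbers at least \<open>v\<close>. In particular nothing below a child depends on the coin of its
  parent; the expectations rest on this independence.\<close>

lemma tree_cong: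
  assumes "\<And>w. v \<le> w \<Longrightarrow> u w = u' w" "\<And>l. l \<in> leaves M v \<Longrightarrow> y l = y' l" "0 < v"
  shows "sm M y v = sm M y' v \<and> key M y u v = key M y' u' v \<and> rep M \<theta> y u v = rep M \<theta> y' u' v \<and>
    settled M \<theta> y u v = settled M \<theta> y' u' v"
  using assms
proof (induction v rule: heap_induct[of M])
  case (leaf v)
  then show ?case by (simp add: tree_leaf)
next
  case (inner v)
  have "sm M y (2 * v) = sm M y' (2 * v) \<and> key M y u (2 * v) = key M y' u' (2 * v) \<and>
    rep M \<theta> y u (2 * v) = rep M \<theta> y' u' (2 * v) \<and> settled M \<theta> y u (2 * v) = settled M \<theta> y' u' (2 * v)"
    using inner by (intro inner.IH) (auto simp: tree_inner)
  moreover have "sm M y (2 * v + 1) = sm M y' (2 * v + 1) \<and> key M y u (2 * v + 1) = key M y' u' (2 * v + 1) \<and>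
    rep M \<theta> y u (2 * v + 1) = rep M \<theta> y' u' (2 * v + 1) \<and>
    settled M \<theta> y u (2 * v + 1) = settled M \<theta> y' u' (2 * v + 1)"
    using inner by (intro inner.IH) (auto simp: tree_inner)
  moreover have "u v = u' v" using inner by simp
  ultimately show ?case using inner(1,2)
    by (simp add: tree_inner left_first_def crossing_def loser_def)
qed

lemma sel_cong:
  assumes "\<And>w. v \<le> w \<Longrightarrow> u w = u' w" "\<And>l. l \<in> leaves M v \<Longrightarrow> y l = y' l" "0 < v"
  shows "sel M \<theta> y u v N = sel M \<theta> y' u' v N"
  using tree_cong[OF assms, where \<theta> = \<theta>] by (simp add: sel_def)

section \<open>Agreement of the bottom-up and the top-down view\<close>

lemma ceiling_sub:
  fixes F :: int and r u :: real
  assumes "0 \<le> r" "r \<le> 1" "0 < u" "u < 1"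
  shows "\<lceil>of_int F + r - u\<rceil> = (if u < r then F + 1 else F)"
  using assms by (auto simp: ceiling_eq_iff)

text \<open>The arithmetic core of the agreement.
  \<open>\<lceil>a\<rceil> \<le> n \<and> 0 < a\<close> says that the left representative is
  selected when \<open>n\<close> elements go left. Without crossing this happens iff the
  representative of the parent is selected and is the left one; with crossing, iff the
  representative of the parent is selected or the left one is settled here.\<close>

lemma split_fresh:
  fixes a b u :: real and N :: int
  defines "n \<equiv> \<lceil>mu N (a + b) a - u\<rceil>" and "f \<equiv> lofrac a" and "g \<equiv> lofrac b"
  assumes "0 \<le> a" "0 \<le> b" "valid N (a + b)" "0 < u" "u < 1" "0 < a + b"
  shows "valid n a" "valid (N - n) b"
    and "f + g \<le> 1 \<Longrightarrow> (\<lceil>a\<rceil> \<le> n \<and> 0 < a) = (\<lceil>a + b\<rceil> \<le> N \<and> u * (f + g) < f)"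
    and "f + g \<le> 1 \<Longrightarrow> (\<lceil>b\<rceil> \<le> N - n \<and> 0 < b) = (\<lceil>a + b\<rceil> \<le> N \<and> \<not> u * (f + g) < f)"
    and "\<not> f + g \<le> 1 \<Longrightarrow> (\<lceil>a\<rceil> \<le> n \<and> 0 < a) = (\<lceil>a + b\<rceil> \<le> N \<or> u * (2 - f - g) < 1 - g)"
    and "\<not> f + g \<le> 1 \<Longrightarrow> (\<lceil>b\<rceil> \<le> N - n \<and> 0 < b) = (\<lceil>a + b\<rceil> \<le> N \<or> \<not> u * (2 - f - g) < 1 - g)"
proof -
  obtain F where F: "0 \<le> F" "a = of_int F + f" "\<lceil>a\<rceil> = (if a = 0 then 0 else F + 1)"
    using lofrac_int[OF assms(4)] unfolding f_def .
  obtain G where G: "0 \<le> G" "b = of_int G + g" "\<lceil>b\<rceil> = (if b = 0 then 0 else G + 1)"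
    using lofrac_int[OF assms(5)] unfolding g_def .
  have f: "0 \<le> f" "f \<le> 1" "a > 0 \<Longrightarrow> 0 < f" and g: "0 \<le> g" "g \<le> 1" "b > 0 \<Longrightarrow> 0 < g"
    using lofrac_range[OF assms(4)] lofrac_range[OF assms(5)] lofrac_pos[of a] lofrac_pos[of b]
    by (auto simp: f_def g_def)
  have Fa: "of_int F \<le> a" "a \<le> of_int F + 1" "a - of_int F = f" using F f by auto
  have f0: "f = 0 \<Longrightarrow> a = 0" "g = 0 \<Longrightarrow> b = 0" using f g assms(4,5) by fastforce+
  have fg0: "0 < f + g" using f g assms by (cases "a > 0") auto
  have va: "valid F a = (f < 1)" "valid (F + 1) a = (0 < f)" and vb: "valid G b = (g < 1)" "valid (G + 1) b = (0 < g)"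
    using F(2) G(2) f g by (auto simp: valid_def)
  have fz: "a = 0 \<Longrightarrow> f = 0" "b = 0 \<Longrightarrow> g = 0" by (auto simp: f_def g_def lofrac_def)
  have ca: "(\<lceil>a\<rceil> \<le> F \<and> 0 < a) = False" "(\<lceil>a\<rceil> \<le> F + 1 \<and> 0 < a) = (0 < f)"
    using F(1,3) f f0 assms(4) fz by auto
  have cb: "(\<lceil>b\<rceil> \<le> G \<and> 0 < b) = False" "(\<lceil>b\<rceil> \<le> G + 1 \<and> 0 < b) = (0 < g)"
    using G(1,3) g f0 assms(5) fz by auto
  have Nn: "F + G + 1 - F = G + 1" "F + G + 1 - (F + 1) = G" "F + G + 2 - (F + 1) = G + 1" "F + G - F = G"
    by simp_all
  \<comment> \<open>Replaces \<open>n\<close> and \<open>N\<close> by explicit values relative to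
    \<open>F\<close> and \<open>G\<close>, so that the cases below compare constants.\<close>
  have cond: "(valid n a \<and> valid (N - n) b \<and>
    (if f + g \<le> 1 then ((\<lceil>a\<rceil> \<le> n \<and> 0 < a) = (\<lceil>a + b\<rceil> \<le> N \<and> u * (f + g) < f)) \<and>
        ((\<lceil>b\<rceil> \<le> N - n \<and> 0 < b) = (\<lceil>a + b\<rceil> \<le> N \<and> \<not> u * (f + g) < f))
     else ((\<lceil>a\<rceil> \<le> n \<and> 0 < a) = (\<lceil>a + b\<rceil> \<le> N \<or> u * (2 - f - g) < 1 - g)) \<and>
        ((\<lceil>b\<rceil> \<le> N - n \<and> 0 < b) = (\<lceil>a + b\<rceil> \<le> N \<or> \<not> u * (2 - f - g) < 1 - g))))"
    if "n = n'" "N = N'" "N' - n' = m'" "\<lceil>a + b\<rceil> = c'"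
      "valid n' a" "valid m' b"
      "if f + g \<le> 1 then ((\<lceil>a\<rceil> \<le> n' \<and> 0 < a) = (c' \<le> N' \<and> u * (f + g) < f)) \<and>
        ((\<lceil>b\<rceil> \<le> m' \<and> 0 < b) = (c' \<le> N' \<and> \<not> u * (f + g) < f))
     else ((\<lceil>a\<rceil> \<le> n' \<and> 0 < a) = (c' \<le> N' \<or> u * (2 - f - g) < 1 - g)) \<and>
        ((\<lceil>b\<rceil> \<le> m' \<and> 0 < b) = (c' \<le> N' \<or> \<not> u * (2 - f - g) < 1 - g))" for n' N' m' c'
    using that by simp
  consider (light) "f + g \<le> 1" | (cross) "1 < f + g" by linarith
  then have "valid n a \<and> valid (N - n) b \<and>
    (if f + g \<le> 1 then ((\<lceil>a\<rceil> \<le> n \<and> 0 < a) = (\<lceil>a + b\<rceil> \<le> N \<and> u * (f + g) < f)) \<and>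
        ((\<lceil>b\<rceil> \<le> N - n \<and> 0 < b) = (\<lceil>a + b\<rceil> \<le> N \<and> \<not> u * (f + g) < f))
     else ((\<lceil>a\<rceil> \<le> n \<and> 0 < a) = (\<lceil>a + b\<rceil> \<le> N \<or> u * (2 - f - g) < 1 - g)) \<and>
        ((\<lceil>b\<rceil> \<le> N - n \<and> 0 < b) = (\<lceil>a + b\<rceil> \<le> N \<or> \<not> u * (2 - f - g) < 1 - g)))"
  proof cases
    case light
    have c: "\<lceil>a + b\<rceil> = F + G + 1"
      using lofrac_unique(2)[of "a + b" "F + G" "f + g"] F G light fg0 by simp
    \<comment> \<open>Since \<open>0 < f + g \<le> 1\<close>, the roundings of \<open>a + b\<close>
      are among \<open>F + G\<close> and \<open>F + G + 1\<close>.\<close>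
    have "real_of_int N < real_of_int (F + G + 2)" "real_of_int N > real_of_int (F + G - 1)"
      using assms(6) F G f g light by (auto simp: valid_def)
    then have "N < F + G + 2" "N > F + G - 1" unfolding of_int_less_iff .
    then consider "N = F + G + 1" | "N = F + G" by linarith
    then show ?thesis
    proof cases
      case 1
      have "f / (f + g) \<le> 1" using f g fg0 by simp
      moreover have "mu N (a + b) a = of_int F + min 1 (f / (f + g))"
      proof -
        have *: "1 - (real_of_int N - (a + b)) = f + g" "a + b \<le> of_int N" using 1 F(2) G(2) light by auto
        then have "real_of_int N - (a + b) < 1" using fg0 by linarith
        from mu_up[OF Fa(1,2) *(2) this] show ?thesis unfolding *(1) Fa(3) .
      qed
      ultimately have "n = \<lceil>of_int F + f / (f + g) - u\<rceil>" by (simp add: n_def)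
      also have "\<dots> = (if u < f / (f + g) then F + 1 else F)"
        using f g fg0 assms by (intro ceiling_sub) auto
      finally have n: "n = (if u * (f + g) < f then F + 1 else F)" using fg0 by (simp add: less_divide_eq)
      show ?thesis
      proof (cases "u * (f + g) < f")
        case True
        have "0 < f" using True fg0 assms by (smt (verit) mult_pos_pos)
        then show ?thesis using True n light
          by (intro cond[OF _ 1 Nn(2) c]) (auto simp: va vb ca cb)
      next
        case False
        have "f < 1"
        proof (rule ccontr)
          assume "\<not> f < 1"
          then have "f = 1" "g = 0" using f g light by auto
          then show False using False assms by simp
        qed
        moreover have "0 < g"
        proof (rule ccontr)
          assume "\<not> 0 < g"
          then have "g = 0" using g by simp
          then show False using False fg0 assms by simp
        qed
        ultimately show ?thesis using False n light
          by (intro cond[OF _ 1 Nn(1) c]) (auto simp: va vb ca cb)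
      qed
    next
      case 2
      have lt: "f + g < 1" using assms(6) 2 F G by (simp add: valid_def)
      have "(f - (f + g)) / (1 - (f + g)) \<le> 0" using g lt by (auto intro!: divide_nonpos_pos)
      moreover have *: "a + b - real_of_int N = f + g" using 2 F(2) G(2) by simp
      moreover have "real_of_int N \<le> a + b" "a + b - real_of_int N < 1" using * fg0 lt by linarith+
      ultimately have "mu N (a + b) a = of_int F"
        using mu_down[OF Fa(1,2), of N "a + b"] by (simp add: Fa(3))
      then have "n = F" using ceiling_sub[of 0 u F] assms by (simp add: n_def)
      then show ?thesis using light lt f g
        by (intro cond[OF _ 2 Nn(4) c]) (auto simp: va vb ca cb)
    qed
  next
    case cross
    have pos: "0 < f" "0 < g" using cross f g by auto
    have c: "\<lceil>a + b\<rceil> = F + G + 2"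
      using lofrac_unique(2)[of "a + b" "F + G + 1" "f + g - 1"] F G cross f g by simp
    have "real_of_int N < real_of_int (F + G + 3)" "real_of_int N > real_of_int (F + G)"
      using assms(6) F G f g cross by (auto simp: valid_def)
    then have "N < F + G + 3" "N > F + G" unfolding of_int_less_iff .
    then consider "N = F + G + 2" | "N = F + G + 1" by linarith
    then show ?thesis
    proof cases
      case 1
      \<comment> \<open>If a crossing node is rounded up, \<open>mu\<close> is capped at
        \<open>F + 1\<close>: both children are rounded up, whatever the coin shows.\<close>
      have "f / (f + g - 1) \<ge> 1" using f g cross by simp
      moreover have *: "1 - (real_of_int N - (a + b)) = f + g - 1" using 1 F(2) G(2) by simp
      moreover have "a + b \<le> real_of_int N" "real_of_int N - (a + b) < 1" using * f g cross by linarith+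
      ultimately have "mu N (a + b) a = of_int F + 1"
        using mu_up[OF Fa(1,2), of "a + b" N] by (simp add: Fa(3))
      then have "n = F + 1" using ceiling_sub[of 1 u F] assms by (simp add: n_def)
      then show ?thesis using cross pos
        by (intro cond[OF _ 1 Nn(3) c]) (auto simp: va vb ca cb)
    next
      case 2
      have lt: "f + g < 2" using assms(6) 2 F G by (simp add: valid_def)
      have e: "(f - (f + g - 1)) / (1 - (f + g - 1)) = (1 - g) / (2 - f - g)"
        by (simp add: algebra_simps)
      have r: "0 \<le> (1 - g) / (2 - f - g)" "(1 - g) / (2 - f - g) \<le> 1" using lt f g by simp_all
      have *: "a + b - real_of_int N = f + g - 1" using 2 F(2) G(2) by simp
      moreover have "real_of_int N \<le> a + b" "a + b - real_of_int N < 1" using * cross lt by linarith+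
      ultimately have "mu N (a + b) a = of_int F + (1 - g) / (2 - f - g)"
        using mu_down[OF Fa(1,2), of N "a + b"] r by (simp only: Fa(3) * e max_absorb2)
      then have "n = (if u < (1 - g) / (2 - f - g) then F + 1 else F)"
        using ceiling_sub[of "(1 - g) / (2 - f - g)" u F] assms r by (simp add: n_def)
      then have n: "n = (if u * (2 - f - g) < 1 - g then F + 1 else F)" using lt by (simp add: less_divide_eq)
      show ?thesis
      proof (cases "u * (2 - f - g) < 1 - g")
        case True
        have "g < 1"
        proof (rule ccontr)
          assume "\<not> g < 1"
          then have "g = 1" using g by simp
          then have "u * (1 - f) < 0" using True by simp
          then show False using f assms by (simp add: mult_less_0_iff)
        qed
        then show ?thesis using True n cross pos
          by (intro cond[OF _ 2 Nn(2) c]) (auto simp: va vb ca cb)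
      next
        case False
        have "f < 1"
        proof (rule ccontr)
          assume "\<not> f < 1"
          then have "f = 1" using f by simp
          then have "u * (1 - g) \<ge> 1 - g" "1 - g > 0" using False lt by auto
          then show False using assms by simp
        qed
        then show ?thesis using False n cross pos
          by (intro cond[OF _ 2 Nn(1) c]) (auto simp: va vb ca cb)
      qed
    qed
  qed
  then show "valid n a" "valid (N - n) b"
    and "f + g \<le> 1 \<Longrightarrow> (\<lceil>a\<rceil> \<le> n \<and> 0 < a) = (\<lceil>a + b\<rceil> \<le> N \<and> u * (f + g) < f)"
    and "f + g \<le> 1 \<Longrightarrow> (\<lceil>b\<rceil> \<le> N - n \<and> 0 < b) = (\<lceil>a + b\<rceil> \<le> N \<and> \<not> u * (f + g) < f)"
    and "\<not> f + g \<le> 1 \<Longrightarrow> (\<lceil>a\<rceil> \<le> n \<and> 0 < a) = (\<lceil>a + b\<rceil> \<le> N \<or> u * (2 - f - g) < 1 - g)"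
    and "\<not> f + g \<le> 1 \<Longrightarrow> (\<lceil>b\<rceil> \<le> N - n \<and> 0 < b) = (\<lceil>a + b\<rceil> \<le> N \<or> \<not> u * (2 - f - g) < 1 - g)"
    by presburger+
qed

text \<open>\<open>\<theta> \<le> 1\<close> gives every light node mass below 1, hence at most one
  element. The coins lie strictly inside the unit interval, which makes \<open>gain\<close>
  positive.\<close>

locale sampling_tree =
  fixes M :: nat and \<theta> :: real and y u :: "nat \<Rightarrow> real"
  assumes theta: "\<theta> \<le> 1"
    and y01: "0 \<le> y l" "y l \<le> 1"
    and u01: "0 < u v" "u v < 1"
begin

lemma gain_pos: "gain (u v) > 0"
  using u01[of v] by (simp add: gain_def divide_neg_neg)

lemma sm_ge0: "0 \<le> sm M y v"
  by (rule sm_nonneg) (rule y01)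

lemma key_nonneg: "0 \<le> key M y u v"
proof (induction v rule: heap_induct[of M])
  case (leaf v)
  show ?case unfolding tree_leaf[OF leaf] using gain_pos[of v] y01(1)[of v] by simp
qed (simp add: tree_inner le_max_iff_disj)

lemma key_pos_iff: "0 < key M y u v \<longleftrightarrow> 0 < sm M y v"
proof (induction v rule: heap_induct[of M])
  case (leaf v)
  show ?case unfolding tree_leaf[OF leaf] using gain_pos[of v] by (simp add: zero_less_mult_iff)
next
  case (inner v)
  have "(0 < a + b) = (0 < a \<or> 0 < b)" if "0 \<le> a" "0 \<le> b" for a b :: real using that by auto
  then show ?case unfolding tree_inner[OF inner(1,2)] using inner.IH sm_ge0 by (simp add: less_max_iff_disj)
qed

lemma light_not_crossing:
  assumes "0 < v" "v < M" "sm M y v < \<theta>"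
  shows "\<not> crossing M y v"
proof -
  have "sm M y (2 * v) + sm M y (2 * v + 1) < 1" "0 \<le> sm M y (2 * v)" "0 \<le> sm M y (2 * v + 1)"
    using assms theta tree_inner(1)[of v M y] sm_ge0 by auto
  then show ?thesis by (simp add: crossing_def lofrac_small)
qed

lemma sel_zero: "sel M \<theta> y u v 0 = settled M \<theta> y u v"
  by (auto simp: sel_def)

lemma sel_up: "\<lceil>sm M y v\<rceil> \<le> N \<Longrightarrow> 0 < sm M y v \<Longrightarrow> sel M \<theta> y u v N = insert (rep M \<theta> y u v) (settled M \<theta> y u v)"
  by (simp add: sel_def)

text \<open>\<open>sel\<close> is defined from the bottom-up quantities \<open>settled\<close> and
  \<open>rep\<close>, yet it obeys a top-down recursion. At a light node the only element, if there
  is one, follows the winner of the race; elsewhere \<open>split_fresh\<close> identifies the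
  tournament coin with the split of \<open>N\<close>.\<close>

lemma sel_rec:
  assumes v: "0 < v" "v < M" and N: "valid N (sm M y v)"
  defines "n \<equiv> nl M \<theta> y u v N"
  shows "valid n (sm M y (2 * v))" "valid (N - n) (sm M y (2 * v + 1))"
    and "sel M \<theta> y u v N = sel M \<theta> y u (2 * v) n \<union> sel M \<theta> y u (2 * v + 1) (N - n)"
proof -
  let ?a = "sm M y (2 * v)" and ?b = "sm M y (2 * v + 1)" and ?l = "left_first M \<theta> y u v"
  have s: "sm M y v = ?a + ?b" and ab: "0 \<le> ?a" "0 \<le> ?b"
    using tree_inner(1)[OF v] sm_ge0 by auto
  have "valid n ?a \<and> valid (N - n) ?b \<and> 
    sel M \<theta> y u v N = sel M \<theta> y u (2 * v) n \<union> sel M \<theta> y u (2 * v + 1) (N - n)"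
  proof (cases "sm M y v < \<theta>")
    case True
    have nc: "\<not> crossing M y v" using light_not_crossing v True .
    have lt: "?a + ?b < 1" using True theta s by simp
    have n: "n = (if ?l then N else 0)" using True by (simp add: n_def nl_def)
    \<comment> \<open>Keys are nonnegative, and positive exactly on positive mass. So a winner by
      key has positive mass, and a count of 1 is a valid rounding for it.\<close>
    have a0: "0 < ?a" if "?l"
      using that True key_nonneg[of "2 * v + 1"] key_pos_iff[of "2 * v"] by (simp add: left_first_def)
    have b0: "0 < ?b" if "\<not> ?l" "0 < ?a + ?b"
      using that True key_pos_iff[of "2 * v + 1"] key_pos_iff[of "2 * v"] ab by (auto simp: left_first_def)
    have "real_of_int N < 2" "real_of_int N > -1" using N lt ab unfolding s valid_def by linarith+
    then have "N = 0 \<or> N = 1" by linarith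
    moreover have c: "\<lceil>?a\<rceil> \<le> 1" "\<lceil>?b\<rceil> \<le> 1" "\<lceil>?a + ?b\<rceil> \<le> 1" using ab lt by (auto simp: ceiling_le_iff)
    moreover have z: "valid 0 ?a" "valid 0 ?b" using ab lt by (auto simp: valid_def)
    moreover have "\<not> (\<lceil>?a\<rceil> \<le> 0 \<and> 0 < ?a)" "\<not> (\<lceil>?b\<rceil> \<le> 0 \<and> 0 < ?b)" "\<not> (\<lceil>?a + ?b\<rceil> \<le> 0 \<and> 0 < ?a + ?b)"
      by (auto simp: ceiling_le_iff)
    moreover have "valid 1 ?a" if "0 < ?a" using that ab lt by (auto simp: valid_def)
    moreover have "valid 1 ?b" if "0 < ?b" using that ab lt by (auto simp: valid_def)
    moreover have "0 < ?a + ?b" if "N = 1" using N that s by (simp add: valid_def)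
    ultimately consider "N = 0" | "N = 1" "?l" "valid 1 ?a" | "N = 1" "\<not> ?l" "valid 1 ?b"
      using a0 b0 by blast
    then show ?thesis
    proof cases
      case 1
      then show ?thesis using z by (simp add: n sel_zero tree_inner v nc)
    next
      case 2
      have pos: "0 < ?a" "0 < sm M y v" using a0 2 ab s by auto
      have "sel M \<theta> y u v 1 = insert (rep M \<theta> y u v) (settled M \<theta> y u v)"
        "sel M \<theta> y u (2 * v) 1 = insert (rep M \<theta> y u (2 * v)) (settled M \<theta> y u (2 * v))"
        using pos c s by (auto intro!: sel_up)
      then show ?thesis using 2 z
        by (simp add: n sel_zero tree_inner(4,5) v nc)
    next
      case 3
      have pos: "0 < sm M y v" using 3 N by (simp add: valid_def)
      then have "0 < ?b" using b0 3 s by auto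
      then have "sel M \<theta> y u v 1 = insert (rep M \<theta> y u v) (settled M \<theta> y u v)"
        "sel M \<theta> y u (2 * v + 1) 1 = insert (rep M \<theta> y u (2 * v + 1)) (settled M \<theta> y u (2 * v + 1))"
        using pos c s by (auto intro!: sel_up)
      then show ?thesis using 3 z
        by (simp add: n sel_zero tree_inner(4,5) v nc)
    qed
  next
    case False
    show ?thesis
    proof (cases "?a + ?b = 0")
      case True
      \<comment> \<open>Without mass the count can only be 0, and a coin strictly between 0 and 1
        sends 0 to the left.\<close>
      then have "?a = 0" "?b = 0" using ab by auto
      then have "N = 0" using N s by (auto simp: valid_def)
      have nc: "\<not> crossing M y v" using \<open>?a = 0\<close> \<open>?b = 0\<close> by (simp add: crossing_def lofrac_def)
      have "mu 0 0 0 = 0" using mu_int[of 0 0] by simp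
      then have "n = 0" using False \<open>N = 0\<close> \<open>?a = 0\<close> \<open>?b = 0\<close> s u01[of v] 
        by (simp add: n_def nl_def ceiling_eq_iff)
      then show ?thesis using nc \<open>N = 0\<close> \<open>?a = 0\<close> \<open>?b = 0\<close>
        by (simp add: sel_def tree_inner v valid_def)
    next
      case ne: False
      then have pos: "0 < ?a + ?b" using ab by linarith
      have n: "n = \<lceil>mu N (?a + ?b) ?a - u v\<rceil>" using False s by (simp add: n_def nl_def)
      note sp = split_fresh[OF ab N[unfolded s] u01(1)[of v] u01(2)[of v] pos, folded n]
      show ?thesis
      proof (cases "crossing M y v")
        case True
        then have *: "\<not> lofrac ?a + lofrac ?b \<le> 1" by (simp add: crossing_def)
        have lf: "?l = (u v * (2 - lofrac ?a - lofrac ?b) < 1 - lofrac ?b)"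
          using True False by (simp add: left_first_def)
        have A: "(\<lceil>?a\<rceil> \<le> n \<and> 0 < ?a) = (\<lceil>?a + ?b\<rceil> \<le> N \<or> ?l)"
          unfolding lf by (rule sp(5)[OF *])
        have B: "(\<lceil>?b\<rceil> \<le> N - n \<and> 0 < ?b) = (\<lceil>?a + ?b\<rceil> \<le> N \<or> \<not> ?l)"
          unfolding lf by (rule sp(6)[OF *])
        have "sel M \<theta> y u v N = sel M \<theta> y u (2 * v) n \<union> sel M \<theta> y u (2 * v + 1) (N - n)"
          unfolding sel_def tree_inner(4,5)[OF v] s A B
          using pos True by (cases ?l; cases "\<lceil>?a + ?b\<rceil> \<le> N") (simp_all add: loser_def Un_ac insert_commute)
        then show ?thesis using sp(1,2) by blast
      next
        case nc: False
        then have *: "lofrac ?a + lofrac ?b \<le> 1" by (simp add: crossing_def)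
        have lf: "?l = (u v * (lofrac ?a + lofrac ?b) < lofrac ?a)"
          using nc False by (simp add: left_first_def)
        have "sel M \<theta> y u v N = sel M \<theta> y u (2 * v) n \<union> sel M \<theta> y u (2 * v + 1) (N - n)"
          unfolding sel_def tree_inner(4,5)[OF v] s sp(3)[OF *] sp(4)[OF *] lf[symmetric]
          using pos nc by (cases ?l; cases "\<lceil>?a + ?b\<rceil> \<le> N") (simp_all add: loser_def Un_ac)
        then show ?thesis using sp(1,2) by blast
      qed
    qed
  qed
  then show "valid n ?a" "valid (N - n) ?b"
    "sel M \<theta> y u v N = sel M \<theta> y u (2 * v) n \<union> sel M \<theta> y u (2 * v + 1) (N - n)" by auto
qed

lemma sel_leaf:
  assumes "\<not> (0 < v \<and> v < M)" "valid N (sm M y v)"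
  shows "sel M \<theta> y u v N = (if N = 1 then {v} else {})" "N = 0 \<or> N = 1"
proof -
  have "real_of_int N < 2" "real_of_int N > -1"
    using assms y01[of v] by (auto simp: valid_def tree_leaf)
  then show *: "N = 0 \<or> N = 1" by linarith
  have "0 < y v" if "N = 1" using assms that by (auto simp: valid_def tree_leaf)
  moreover have "\<lceil>y v\<rceil> \<le> 1" using y01 by (simp add: ceiling_le_iff)
  ultimately show "sel M \<theta> y u v N = (if N = 1 then {v} else {})"
    using assms * y01[of v] by (auto simp: sel_def tree_leaf)
qed

lemma rep_in_leaves: "rep M \<theta> y u v \<in> leaves M v"
  by (induction v rule: heap_induct[of M]) (auto simp: tree_inner tree_leaf)

lemma settled_subset: "settled M \<theta> y u v \<subseteq> leaves M v"
  using rep_in_leaves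
  by (induction v rule: heap_induct[of M]) (auto simp: tree_inner tree_leaf loser_def split: if_splits)

lemma sel_subset: "sel M \<theta> y u v N \<subseteq> leaves M v"
  using rep_in_leaves settled_subset by (auto simp: sel_def)

lemma finite_sel [simp]: "finite (sel M \<theta> y u v N)"
  using sel_subset finite_leaves finite_subset by blast

lemma card_sel: "0 < v \<Longrightarrow> valid N (sm M y v) \<Longrightarrow> 0 \<le> N \<and> card (sel M \<theta> y u v N) = nat N"
proof (induction v arbitrary: N rule: heap_induct[of M])
  case (leaf v)
  then show ?case using sel_leaf[OF leaf(1,3)] by auto
next
  case (inner v)
  let ?n = "nl M \<theta> y u v N"
  note r = sel_rec[OF inner(1,2) inner.prems(2)]
  have "0 \<le> ?n \<and> card (sel M \<theta> y u (2 * v) ?n) = nat ?n" using inner r by simp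
  moreover have "0 \<le> N - ?n \<and> card (sel M \<theta> y u (2 * v + 1) (N - ?n)) = nat (N - ?n)"
    using inner.IH(2)[OF _ r(2)] by simp
  moreover have "sel M \<theta> y u (2 * v) ?n \<inter> sel M \<theta> y u (2 * v + 1) (N - ?n) = {}"
    using sel_subset leaves_disjoint[OF inner(1)] by blast
  ultimately show ?case unfolding r(3) by (simp add: card_Un_disjoint flip: nat_add_distrib)
qed

text \<open>\<open>settled\<close> does not depend on the count, so selections for two counts are
  nested.\<close>

lemma card_sel_diff:
  assumes "0 < v" "valid N (sm M y v)" "valid N' (sm M y v)"
  shows "real (card (sym_diff (sel M \<theta> y u v N) (sel M \<theta> y u v N'))) = \<bar>of_int N - of_int N'\<bar>"
proof -
  have *: "real (card (sym_diff (sel M \<theta> y u v N) (sel M \<theta> y u v N'))) = of_int N' - of_int N"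
    if "N \<le> N'" "valid N (sm M y v)" "valid N' (sm M y v)" for N N'
  proof -
    have sub: "sel M \<theta> y u v N \<subseteq> sel M \<theta> y u v N'" using that(1) by (auto simp: sel_def)
    then have "sym_diff (sel M \<theta> y u v N) (sel M \<theta> y u v N') = sel M \<theta> y u v N' - sel M \<theta> y u v N"
      by auto
    then have "card (sym_diff (sel M \<theta> y u v N) (sel M \<theta> y u v N')) = nat N' - nat N"
      using card_Diff_subset[OF _ sub] card_sel assms(1) that by simp
    then show ?thesis using card_sel[OF assms(1) that(2)] that(1) by (simp add: of_nat_diff nat_mono)
  qed
  show ?thesis
    using *[of N N'] *[of N' N] assms by (cases "N \<le> N'") (auto simp: Un_commute)
qed

text \<open>An empty child has key 0 and \<open>lofrac\<close> 0, so it loses both kinds of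
  comparison against a nonempty one. In an empty subtree \<open>rep\<close> still names some leaf,
  which is why \<open>sel\<close> tests for positive mass.\<close>

lemma rep_pos: "0 < sm M y v \<Longrightarrow> 0 < y (rep M \<theta> y u v)"
proof (induction v rule: heap_induct[of M])
  case (leaf v)
  then show ?case by (simp add: tree_leaf)
next
  case (inner v)
  let ?a = "sm M y (2 * v)" and ?b = "sm M y (2 * v + 1)" and ?l = "left_first M \<theta> y u v"
  have ab: "0 \<le> ?a" "0 \<le> ?b" "0 < ?a + ?b" using sm_ge0 inner tree_inner(1)[of v M] by auto
  show ?case
  proof (cases "?a = 0 \<or> ?b = 0")
    case False
    then have "0 < ?a" "0 < ?b" using ab by auto
    then show ?thesis using inner by (simp add: tree_inner)
  next
    case True
    then have nc: "\<not> crossing M y v" using lofrac_range[OF ab(1)] lofrac_range[OF ab(2)]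
      by (auto simp: crossing_def lofrac_def[of 0])
    have "?l = (?b = 0)"
    proof (cases "?b = 0")
      case True
      then have a: "0 < ?a" "0 < lofrac ?a" using ab lofrac_pos by auto
      have "u v * lofrac ?a < lofrac ?a" using a u01 by simp
      moreover have "key M y u (2 * v + 1) < key M y u (2 * v)"
        using key_pos_iff[of "2 * v"] key_pos_iff[of "2 * v + 1"] a True by simp
      ultimately show ?thesis using True nc by (simp add: left_first_def lofrac_def[of 0])
    next
      case False
      then have b: "?a = 0" "0 < ?b" "0 < lofrac ?b" using \<open>?a = 0 \<or> ?b = 0\<close> ab lofrac_pos by auto
      have "\<not> key M y u (2 * v + 1) < key M y u (2 * v)"
        using key_pos_iff[of "2 * v"] key_pos_iff[of "2 * v + 1"] b by simp
      then show ?thesis using False b nc u01[of v] by (simp add: left_first_def lofrac_def[of 0] not_less)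
    qed
    then show ?thesis using inner nc True ab by (auto simp: tree_inner)
  qed
qed

lemma settled_pos: "l \<in> settled M \<theta> y u v \<Longrightarrow> 0 < y l"
proof (induction v rule: heap_induct[of M])
  case (inner v)
  have "0 < y (loser M \<theta> y u v)" if "crossing M y v"
  proof -
    have "lofrac (sm M y (2 * v)) \<le> 1" "lofrac (sm M y (2 * v + 1)) \<le> 1"
      using lofrac_range sm_ge0 by auto
    then have "lofrac (sm M y (2 * v)) \<noteq> 0" "lofrac (sm M y (2 * v + 1)) \<noteq> 0"
      using that by (auto simp: crossing_def)
    then have "sm M y (2 * v) \<noteq> 0" "sm M y (2 * v + 1) \<noteq> 0" by (auto simp: lofrac_def)
    then have "0 < sm M y (2 * v)" "0 < sm M y (2 * v + 1)"
      using sm_ge0[of "2 * v"] sm_ge0[of "2 * v + 1"] by linarith+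
    then show ?thesis using rep_pos by (simp add: loser_def)
  qed
  then show ?case using inner by (auto simp: tree_inner split: if_splits)
qed (simp add: tree_leaf)

lemma sel_pos: "l \<in> sel M \<theta> y u v N \<Longrightarrow> 0 < y l"
  using rep_pos settled_pos by (auto simp: sel_def split: if_splits)

lemma sel_light:
  assumes "sm M y v < \<theta>" "0 < v"
  shows "settled M \<theta> y u v = {}"
  using assms
proof (induction v rule: heap_induct[of M])
  case (inner v)
  have "sm M y (2 * v) < \<theta>" "sm M y (2 * v + 1) < \<theta>"
    using inner tree_inner(1)[of v M y] sm_ge0[of "2 * v"] sm_ge0[of "2 * v + 1"] by auto
  then show ?case using inner light_not_crossing by (simp add: tree_inner)
qed (simp add: tree_leaf)

lemma valid_root: "valid \<lceil>sm M y v - u 0\<rceil> (sm M y v)"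
  unfolding valid_def using u01[of 0] by linarith

text \<open>The form in which the machine evaluates the root: a comparison with the coin of node 0
  in place of a ceiling.\<close>

lemma sample_eq: "sample M \<theta> y u =
    settled M \<theta> y u 1 \<union> (if u 0 < lofrac (sm M y 1) then {rep M \<theta> y u 1} else {})"
proof -
  obtain F :: int where F: "0 \<le> F" "sm M y 1 = of_int F + lofrac (sm M y 1)"
      "\<lceil>sm M y 1\<rceil> = (if sm M y 1 = 0 then 0 else F + 1)"
    using lofrac_int[OF sm_ge0] .
  have r: "0 \<le> lofrac (sm M y 1)" "lofrac (sm M y 1) \<le> 1" using lofrac_range sm_ge0 by auto
  have *: "\<lceil>sm M y 1 - u 0\<rceil> = (if u 0 < lofrac (sm M y 1) then F + 1 else F)"
    using ceiling_sub[OF r u01[of 0], of F] F(2) by simp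
  have "lofrac (sm M y 1) = 0" if "sm M y 1 = 0" using that by (simp add: lofrac_def)
  then have "(\<lceil>sm M y 1\<rceil> \<le> \<lceil>sm M y 1 - u 0\<rceil> \<and> 0 < sm M y 1) = (u 0 < lofrac (sm M y 1))"
    using * F sm_ge0[of 1] u01[of 0] by (cases "sm M y 1 = 0") auto
  then show ?thesis by (simp add: sample_def sel_def)
qed

lemma card_sample: "int (card (sample M \<theta> y u)) \<in> {\<lfloor>sm M y 1\<rfloor>, \<lceil>sm M y 1\<rceil>}"
proof -
  have "\<lceil>sm M y 1 - u 0\<rceil> \<in> {\<lfloor>sm M y 1\<rfloor>, \<lceil>sm M y 1\<rceil>}"
    using u01[of 0] by (simp; linarith)
  then show ?thesis using card_sel[OF _ valid_root, of 1] by (simp add: sample_def)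
qed

end

section \<open>Random coins\<close>

text \<open>The open interval, because \<open>ln u\<close> has to be finite and nonzero at every
  outcome: the cardinality condition is demanded on the whole support and not just almost
  surely.\<close>

definition U01 :: "real measure" where
  "U01 = restrict_space lborel {0<..<1}"

definition coins :: "(nat \<Rightarrow> real) measure" where
  "coins = (\<Pi>\<^sub>M i\<in>UNIV. U01)"

lemma space_U01 [simp]: "space U01 = {0<..<1}"
  by (simp add: U01_def space_restrict_space)

lemma prob_space_U01: "prob_space U01"
  by (rule prob_spaceI) (simp add: U01_def emeasure_restrict_space space_restrict_space)

interpretation U01: prob_space U01
  by (rule prob_space_U01)

interpretation coins_prod: product_prob_space "\<lambda>_. U01" UNIV
  by unfold_locales

lemma prob_space_coins: "prob_space coins"
  unfolding coins_def by (intro prob_space_PiM prob_space_U01)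

interpretation coins: prob_space coins
  by (rule prob_space_coins)

lemma space_coins: "\<omega> \<in> space coins \<longleftrightarrow> (\<forall>i. 0 < \<omega> i \<and> \<omega> i < 1)"
  by (auto simp: coins_def space_PiM PiE_iff)

lemma measurable_U01: "f \<in> borel_measurable borel \<Longrightarrow> f \<in> borel_measurable U01"
  unfolding U01_def by (intro measurable_restrict_space1) simp

lemma U01_in_borel: "(\<lambda>x. x) \<in> measurable U01 borel"
  by (rule measurable_U01) simp

lemma coin_measurable: "(\<lambda>\<omega>. \<omega> i) \<in> borel_measurable coins"
proof -
  have "(\<lambda>\<omega>. \<omega> i) \<in> measurable coins U01"
    unfolding coins_def by (rule measurable_component_singleton) simp
  from measurable_compose[OF this U01_in_borel] show ?thesis .
qed

lemma measure_U01: "A \<subseteq> {0<..<1} \<Longrightarrow> measure U01 A = measure lborel A"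
  unfolding U01_def by (rule measure_restrict_space) auto

lemma U01_less:
  assumes "0 \<le> c" "c \<le> 1"
  shows "measure U01 {u \<in> space U01. u < c} = c"
proof -
  have "{u \<in> space U01. u < c} = {0<..<c}" using assms by auto
  moreover have "{0<..<c} \<subseteq> {0<..<1}" using assms by auto
  ultimately show ?thesis using assms by (simp add: measure_U01)
qed

lemma U01_le:
  assumes "0 \<le> c" "c \<le> 1"
  shows "measure U01 {u \<in> space U01. u \<le> c} = c"
proof (cases "c = 1")
  case True
  have "{u \<in> space U01. u \<le> c} = {0<..<1}" using True by auto
  then show ?thesis using True by (simp add: measure_U01)
next
  case False
  have "{u \<in> space U01. u \<le> c} = {0<..c}" using assms False by auto
  moreover have "{0<..c} \<subseteq> {0<..<1}" using assms False by auto
  ultimately show ?thesis using assms by (simp add: measure_U01)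
qed

lemma U01_interval: "measure U01 {u \<in> space U01. a < u \<and> u \<le> b} \<le> max 0 (b - a)"
proof (cases "a \<le> b")
  case True
  have "{u \<in> space U01. a < u \<and> u \<le> b} = {0<..<1} \<inter> {a<..b}" by auto
  then have "measure U01 {u \<in> space U01. a < u \<and> u \<le> b} = measure lborel ({0<..<1} \<inter> {a<..b})"
    by (simp add: measure_U01)
  also have "\<dots> \<le> measure lborel {a<..b}"
    by (intro measure_mono_fmeasurable) (use True in \<open>auto simp: fmeasurable_def\<close>)
  finally show ?thesis using True by simp
next
  case False
  then have "{u \<in> space U01. a < u \<and> u \<le> b} = {}" by auto
  then show ?thesis by (simp only: measure_empty)
qed

lemma U01_ceiling:
  fixes h :: "int \<Rightarrow> real"
  shows "integrable U01 (\<lambda>u. h \<lceil>x - u\<rceil>)" "(\<integral>u. h \<lceil>x - u\<rceil> \<partial>U01) = lin h x"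
proof -
  let ?f = "\<lambda>u. h \<lfloor>x\<rfloor> + (h (\<lfloor>x\<rfloor> + 1) - h \<lfloor>x\<rfloor>) * indicator {u \<in> space U01. u < frac x} u"
  have eq: "h \<lceil>x - u\<rceil> = ?f u" if "u \<in> space U01" for u
  proof -
    have "\<lceil>of_int \<lfloor>x\<rfloor> + frac x - u\<rceil> = (if u < frac x then \<lfloor>x\<rfloor> + 1 else \<lfloor>x\<rfloor>)"
      using frac_ge_0[of x] frac_lt_1[of x] that by (intro ceiling_sub) auto
    then show ?thesis using that by (auto simp: frac_def)
  qed
  have m: "{u \<in> space U01. u < frac x} \<in> sets U01"
    using borel_measurable_less[OF U01_in_borel borel_measurable_const] .
  have i: "integrable U01 ?f"
    using m by (intro Bochner_Integration.integrable_add integrable_mult_right integrable_real_indicator)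
      (auto simp: U01.emeasure_eq_measure)
  then show "integrable U01 (\<lambda>u. h \<lceil>x - u\<rceil>)"
    using Bochner_Integration.integrable_cong[THEN iffD2, OF refl eq i] by simp
  have "(\<integral>u. h \<lceil>x - u\<rceil> \<partial>U01) = (\<integral>u. ?f u \<partial>U01)"
    by (rule Bochner_Integration.integral_cong[OF refl eq])
  also have "\<dots> = h \<lfloor>x\<rfloor> + (h (\<lfloor>x\<rfloor> + 1) - h \<lfloor>x\<rfloor>) * measure U01 {u \<in> space U01. u < frac x}"
    using m by (subst Bochner_Integration.integral_add)
      (auto intro!: integrable_mult_right integrable_real_indicator simp: U01.emeasure_eq_measure U01.prob_space[simplified] Int_absorb2 subset_eq)
  also have "\<dots> = lin h x"
    using U01_less[of "frac x"] frac_ge_0[of x] frac_lt_1[of x] unfolding lin_def by (simp add: algebra_simps)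
  finally show "(\<integral>u. h \<lceil>x - u\<rceil> \<partial>U01) = lin h x" .
qed

lemma U01_powr:
  assumes "0 \<le> a"
  shows "(\<integral>\<^sup>+u. ennreal (u powr a) \<partial>U01) = ennreal (1 / (a + 1))"
proof -
  have "(\<integral>\<^sup>+u. ennreal (u powr a) \<partial>U01) = (\<integral>\<^sup>+u. ennreal (u powr a) * indicator {0<..<1} u \<partial>lborel)"
    unfolding U01_def by (subst nn_integral_restrict_space) auto
  also have "\<dots> = (\<integral>\<^sup>+u. ennreal (u powr a) * indicator {0..1} u \<partial>lborel)"
  proof (rule nn_integral_cong_AE)
    have "AE u in lborel. u \<noteq> 0 \<and> u \<noteq> (1::real)"
      using AE_lborel_singleton[of 0] AE_lborel_singleton[of 1] by auto
    then show "AE u in lborel. ennreal (u powr a) * indicator {0<..<1} u = ennreal (u powr a) * indicator {0..1} u"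
      by eventually_elim (auto simp: indicator_def)
  qed
  also have "\<dots> = ennreal (1 / (a + 1))"
    using has_integral_powr_from_0[of a 1] assms
    by (subst nn_integral_has_integral_lebesgue'[of "{0..1}" "\<lambda>u. u powr a" "1 / (a + 1)"]) auto
  finally show ?thesis .
qed

section \<open>Redrawing a single coin\<close>

lemma measurable_coins_upd: "(\<lambda>p. fun_upd (snd p) i (fst p)) \<in> measurable (U01 \<Otimes>\<^sub>M coins) coins"
proof -
  have "(\<lambda>p. fun_upd (snd p) i (fst p) j) \<in> measurable (U01 \<Otimes>\<^sub>M coins) U01" for j
    by (cases "j = i") (simp_all add: coins_def)
  then show ?thesis unfolding coins_def by (intro measurable_PiM_single') (auto simp: space_pair_measure space_PiM)
qed

lemma coins_distr: "distr (U01 \<Otimes>\<^sub>M coins) coins (\<lambda>p. fun_upd (snd p) i (fst p)) = coins"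
  using distr_pair_PiM_eq_PiM[of UNIV "\<lambda>_. U01" i] prob_space_U01 by (simp add: coins_def split_beta')

text \<open>Overwriting coin \<open>i\<close> by an independent one does not change the law of the
  family, so a coin can be singled out without splitting the infinite product. Here the new coin is
  integrated last; \<open>coins_resample\<close> integrates it first, for bounded
  integrands.\<close>

lemma coins_resample_nn:
  assumes [measurable]: "F \<in> borel_measurable coins"
  shows "(\<integral>\<^sup>+\<omega>. F \<omega> \<partial>coins) = (\<integral>\<^sup>+u. (\<integral>\<^sup>+\<omega>. F (fun_upd \<omega> i u) \<partial>coins) \<partial>U01)"
proof -
  have "(\<integral>\<^sup>+\<omega>. F \<omega> \<partial>coins) = (\<integral>\<^sup>+\<omega>. F \<omega> \<partial>distr (U01 \<Otimes>\<^sub>M coins) coins (\<lambda>p. fun_upd (snd p) i (fst p)))"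
    by (simp only: coins_distr)
  also have "\<dots> = (\<integral>\<^sup>+p. F (fun_upd (snd p) i (fst p)) \<partial>(U01 \<Otimes>\<^sub>M coins))"
    by (rule nn_integral_distr[OF measurable_coins_upd]) (simp add: assms(1))
  also have "\<dots> = (\<integral>\<^sup>+u. (\<integral>\<^sup>+\<omega>. F (fun_upd \<omega> i u) \<partial>coins) \<partial>U01)"
    using coins.nn_integral_fst[OF measurable_compose[OF measurable_coins_upd assms(1)]] by simp
  finally show ?thesis .
qed

interpretation U01_coins: pair_prob_space U01 coins
  by unfold_locales

lemma coins_resample:
  fixes F :: "(nat \<Rightarrow> real) \<Rightarrow> real"
  assumes [measurable]: "F \<in> borel_measurable coins" and B: "\<And>\<omega>. \<omega> \<in> space coins \<Longrightarrow> \<bar>F \<omega>\<bar> \<le> B"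
  shows "(\<integral>\<omega>. F \<omega> \<partial>coins) = (\<integral>\<omega>. (\<integral>u. F (fun_upd \<omega> i u) \<partial>U01) \<partial>coins)"
proof -
  have B': "\<bar>F (fun_upd (snd p) i (fst p))\<bar> \<le> B" if "p \<in> space (U01 \<Otimes>\<^sub>M coins)" for p
    using that by (intro B) (auto simp: space_pair_measure space_coins)
  have int: "integrable (U01 \<Otimes>\<^sub>M coins) (\<lambda>(u, \<omega>). F (fun_upd \<omega> i u))"
  proof (rule U01_coins.P.integrable_const_bound[where B = B])
    show "AE p in U01 \<Otimes>\<^sub>M coins. norm (case p of (u, \<omega>) \<Rightarrow> F (fun_upd \<omega> i u)) \<le> B"
      using B' by (intro AE_I2) (simp add: split_beta')
    show "(\<lambda>(u, \<omega>). F (fun_upd \<omega> i u)) \<in> borel_measurable (U01 \<Otimes>\<^sub>M coins)"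
      unfolding split_beta' by (rule measurable_compose[OF measurable_coins_upd assms(1)])
  qed
  have "(\<integral>\<omega>. F \<omega> \<partial>coins) = integral\<^sup>L (distr (U01 \<Otimes>\<^sub>M coins) coins (\<lambda>p. fun_upd (snd p) i (fst p))) F"
    by (simp only: coins_distr)
  also have "\<dots> = (\<integral>p. F (fun_upd (snd p) i (fst p)) \<partial>(U01 \<Otimes>\<^sub>M coins))"
    by (rule integral_distr[OF measurable_coins_upd assms(1)])
  also have "\<dots> = integral\<^sup>L (U01 \<Otimes>\<^sub>M coins) (\<lambda>(u, \<omega>). F (fun_upd \<omega> i u))"
    by (simp add: split_beta')
  also have "\<dots> = (\<integral>\<omega>. (\<integral>u. F (fun_upd \<omega> i u) \<partial>U01) \<partial>coins)"
    by (rule U01_coins.integral_snd[symmetric]) (rule int)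
  finally show ?thesis .
qed

text \<open>Measurability is joint in masses, coins and threshold, since \<theta> is random and
  \<tau> enters through the masses.\<close>

lemma tree_measurable [measurable]:
  assumes Y [measurable]: "\<And>l. (\<lambda>w. Y w l) \<in> borel_measurable \<Omega>"
    and Us [measurable]: "\<And>v. (\<lambda>w. Us w v) \<in> borel_measurable \<Omega>"
    and Th [measurable]: "Th \<in> borel_measurable \<Omega>"
  shows sm_measurable: "(\<lambda>w. sm M (Y w) v) \<in> borel_measurable \<Omega>"
    and key_measurable: "(\<lambda>w. key M (Y w) (Us w) v) \<in> borel_measurable \<Omega>"
    and crossing_measurable: "Measurable.pred \<Omega> (\<lambda>w. crossing M (Y w) v)"
    and left_first_measurable: "Measurable.pred \<Omega> (\<lambda>w. left_first M (Th w) (Y w) (Us w) v)"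
    and rep_measurable: "Measurable.pred \<Omega> (\<lambda>w. rep M (Th w) (Y w) (Us w) v = x)"
    and settled_measurable: "Measurable.pred \<Omega> (\<lambda>w. x \<in> settled M (Th w) (Y w) (Us w) v)"
    and sample_measurable: "Measurable.pred \<Omega> (\<lambda>w. x \<in> sample M (Th w) (Y w) (Us w))"
    and sel_measurable: "Measurable.pred \<Omega> (\<lambda>w. x \<in> sel M (Th w) (Y w) (Us w) v N)"
proof -
  have s [measurable]: "(\<lambda>w. sm M (Y w) v) \<in> borel_measurable \<Omega>" for v
    unfolding sm_eq_sum by (intro borel_measurable_sum Y)
  have k [measurable]: "(\<lambda>w. key M (Y w) (Us w) v) \<in> borel_measurable \<Omega>" for v
  proof (induction v rule: heap_induct[of M])
    case (leaf v)
    have "(\<lambda>w. gain (Us w v)) \<in> borel_measurable \<Omega>"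
      unfolding gain_def by (intro borel_measurable_divide borel_measurable_const borel_measurable_ln Us)
    then show ?case unfolding tree_leaf(3)[OF leaf] by (intro borel_measurable_times Y)
  next
    case (inner v)
    show ?case unfolding tree_inner(3)[OF inner(1,2)] by (intro borel_measurable_max inner.IH)
  qed
  have "lofrac \<in> borel_measurable borel"
    unfolding lofrac_def[abs_def] by measurable
  then have l [measurable]: "(\<lambda>w. lofrac (sm M (Y w) v)) \<in> borel_measurable \<Omega>" for v
    using measurable_compose s by blast
  have c [measurable]: "Measurable.pred \<Omega> (\<lambda>w. crossing M (Y w) v)" for v
    unfolding crossing_def by measurable
  have lf [measurable]: "Measurable.pred \<Omega> (\<lambda>w. left_first M (Th w) (Y w) (Us w) v)" for v
    unfolding left_first_def by measurable
  have r [measurable]: "Measurable.pred \<Omega> (\<lambda>w. rep M (Th w) (Y w) (Us w) v = x)" for v x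
  proof (induction v rule: heap_induct[of M])
    case (inner v)
    note [measurable] = inner.IH
    have "(\<lambda>w. rep M (Th w) (Y w) (Us w) v = x) = (\<lambda>w. if left_first M (Th w) (Y w) (Us w) v = crossing M (Y w) v
        then rep M (Th w) (Y w) (Us w) (2 * v + 1) = x else rep M (Th w) (Y w) (Us w) (2 * v) = x)"
      using inner(1,2) by (auto simp: tree_inner(4))
    then show ?case by simp
  qed (simp add: tree_leaf)
  have st [measurable]: "Measurable.pred \<Omega> (\<lambda>w. x \<in> settled M (Th w) (Y w) (Us w) v)" for v x
  proof (induction v rule: heap_induct[of M])
    case (inner v)
    note [measurable] = inner.IH
    have "(\<lambda>w. x \<in> settled M (Th w) (Y w) (Us w) v) = (\<lambda>w. x \<in> settled M (Th w) (Y w) (Us w) (2 * v) \<or>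
        x \<in> settled M (Th w) (Y w) (Us w) (2 * v + 1) \<or>
        crossing M (Y w) v \<and> (if left_first M (Th w) (Y w) (Us w) v = crossing M (Y w) v
        then rep M (Th w) (Y w) (Us w) (2 * v) = x else rep M (Th w) (Y w) (Us w) (2 * v + 1) = x))"
      using inner(1,2) by (auto simp: tree_inner(5) loser_def)
    then show ?case by (simp only:) measurable
  qed (simp add: tree_leaf)
  have se: "Measurable.pred \<Omega> (\<lambda>w. x \<in> sel M (Th w) (Y w) (Us w) v N)"
  proof -
    have "(\<lambda>w. x \<in> sel M (Th w) (Y w) (Us w) v N) = (\<lambda>w. x \<in> settled M (Th w) (Y w) (Us w) v \<or>
      \<lceil>sm M (Y w) v\<rceil> \<le> N \<and> 0 < sm M (Y w) v \<and> rep M (Th w) (Y w) (Us w) v = x)"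
      by (auto simp: sel_def)
    then show ?thesis by simp
  qed
  have sa: "Measurable.pred \<Omega> (\<lambda>w. x \<in> sample M (Th w) (Y w) (Us w))"
  proof -
    have "(\<lambda>w. x \<in> sample M (Th w) (Y w) (Us w)) = (\<lambda>w. x \<in> settled M (Th w) (Y w) (Us w) 1 \<or>
      \<lceil>sm M (Y w) 1\<rceil> \<le> \<lceil>sm M (Y w) 1 - Us w 0\<rceil> \<and> 0 < sm M (Y w) 1 \<and> rep M (Th w) (Y w) (Us w) 1 = x)"
      by (auto simp: sample_def sel_def)
    then show ?thesis by simp
  qed
  show "(\<lambda>w. sm M (Y w) v) \<in> borel_measurable \<Omega>" "(\<lambda>w. key M (Y w) (Us w) v) \<in> borel_measurable \<Omega>"
    "Measurable.pred \<Omega> (\<lambda>w. crossing M (Y w) v)" "Measurable.pred \<Omega> (\<lambda>w. left_first M (Th w) (Y w) (Us w) v)"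
    "Measurable.pred \<Omega> (\<lambda>w. rep M (Th w) (Y w) (Us w) v = x)"
    "Measurable.pred \<Omega> (\<lambda>w. x \<in> settled M (Th w) (Y w) (Us w) v)"
    "Measurable.pred \<Omega> (\<lambda>w. x \<in> sample M (Th w) (Y w) (Us w))"
    "Measurable.pred \<Omega> (\<lambda>w. x \<in> sel M (Th w) (Y w) (Us w) v N)"
    by (rule s k c lf r st sa se)+
qed

section \<open>The exponential race at light nodes\<close>

context sampling_tree
begin

lemma key_ge: "l \<in> leaves M v \<Longrightarrow> y l * gain (u l) \<le> key M y u v"
  by (induction v rule: heap_induct[of M]) (auto simp: tree_inner(2,3) tree_leaf le_max_iff_disj)

text \<open>Everything below a light node is light and nothing crosses there, so the tournament is a
  plain maximum over the leaves.\<close>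

lemma light_key:
  assumes "sm M y v < \<theta>" "0 < v"
  shows "key M y u v = y (rep M \<theta> y u v) * gain (u (rep M \<theta> y u v))"
  using assms
proof (induction v rule: heap_induct[of M])
  case (inner v)
  have l: "sm M y (2 * v) < \<theta>" "sm M y (2 * v + 1) < \<theta>"
    using inner tree_inner(1)[of v M y] sm_ge0[of "2 * v"] sm_ge0[of "2 * v + 1"] by auto
  have "\<not> crossing M y v" using inner light_not_crossing by simp
  then show ?case using inner.IH(1)[OF l(1)] inner.IH(2)[OF l(2)] inner
    by (auto simp: tree_inner(3,4) left_first_def max_def)
qed (simp add: tree_leaf)

end

text \<open>With the coins fixed, raising \<open>y l\<close> raises no key but that of
  \<open>l\<close>, so the winner can change only from some other leaf to \<open>l\<close>. This
  monotone coupling is what spares light subtrees a cost per level.\<close>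

lemma sampling_tree_mono:
  assumes "sampling_tree \<theta> y u" "sampling_tree \<theta> y' u"
    and l: "\<And>j. j \<noteq> l \<Longrightarrow> y j = y' j" "y l \<le> y' l"
    and light: "sm M y v < \<theta>" "sm M y' v < \<theta>" "0 < v"
  shows "(rep M \<theta> y u v = l \<longrightarrow> rep M \<theta> y' u v = l) \<and>
    (rep M \<theta> y' u v \<noteq> l \<longrightarrow> rep M \<theta> y u v = rep M \<theta> y' u v) \<and> key M y u v \<le> key M y' u v"
proof -
  interpret y: sampling_tree M \<theta> y u by fact
  interpret y': sampling_tree M \<theta> y' u by fact
  show ?thesis using light
  proof (induction v rule: heap_induct[of M])
    case (leaf v)
    have "y v * gain (u v) \<le> y' v * gain (u v)"
      using l y.gain_pos[of v] by (cases "v = l") auto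
    then show ?case using l(1) unfolding tree_leaf[OF leaf(1)] by simp
  next
    case (inner v)
    have lt: "sm M y (2 * v) < \<theta>" "sm M y (2 * v + 1) < \<theta>" "sm M y' (2 * v) < \<theta>" "sm M y' (2 * v + 1) < \<theta>"
      using inner.prems(1,2) tree_inner(1)[OF inner(1,2), of y] tree_inner(1)[OF inner(1,2), of y']
        y.sm_ge0[where v = "2 * v"] y.sm_ge0[where v = "2 * v + 1"]
        y'.sm_ge0[where v = "2 * v"] y'.sm_ge0[where v = "2 * v + 1"] by linarith+
    have nc: "\<not> crossing M y v" "\<not> crossing M y' v"
      using y.light_not_crossing y'.light_not_crossing inner by auto
    let ?a = "2 * v" and ?b = "2 * v + 1"
    have A: "(rep M \<theta> y u ?a = l \<longrightarrow> rep M \<theta> y' u ?a = l) \<and>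
      (rep M \<theta> y' u ?a \<noteq> l \<longrightarrow> rep M \<theta> y u ?a = rep M \<theta> y' u ?a) \<and> key M y u ?a \<le> key M y' u ?a"
      by (rule inner.IH(1)[OF lt(1,3)]) (simp add: inner(1))
    have B: "(rep M \<theta> y u ?b = l \<longrightarrow> rep M \<theta> y' u ?b = l) \<and>
      (rep M \<theta> y' u ?b \<noteq> l \<longrightarrow> rep M \<theta> y u ?b = rep M \<theta> y' u ?b) \<and> key M y u ?b \<le> key M y' u ?b"
      by (rule inner.IH(2)[OF lt(2,4)]) simp
    \<comment> \<open>If the champion of the subtree is not \<open>l\<close>, its mass and hence the
      key are the same for both vectors.\<close>
    have ka: "key M y' u ?a = key M y u ?a" if "rep M \<theta> y' u ?a \<noteq> l"
    proof -
      have "0 < ?a" "y' (rep M \<theta> y' u ?a) = y (rep M \<theta> y' u ?a)" using l(1)[OF that] inner(1) by simp_all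
      moreover have "rep M \<theta> y u ?a = rep M \<theta> y' u ?a" using A that by blast
      ultimately show ?thesis using y.light_key[OF lt(1)] y'.light_key[OF lt(3)] by metis
    qed
    have kb: "key M y' u ?b = key M y u ?b" if "rep M \<theta> y' u ?b \<noteq> l"
    proof -
      have "0 < ?b" "y' (rep M \<theta> y' u ?b) = y (rep M \<theta> y' u ?b)" using l(1)[OF that] inner(1) by simp_all
      moreover have "rep M \<theta> y u ?b = rep M \<theta> y' u ?b" using B that by blast
      ultimately show ?thesis using y.light_key[OF lt(2)] y'.light_key[OF lt(4)] by metis
    qed
    have la: "left_first M \<theta> y u v = (key M y u ?b < key M y u ?a)"
      "left_first M \<theta> y' u v = (key M y' u ?b < key M y' u ?a)"
      using inner.prems by (auto simp: left_first_def)
    \<comment> \<open>The leaf \<open>l\<close> can lie below only one child, so at least one of the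
      two keys is common to both vectors.\<close>
    have ex: "rep M \<theta> y' u ?a \<noteq> l \<or> rep M \<theta> y' u ?b \<noteq> l"
      using y'.rep_in_leaves[of ?a] y'.rep_in_leaves[of ?b] leaves_disjoint[OF inner(1), of M] by auto
    have "key M y u v \<le> key M y' u v" using A B inner(1,2) by (simp add: tree_inner(3) le_max_iff_disj) linarith
    moreover have "rep M \<theta> y u v = (if key M y u ?b < key M y u ?a then rep M \<theta> y u ?a else rep M \<theta> y u ?b)"
      "rep M \<theta> y' u v = (if key M y' u ?b < key M y' u ?a then rep M \<theta> y' u ?a else rep M \<theta> y' u ?b)"
      using nc la inner(1,2) by (auto simp: tree_inner(4))
    ultimately show ?case using A B ka kb ex by (smt (verit))
  qed
qed

lemma gain_compare:
  assumes "0 < r" "r < 1" "0 < u" "u < 1" "0 < b" "0 \<le> a"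
  shows "a * gain r < b * gain u \<longleftrightarrow> a = 0 \<or> r < u powr (a / b)"
    and "a * gain r \<le> b * gain u \<longleftrightarrow> a = 0 \<or> r \<le> u powr (a / b)"
proof -
  have ln: "ln r < 0" "ln u < 0" using assms by auto
  have g: "0 < gain u" using ln by (simp add: gain_def divide_neg_neg)
  have "r < u powr (a / b) \<longleftrightarrow> ln r < a / b * ln u"
    using assms by (metis ln_less_cancel_iff ln_powr powr_gt_zero less_irrefl)
  also have "\<dots> \<longleftrightarrow> b * ln r < a * ln u" using assms by (simp add: field_simps)
  also have "\<dots> \<longleftrightarrow> a * gain r < b * gain u"
    using ln by (simp add: gain_def divide_simps)
  finally show "a * gain r < b * gain u \<longleftrightarrow> a = 0 \<or> r < u powr (a / b)"
    using assms g by auto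
  have "r \<le> u powr (a / b) \<longleftrightarrow> ln r \<le> a / b * ln u"
    using assms by (metis ln_le_cancel_iff ln_powr powr_gt_zero less_irrefl)
  also have "\<dots> \<longleftrightarrow> b * ln r \<le> a * ln u" using assms by (simp add: field_simps)
  also have "\<dots> \<longleftrightarrow> a * gain r \<le> b * gain u"
    using ln by (simp add: gain_def divide_simps)
  finally show "a * gain r \<le> b * gain u \<longleftrightarrow> a = 0 \<or> r \<le> u powr (a / b)"
    using assms g by auto
qed

text \<open>Given the coin \<open>u\<close> of \<open>l\<close>, each rival \<open>j\<close> loses
  independently with probability \<open>u powr (y j / y l)\<close>, so all of them lose with
  probability \<open>u powr (sum y J / y l)\<close>. Integrating over \<open>u\<close> gives the
  share of \<open>y l\<close>. Strict and weak races are both needed because the tournament breaks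
  ties by position.\<close>

lemma race_probability:
  fixes y :: "nat \<Rightarrow> real" and strict :: bool
  assumes J: "finite J" "l \<notin> J" and y: "\<And>j. 0 \<le> y j" "0 < y l"
  defines "wins \<equiv> \<lambda>\<omega> :: nat \<Rightarrow> real. \<forall>j\<in>J. if strict then y j * gain (\<omega> j) < y l * gain (\<omega> l)
    else y j * gain (\<omega> j) \<le> y l * gain (\<omega> l)"
  shows "{\<omega> \<in> space coins. wins \<omega>} \<in> sets coins"
    and "measure coins {\<omega> \<in> space coins. wins \<omega>} = y l / (y l + sum y J)"
proof -
  have gm: "(\<lambda>\<omega>. gain (\<omega> j)) \<in> borel_measurable coins" for j
    unfolding gain_def by (intro borel_measurable_divide borel_measurable_const borel_measurable_ln coin_measurable)
  note [measurable] = gm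
  show m [measurable]: "{\<omega> \<in> space coins. wins \<omega>} \<in> sets coins"
    unfolding wins_def using J(1)
    by (cases strict) (auto intro!: sets.sets_Collect_finite_All borel_measurable_less borel_measurable_le
      borel_measurable_times gm)
  define C where "C = (\<lambda>u j. {r \<in> space U01. if strict then y j * gain r < y l * gain u else y j * gain r \<le> y l * gain u})"
  have C: "C u j \<in> sets U01 \<and> emeasure U01 (C u j) = ennreal (u powr (y j / y l))"
    if u: "u \<in> space U01" for u j
  proof (cases "y j = 0")
    case True
    have "0 < gain u" using u by (simp add: gain_def divide_neg_neg)
    then have "C u j = space U01" using True y by (auto simp: C_def)
    moreover have "emeasure U01 (space U01) = 1" by (rule U01.emeasure_space_1)
    moreover have "space U01 \<in> sets U01" by (rule sets.top)
    ultimately show ?thesis using True u by simp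
  next
    case False
    let ?c = "u powr (y j / y l)"
    have c: "0 \<le> ?c" "?c \<le> 1" using u y by (auto intro!: powr_le1)
    have "C u j = (if strict then {r \<in> space U01. r < ?c} else {r \<in> space U01. r \<le> ?c})"
      using gain_compare[of _ u "y l" "y j"] u y False by (auto simp: C_def)
    moreover have "{r \<in> space U01. r < ?c} \<in> sets U01" "{r \<in> space U01. r \<le> ?c} \<in> sets U01"
      using borel_measurable_less[OF U01_in_borel borel_measurable_const]
        borel_measurable_le[OF U01_in_borel borel_measurable_const] by blast+
    ultimately show ?thesis using U01_less[OF c] U01_le[OF c] by (simp add: U01.emeasure_eq_measure)
  qed
  have "emeasure coins {\<omega> \<in> space coins. wins \<omega>} = (\<integral>\<^sup>+\<omega>. indicator {\<omega> \<in> space coins. wins \<omega>} \<omega> \<partial>coins)"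
    by simp
  also have "\<dots> = (\<integral>\<^sup>+u. (\<integral>\<^sup>+\<omega>. indicator {\<omega> \<in> space coins. wins \<omega>} (fun_upd \<omega> l u) \<partial>coins) \<partial>U01)"
    by (rule coins_resample_nn) simp
  also have "\<dots> = (\<integral>\<^sup>+u. ennreal (u powr (sum y J / y l)) \<partial>U01)"
  proof (rule nn_integral_cong)
    fix u assume u: "u \<in> space U01"
    have "(\<integral>\<^sup>+\<omega>. indicator {\<omega> \<in> space coins. wins \<omega>} (fun_upd \<omega> l u) \<partial>coins) =
        (\<integral>\<^sup>+\<omega>. indicator {\<omega> \<in> space coins. \<forall>j\<in>J. \<omega> j \<in> C u j} \<omega> \<partial>coins)"
    proof (rule nn_integral_cong)
      fix \<omega> assume "\<omega> \<in> space coins"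
      moreover have "j \<noteq> l" if "j \<in> J" for j using J that by auto
      ultimately show "indicator {\<omega> \<in> space coins. wins \<omega>} (fun_upd \<omega> l u) =
          (indicator {\<omega> \<in> space coins. \<forall>j\<in>J. \<omega> j \<in> C u j} \<omega> :: ennreal)"
        using u by (auto simp: indicator_def wins_def C_def space_coins)
    qed
    also have "\<dots> = emeasure coins {\<omega> \<in> space coins. \<forall>j\<in>J. \<omega> j \<in> C u j}"
    proof (rule nn_integral_indicator)
      have "{\<omega> \<in> space coins. \<omega> j \<in> C u j} \<in> sets coins" for j
      proof -
        have "(\<lambda>\<omega>. \<omega> j) \<in> measurable coins U01"
          unfolding coins_def by (rule measurable_component_singleton) simp
        from measurable_sets[OF this, of "C u j"] show ?thesis
          using C[OF u, of j] by (simp add: vimage_def Int_def conj_commute)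
      qed
      then show "{\<omega> \<in> space coins. \<forall>j\<in>J. \<omega> j \<in> C u j} \<in> sets coins"
        using J(1) by (intro sets.sets_Collect_finite_All) auto
    qed
    also have "\<dots> = (\<Prod>j\<in>J. emeasure U01 (C u j))"
      unfolding coins_def using C[OF u] J(1) by (intro coins_prod.emeasure_PiM_Collect) auto
    also have "\<dots> = (\<Prod>j\<in>J. ennreal (u powr (y j / y l)))" using C[OF u] by simp
    also have "\<dots> = ennreal (\<Prod>j\<in>J. u powr (y j / y l))" by (rule prod_ennreal) simp
    also have "(\<Prod>j\<in>J. u powr (y j / y l)) = u powr (sum y J / y l)"
      using u J(1) by (simp add: sum_divide_distrib powr_sum)
    finally show "(\<integral>\<^sup>+\<omega>. indicator {\<omega> \<in> space coins. wins \<omega>} (fun_upd \<omega> l u) \<partial>coins) =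
        ennreal (u powr (sum y J / y l))" .
  qed
  also have "\<dots> = ennreal (1 / (sum y J / y l + 1))"
    using y by (intro U01_powr) (simp add: sum_nonneg)
  also have "1 / (sum y J / y l + 1) = y l / (y l + sum y J)"
    using y by (simp add: field_simps)
  finally show "measure coins {\<omega> \<in> space coins. wins \<omega>} = y l / (y l + sum y J)"
    using y by (simp add: measure_def sum_nonneg less_imp_le)
qed

lemma coin_tree:
  assumes "\<theta> \<le> 1" "\<And>l. 0 \<le> y l" "\<And>l. y l \<le> 1" "\<omega> \<in> space coins"
  shows "sampling_tree \<theta> y \<omega>"
  using assms by unfold_locales (auto simp: space_coins)

lemma coins_measurable_sel:
  "Measurable.pred coins (\<lambda>\<omega>. x \<in> sel M \<theta> y \<omega> v N)"
  "Measurable.pred coins (\<lambda>\<omega>. rep M \<theta> y \<omega> v = x)"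
  "Measurable.pred coins (\<lambda>\<omega>. x \<in> sample M \<theta> y \<omega>)"
  by (intro sel_measurable rep_measurable sample_measurable coin_measurable borel_measurable_const)+

lemma winner_probability:
  assumes "\<theta> \<le> 1" and y: "\<And>l. 0 \<le> y l" "\<And>l. y l \<le> 1"
    and v: "0 < v" "sm M y v < \<theta>" "0 < sm M y v" and l: "l \<in> leaves M v"
  shows "measure coins {\<omega> \<in> space coins. rep M \<theta> y \<omega> v = l} = y l / sm M y v"
proof (cases "y l = 0")
  case True
  have "rep M \<theta> y \<omega> v \<noteq> l" if "\<omega> \<in> space coins" for \<omega>
  proof -
    interpret sampling_tree M \<theta> y \<omega> using assms that by (intro coin_tree)
    show ?thesis using rep_pos[OF v(3)] True by auto
  qed
  then have "{\<omega> \<in> space coins. rep M \<theta> y \<omega> v = l} = {}" by auto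
  then show ?thesis using True by (simp only: measure_empty)
next
  case False
  then have pos: "0 < y l" using y(1)[of l] by simp
  let ?J = "leaves M v - {l}"
  let ?A = "{\<omega> \<in> space coins. rep M \<theta> y \<omega> v = l}"
  let ?S = "{\<omega> \<in> space coins. \<forall>j\<in>?J. if True then y j * gain (\<omega> j) < y l * gain (\<omega> l)
    else y j * gain (\<omega> j) \<le> y l * gain (\<omega> l)}"
  let ?W = "{\<omega> \<in> space coins. \<forall>j\<in>?J. if False then y j * gain (\<omega> j) < y l * gain (\<omega> l)
    else y j * gain (\<omega> j) \<le> y l * gain (\<omega> l)}"
  have s: "y l + sum y ?J = sm M y v"
    using l by (simp add: sm_eq_sum sum.remove)
  have mA: "?A \<in> sets coins" using coins_measurable_sel(2) by simp
  have J: "finite ?J" "l \<notin> ?J" by auto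
  note S = race_probability[where y = y and l = l, OF J y(1) pos, where strict = True, unfolded s]
  note W = race_probability[where y = y and l = l, OF J y(1) pos, where strict = False, unfolded s]
  \<comment> \<open>Winning strictly forces \<open>rep = l\<close>, and \<open>rep = l\<close>
    forces winning weakly. Both races have the same probability, so ties need no separate
    treatment.\<close>
  have "?S \<subseteq> ?A"
  proof
    fix \<omega> assume \<omega>: "\<omega> \<in> ?S"
    then interpret sampling_tree M \<theta> y \<omega> using assms by (intro coin_tree) auto
    have "y l * gain (\<omega> l) \<le> y (rep M \<theta> y \<omega> v) * gain (\<omega> (rep M \<theta> y \<omega> v))"
      using key_ge[OF l] light_key[OF v(2,1)] by simp
    moreover have "y (rep M \<theta> y \<omega> v) * gain (\<omega> (rep M \<theta> y \<omega> v)) < y l * gain (\<omega> l)"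
      if "rep M \<theta> y \<omega> v \<noteq> l"
    proof -
      have "rep M \<theta> y \<omega> v \<in> ?J" using that rep_in_leaves[of v] by simp
      then show ?thesis using \<omega> by simp
    qed
    ultimately have "rep M \<theta> y \<omega> v = l" by fastforce
    then show "\<omega> \<in> ?A" using \<omega> by auto
  qed
  moreover have "?A \<subseteq> ?W"
  proof
    fix \<omega> assume \<omega>: "\<omega> \<in> ?A"
    then interpret sampling_tree M \<theta> y \<omega> using assms by (intro coin_tree) auto
    have "y j * gain (\<omega> j) \<le> y l * gain (\<omega> l)" if "j \<in> leaves M v" for j
      using key_ge[OF that] light_key[OF v(2,1)] \<omega> by simp
    then show "\<omega> \<in> ?W" using \<omega> by auto
  qed
  ultimately have "measure coins ?S \<le> measure coins ?A" "measure coins ?A \<le> measure coins ?W"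
    using S(1) W(1) mA by (auto intro!: coins.finite_measure_mono)
  then show ?thesis using S(2) W(2) by linarith
qed

section \<open>Distance of sets and the count handed to a child\<close>

definition sd :: "'a set \<Rightarrow> 'a set \<Rightarrow> real" where
  "sd A B = real (card (sym_diff A B))"

lemma sd_nonneg [simp]: "0 \<le> sd A B"
  by (simp add: sd_def)

lemma sd_self [simp]: "sd A A = 0"
  by (simp add: sd_def)

lemma sd_commute: "sd A B = sd B A"
  by (simp add: sd_def Un_commute)

lemma sd_triangle: "finite A \<Longrightarrow> finite B \<Longrightarrow> finite C \<Longrightarrow> sd A C \<le> sd A B + sd B C"
proof -
  assume "finite A" "finite B" "finite C"
  then have "card (sym_diff A C) \<le> card (sym_diff A B \<union> sym_diff B C)" by (intro card_mono) auto
  also have "\<dots> \<le> card (sym_diff A B) + card (sym_diff B C)" by (rule card_Un_le)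
  finally show ?thesis by (simp add: sd_def)
qed

lemma sd_Un: "finite A \<Longrightarrow> finite B \<Longrightarrow> finite C \<Longrightarrow> finite D \<Longrightarrow> sd (A \<union> B) (C \<union> D) \<le> sd A C + sd B D"
proof -
  assume "finite A" "finite B" "finite C" "finite D"
  then have "card (sym_diff (A \<union> B) (C \<union> D)) \<le> card (sym_diff A C \<union> sym_diff B D)" by (intro card_mono) auto
  also have "\<dots> \<le> card (sym_diff A C) + card (sym_diff B D)" by (rule card_Un_le)
  finally show ?thesis by (simp add: sd_def)
qed

lemma sd_le_card: "finite A \<Longrightarrow> finite B \<Longrightarrow> sd A B \<le> card A + card B"
proof -
  assume "finite A" "finite B"
  then have "card (sym_diff A B) \<le> card (A \<union> B)" by (intro card_mono) auto
  also have "\<dots> \<le> card A + card B" by (rule card_Un_le)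
  finally show ?thesis by (simp add: sd_def)
qed

lemma sd_eq_sum:
  assumes "finite S" "A \<subseteq> S" "B \<subseteq> S"
  shows "sd A B = (\<Sum>x\<in>S. of_bool ((x \<in> A) \<noteq> (x \<in> B)))"
proof -
  have "sym_diff A B = S \<inter> {x. (x \<in> A) \<noteq> (x \<in> B)}" using assms by auto
  then show ?thesis using assms(1) by (simp add: sd_def sum_of_bool_eq)
qed

lemma sd_measurable:
  assumes "finite S" "\<And>w. w \<in> space \<Omega> \<Longrightarrow> A w \<subseteq> S" "\<And>w. w \<in> space \<Omega> \<Longrightarrow> B w \<subseteq> S"
    and [measurable]: "\<And>x. Measurable.pred \<Omega> (\<lambda>w. x \<in> A w)" "\<And>x. Measurable.pred \<Omega> (\<lambda>w. x \<in> B w)"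
  shows "(\<lambda>w. sd (A w) (B w)) \<in> borel_measurable \<Omega>"
proof -
  have "(\<lambda>w. \<Sum>x\<in>S. of_bool ((x \<in> A w) \<noteq> (x \<in> B w)) :: real) \<in> borel_measurable \<Omega>"
    unfolding of_bool_def by measurable
  then show ?thesis
    by (rule measurable_cong[THEN iffD1, rotated]) (use assms in \<open>simp add: sd_eq_sum[of S]\<close>)
qed

lemma lin_reflect: "lin (\<lambda>m. h (N - m)) x = lin h (of_int N - x)"
proof -
  have x: "of_int (N - \<lfloor>x\<rfloor> - 1) \<le> of_int N - x" "of_int N - x \<le> of_int (N - \<lfloor>x\<rfloor> - 1) + 1"
    by (simp_all; linarith)+
  show ?thesis unfolding lin_eq[OF x] by (simp add: lin_def frac_def algebra_simps)
qed

text \<open>For a fixed coin the rounding is monotone in \<open>x\<close>, so the absolute value can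
  be taken outside the integral: roundings by a common coin are as close as their means.\<close>

lemma U01_ceiling_diff:
  "(\<integral>u. \<bar>real_of_int \<lceil>x - u\<rceil> - of_int \<lceil>x' - u\<rceil>\<bar> \<partial>U01) = \<bar>x - x'\<bar>"
  "integrable U01 (\<lambda>u. \<bar>real_of_int \<lceil>x - u\<rceil> - of_int \<lceil>x' - u\<rceil>\<bar>)"
proof -
  note c = U01_ceiling[where h = of_int]
  show "integrable U01 (\<lambda>u. \<bar>real_of_int \<lceil>x - u\<rceil> - of_int \<lceil>x' - u\<rceil>\<bar>)"
    using c(1)[of x] c(1)[of x'] by auto
  have *: "(\<integral>u. \<bar>real_of_int \<lceil>x - u\<rceil> - of_int \<lceil>x' - u\<rceil>\<bar> \<partial>U01) = x' - x" if "x \<le> x'" for x x'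
  proof -
    have "\<bar>real_of_int \<lceil>x - u\<rceil> - of_int \<lceil>x' - u\<rceil>\<bar> = of_int \<lceil>x' - u\<rceil> - of_int \<lceil>x - u\<rceil>" for u
      using ceiling_mono[of "x - u" "x' - u"] that by simp
    then show ?thesis using c[of x] c[of x'] by simp
  qed
  show "(\<integral>u. \<bar>real_of_int \<lceil>x - u\<rceil> - of_int \<lceil>x' - u\<rceil>\<bar> \<partial>U01) = \<bar>x - x'\<bar>"
    using *[of x x'] *[of x' x] by (cases "x \<le> x'") (auto simp: abs_minus_commute)
qed

text \<open>The flag tells on which side the path continues, so that both sides are covered by one
  argument; the right child gets the remainder.\<close>

definition child_count :: "int \<Rightarrow> real \<Rightarrow> real \<Rightarrow> bool \<Rightarrow> real \<Rightarrow> int" where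
  "child_count N s a right u = (if right then N - \<lceil>mu N s a - u\<rceil> else \<lceil>mu N s a - u\<rceil>)"

lemma child_count_integral:
  fixes h :: "int \<Rightarrow> real"
  assumes "valid N s"
  shows "(\<integral>u. h (child_count N s a right u) \<partial>U01) = lin h (mu N s (if right then s - a else a))"
proof (cases right)
  case True
  have "(\<integral>u. h (N - \<lceil>mu N s a - u\<rceil>) \<partial>U01) = lin (\<lambda>m. h (N - m)) (mu N s a)"
    by (rule U01_ceiling(2))
  also have "of_int N - mu N s a = mu N s (s - a)" using mu_sym[OF assms, of a] by simp
  then have "lin (\<lambda>m. h (N - m)) (mu N s a) = lin h (mu N s (s - a))" by (simp add: lin_reflect)
  finally show ?thesis using True by (simp add: child_count_def)
qed (simp add: child_count_def U01_ceiling)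

lemma child_count_diff:
  assumes "valid N s" "valid N s'"
  shows "(\<integral>u. \<bar>real_of_int (child_count N s a right u) - of_int (child_count N s' a' right u)\<bar> \<partial>U01) =
      \<bar>mu N s (if right then s - a else a) - mu N s' (if right then s' - a' else a')\<bar>"
    and "integrable U01 (\<lambda>u. \<bar>real_of_int (child_count N s a right u) - of_int (child_count N s' a' right u)\<bar>)"
proof -
  have eq: "\<bar>real_of_int (child_count N s a right u) - of_int (child_count N s' a' right u)\<bar> =
      \<bar>real_of_int \<lceil>mu N s a - u\<rceil> - of_int \<lceil>mu N s' a' - u\<rceil>\<bar>" for u
    by (cases right) (simp_all add: child_count_def abs_minus_commute)
  show "integrable U01 (\<lambda>u. \<bar>real_of_int (child_count N s a right u) - of_int (child_count N s' a' right u)\<bar>)"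
    unfolding eq by (rule U01_ceiling_diff)
  show "(\<integral>u. \<bar>real_of_int (child_count N s a right u) - of_int (child_count N s' a' right u)\<bar> \<partial>U01) =
      \<bar>mu N s (if right then s - a else a) - mu N s' (if right then s' - a' else a')\<bar>"
    unfolding eq U01_ceiling_diff using mu_sym[OF assms(1), of a] mu_sym[OF assms(2), of a'] by simp linarith
qed

lemma child_count_measurable: "(\<lambda>\<omega>. child_count N s a right (\<omega> v)) \<in> measurable coins (count_space UNIV)"
  unfolding child_count_def
  using measurable_compose[OF borel_measurable_diff[OF borel_measurable_const coin_measurable] measurable_real_ceiling]
  by (cases right) (auto intro: measurable_compose[where N = "count_space UNIV"])

lemma coin_integral:
  fixes g :: "real \<Rightarrow> real"
  assumes "g \<in> borel_measurable U01"
  shows "(\<integral>\<omega>. g (\<omega> v) \<partial>coins) = (\<integral>u. g u \<partial>U01)" "integrable U01 g \<Longrightarrow> integrable coins (\<lambda>\<omega>. g (\<omega> v))"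
proof -
  have m: "(\<lambda>\<omega>. \<omega> v) \<in> measurable coins U01"
    unfolding coins_def by (rule measurable_component_singleton) simp
  have d: "distr coins U01 (\<lambda>\<omega>. \<omega> v) = U01"
    unfolding coins_def by (rule coins_prod.PiM_component) simp
  show "(\<integral>\<omega>. g (\<omega> v) \<partial>coins) = (\<integral>u. g u \<partial>U01)"
    using integral_distr[OF m assms] d by simp
  show "integrable U01 g \<Longrightarrow> integrable coins (\<lambda>\<omega>. g (\<omega> v))"
    using integrable_distr_eq[OF m assms] d by simp
qed

lemma (in sampling_tree) sel_child:
  assumes v: "0 < v" "v < M" and N: "valid N (sm M y v)" and fresh: "\<not> sm M y v < \<theta>"
  defines "n \<equiv> \<lambda>right. child_count N (sm M y v) (sm M y (2 * v)) right (u v)"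
  shows "valid (n right) (sm M y (2 * v + of_bool right))"
    and "valid (N - n right) (sm M y (2 * v + of_bool (\<not> right)))"
    and "sel M \<theta> y u v N = sel M \<theta> y u (2 * v + of_bool right) (n right) \<union>
      sel M \<theta> y u (2 * v + of_bool (\<not> right)) (N - n right)"
proof -
  have "nl M \<theta> y u v N = \<lceil>mu N (sm M y v) (sm M y (2 * v)) - u v\<rceil>" using fresh by (simp add: nl_def)
  note r = sel_rec[OF v N, unfolded this]
  show "valid (n right) (sm M y (2 * v + of_bool right))"
    and "valid (N - n right) (sm M y (2 * v + of_bool (\<not> right)))"
    using r(1,2) by (cases right; simp add: n_def child_count_def)+
  show "sel M \<theta> y u v N = sel M \<theta> y u (2 * v + of_bool right) (n right) \<union>
      sel M \<theta> y u (2 * v + of_bool (\<not> right)) (N - n right)"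
    using r(3) by (cases right) (simp_all add: n_def child_count_def Un_commute)
qed

section \<open>Changing one leaf\<close>

locale leaf_change =
  fixes M :: nat and \<theta> :: real and y y' :: "nat \<Rightarrow> real" and l :: nat
  assumes theta: "\<theta> \<le> 1"
    and y01: "\<And>j. 0 \<le> y j" "\<And>j. y j \<le> 1"
    and y01': "\<And>j. 0 \<le> y' j" "\<And>j. y' j \<le> 1"
    and other: "\<And>j. j \<noteq> l \<Longrightarrow> y j = y' j"
    and l: "M \<le> l" "l < 2 * M"
begin

text \<open>Both inputs are handed the same \<open>N\<close> here. The effect of handing different
  counts to a child is charged to its parent.\<close>

definition hd :: "nat \<Rightarrow> int \<Rightarrow> real" where
  "hd v N = (\<integral>\<omega>. sd (sel M \<theta> y \<omega> v N) (sel M \<theta> y' \<omega> v N) \<partial>coins)"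

lemma tree: "\<omega> \<in> space coins \<Longrightarrow> sampling_tree \<theta> y \<omega>" "\<omega> \<in> space coins \<Longrightarrow> sampling_tree \<theta> y' \<omega>"
  using theta y01 y01' by (auto intro!: coin_tree)

lemma sel_sub: "\<omega> \<in> space coins \<Longrightarrow> sel M \<theta> y \<omega> v N \<subseteq> leaves M v"
  "\<omega> \<in> space coins \<Longrightarrow> sel M \<theta> y' \<omega> v N \<subseteq> leaves M v"
  using sampling_tree.sel_subset[OF tree(1)] sampling_tree.sel_subset[OF tree(2)] by auto

lemma sel_finite: "\<omega> \<in> space coins \<Longrightarrow> finite (sel M \<theta> y \<omega> v N)"
  "\<omega> \<in> space coins \<Longrightarrow> finite (sel M \<theta> y' \<omega> v N)"
  using sel_sub[of \<omega> v N] finite_leaves finite_subset by blast+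

lemma sd_sel_measurable: "(\<lambda>\<omega>. sd (sel M \<theta> y \<omega> v N) (sel M \<theta> y' \<omega> v N')) \<in> borel_measurable coins"
  by (rule sd_measurable[OF finite_leaves sel_sub]) (auto intro: coins_measurable_sel)

lemma sd_sel_bound: "\<omega> \<in> space coins \<Longrightarrow> sd (sel M \<theta> y \<omega> v N) (sel M \<theta> y' \<omega> v N') \<le> 2 * real (card (leaves M v))"
  using sd_le_card[of "sel M \<theta> y \<omega> v N" "sel M \<theta> y' \<omega> v N'"] sel_finite[of \<omega> v]
    card_mono[OF finite_leaves sel_sub(1)[of \<omega> v N]] card_mono[OF finite_leaves sel_sub(2)[of \<omega> v N']] by simp

lemma sd_sel_integrable: "integrable coins (\<lambda>\<omega>. sd (sel M \<theta> y \<omega> v N) (sel M \<theta> y' \<omega> v N'))"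
  by (rule coins.integrable_const_bound[where B = "2 * real (card (leaves M v))"])
    (auto intro!: AE_I2 sd_sel_bound sd_sel_measurable)

lemma sm_diff: "sm M y' v - sm M y v = (if l \<in> leaves M v then y' l - y l else 0)"
proof (cases "l \<in> leaves M v")
  case True
  have "sum y (leaves M v - {l}) = sum y' (leaves M v - {l})" using other by (intro sum.cong) auto
  then show ?thesis using True by (simp add: sm_eq_sum sum.remove[of _ l])
next
  case False
  have "sum y (leaves M v) = sum y' (leaves M v)" using False by (intro sum.cong refl other) auto
  then show ?thesis using False by (simp add: sm_eq_sum)
qed

text \<open>Shared coins make the two events "\<open>l\<close> wins" nested, and the winner can
  change only to or from \<open>l\<close>. So the probability of a change is the difference of two
  winning probabilities, whatever the depth of the subtree.\<close>

lemma rep_change_probability: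
  assumes v: "0 < v" "l \<in> leaves M v" and light: "sm M y v < \<theta>" "sm M y' v < \<theta>"
    and pos: "0 < sm M y v" "0 < sm M y' v"
  shows "{\<omega> \<in> space coins. rep M \<theta> y \<omega> v \<noteq> rep M \<theta> y' \<omega> v} \<in> sets coins"
    and "measure coins {\<omega> \<in> space coins. rep M \<theta> y \<omega> v \<noteq> rep M \<theta> y' \<omega> v} \<le> \<bar>y' l / sm M y' v - y l / sm M y v\<bar>"
proof -
  let ?D = "{\<omega> \<in> space coins. rep M \<theta> y \<omega> v \<noteq> rep M \<theta> y' \<omega> v}"
  let ?E = "{\<omega> \<in> space coins. rep M \<theta> y \<omega> v = l}" and ?E' = "{\<omega> \<in> space coins. rep M \<theta> y' \<omega> v = l}"
  have m: "{\<omega> \<in> space coins. rep M \<theta> y \<omega> v = x} \<in> sets coins" "{\<omega> \<in> space coins. rep M \<theta> y' \<omega> v = x} \<in> sets coins" for x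
    using coins_measurable_sel(2) by auto
  then have E: "?E \<in> sets coins" "?E' \<in> sets coins" by auto
  have D_eq: "?D = {\<omega> \<in> space coins. \<exists>x\<in>leaves M v. rep M \<theta> y \<omega> v = x \<and> rep M \<theta> y' \<omega> v \<noteq> x}"
    using sampling_tree.rep_in_leaves[OF tree(1)] by auto
  show D: "?D \<in> sets coins"
    unfolding D_eq using m
    by (intro sets.sets_Collect_finite_Ex sets.sets_Collect_conj sets.sets_Collect_neg finite_leaves)
  have p: "measure coins ?E = y l / sm M y v" "measure coins ?E' = y' l / sm M y' v"
    using winner_probability theta y01 y01' v light pos by auto
  show "measure coins ?D \<le> \<bar>y' l / sm M y' v - y l / sm M y v\<bar>"
  proof (cases "y l \<le> y' l")
    case True
    note mono = sampling_tree_mono[OF tree(1,2) other True light v(1)]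
    have up: "rep M \<theta> y' \<omega> v = l" if "\<omega> \<in> space coins" "rep M \<theta> y \<omega> v = l" for \<omega>
      using mono[OF that(1,1)] that(2) by blast
    have same: "rep M \<theta> y \<omega> v = rep M \<theta> y' \<omega> v" if "\<omega> \<in> space coins" "rep M \<theta> y' \<omega> v \<noteq> l" for \<omega>
      using mono[OF that(1,1)] that(2) by blast
    have "?D \<subseteq> ?E' - ?E"
    proof
      fix \<omega> assume "\<omega> \<in> ?D"
      then have "\<omega> \<in> space coins" "rep M \<theta> y \<omega> v \<noteq> rep M \<theta> y' \<omega> v" by blast+
      with up[of \<omega>] same[of \<omega>] show "\<omega> \<in> ?E' - ?E" by (metis (mono_tags, lifting) DiffI mem_Collect_eq)
    qed
    moreover have "?E \<subseteq> ?E'"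
    proof
      fix \<omega> assume "\<omega> \<in> ?E"
      then show "\<omega> \<in> ?E'" using up[of \<omega>] by blast
    qed
    ultimately have "measure coins ?D \<le> measure coins (?E' - ?E)" using E D by (intro coins.finite_measure_mono) simp_all
    also have "\<dots> = measure coins ?E' - measure coins ?E"
      by (intro coins.finite_measure_Diff E \<open>?E \<subseteq> ?E'\<close>)
    finally show ?thesis using p by simp
  next
    case False
    then have le: "y' l \<le> y l" by simp
    note mono = sampling_tree_mono[OF tree(2,1) other[symmetric] le light(2,1) v(1)]
    have up: "rep M \<theta> y \<omega> v = l" if "\<omega> \<in> space coins" "rep M \<theta> y' \<omega> v = l" for \<omega>
      using mono[OF that(1,1)] that(2) by blast
    have same: "rep M \<theta> y' \<omega> v = rep M \<theta> y \<omega> v" if "\<omega> \<in> space coins" "rep M \<theta> y \<omega> v \<noteq> l" for \<omega>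
      using mono[OF that(1,1)] that(2) by blast
    have "?D \<subseteq> ?E - ?E'"
    proof
      fix \<omega> assume "\<omega> \<in> ?D"
      then have "\<omega> \<in> space coins" "rep M \<theta> y \<omega> v \<noteq> rep M \<theta> y' \<omega> v" by blast+
      with up[of \<omega>] same[of \<omega>] show "\<omega> \<in> ?E - ?E'" by (metis (mono_tags, lifting) DiffI mem_Collect_eq)
    qed
    moreover have "?E' \<subseteq> ?E"
    proof
      fix \<omega> assume "\<omega> \<in> ?E'"
      then show "\<omega> \<in> ?E" using up[of \<omega>] by blast
    qed
    ultimately have "measure coins ?D \<le> measure coins (?E - ?E')" using E D by (intro coins.finite_measure_mono) simp_all
    also have "\<dots> = measure coins ?E - measure coins ?E'"
      by (intro coins.finite_measure_Diff E \<open>?E' \<subseteq> ?E\<close>)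
    finally show ?thesis using p by simp
  qed
qed

lemma hd_light_0:
  assumes "0 < v" "sm M y v < \<theta>" "sm M y' v < \<theta>"
  shows "hd v 0 = 0"
proof -
  have "sd (sel M \<theta> y \<omega> v 0) (sel M \<theta> y' \<omega> v 0) = 0" if \<omega>: "\<omega> \<in> space coins" for \<omega>
    using sampling_tree.sel_zero[OF tree(1)[OF \<omega>]] sampling_tree.sel_zero[OF tree(2)[OF \<omega>]]
      sampling_tree.sel_light[OF tree(1)[OF \<omega>] assms(2,1)]
      sampling_tree.sel_light[OF tree(2)[OF \<omega>] assms(3,1)] by simp
  then show ?thesis unfolding hd_def by (simp cong: Bochner_Integration.integral_cong)
qed

text \<open>The subtree receives its element with probability \<open>s\<close>, and
  \<open>s * |y' l / s' - y l / s|\<close> equals \<open>|y' l - y l|\<close> times the factor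
  \<open>(s - y l) / s'\<close>, which is at most 1. The steep change of winning shares at small
  \<open>s\<close> is made up for by the small chance of being reached.\<close>

lemma hd_light:
  assumes v: "0 < v" "l \<in> leaves M v" and light: "sm M y v < \<theta>" "sm M y' v < \<theta>"
    and near: "near (sm M y v) (sm M y' v)"
  shows "lin (hd v) (sm M y v) \<le> 2 * \<bar>y' l - y l\<bar>"
proof -
  let ?s = "sm M y v" and ?s' = "sm M y' v"
  have s: "0 \<le> ?s" "0 \<le> ?s'" using sm_nonneg y01(1) y01'(1) by auto
  have lin: "lin (hd v) ?s = ?s * hd v 1"
    using lin_eq[of 0 ?s "hd v"] s light theta hd_light_0[OF v(1) light] by simp
  show ?thesis
  proof (cases "?s = 0")
    case True
    then show ?thesis using lin by simp
  next
    case False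
    then have pos: "0 < ?s" using s by simp
    then have "valid 1 ?s" using light theta by (simp add: valid_def)
    then have "valid 1 ?s'" using near by (simp add: near_def)
    then have pos': "0 < ?s'" by (simp add: valid_def)
    let ?D = "{\<omega> \<in> space coins. rep M \<theta> y \<omega> v \<noteq> rep M \<theta> y' \<omega> v}"
    note D = rep_change_probability[OF v light pos pos']
    have "hd v 1 \<le> (\<integral>\<omega>. 2 * indicator ?D \<omega> \<partial>coins)"
      unfolding hd_def
    proof (rule integral_mono)
      show "integrable coins (\<lambda>\<omega>. 2 * indicator ?D \<omega> :: real)"
        using D(1) by (intro integrable_mult_right integrable_real_indicator) (auto simp: coins.emeasure_eq_measure)
      fix \<omega> assume \<omega>: "\<omega> \<in> space coins"
      have c: "\<lceil>?s\<rceil> \<le> 1" "\<lceil>?s'\<rceil> \<le> 1" using light theta by (auto simp: ceiling_le_iff)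
      have "sel M \<theta> y \<omega> v 1 = {rep M \<theta> y \<omega> v}" "sel M \<theta> y' \<omega> v 1 = {rep M \<theta> y' \<omega> v}"
        using sampling_tree.sel_up[OF tree(1)[OF \<omega>] c(1) pos] sampling_tree.sel_up[OF tree(2)[OF \<omega>] c(2) pos']
          sampling_tree.sel_light[OF tree(1)[OF \<omega>] light(1) v(1)]
          sampling_tree.sel_light[OF tree(2)[OF \<omega>] light(2) v(1)] by auto
      moreover have "sd {a} {b} \<le> 2" for a b :: nat using sd_le_card[of "{a}" "{b}"] by simp
      ultimately show "sd (sel M \<theta> y \<omega> v 1) (sel M \<theta> y' \<omega> v 1) \<le> 2 * indicator ?D \<omega>"
        using \<omega> by (auto simp: indicator_def)
    qed (rule sd_sel_integrable)
    also have "\<dots> = 2 * measure coins ?D" using D(1) by simp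
    also have "\<dots> \<le> 2 * \<bar>y' l / ?s' - y l / ?s\<bar>" using D(2) by simp
    finally have "?s * hd v 1 \<le> ?s * (2 * \<bar>y' l / ?s' - y l / ?s\<bar>)"
      using pos by (intro mult_left_mono) auto
    also have "\<dots> = 2 * \<bar>?s * (y' l / ?s' - y l / ?s)\<bar>" using pos by (simp add: abs_mult)
    also have "?s * (y' l / ?s' - y l / ?s) = (?s - y l) / ?s' * (y' l - y l)"
    proof -
      have "?s' = ?s + (y' l - y l)" using sm_diff[of v] v by simp
      then have "y' l * ?s - y l * ?s' = (?s - y l) * (y' l - y l)"
        unfolding \<open>?s' = _\<close> by (simp add: algebra_simps)
      moreover have "?s * (y' l / ?s' - y l / ?s) = (y' l * ?s - y l * ?s') / ?s'"
        using pos pos' by (simp add: field_simps)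
      ultimately show ?thesis by simp
    qed
    also have "2 * \<bar>(?s - y l) / ?s' * (y' l - y l)\<bar> \<le> 2 * \<bar>y' l - y l\<bar>"
    proof -
      have "0 \<le> ?s - y l" using v(2) y01(1) by (simp add: sm_eq_sum sum.remove[of _ l] sum_nonneg)
      moreover have "?s - y l \<le> ?s'" using sm_diff[of v] v y01'(1)[of l] by simp
      ultimately have "\<bar>(?s - y l) / ?s'\<bar> \<le> 1" using pos' by simp
      then have "\<bar>(?s - y l) / ?s'\<bar> * \<bar>y' l - y l\<bar> \<le> 1 * \<bar>y' l - y l\<bar>" by (rule mult_right_mono) simp
      then show ?thesis by (simp add: abs_mult)
    qed
    finally show ?thesis using lin by simp
  qed
qed

text \<open>Crude bound, used where the decision rule of \<open>v\<close> differs between \<open>y\<close> and \<open>y'\<close>.\<close>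

lemma hd_switch:
  assumes v: "0 < v" and near: "near (sm M y v) (sm M y' v)"
    and small: "sm M y v < 1 \<or> sm M y' v < 1"
  shows "lin (hd v) (sm M y v) \<le> 2"
proof -
  have "hd v N \<le> 2" if N: "valid N (sm M y v)" for N
  proof -
    have N': "valid N (sm M y' v)" using N near by (simp add: near_def)
    \<comment> \<open>One of the two masses is below 1 and both accept \<open>N\<close>, so each
      side selects at most one element.\<close>
    then have "N \<le> 1" using N small by (auto simp: valid_def)
    have "sd (sel M \<theta> y \<omega> v N) (sel M \<theta> y' \<omega> v N) \<le> 2" if \<omega>: "\<omega> \<in> space coins" for \<omega>
      using sd_le_card[OF sel_finite(1)[OF \<omega>] sel_finite(2)[OF \<omega>], of v N v N] \<open>N \<le> 1\<close>
        sampling_tree.card_sel[OF tree(1)[OF \<omega>] v N] sampling_tree.card_sel[OF tree(2)[OF \<omega>] v N'] by simp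
    then show ?thesis unfolding hd_def by (intro coins.integral_le_const sd_sel_integrable AE_I2)
  qed
  then have "lin (hd v) (sm M y v) \<le> lin (\<lambda>N. 2) (sm M y v)" by (rule lin_mono)
  then show ?thesis by simp
qed

text \<open>If \<open>l\<close> carries all the mass, both selections lie in \<open>{l}\<close> and
  have the same size. A long path above a single nonempty leaf therefore costs nothing.\<close>

lemma hd_alone:
  assumes v: "0 < v" "l \<in> leaves M v" and near: "near (sm M y v) (sm M y' v)"
    and alone: "sm M y v = y l"
  shows "lin (hd v) (sm M y v) = 0"
proof -
  have "sm M y v = y l + sum y (leaves M v - {l})" using v(2) by (simp add: sm_eq_sum sum.remove[of _ l])
  then have "sum y (leaves M v - {l}) = 0" using alone by simp
  then have z: "y j = 0" "y' j = 0" if "j \<in> leaves M v" "j \<noteq> l" for j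
    using that y01(1) other[of j] by (auto simp: sum_nonneg_eq_0_iff)
  have "hd v N = 0" if N: "valid N (sm M y v)" for N
  proof -
    have N': "valid N (sm M y' v)" using N near by (simp add: near_def)
    have "sel M \<theta> y \<omega> v N = sel M \<theta> y' \<omega> v N" if \<omega>: "\<omega> \<in> space coins" for \<omega>
    proof -
      have "sel M \<theta> y \<omega> v N \<subseteq> {l}" "sel M \<theta> y' \<omega> v N \<subseteq> {l}"
        using sampling_tree.sel_pos[OF tree(1)[OF \<omega>]] sampling_tree.sel_pos[OF tree(2)[OF \<omega>]]
          sel_sub[OF \<omega>] z by fastforce+
      moreover have "card (sel M \<theta> y \<omega> v N) = card (sel M \<theta> y' \<omega> v N)"
        using sampling_tree.card_sel[OF tree(1)[OF \<omega>] v(1) N] sampling_tree.card_sel[OF tree(2)[OF \<omega>] v(1) N'] by simp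
      ultimately show ?thesis by (auto simp: subset_singleton_iff)
    qed
    then show ?thesis unfolding hd_def by (simp cong: Bochner_Integration.integral_cong)
  qed
  then have "lin (hd v) (sm M y v) = lin (\<lambda>N. 0) (sm M y v)" by (rule lin_cong)
  then show ?thesis by simp
qed

text \<open>With the same coin and the same \<open>N\<close>, the counts handed to the path child
  differ on average by the change of \<open>mu\<close>. Each unit of difference costs one element
  below \<open>p\<close> and one below its sibling, whence the factor 2. The rest is
  \<open>hd p\<close> at the common count, and averaging over \<open>N\<close> turns it into
  \<open>lin (hd p)\<close> at the mass of \<open>p\<close>.\<close>

lemma hd_fresh:
  fixes right :: bool and v :: nat
  defines "p \<equiv> 2 * v + of_bool right"
  assumes v: "0 < v" "v < M" "l \<in> leaves M p"
    and near: "near (sm M y v) (sm M y' v)" "near (sm M y p) (sm M y' p)"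
    and fresh: "\<not> sm M y v < \<theta>" "\<not> sm M y' v < \<theta>"
  shows "lin (hd v) (sm M y v) \<le> lin (hd p) (sm M y p) +
    2 * lin (\<lambda>N. \<bar>mu N (sm M y' v) (sm M y' p) - mu N (sm M y v) (sm M y p)\<bar>) (sm M y v)"
proof -
  define q where "q = 2 * v + of_bool (\<not> right)"
  let ?s = "sm M y v" and ?s' = "sm M y' v"
  have pq: "p \<noteq> q" "p = 2 * v \<and> q = 2 * v + 1 \<or> p = 2 * v + 1 \<and> q = 2 * v" "v < p" "0 < p" "0 < q"
    using v(1) by (auto simp: p_def q_def)
  have lq: "l \<notin> leaves M q" using leaves_disjoint[OF v(1), of M] v(3) pq by auto
  have pe: "sm M y p = (if right then ?s - sm M y (2 * v) else sm M y (2 * v))"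
    "sm M y' p = (if right then ?s' - sm M y' (2 * v) else sm M y' (2 * v))"
    using tree_inner(1)[OF v(1,2)] by (auto simp: p_def)
  have qe: "sm M y' q = sm M y q" using sm_diff[of q] lq by simp
  have "hd v N \<le> lin (hd p) (mu N ?s (sm M y p)) + 2 * \<bar>mu N ?s' (sm M y' p) - mu N ?s (sm M y p)\<bar>"
    if N: "valid N ?s" for N
  proof -
    have N': "valid N ?s'" using N near(1) by (simp add: near_def)
    define n where "n = child_count N ?s (sm M y (2 * v)) right"
    define n' where "n' = child_count N ?s' (sm M y' (2 * v)) right"
    define Z where "Z = (\<lambda>m \<omega>. sd (sel M \<theta> y \<omega> p m) (sel M \<theta> y' \<omega> p m))"
    define F where "F = (\<lambda>\<omega>. Z (n (\<omega> v)) \<omega>)"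
    define G where "G = (\<lambda>u. \<bar>real_of_int (n u) - of_int (n' u)\<bar>)"
    have Fm: "F \<in> borel_measurable coins"
      unfolding F_def Z_def n_def
      by (rule measurable_compose_countable[OF sd_sel_measurable child_count_measurable])
    have Fb: "\<bar>F \<omega>\<bar> \<le> 2 * real (card (leaves M p))" if "\<omega> \<in> space coins" for \<omega>
      using sd_sel_bound[OF that] by (simp add: F_def Z_def)
    have Fi: "integrable coins F"
      by (rule coins.integrable_const_bound[OF _ Fm, where B = "2 * real (card (leaves M p))"])
        (use Fb in \<open>auto intro!: AE_I2\<close>)
    have Gi: "integrable U01 G" "(\<integral>u. G u \<partial>U01) = \<bar>mu N ?s' (sm M y' p) - mu N ?s (sm M y p)\<bar>"
      using child_count_diff[OF N N', of "sm M y (2 * v)" right "sm M y' (2 * v)"] pe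
      by (simp_all add: G_def n_def n'_def abs_minus_commute)
    have Gc: "integrable coins (\<lambda>\<omega>. G (\<omega> v))"
      "(\<integral>\<omega>. G (\<omega> v) \<partial>coins) = \<bar>mu N ?s' (sm M y' p) - mu N ?s (sm M y p)\<bar>"
      using coin_integral(2)[OF borel_measurable_integrable[OF Gi(1)] Gi(1)]
        coin_integral(1)[OF borel_measurable_integrable[OF Gi(1)]] Gi(2) by simp_all
    have EF: "(\<integral>\<omega>. F \<omega> \<partial>coins) = lin (hd p) (mu N ?s (sm M y p))"
    proof -
      have "F (fun_upd \<omega> v u) = Z (n u) \<omega>" if "\<omega> \<in> space coins" for \<omega> u
      proof -
        have "sel M \<theta> z (fun_upd \<omega> v u) p m = sel M \<theta> z \<omega> p m" for z m
          using pq by (intro sel_cong) auto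
        then show ?thesis by (simp add: F_def Z_def)
      qed
      then have "(\<integral>\<omega>. (\<integral>u. F (fun_upd \<omega> v u) \<partial>U01) \<partial>coins) = (\<integral>\<omega>. (\<integral>u. Z (n u) \<omega> \<partial>U01) \<partial>coins)"
        by (intro Bochner_Integration.integral_cong refl) simp
      then have "(\<integral>\<omega>. F \<omega> \<partial>coins) = (\<integral>\<omega>. (\<integral>u. Z (n u) \<omega> \<partial>U01) \<partial>coins)"
        using coins_resample[OF Fm Fb, of v] by simp
      also have "\<dots> = (\<integral>\<omega>. lin (\<lambda>m. Z m \<omega>) (mu N ?s (sm M y p)) \<partial>coins)"
        using child_count_integral[OF N, of "\<lambda>m. Z m _"] pe by (simp add: n_def)
      also have "\<dots> = lin (hd p) (mu N ?s (sm M y p))"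
        unfolding lin_def hd_def Z_def by (simp add: sd_sel_integrable)
      finally show ?thesis .
    qed
    have "hd v N \<le> (\<integral>\<omega>. F \<omega> + 2 * G (\<omega> v) \<partial>coins)"
      unfolding hd_def
    proof (rule integral_mono)
      show "integrable coins (\<lambda>\<omega>. F \<omega> + 2 * G (\<omega> v))" using Fi Gc by auto
      fix \<omega> assume \<omega>: "\<omega> \<in> space coins"
      note T = tree(1)[OF \<omega>] and T' = tree(2)[OF \<omega>]
      let ?n = "n (\<omega> v)" and ?n' = "n' (\<omega> v)"
      note c = sampling_tree.sel_child[OF T v(1,2) N fresh(1), of right, folded n_def p_def q_def]
      note c' = sampling_tree.sel_child[OF T' v(1,2) N' fresh(2), of right, folded n'_def p_def q_def]
      \<comment> \<open>The intermediate set of the triangle inequality uses the count of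
        \<open>y\<close> in the tree of \<open>y'\<close>; nearness at \<open>p\<close> permits
        this.\<close>
      have vn: "valid ?n (sm M y' p)" using c(1) near(2) by (simp add: near_def)
      \<comment> \<open>The sibling has the same masses and coins on both sides, so only its count
        can differ.\<close>
      have q: "sel M \<theta> y' \<omega> q m = sel M \<theta> y \<omega> q m" for m
      proof (rule sel_cong[OF refl _ pq(5)])
        fix j assume "j \<in> leaves M q"
        then have "j \<noteq> l" using lq by blast
        then show "y' j = y j" using other by simp
      qed
      note fin = sel_finite[OF \<omega>]
      have "sd (sel M \<theta> y \<omega> v N) (sel M \<theta> y' \<omega> v N) \<le>
          sd (sel M \<theta> y \<omega> p ?n) (sel M \<theta> y' \<omega> p ?n') + sd (sel M \<theta> y \<omega> q (N - ?n)) (sel M \<theta> y \<omega> q (N - ?n'))"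
        unfolding c(3) c'(3) q by (intro sd_Un fin)
      also have "sd (sel M \<theta> y \<omega> p ?n) (sel M \<theta> y' \<omega> p ?n') \<le>
          sd (sel M \<theta> y \<omega> p ?n) (sel M \<theta> y' \<omega> p ?n) + sd (sel M \<theta> y' \<omega> p ?n) (sel M \<theta> y' \<omega> p ?n')"
        by (intro sd_triangle fin)
      also have "sd (sel M \<theta> y' \<omega> p ?n) (sel M \<theta> y' \<omega> p ?n') = \<bar>of_int ?n - of_int ?n'\<bar>"
        unfolding sd_def by (rule sampling_tree.card_sel_diff[OF T' pq(4) vn c'(1)])
      also have "sd (sel M \<theta> y \<omega> q (N - ?n)) (sel M \<theta> y \<omega> q (N - ?n')) = \<bar>of_int (N - ?n) - of_int (N - ?n')\<bar>"
        unfolding sd_def using c'(2) qe by (intro sampling_tree.card_sel_diff[OF T pq(5) c(2)]) simp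
      finally show "sd (sel M \<theta> y \<omega> v N) (sel M \<theta> y' \<omega> v N) \<le> F \<omega> + 2 * G (\<omega> v)"
        by (simp add: F_def G_def Z_def abs_minus_commute)
    qed (rule sd_sel_integrable)
    also have "\<dots> = (\<integral>\<omega>. F \<omega> \<partial>coins) + 2 * (\<integral>\<omega>. G (\<omega> v) \<partial>coins)" using Fi Gc by simp
    finally show ?thesis using EF Gc by simp
  qed
  then have "lin (hd v) ?s \<le> lin (\<lambda>N. lin (hd p) (mu N ?s (sm M y p)) + 2 * \<bar>mu N ?s' (sm M y' p) - mu N ?s (sm M y p)\<bar>) ?s"
    by (rule lin_mono)
  also have "\<dots> = lin (hd p) (sm M y p) + 2 * lin (\<lambda>N. \<bar>mu N ?s' (sm M y' p) - mu N ?s (sm M y p)\<bar>) ?s"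
    by (simp only: lin_add lin_cmult lin_mu)
  finally show ?thesis .
qed

end

section \<open>Cost accumulated on the path to the root\<close>

lemma mu_self:
  assumes "valid N s"
  shows "mu N s s = of_int N"
proof -
  have "mu N s 0 = 0"
  proof (cases "s \<le> of_int N")
    case False
    then have "s - of_int N < 1" using assms by (simp add: valid_def)
    then show ?thesis using False by (simp add: mu_def divide_nonpos_pos)
  qed (simp add: mu_def)
  then show ?thesis using mu_sym[OF assms, of s] by simp
qed

context leaf_change
begin

lemma others_nonneg: "l \<in> leaves M v \<Longrightarrow> 0 \<le> sm M y v - y l"
  using y01(1) by (simp add: sm_eq_sum sum.remove[of _ l] sum_nonneg)

text \<open>At light, singleton and switching nodes the whole subtree is bounded at once, and what
  was accumulated below is forgotten. Only nodes that use the ordinary rule on both sides add to the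
  bound, and only if the sibling has mass. Those levels lie in \<open>B\<close>; levels of rule
  change lie in \<open>S\<close>.\<close>

lemma path_bound:
  assumes near: "\<And>j. 0 < l div 2 ^ j \<Longrightarrow> near (sm M y (l div 2 ^ j)) (sm M y' (l div 2 ^ j))"
    and B: "finite B" "\<And>j. 0 < l div 2 ^ j \<Longrightarrow> 0 < sm M y (l div 2 ^ j) - y l \<Longrightarrow>
      \<theta> \<le> max (sm M y (l div 2 ^ j)) (sm M y' (l div 2 ^ j)) \<Longrightarrow> j \<in> B"
  defines "S \<equiv> {j \<in> B. min (sm M y (l div 2 ^ j)) (sm M y' (l div 2 ^ j)) < \<theta> \<and>
      \<theta> \<le> max (sm M y (l div 2 ^ j)) (sm M y' (l div 2 ^ j))}"
  assumes "0 < l div 2 ^ j"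
  shows "lin (hd (l div 2 ^ j)) (sm M y (l div 2 ^ j)) \<le>
    \<bar>y' l - y l\<bar> * (2 + 4 * card (B \<inter> {..j})) + 2 * card (S \<inter> {..j})"
  using assms(5)
proof (induction j)
  case 0
  have nl: "\<not> (0 < l \<and> l < M)" using l by simp
  have "lin (hd l) (sm M y l) = 0"
    using 0 near[of 0] by (intro hd_alone) (simp_all add: tree_leaf[OF nl])
  then show ?case by simp
next
  case (Suc j)
  let ?d = "\<bar>y' l - y l\<bar>"
  define v where "v = l div 2 ^ Suc j"
  define p where "p = l div 2 ^ j"
  let ?s = "sm M y v" and ?s' = "sm M y' v"
  have v: "v = p div 2" by (simp add: v_def p_def div_mult2_eq mult.commute[of 2])
  have v0: "0 < v" using Suc.prems by (simp add: v_def)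
  then have p0: "0 < p" using v by (metis div_0 gr0I)
  have "v \<le> l div 2" unfolding v using div_le_mono[OF div_le_dividend[of l "2 ^ j"], of 2]
    by (simp add: p_def)
  then have vM: "v < M" using l by linarith
  define right where "right \<longleftrightarrow> odd p"
  have p: "p = 2 * v + of_bool right" using v by (auto simp: right_def)
  have lp: "l \<in> leaves M p" using leaf_in_ancestor[OF l] p0 by (simp add: p_def)
  have lv: "l \<in> leaves M v" using leaf_in_ancestor[OF l, of "Suc j"] v0 by (simp only: v_def)
  have nv: "near ?s ?s'" and np: "near (sm M y p) (sm M y' p)"
    using near[of "Suc j"] near[of j] v0 p0 by (auto simp: v_def p_def)
  have IH: "lin (hd p) (sm M y p) \<le> ?d * (2 + 4 * card (B \<inter> {..j})) + 2 * card (S \<inter> {..j})"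
    using Suc.IH p0 by (simp add: p_def)
  have fS: "finite S" using B(1) by (simp add: S_def)
  have mono: "card (B \<inter> {..j}) \<le> card (B \<inter> {..Suc j})" "card (S \<inter> {..j}) \<le> card (S \<inter> {..Suc j})"
    using B(1) fS by (auto intro!: card_mono)
  have le: "?d * (2 + 4 * card (B \<inter> {..j})) + 2 * card (S \<inter> {..j}) \<le>
      ?d * (2 + 4 * card (B \<inter> {..Suc j})) + 2 * card (S \<inter> {..Suc j})"
    using mono by (intro add_mono mult_left_mono) auto
  consider (light) "?s < \<theta>" "?s' < \<theta>" | (alone) "?s = y l"
    | (switch) "?s \<noteq> y l" "min ?s ?s' < \<theta>" "\<theta> \<le> max ?s ?s'" | (fresh) "\<not> ?s < \<theta>" "\<not> ?s' < \<theta>" by linarith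
  then have "lin (hd v) ?s \<le> ?d * (2 + 4 * card (B \<inter> {..Suc j})) + 2 * card (S \<inter> {..Suc j})"
  proof cases
    case light
    have "2 * ?d \<le> ?d * (2 + 4 * card (B \<inter> {..Suc j})) + 2 * card (S \<inter> {..Suc j})"
      by (simp add: algebra_simps)
    then show ?thesis using hd_light[OF v0 lv light nv] by linarith
  next
    case alone
    then show ?thesis using hd_alone[OF v0 lv nv] by simp
  next
    case switch
    then have "Suc j \<in> B" using B(2)[of "Suc j"] others_nonneg[OF lv] v0 by (simp add: v_def)
    then have "Suc j \<in> S \<inter> {..Suc j}" using switch by (simp add: S_def v_def)
    then have "1 \<le> card (S \<inter> {..Suc j})" using fS by (metis One_nat_def Suc_leI card_gt_0_iff emptyE finite_Int)
    \<comment> \<open>The crude bound 2 for the whole subtree is paid for by this level being in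
      \<open>S\<close>.\<close>
    then have "2 \<le> ?d * (2 + 4 * card (B \<inter> {..Suc j})) + 2 * card (S \<inter> {..Suc j})"
      by (intro add_increasing) auto
    moreover have "?s < 1 \<or> ?s' < 1" using switch theta by linarith
    ultimately show ?thesis using hd_switch[OF v0 nv] by linarith
  next
    case fresh
    note h = hd_fresh[OF v0 vM, of right, folded p, OF lp nv np fresh]
    show ?thesis
    proof (cases "sm M y v = sm M y p")
      case True
      \<comment> \<open>The sibling is empty, so \<open>mu\<close> sends all of \<open>N\<close>
        along the path for both inputs.\<close>
      have "sm M y' v = sm M y' p" using True sm_diff[of v] sm_diff[of p] lv lp by simp
      then have "lin (\<lambda>N. \<bar>mu N ?s' (sm M y' p) - mu N ?s (sm M y p)\<bar>) ?s = lin (\<lambda>N. 0) ?s"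
        using True nv by (intro lin_cong) (simp add: near_def mu_self)
      then show ?thesis using h IH le by simp
    next
      case False
      have "0 \<le> sm M y w" for w using sm_nonneg y01(1) by blast
      from this[of "2 * v"] this[of "2 * v + 1"] have "sm M y p \<le> ?s"
        using tree_inner(1)[OF v0 vM, of y] p by (cases right) auto
      then have "Suc j \<in> B" using False others_nonneg[OF lp] B(2)[of "Suc j"] v0 fresh by (simp add: v_def)
      then have "B \<inter> {..Suc j} = insert (Suc j) (B \<inter> {..j})" by auto
      then have c: "card (B \<inter> {..Suc j}) = Suc (card (B \<inter> {..j}))" using B(1) by simp
      have "lin (\<lambda>N. \<bar>mu N ?s' (sm M y' p) - mu N ?s (sm M y p)\<bar>) ?s \<le> 2 * ?d"
        using lin_mu_lipschitz[OF nv np] sm_diff[of v] sm_diff[of p] lv lp by simp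
      then have "lin (hd v) ?s \<le> ?d * (2 + 4 * card (B \<inter> {..Suc j})) + 2 * card (S \<inter> {..j})"
        using h IH by (simp add: c algebra_simps)
      then show ?thesis using mono(2) by linarith
    qed
  qed
  then show ?case by (simp add: v_def)
qed


text \<open>The coin at the root is added to the account: its roundings of the two total masses
  differ by \<open>|y' l - y l|\<close> on average, hence 3 in place of 2.\<close>

lemma sample_change:
  assumes root: "l div 2 ^ H = 1"
    and near: "\<And>j. 0 < l div 2 ^ j \<Longrightarrow> near (sm M y (l div 2 ^ j)) (sm M y' (l div 2 ^ j))"
    and B: "finite B" "\<And>j. 0 < l div 2 ^ j \<Longrightarrow> 0 < sm M y (l div 2 ^ j) - y l \<Longrightarrow>
      \<theta> \<le> max (sm M y (l div 2 ^ j)) (sm M y' (l div 2 ^ j)) \<Longrightarrow> j \<in> B"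
  defines "S \<equiv> {j \<in> B. min (sm M y (l div 2 ^ j)) (sm M y' (l div 2 ^ j)) < \<theta> \<and>
      \<theta> \<le> max (sm M y (l div 2 ^ j)) (sm M y' (l div 2 ^ j))}"
  shows "(\<integral>\<omega>. sd (sample M \<theta> y \<omega>) (sample M \<theta> y' \<omega>) \<partial>coins) \<le>
    \<bar>y' l - y l\<bar> * (3 + 4 * card B) + 2 * card S"
proof -
  let ?s = "sm M y 1" and ?s' = "sm M y' 1" and ?d = "\<bar>y' l - y l\<bar>"
  have n1: "near ?s ?s'" using near[of H] root by simp
  have l1: "l \<in> leaves M 1" using leaf_in_ancestor[OF l, of H] root by simp
  define n where "n = (\<lambda>u. \<lceil>?s - u\<rceil>)"
  define n' where "n' = (\<lambda>u. \<lceil>?s' - u\<rceil>)"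
  define Z where "Z = (\<lambda>m \<omega>. sd (sel M \<theta> y \<omega> 1 m) (sel M \<theta> y' \<omega> 1 m))"
  define F where "F = (\<lambda>\<omega>. Z (n (\<omega> 0)) \<omega>)"
  define G where "G = (\<lambda>u. \<bar>real_of_int (n u) - of_int (n' u)\<bar>)"
  have nm: "(\<lambda>\<omega>. n (\<omega> 0)) \<in> measurable coins (count_space UNIV)"
    unfolding n_def
    by (rule measurable_compose[OF borel_measurable_diff[OF borel_measurable_const coin_measurable] measurable_real_ceiling])
  have Fm: "F \<in> borel_measurable coins"
    unfolding F_def Z_def by (rule measurable_compose_countable[OF sd_sel_measurable nm])
  have Fb: "\<bar>F \<omega>\<bar> \<le> 2 * real (card (leaves M 1))" if "\<omega> \<in> space coins" for \<omega>
    using sd_sel_bound[OF that] by (simp add: F_def Z_def)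
  have Fi: "integrable coins F"
    by (rule coins.integrable_const_bound[OF _ Fm, where B = "2 * real (card (leaves M 1))"])
      (use Fb in \<open>auto intro!: AE_I2\<close>)
  have Gi: "integrable U01 G" "(\<integral>u. G u \<partial>U01) = ?d"
    using U01_ceiling_diff[of ?s ?s'] sm_diff[of 1] l1 by (simp_all add: G_def n_def n'_def abs_minus_commute)
  have Gc: "integrable coins (\<lambda>\<omega>. G (\<omega> 0))" "(\<integral>\<omega>. G (\<omega> 0) \<partial>coins) = ?d"
    using coin_integral(2)[OF borel_measurable_integrable[OF Gi(1)] Gi(1)]
        coin_integral(1)[OF borel_measurable_integrable[OF Gi(1)]] Gi(2) by simp_all
  have EF: "(\<integral>\<omega>. F \<omega> \<partial>coins) = lin (hd 1) ?s"
  proof -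
    have "F (fun_upd \<omega> 0 u) = Z (n u) \<omega>" for \<omega> u
    proof -
      have "sel M \<theta> z (fun_upd \<omega> 0 u) 1 m = sel M \<theta> z \<omega> 1 m" for z m
        by (intro sel_cong) auto
      then show ?thesis by (simp add: F_def Z_def)
    qed
    then have "(\<integral>\<omega>. F \<omega> \<partial>coins) = (\<integral>\<omega>. (\<integral>u. Z (n u) \<omega> \<partial>U01) \<partial>coins)"
      using coins_resample[OF Fm Fb, of 0] by simp
    also have "\<dots> = (\<integral>\<omega>. lin (\<lambda>m. Z m \<omega>) ?s \<partial>coins)"
      unfolding n_def by (simp add: U01_ceiling(2)[where h = "\<lambda>m. Z m _"])
    also have "\<dots> = lin (hd 1) ?s"
      unfolding lin_def hd_def Z_def by (simp add: sd_sel_integrable)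
    finally show ?thesis .
  qed
  have "(\<integral>\<omega>. sd (sample M \<theta> y \<omega>) (sample M \<theta> y' \<omega>) \<partial>coins) \<le> (\<integral>\<omega>. F \<omega> + G (\<omega> 0) \<partial>coins)"
  proof (rule integral_mono')
    show "integrable coins (\<lambda>\<omega>. F \<omega> + G (\<omega> 0))" using Fi Gc by auto
    fix \<omega> assume \<omega>: "\<omega> \<in> space coins"
    note T = tree(1)[OF \<omega>] and T' = tree(2)[OF \<omega>]
    let ?n = "n (\<omega> 0)" and ?n' = "n' (\<omega> 0)"
    have v: "valid ?n ?s" "valid ?n' ?s'"
      using sampling_tree.valid_root[OF T] sampling_tree.valid_root[OF T'] by (auto simp: n_def n'_def)
    then have v': "valid ?n ?s'" using n1 by (simp add: near_def)
    have "sd (sel M \<theta> y \<omega> 1 ?n) (sel M \<theta> y' \<omega> 1 ?n') \<le>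
      sd (sel M \<theta> y \<omega> 1 ?n) (sel M \<theta> y' \<omega> 1 ?n) + sd (sel M \<theta> y' \<omega> 1 ?n) (sel M \<theta> y' \<omega> 1 ?n')"
      by (intro sd_triangle sel_finite[OF \<omega>])
    also have "sd (sel M \<theta> y' \<omega> 1 ?n) (sel M \<theta> y' \<omega> 1 ?n') = G (\<omega> 0)"
      unfolding sd_def G_def by (rule sampling_tree.card_sel_diff[OF T' _ v' v(2)]) simp
    finally show "sd (sample M \<theta> y \<omega>) (sample M \<theta> y' \<omega>) \<le> F \<omega> + G (\<omega> 0)"
      by (simp add: sample_def F_def Z_def n_def n'_def)
    show "0 \<le> F \<omega> + G (\<omega> 0)" by (simp add: F_def G_def Z_def)
  qed
  also have "\<dots> = lin (hd 1) ?s + ?d" using Fi Gc EF by simp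
  also have "lin (hd 1) ?s \<le> ?d * (2 + 4 * card (B \<inter> {..H})) + 2 * card (S \<inter> {..H})"
    using path_bound[OF near B, of H] root unfolding S_def by simp
  also have "\<dots> \<le> ?d * (2 + 4 * card B) + 2 * card S"
    using B(1) by (intro add_mono mult_left_mono) (auto simp: S_def intro!: card_mono)
  finally show ?thesis by (simp add: algebra_simps)
qed

end

section \<open>From small moves of a leaf to arbitrary ones\<close>

lemma sample_measurable_coins:
  assumes "\<theta> \<le> 1" "\<And>l. 0 \<le> y l" "\<And>l. y l \<le> 1" "\<And>l. 0 \<le> y' l" "\<And>l. y' l \<le> 1"
  shows "integrable coins (\<lambda>\<omega>. sd (sample M \<theta> y \<omega>) (sample M \<theta> y' \<omega>))"
proof -
  have sub: "sample M \<theta> y \<omega> \<subseteq> leaves M 1" "sample M \<theta> y' \<omega> \<subseteq> leaves M 1" if "\<omega> \<in> space coins" for \<omega>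
    using sampling_tree.sel_subset[OF coin_tree[OF assms(1-3) that]]
      sampling_tree.sel_subset[OF coin_tree[OF assms(1,4,5) that]] by (auto simp: sample_def)
  have m: "(\<lambda>\<omega>. sd (sample M \<theta> y \<omega>) (sample M \<theta> y' \<omega>)) \<in> borel_measurable coins"
    by (rule sd_measurable[OF finite_leaves sub]) (auto intro: coins_measurable_sel)
  show ?thesis
  proof (rule coins.integrable_const_bound[OF _ m, where B = "2 * real (card (leaves M 1))"], rule AE_I2)
    fix \<omega> assume \<omega>: "\<omega> \<in> space coins"
    show "norm (sd (sample M \<theta> y \<omega>) (sample M \<theta> y' \<omega>)) \<le> 2 * real (card (leaves M 1))"
      using sd_le_card[OF finite_subset[OF sub(1)[OF \<omega>] finite_leaves] finite_subset[OF sub(2)[OF \<omega>] finite_leaves]]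
        card_mono[OF finite_leaves sub(1)[OF \<omega>]] card_mono[OF finite_leaves sub(2)[OF \<omega>]] by simp
  qed
qed

text \<open>Any move of one leaf is a chain of moves to which nearness applies, and both parts of
  the bound are additive along a chain: the lengths of the moves and the numbers of thresholds
  passed. The set \<open>B\<close> is described by the upper end \<open>b\<close>, so it serves all
  intermediate values.\<close>

lemma sample_lipschitz:
  fixes y :: "nat \<Rightarrow> real"
  assumes theta: "\<theta> \<le> 1" and y: "\<And>j. 0 \<le> y j" "\<And>j. y j \<le> 1"
    and l: "M \<le> l" "l < 2 * M" and root: "l div 2 ^ H = 1"
    and ab: "0 \<le> a" "a \<le> b" "b \<le> 1"
    and BH: "B \<subseteq> {..H}" and B: "finite B" "\<And>j. j \<le> H \<Longrightarrow> 0 < sm M (y(l := 0)) (l div 2 ^ j) \<Longrightarrow>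
      \<theta> \<le> sm M (y(l := 0)) (l div 2 ^ j) + b \<Longrightarrow> j \<in> B"
  shows "(\<integral>\<omega>. sd (sample M \<theta> (y(l := a)) \<omega>) (sample M \<theta> (y(l := b)) \<omega>) \<partial>coins) \<le>
    (b - a) * (3 + 4 * card B) +
    2 * card {j \<in> B. sm M (y(l := 0)) (l div 2 ^ j) + a < \<theta> \<and> \<theta> \<le> sm M (y(l := 0)) (l div 2 ^ j) + b}"
proof -
  define z where "z = (\<lambda>t. y(l := t))"
  define r where "r = (\<lambda>j. sm M (y(l := 0)) (l div 2 ^ j))"
  define E where "E = (\<lambda>a b. \<integral>\<omega>. sd (sample M \<theta> (z a) \<omega>) (sample M \<theta> (z b) \<omega>) \<partial>coins)"
  \<comment> \<open>Half-open, so that adjacent intervals do not share a passed threshold and the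
    numbers add up exactly.\<close>
  define S where "S = (\<lambda>a b. {j \<in> B. r j + a < \<theta> \<and> \<theta> \<le> r j + b})"
  define P where "P = (\<lambda>a' b'. a \<le> a' \<and> b' \<le> b \<longrightarrow> E a' b' \<le> (b' - a') * (3 + 4 * card B) + 2 * card (S a' b'))"
  have z: "0 \<le> z t j" "z t j \<le> 1" if "a \<le> t" "t \<le> b" for t j
    using that y ab by (auto simp: z_def)
  have pos: "0 < l div 2 ^ j \<longleftrightarrow> j \<le> H" for j
  proof (cases "j \<le> H")
    case True
    then have "l div 2 ^ H = l div 2 ^ j div 2 ^ (H - j)" by (simp flip: div_mult2_eq power_add)
    then show ?thesis using root True by (metis div_0 gr0I zero_neq_one)
  next
    case False
    then obtain k where k: "j = H + Suc k" using less_imp_Suc_add by (metis add_Suc_right not_le)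
    have "l div 2 ^ j = l div 2 ^ H div 2 ^ Suc k" unfolding k power_add by (rule div_mult2_eq)
    also have "\<dots> = 0" unfolding root by (intro div_less one_less_power) simp_all
    finally show ?thesis using False by simp
  qed
  have smz: "sm M (z t) (l div 2 ^ j) = r j + t" if "j \<le> H" for t j
  proof -
    have "l \<in> leaves M (l div 2 ^ j)" using leaf_in_ancestor[OF l] pos that by simp
    moreover have "(\<Sum>x\<in>leaves M (l div 2 ^ j) - {l}. (y(l := t)) x) = (\<Sum>x\<in>leaves M (l div 2 ^ j) - {l}. (y(l := 0)) x)"
      by (intro sum.cong) auto
    ultimately show ?thesis by (simp add: r_def z_def sm_eq_sum sum.remove[of _ l])
  qed
  have step: "E t t' \<le> \<bar>t' - t\<bar> * (3 + 4 * card B) + 2 * card (S (min t t') (max t t'))"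
    if t: "a \<le> t" "t \<le> b" "a \<le> t'" "t' \<le> b" and near: "\<And>j. j \<le> H \<Longrightarrow> near (r j + t) (r j + t')" for t t'
  proof -
    interpret leaf_change M \<theta> "z t" "z t'" l
      using theta z[OF t(1,2)] z[OF t(3,4)] l by unfold_locales (auto simp: z_def)
    have "E t t' \<le> \<bar>z t' l - z t l\<bar> * (3 + 4 * card B) +
      2 * card {j \<in> B. min (sm M (z t) (l div 2 ^ j)) (sm M (z t') (l div 2 ^ j)) < \<theta> \<and>
      \<theta> \<le> max (sm M (z t) (l div 2 ^ j)) (sm M (z t') (l div 2 ^ j))}"
      unfolding E_def
    proof (rule sample_change[OF root _ B(1)])
      show "near (sm M (z t) (l div 2 ^ j)) (sm M (z t') (l div 2 ^ j))" if "0 < l div 2 ^ j" for j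
        using that near pos smz by simp
      fix j assume j: "0 < l div 2 ^ j" "0 < sm M (z t) (l div 2 ^ j) - z t l"
        "\<theta> \<le> max (sm M (z t) (l div 2 ^ j)) (sm M (z t') (l div 2 ^ j))"
      then have "j \<le> H" "0 < r j" "\<theta> \<le> r j + b" using pos smz t by (auto simp: z_def)
      then show "j \<in> B" using B(2) by (simp add: r_def)
    qed
    also have "{j \<in> B. min (sm M (z t) (l div 2 ^ j)) (sm M (z t') (l div 2 ^ j)) < \<theta> \<and>
      \<theta> \<le> max (sm M (z t) (l div 2 ^ j)) (sm M (z t') (l div 2 ^ j))} = S (min t t') (max t t')"
      unfolding S_def
    proof (intro Collect_cong conj_cong refl)
      fix j assume "j \<in> B"
      then have "j \<le> H" using BH by auto
      then show "(min (sm M (z t) (l div 2 ^ j)) (sm M (z t') (l div 2 ^ j)) < \<theta>) = (r j + min t t' < \<theta>)"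
        "(\<theta> \<le> max (sm M (z t) (l div 2 ^ j)) (sm M (z t') (l div 2 ^ j))) = (\<theta> \<le> r j + max t t')"
        by (auto simp: smz min_def max_def)
    qed
    finally show ?thesis by (simp add: z_def)
  qed
  have P_trans: "P a' c'" if trans: "P a' b'" "P b' c'" "a' \<le> b'" "b' \<le> c'" for a' b' c'
    unfolding P_def
  proof
      assume c: "a \<le> a' \<and> c' \<le> b"
      have fin: "finite (sample M \<theta> (z t) \<omega>)" if "a \<le> t" "t \<le> b" "\<omega> \<in> space coins" for t \<omega>
        using sampling_tree.finite_sel[OF coin_tree[OF theta z[OF that(1,2)] that(3)]] by (simp add: sample_def)
      have int: "integrable coins (\<lambda>\<omega>. sd (sample M \<theta> (z t) \<omega>) (sample M \<theta> (z t') \<omega>))"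
        if "a \<le> t" "t \<le> b" "a \<le> t'" "t' \<le> b" for t t'
        using that theta z by (intro sample_measurable_coins) auto
      have "E a' c' \<le> (\<integral>\<omega>. sd (sample M \<theta> (z a') \<omega>) (sample M \<theta> (z b') \<omega>) +
          sd (sample M \<theta> (z b') \<omega>) (sample M \<theta> (z c') \<omega>) \<partial>coins)"
        unfolding E_def using c trans(3,4)
        by (intro integral_mono Bochner_Integration.integrable_add int sd_triangle fin) auto
      also have "\<dots> = E a' b' + E b' c'"
        unfolding E_def using c trans(3,4) by (intro Bochner_Integration.integral_add int) auto
      finally have "E a' c' \<le> E a' b' + E b' c'" .
      moreover have "S a' c' = S a' b' \<union> S b' c'" "S a' b' \<inter> S b' c' = {}"
        using trans(3,4) by (auto simp: S_def)
      then have "card (S a' c') = card (S a' b') + card (S b' c')"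
        using B(1) by (simp add: card_Un_disjoint S_def)
      moreover have "E a' b' \<le> (b' - a') * (3 + 4 * card B) + 2 * card (S a' b')"
        "E b' c' \<le> (c' - b') * (3 + 4 * card B) + 2 * card (S b' c')"
        using trans c by (auto simp: P_def)
      ultimately show "E a' c' \<le> (c' - a') * (3 + 4 * card B) + 2 * card (S a' c')"
        by (simp add: algebra_simps)
  qed
  \<comment> \<open>Interval induction: \<open>P\<close> is stable under concatenation and holds on
    short intervals around each point.\<close>
  have "P a b"
    using ab(2)
  proof (induction rule: Bolzano)
    case (trans a' b' c')
    then show ?case using P_trans by blast
  next
    case (local x)
    have "\<exists>d>0. \<forall>j\<le>H. \<forall>t. \<bar>t - x\<bar> < d \<longrightarrow> near (r j + x) (r j + t)"
    proof -
      have "\<forall>j. \<exists>d>0. \<forall>s'. \<bar>s' - (r j + x)\<bar> < d \<longrightarrow> near (r j + x) s'" using near_exists by blast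
      then obtain D where D: "\<And>j. 0 < D j" "\<And>j s'. \<bar>s' - (r j + x)\<bar> < D j \<Longrightarrow> near (r j + x) s'" by metis
      let ?d = "Min (D ` {..H})"
      have "0 < ?d" using D(1) by (simp add: Min_gr_iff)
      moreover have "near (r j + x) (r j + t)" if "j \<le> H" "\<bar>t - x\<bar> < ?d" for j t
        using that by (intro D(2)) (auto intro: less_le_trans)
      ultimately show ?thesis by blast
    qed
    then obtain d where d: "0 < d" "\<And>j t. j \<le> H \<Longrightarrow> \<bar>t - x\<bar> < d \<Longrightarrow> near (r j + x) (r j + t)" by blast
    have "P a' b'" if "a' \<le> x" "x \<le> b'" "b' - a' < d" for a' b'
    proof -
      \<comment> \<open>Nearness is available only outwards from \<open>x\<close>; the left part is
        traversed backwards and turned around by the symmetry of \<open>sd\<close>.\<close>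
      have "P a' x"
        unfolding P_def
      proof
        assume c: "a \<le> a' \<and> x \<le> b"
        have "E a' x = E x a'" unfolding E_def by (simp add: sd_commute)
        also have "\<dots> \<le> \<bar>a' - x\<bar> * (3 + 4 * card B) + 2 * card (S (min x a') (max x a'))"
          using c that d(2) by (intro step) auto
        finally show "E a' x \<le> (x - a') * (3 + 4 * card B) + 2 * card (S a' x)" using that by simp
      qed
      moreover have "P x b'"
        unfolding P_def
      proof
        assume c: "a \<le> x \<and> b' \<le> b"
        have "E x b' \<le> \<bar>b' - x\<bar> * (3 + 4 * card B) + 2 * card (S (min x b') (max x b'))"
          using c that d(2) by (intro step) auto
        then show "E x b' \<le> (b' - x) * (3 + 4 * card B) + 2 * card (S x b')" using that by simp
      qed
      ultimately show ?thesis using that P_trans by blast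
    qed
    then show ?case using d(1) by blast
  qed
  then show ?thesis by (simp add: P_def E_def S_def z_def r_def)
qed

section \<open>Marginals\<close>

locale static_tree =
  fixes M :: nat and \<theta> :: real and y :: "nat \<Rightarrow> real" and l :: nat
  assumes theta: "\<theta> \<le> 1"
    and y01: "\<And>j. 0 \<le> y j" "\<And>j. y j \<le> 1"
    and l: "M \<le> l" "l < 2 * M"
begin

definition pm :: "nat \<Rightarrow> int \<Rightarrow> real" where
  "pm v N = (\<integral>\<omega>. of_bool (l \<in> sel M \<theta> y \<omega> v N) \<partial>coins)"

lemma tree: "\<omega> \<in> space coins \<Longrightarrow> sampling_tree \<theta> y \<omega>"
  using theta y01 by (auto intro!: coin_tree)

lemma mem_measurable: "(\<lambda>\<omega>. of_bool (l \<in> sel M \<theta> y \<omega> v N) :: real) \<in> borel_measurable coins"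
proof -
  have [measurable]: "Measurable.pred coins (\<lambda>\<omega>. l \<in> sel M \<theta> y \<omega> v N)" by (rule coins_measurable_sel)
  show ?thesis unfolding of_bool_def by measurable
qed

lemma mem_integrable: "integrable coins (\<lambda>\<omega>. of_bool (l \<in> sel M \<theta> y \<omega> v N) :: real)"
  by (rule coins.integrable_const_bound[OF _ mem_measurable, where B = 1]) (auto intro!: AE_I2)

lemma pm_light:
  assumes v: "0 < v" "l \<in> leaves M v" and light: "sm M y v < \<theta>"
  shows "lin (pm v) (sm M y v) = y l"
proof -
  let ?s = "sm M y v"
  have s: "0 \<le> ?s" "y l \<le> ?s" using sm_nonneg y01(1) v(2) by (auto simp: sm_eq_sum sum.remove[of _ l] sum_nonneg)
  have "l \<notin> sel M \<theta> y \<omega> v 0" if \<omega>: "\<omega> \<in> space coins" for \<omega>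
    using sampling_tree.sel_zero[OF tree[OF \<omega>]] sampling_tree.sel_light[OF tree[OF \<omega>] light v(1)] by simp
  then have "pm v 0 = 0" unfolding pm_def by (simp cong: Bochner_Integration.integral_cong)
  then have lin: "lin (pm v) ?s = ?s * pm v 1"
    using lin_eq[of 0 ?s "pm v"] s light theta by simp
  show ?thesis
  proof (cases "?s = 0")
    case True
    then show ?thesis using lin s y01(1)[of l] by simp
  next
    case False
    then have pos: "0 < ?s" using s by simp
    have c: "\<lceil>?s\<rceil> \<le> 1" using light theta by (simp add: ceiling_le_iff)
    let ?E = "{\<omega> \<in> space coins. rep M \<theta> y \<omega> v = l}"
    have m: "?E \<in> sets coins" using coins_measurable_sel(2) by auto
    have "of_bool (l \<in> sel M \<theta> y \<omega> v 1) = indicat_real ?E \<omega>" if \<omega>: "\<omega> \<in> space coins" for \<omega>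
    proof -
      have "sel M \<theta> y \<omega> v 1 = {rep M \<theta> y \<omega> v}"
        using sampling_tree.sel_up[OF tree[OF \<omega>] c pos] sampling_tree.sel_light[OF tree[OF \<omega>] light v(1)] by auto
      then show ?thesis using \<omega> by (auto simp: indicator_def)
    qed
    then have "pm v 1 = (\<integral>\<omega>. indicat_real ?E \<omega> \<partial>coins)"
      unfolding pm_def by (intro Bochner_Integration.integral_cong refl)
    also have "\<dots> = y l / ?s" using m winner_probability[OF theta y01 v(1) light pos v(2)] by simp
    finally show ?thesis using lin pos by simp
  qed
qed

text \<open>Only the child above \<open>l\<close> matters for \<open>l\<close>; averaging over the
  coin and then over \<open>N\<close> is the tower property \<open>lin_mu\<close>.\<close>

lemma pm_fresh:
  fixes right :: bool and v :: nat
  defines "p \<equiv> 2 * v + of_bool right"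
  assumes v: "0 < v" "v < M" "l \<in> leaves M p" and fresh: "\<not> sm M y v < \<theta>"
  shows "lin (pm v) (sm M y v) = lin (pm p) (sm M y p)"
proof -
  define q where "q = 2 * v + of_bool (\<not> right)"
  let ?s = "sm M y v"
  have pq: "p \<noteq> q" "p = 2 * v \<and> q = 2 * v + 1 \<or> p = 2 * v + 1 \<and> q = 2 * v" "v < p" "0 < p" "0 < q"
    using v(1) by (auto simp: p_def q_def)
  have lq: "l \<notin> leaves M q" using leaves_disjoint[OF v(1), of M] v(3) pq by auto
  have pe: "sm M y p = (if right then ?s - sm M y (2 * v) else sm M y (2 * v))"
    using tree_inner(1)[OF v(1,2)] by (auto simp: p_def)
  have "pm v N = lin (pm p) (mu N ?s (sm M y p))" if N: "valid N ?s" for N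
  proof -
    define n where "n = child_count N ?s (sm M y (2 * v)) right"
    define Z where "Z = (\<lambda>m \<omega>. of_bool (l \<in> sel M \<theta> y \<omega> p m) :: real)"
    define F where "F = (\<lambda>\<omega>. Z (n (\<omega> v)) \<omega>)"
    have Fm: "F \<in> borel_measurable coins"
      unfolding F_def Z_def n_def
      by (rule measurable_compose_countable[OF mem_measurable child_count_measurable])
    have Fb: "\<bar>F \<omega>\<bar> \<le> 1" for \<omega> by (simp add: F_def Z_def)
    have "pm v N = (\<integral>\<omega>. F \<omega> \<partial>coins)"
      unfolding pm_def
    proof (rule Bochner_Integration.integral_cong[OF refl])
      fix \<omega> assume \<omega>: "\<omega> \<in> space coins"
      note c = sampling_tree.sel_child[OF tree[OF \<omega>] v(1,2) N fresh, of right, folded n_def p_def q_def]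
      have "l \<notin> sel M \<theta> y \<omega> q (N - n (\<omega> v))"
        using sampling_tree.sel_subset[OF tree[OF \<omega>]] lq by blast
      then show "of_bool (l \<in> sel M \<theta> y \<omega> v N) = F \<omega>" unfolding c(3) by (simp add: F_def Z_def)
    qed
    also have "\<dots> = (\<integral>\<omega>. (\<integral>u. F (fun_upd \<omega> v u) \<partial>U01) \<partial>coins)"
      by (rule coins_resample[OF Fm Fb])
    also have "\<dots> = (\<integral>\<omega>. (\<integral>u. Z (n u) \<omega> \<partial>U01) \<partial>coins)"
    proof -
      have "F (fun_upd \<omega> v u) = Z (n u) \<omega>" for \<omega> u
      proof -
        have "sel M \<theta> y (fun_upd \<omega> v u) p m = sel M \<theta> y \<omega> p m" for m
          using pq by (intro sel_cong) auto
        then show ?thesis by (simp add: F_def Z_def)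
      qed
      then show ?thesis by simp
    qed
    also have "\<dots> = (\<integral>\<omega>. lin (\<lambda>m. Z m \<omega>) (mu N ?s (sm M y p)) \<partial>coins)"
      using child_count_integral[OF N, of "\<lambda>m. Z m _"] pe by (simp add: n_def)
    also have "\<dots> = lin (pm p) (mu N ?s (sm M y p))"
      unfolding lin_def pm_def Z_def by (simp add: mem_integrable)
    finally show ?thesis .
  qed
  then have "lin (pm v) ?s = lin (\<lambda>N. lin (pm p) (mu N ?s (sm M y p))) ?s" by (rule lin_cong)
  then show ?thesis by (simp add: lin_mu)
qed

text \<open>The average is constant on the path: it is \<open>y l\<close> at the leaf,
  \<open>s * (y l / s)\<close> at a nonempty light node, and every other node inherits the value of
  its child.\<close>

lemma pm_path: "0 < l div 2 ^ j \<Longrightarrow> lin (pm (l div 2 ^ j)) (sm M y (l div 2 ^ j)) = y l"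
proof (induction j)
  case 0
  have nl: "\<not> (0 < l \<and> l < M)" using l by simp
  have "pm l N = of_bool (N = 1)" if N: "valid N (sm M y l)" for N
  proof -
    have "l \<in> sel M \<theta> y \<omega> l N \<longleftrightarrow> N = 1" if "\<omega> \<in> space coins" for \<omega>
      using sampling_tree.sel_leaf[OF tree[OF that] nl N] by simp
    then have "pm l N = (\<integral>\<omega>. of_bool (N = 1) \<partial>coins)"
      unfolding pm_def by (intro Bochner_Integration.integral_cong refl) simp
    then show ?thesis by (simp add: coins.prob_space)
  qed
  then have "lin (pm l) (sm M y l) = lin (\<lambda>N. of_bool (N = 1)) (sm M y l)" by (rule lin_cong)
  also have "\<dots> = y l" using lin_eq[of 0 "y l"] y01 by (simp add: tree_leaf[OF nl])
  finally show ?case by simp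
next
  case (Suc j)
  define v where "v = l div 2 ^ Suc j"
  define p where "p = l div 2 ^ j"
  have v: "v = p div 2" by (simp add: v_def p_def div_mult2_eq mult.commute[of 2])
  have v0: "0 < v" using Suc.prems by (simp add: v_def)
  then have p0: "0 < p" using v by (metis div_0 gr0I)
  have "v \<le> l div 2" unfolding v using div_le_mono[OF div_le_dividend[of l "2 ^ j"], of 2]
    by (simp add: p_def)
  then have vM: "v < M" using l by linarith
  have p: "p = 2 * v + of_bool (odd p)" using v by auto
  have lp: "l \<in> leaves M p" using leaf_in_ancestor[OF l] p0 by (simp add: p_def)
  have lv: "l \<in> leaves M v" using leaf_in_ancestor[OF l, of "Suc j"] v0 by (simp only: v_def)
  have "lin (pm v) (sm M y v) = y l"
  proof (cases "sm M y v < \<theta>")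
    case True
    then show ?thesis by (rule pm_light[OF v0 lv])
  next
    case False
    have "lin (pm v) (sm M y v) = lin (pm p) (sm M y p)"
      using pm_fresh[OF v0 vM, of "odd p", folded p, OF lp False] .
    then show ?thesis using Suc.IH p0 by (simp add: p_def)
  qed
  then show ?case by (simp add: v_def)
qed

lemma sample_marginal:
  assumes root: "l div 2 ^ H = 1"
  shows "measure coins {\<omega> \<in> space coins. l \<in> sample M \<theta> y \<omega>} = y l"
proof -
  let ?s = "sm M y 1"
  define n where "n = (\<lambda>u. \<lceil>?s - u\<rceil>)"
  define Z where "Z = (\<lambda>m \<omega>. of_bool (l \<in> sel M \<theta> y \<omega> 1 m) :: real)"
  define F where "F = (\<lambda>\<omega>. Z (n (\<omega> 0)) \<omega>)"
  have nm: "(\<lambda>\<omega>. n (\<omega> 0)) \<in> measurable coins (count_space UNIV)"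
    unfolding n_def
    by (rule measurable_compose[OF borel_measurable_diff[OF borel_measurable_const coin_measurable] measurable_real_ceiling])
  have Fm: "F \<in> borel_measurable coins"
    unfolding F_def Z_def by (rule measurable_compose_countable[OF mem_measurable nm])
  have Fb: "\<bar>F \<omega>\<bar> \<le> 1" for \<omega> by (simp add: F_def Z_def)
  have m: "{\<omega> \<in> space coins. l \<in> sample M \<theta> y \<omega>} \<in> sets coins"
    using coins_measurable_sel(3) by auto
  then have "measure coins {\<omega> \<in> space coins. l \<in> sample M \<theta> y \<omega>} =
      (\<integral>\<omega>. indicat_real {\<omega> \<in> space coins. l \<in> sample M \<theta> y \<omega>} \<omega> \<partial>coins)" by simp
  also have "\<dots> = (\<integral>\<omega>. F \<omega> \<partial>coins)"
    by (intro Bochner_Integration.integral_cong refl) (simp add: F_def Z_def n_def sample_def indicator_def)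
  also have "\<dots> = (\<integral>\<omega>. (\<integral>u. F (fun_upd \<omega> 0 u) \<partial>U01) \<partial>coins)"
    by (rule coins_resample[OF Fm Fb])
  also have "\<dots> = (\<integral>\<omega>. (\<integral>u. Z (n u) \<omega> \<partial>U01) \<partial>coins)"
  proof -
    have "F (fun_upd \<omega> 0 u) = Z (n u) \<omega>" for \<omega> u
    proof -
      have "sel M \<theta> y (fun_upd \<omega> 0 u) 1 m = sel M \<theta> y \<omega> 1 m" for m
        by (intro sel_cong) auto
      then show ?thesis by (simp add: F_def Z_def)
    qed
    then show ?thesis by simp
  qed
  also have "\<dots> = (\<integral>\<omega>. lin (\<lambda>m. Z m \<omega>) ?s \<partial>coins)"
    unfolding n_def by (simp add: U01_ceiling(2)[where h = "\<lambda>m. Z m _"])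
  also have "\<dots> = lin (pm 1) ?s"
    unfolding lin_def pm_def Z_def by (simp add: mem_integrable)
  also have "\<dots> = y l" using pm_path[of H] root by simp
  finally show ?thesis .
qed

end

section \<open>Random placement of the coordinates\<close>

text \<open>Reduction modulo \<open>2 ^ L\<close> forgets the half of the tree, so both leaves of a
  coordinate bear its label.\<close>

definition label :: "nat \<Rightarrow> (nat \<Rightarrow> nat) \<Rightarrow> nat \<Rightarrow> nat" where
  "label L p v = p (v mod 2 ^ L)"

text \<open>Each coordinate owns one of the \<open>2 ^ L\<close> light leaves below node 2 and one of the heavy leaves below node 3.\<close>

definition leaf :: "nat \<Rightarrow> (nat \<Rightarrow> nat) \<Rightarrow> bool \<Rightarrow> nat \<Rightarrow> nat" where
  "leaf L p heavy i = (if heavy then 3 else 2) * 2 ^ L + inv p i"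

definition spread :: "nat \<Rightarrow> nat \<Rightarrow> (nat \<Rightarrow> nat) \<Rightarrow> real \<Rightarrow> (nat \<Rightarrow> real) \<Rightarrow> nat \<Rightarrow> real" where
  "spread L n p \<tau> x v =
    (if label L p v \<in> {1..n} \<and> v div 2 ^ L = (if \<tau> \<le> x (label L p v) then 3 else 2) then x (label L p v) else 0)"

definition algo :: "nat \<Rightarrow> nat \<Rightarrow> (nat \<Rightarrow> nat) \<Rightarrow> real \<Rightarrow> real \<Rightarrow> (nat \<Rightarrow> real) \<Rightarrow> (nat \<Rightarrow> real) \<Rightarrow> nat set" where
  "algo L n p \<tau> \<theta> u x = label L p ` sample (2 * 2 ^ L) \<theta> (spread L n p \<tau> x) u"

text \<open>A coordinate is counted by its position, in whichever half its leaf lies. This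
  overestimates the mass in either half but does not involve \<tau>, so the permutation can be
  averaged separately.\<close>

definition block_mass :: "nat \<Rightarrow> (nat \<Rightarrow> nat) \<Rightarrow> (nat \<Rightarrow> real) \<Rightarrow> nat \<Rightarrow> nat \<Rightarrow> real" where
  "block_mass n p x i j = (\<Sum>i'\<in>{i' \<in> {1..n} - {i}. inv p i' div 2 ^ j = inv p i div 2 ^ j}. x i')"

locale placement =
  fixes L n :: nat and p :: "nat \<Rightarrow> nat"
  assumes n: "n < 2 ^ L" and p: "p permutes {..<2 ^ L}"
begin

abbreviation M :: nat where "M \<equiv> 2 * 2 ^ L"

lemma inv_less: "i \<in> {1..n} \<Longrightarrow> inv p i < 2 ^ L"
  using permutes_in_image[OF permutes_inv[OF p], of i] n by simp

lemma p_inv [simp]: "p (inv p i) = i" "inv p (p i) = i"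
  using permutes_inverses[OF p] by auto

lemma leaf_simps:
  assumes "i \<in> {1..n}"
  shows "leaf L p h i mod 2 ^ L = inv p i" "leaf L p h i div 2 ^ L = (if h then 3 else 2)"
    "label L p (leaf L p h i) = i" "M \<le> leaf L p h i" "leaf L p h i < 2 * M" "leaf L p h i div 2 ^ Suc L = 1"
proof -
  show m: "leaf L p h i mod 2 ^ L = inv p i" "leaf L p h i div 2 ^ L = (if h then 3 else 2)"
    using inv_less[OF assms] by (simp_all add: leaf_def)
  show "label L p (leaf L p h i) = i" by (simp add: label_def m)
  show "M \<le> leaf L p h i" "leaf L p h i < 2 * M" using inv_less[OF assms] by (simp_all add: leaf_def)
  have "leaf L p h i div 2 ^ Suc L = leaf L p h i div 2 ^ L div 2" by (simp add: div_mult2_eq mult.commute[of 2])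
  then show "leaf L p h i div 2 ^ Suc L = 1" using m by simp
qed

lemma leaf_eqI:
  assumes "label L p v = i" "v div 2 ^ L = (if h then 3 else 2)"
  shows "v = leaf L p h i"
proof -
  have "v mod 2 ^ L = inv p i" using assms(1) unfolding label_def by (metis p_inv(2))
  then show ?thesis using assms(2) div_mult_mod_eq[of v "2 ^ L"] by (simp add: leaf_def)
qed

lemma spread_leaf: "i \<in> {1..n} \<Longrightarrow> spread L n p \<tau> x (leaf L p h i) = (if h = (\<tau> \<le> x i) then x i else 0)"
  using leaf_simps[of i h] by (auto simp: spread_def)

lemma spread_nonzero:
  assumes "spread L n p \<tau> x v \<noteq> 0"
  obtains i where "i \<in> {1..n}" "v = leaf L p (\<tau> \<le> x i) i" "spread L n p \<tau> x v = x i"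
proof -
  have "label L p v \<in> {1..n}" "v div 2 ^ L = (if \<tau> \<le> x (label L p v) then 3 else 2)"
    using assms by (auto simp: spread_def split: if_splits)
  then show ?thesis using that[of "label L p v"] leaf_eqI[OF refl] by (simp add: spread_def)
qed

lemma spread_range:
  assumes "\<And>i. i \<in> {1..n} \<Longrightarrow> 0 \<le> x i" "\<And>i. i \<in> {1..n} \<Longrightarrow> x i \<le> 1"
  shows "0 \<le> spread L n p \<tau> x v" "spread L n p \<tau> x v \<le> 1"
  using assms by (auto simp: spread_def)

lemma leaves_root: "leaves M 1 = {M..<2 * M}"
proof -
  have "l \<in> leaves M 1" if "M \<le> l" "l < 2 * M" for l
  proof -
    have "l div 2 ^ Suc L = 1"
      using that by (intro div_nat_eqI) auto
    then show ?thesis using leaf_in_ancestor[OF that, of "Suc L"] by (simp only:)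
  qed
  moreover have "l \<in> {M..<2 * M}" if "l \<in> leaves M 1" for l
  proof -
    have "(1::nat) \<le> 2 ^ L" by simp
    then have "1 < 2 * M" by linarith
    then show ?thesis using leaves_range[OF that] by simp
  qed
  ultimately show ?thesis by auto
qed

lemma sum_spread: "sm M (spread L n p \<tau> x) 1 = sum x {1..n}"
proof -
  have inj: "inj_on (\<lambda>i. leaf L p (\<tau> \<le> x i) i) {1..n}"
    by (rule inj_on_inverseI[of _ "label L p"]) (simp add: leaf_simps(3))
  have "sm M (spread L n p \<tau> x) 1 = (\<Sum>v\<in>(\<lambda>i. leaf L p (\<tau> \<le> x i) i) ` {1..n}. spread L n p \<tau> x v)"
    unfolding sm_eq_sum leaves_root
  proof (rule sum.mono_neutral_right)
    show "(\<lambda>i. leaf L p (\<tau> \<le> x i) i) ` {1..n} \<subseteq> {M..<2 * M}" using leaf_simps(4,5) by auto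
    show "\<forall>v\<in>{M..<2 * M} - (\<lambda>i. leaf L p (\<tau> \<le> x i) i) ` {1..n}. spread L n p \<tau> x v = 0"
      using spread_nonzero by blast
  qed simp
  also have "\<dots> = sum x {1..n}"
    unfolding sum.reindex[OF inj] by (rule sum.cong[OF refl]) (simp only: spread_leaf comp_apply, simp)
  finally show ?thesis .
qed

text \<open>As 0 is below \<tau>, a coordinate set to 0 leaves both of its leaves empty, and any
  other value amounts to one write on top of that.\<close>

lemma spread_update:
  fixes x :: "nat \<Rightarrow> real" and i :: nat and \<tau> :: real
  assumes i: "i \<in> {1..n}" and "0 < \<tau>"
  defines "z \<equiv> spread L n p \<tau> (x(i := 0))"
  shows "spread L n p \<tau> (x(i := t)) = z(leaf L p (\<tau> \<le> t) i := t)"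
    and "z(leaf L p h i := 0) = z"
proof -
  show "z(leaf L p h i := 0) = z" using spread_leaf[OF i] by (auto simp: z_def)
  show "spread L n p \<tau> (x(i := t)) = z(leaf L p (\<tau> \<le> t) i := t)"
  proof
    fix v
    show "spread L n p \<tau> (x(i := t)) v = (z(leaf L p (\<tau> \<le> t) i := t)) v"
    proof (cases "label L p v = i")
      case True
      show ?thesis
      proof (cases "v div 2 ^ L = (if \<tau> \<le> t then 3 else 2)")
        case T: True
        then have "v = leaf L p (\<tau> \<le> t) i" using True leaf_eqI by blast
        then show ?thesis using spread_leaf[OF i, of \<tau> "x(i := t)"] by simp
      next
        case F: False
        then have "v \<noteq> leaf L p (\<tau> \<le> t) i" using leaf_simps(2)[OF i] by auto
        then show ?thesis using True F by (simp add: z_def spread_def)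
      qed
    next
      case False
      then have "v \<noteq> leaf L p (\<tau> \<le> t) i" using leaf_simps(3)[OF i] by auto
      then show ?thesis using False by (simp add: z_def spread_def)
    qed
  qed
qed

text \<open>\<open>leaves_imp_div\<close> yields only some exponent. All leaf numbers lie between
  \<open>M\<close> and \<open>2 * M\<close>, so any exponent other than \<open>j\<close> would lead
  to a node of a different level.\<close>

lemma leaves_level:
  assumes l: "M \<le> l" "l < 2 * M" and j: "j \<le> L" and v: "v \<in> leaves M (l div 2 ^ j)"
  shows "v div 2 ^ j = l div 2 ^ j"
proof -
  let ?w = "l div 2 ^ j"
  have p2: "(2::nat) ^ L = 2 ^ j * 2 ^ (L - j)" using j by (simp flip: power_add)
  have w: "2 * 2 ^ (L - j) \<le> ?w" "?w < 4 * 2 ^ (L - j)"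
  proof -
    have "2 * 2 ^ (L - j) * 2 ^ j \<le> l" using l(1) p2 by (simp add: mult_ac)
    then show "2 * 2 ^ (L - j) \<le> ?w" by (simp add: less_eq_div_iff_mult_less_eq)
    have "l < 4 * 2 ^ (L - j) * 2 ^ j" using l(2) p2 by (simp add: mult_ac)
    then show "?w < 4 * 2 ^ (L - j)" by (simp add: div_less_iff_less_mult)
  qed
  then have w0: "0 < ?w" by (metis bot_nat_0.extremum_uniqueI gr0I mult_is_0 power_not_zero zero_neq_numeral)
  have "?w < 2 * M" using l(2) div_le_dividend le_less_trans by blast
  then have vr: "M \<le> v" "v < 2 * M" using leaves_range[OF v w0] by auto
  obtain a where a: "v div 2 ^ a = ?w" using leaves_imp_div[OF v] by blast
  have "a = j"
  proof (rule ccontr)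
    assume "a \<noteq> j"
    then consider "a < j" | "j < a" by linarith
    then show False
    proof cases
      case 1
      have "2 * 2 ^ (L - a) * 2 ^ a \<le> v" using vr(1) 1 j by (simp add: mult.assoc flip: power_add)
      then have "2 * 2 ^ (L - a) \<le> ?w" using a by (metis less_eq_div_iff_mult_less_eq pos2 zero_less_power)
      moreover have "(4::nat) * 2 ^ (L - j) \<le> 2 * 2 ^ (L - a)"
      proof -
        have "(2::nat) ^ Suc (L - j) \<le> 2 ^ (L - a)" using 1 j by (intro power_increasing) auto
        then show ?thesis by simp
      qed
      ultimately show False using w(2) by linarith
    next
      case 2
      have "v < 4 * 2 ^ L" using vr(2) by simp
      also have "(4::nat) * 2 ^ L = 2 * 2 ^ (L - j) * 2 ^ Suc j" using p2 by (simp add: mult_ac)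
      also have "\<dots> \<le> 2 * 2 ^ (L - j) * 2 ^ a" using 2 by (intro mult_le_mono power_increasing) auto
      finally have "?w < 2 * 2 ^ (L - j)" using a by (metis div_less_iff_less_mult pos2 zero_less_power)
      then show False using w(1) by linarith
    qed
  qed
  then show ?thesis using a by simp
qed

lemma level_half:
  fixes v l :: nat
  assumes "v div 2 ^ j = l div 2 ^ j" "j \<le> L"
  shows "v div 2 ^ L = l div 2 ^ L" "(v mod 2 ^ L) div 2 ^ j = (l mod 2 ^ L) div 2 ^ j"
proof -
  have p2: "(2::nat) ^ L = 2 ^ j * 2 ^ (L - j)" using assms(2) by (simp flip: power_add)
  show "v div 2 ^ L = l div 2 ^ L" unfolding p2 div_mult2_eq assms(1) ..
  have "(w mod 2 ^ L) div 2 ^ j = (w div 2 ^ j) mod 2 ^ (L - j)" for w :: nat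
    unfolding p2 by (simp add: mod_mult2_eq)
  then show "(v mod 2 ^ L) div 2 ^ j = (l mod 2 ^ L) div 2 ^ j" using assms(1) by simp
qed

lemma block_sum_le:
  assumes i: "i \<in> {1..n}" and j: "j \<le> L" and x: "\<And>i. i \<in> {1..n} \<Longrightarrow> 0 \<le> x i" and "0 < \<tau>"
  shows "sm M (spread L n p \<tau> (x(i := 0))) (leaf L p h i div 2 ^ j) \<le> block_mass n p x i j"
    (is "sm M ?z ?w \<le> _")
proof -
  have "sm M ?z ?w = (\<Sum>v\<in>{v \<in> leaves M ?w. ?z v \<noteq> 0}. ?z v)"
    unfolding sm_eq_sum by (rule sum.mono_neutral_right) auto
  also have "\<dots> \<le> block_mass n p x i j"
    unfolding block_mass_def
  proof (rule sum_le_included[where i = "leaf L p h"])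
    show "\<forall>v\<in>{v \<in> leaves M ?w. ?z v \<noteq> 0}.
        \<exists>i'\<in>{i' \<in> {1..n} - {i}. inv p i' div 2 ^ j = inv p i div 2 ^ j}. leaf L p h i' = v \<and> ?z v \<le> x i'"
    proof
      fix v assume "v \<in> {v \<in> leaves M ?w. ?z v \<noteq> 0}"
      then have v: "v \<in> leaves M ?w" "?z v \<noteq> 0" by auto
      obtain i' where i': "i' \<in> {1..n}" "v = leaf L p (\<tau> \<le> (x(i := 0)) i') i'" "?z v = (x(i := 0)) i'"
        using spread_nonzero[OF v(2)] by blast
      have ne: "i' \<noteq> i" using i'(3) v(2) by auto
      have "v div 2 ^ j = leaf L p h i div 2 ^ j"
        using leaves_level[OF leaf_simps(4,5)[OF i] j v(1)] .
      note lh = level_half[OF this j]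
      have "v = leaf L p h i'"
        using lh(1) i'(2) leaf_simps(2)[OF i] leaf_simps(2)[OF i'(1)] by (auto split: if_splits)
      moreover have "inv p i' div 2 ^ j = inv p i div 2 ^ j"
        using lh(2) i'(2) leaf_simps(1)[OF i] leaf_simps(1)[OF i'(1)] by simp
      ultimately show "\<exists>i'\<in>{i' \<in> {1..n} - {i}. inv p i' div 2 ^ j = inv p i div 2 ^ j}.
          leaf L p h i' = v \<and> ?z v \<le> x i'"
        using i' ne by auto
    qed
  qed (use x in auto)
  finally show ?thesis .
qed

text \<open>A leaf of the heavy half is empty or carries at least \<tau>, so the others cannot have
  a small positive mass there.\<close>

lemma heavy_block:
  assumes i: "i \<in> {1..n}" and j: "j \<le> L" and x: "\<And>i. i \<in> {1..n} \<Longrightarrow> 0 \<le> x i" and "0 < \<tau>"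
    and pos: "0 < sm M (spread L n p \<tau> (x(i := 0))) (leaf L p True i div 2 ^ j)"
  shows "\<tau> \<le> sm M (spread L n p \<tau> (x(i := 0))) (leaf L p True i div 2 ^ j)"
    (is "_ \<le> sm M ?z ?w")
proof -
  have z0: "0 \<le> ?z v" for v using x by (auto simp: spread_def)
  have "\<exists>v\<in>leaves M ?w. ?z v \<noteq> 0"
    using pos unfolding sm_eq_sum by (metis less_irrefl sum.neutral)
  then obtain v where v: "v \<in> leaves M ?w" "?z v \<noteq> 0" by blast
  obtain i' where i': "i' \<in> {1..n}" "v = leaf L p (\<tau> \<le> (x(i := 0)) i') i'" "?z v = (x(i := 0)) i'"
    using spread_nonzero[OF v(2)] by blast
  have "v div 2 ^ j = leaf L p True i div 2 ^ j"
    using leaves_level[OF leaf_simps(4,5)[OF i] j v(1)] .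
  note lh = level_half[OF this j]
  have "\<tau> \<le> ?z v"
    using lh(1) i'(2,3) leaf_simps(2)[OF i] leaf_simps(2)[OF i'(1)] by (auto split: if_splits)
  also have "\<dots> \<le> sm M ?z ?w" unfolding sm_eq_sum using v(1) z0 by (intro member_le_sum) auto
  finally show ?thesis .
qed

end

section \<open>Collisions under a uniform permutation\<close>

lemma card_block:
  assumes "j \<le> L" "b < 2 ^ (L - j)"
  shows "card {k :: nat. k < 2 ^ L \<and> k div 2 ^ j = b} = 2 ^ j"
proof -
  have p2: "(2::nat) ^ L = 2 ^ j * 2 ^ (L - j)" using assms(1) by (simp flip: power_add)
  have "{k :: nat. k < 2 ^ L \<and> k div 2 ^ j = b} = {b * 2 ^ j..<Suc b * 2 ^ j}"
  proof (intro set_eqI iffI)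
    fix k assume "k \<in> {b * 2 ^ j..<Suc b * 2 ^ j}"
    then have k: "b * 2 ^ j \<le> k" "k < Suc b * 2 ^ j" by auto
    then have "k div 2 ^ j = b" by (intro div_nat_eqI) (auto simp: mult.commute)
    moreover have "Suc b * 2 ^ j \<le> 2 ^ (L - j) * 2 ^ j" using assms(2) by (intro mult_le_mono) auto
    then have "k < 2 ^ L" using k p2 by (simp add: mult.commute)
    ultimately show "k \<in> {k. k < 2 ^ L \<and> k div 2 ^ j = b}" by simp
  next
    fix k :: nat assume "k \<in> {k. k < 2 ^ L \<and> k div 2 ^ j = b}"
    then have "k div 2 ^ j = b" by simp
    then show "k \<in> {b * 2 ^ j..<Suc b * 2 ^ j}"
      by (auto simp: dividend_less_div_times mult.commute intro: div_times_less_eq_dividend)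
        (metis dividend_less_times_div mult.commute mult_Suc_right pos2 zero_less_power)
  qed
  then show ?thesis by simp
qed

text \<open>By symmetry under transpositions fixing \<open>i\<close>, every
  \<open>k \<noteq> i\<close> shares the block of \<open>i\<close> equally often, and for each
  permutation exactly \<open>2 ^ j - 1\<close> of them do. Double counting gives the proportion
  \<open>(2 ^ j - 1) / (2 ^ L - 1)\<close>, which is at most \<open>2 ^ j / 2 ^ L\<close>.\<close>

lemma permutation_collisions:
  fixes i i' :: nat
  assumes i: "i < 2 ^ L" "i' < 2 ^ L" "i \<noteq> i'" and j: "j \<le> L"
  shows "real (card {p. p permutes {..<2 ^ L} \<and> inv p i' div 2 ^ j = inv p i div 2 ^ j}) * 2 ^ L \<le>
    real (card {p. p permutes {..<2 ^ L :: nat}}) * 2 ^ j"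
proof -
  define Q where "Q = {q. q permutes {..<2 ^ L :: nat}}"
  have fQ: "finite Q" unfolding Q_def by (rule finite_permutations) simp
  define f where "f = (\<lambda>k. card {q \<in> Q. q k div 2 ^ j = q i div 2 ^ j})"
  have "bij_betw inv {p. p permutes {..<2 ^ L} \<and> inv p i' div 2 ^ j = inv p i div 2 ^ j} {q \<in> Q. q i' div 2 ^ j = q i div 2 ^ j}"
    by (rule bij_betwI[where g = inv]) (auto simp: Q_def permutes_inv permutes_inv_inv)
  then have c: "card {p. p permutes {..<2 ^ L} \<and> inv p i' div 2 ^ j = inv p i div 2 ^ j} = f i'"
    unfolding f_def by (rule bij_betw_same_card)
  have same: "f k = f i'" if k: "k \<in> {..<2 ^ L} - {i}" for k
  proof -
    let ?t = "Transposition.transpose k i'"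
    have t: "?t permutes {..<2 ^ L}" using k i by (intro permutes_swap_id) auto
    have ti: "?t i = i" "?t i' = k" "?t k = i'" using k i by (auto simp: Transposition.transpose_def)
    have "bij_betw (\<lambda>q. q \<circ> ?t) {q \<in> Q. q k div 2 ^ j = q i div 2 ^ j} {q \<in> Q. q i' div 2 ^ j = q i div 2 ^ j}"
      by (rule bij_betwI[where g = "\<lambda>q. q \<circ> ?t"])
        (auto simp: Q_def permutes_compose[OF t] ti comp_assoc)
    then show ?thesis unfolding f_def by (rule bij_betw_same_card)
  qed
  have blk: "card {k \<in> {..<2 ^ L} - {i}. q k div 2 ^ j = q i div 2 ^ j} = 2 ^ j - 1" if q: "q \<in> Q" for q
  proof -
    have qp: "q permutes {..<2 ^ L}" using q by (simp add: Q_def)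
    have "{k \<in> {..<2 ^ L}. q k div 2 ^ j = q i div 2 ^ j} = inv q ` {k. k < 2 ^ L \<and> k div 2 ^ j = q i div 2 ^ j}"
    proof (intro set_eqI iffI)
      fix k assume "k \<in> {k \<in> {..<2 ^ L}. q k div 2 ^ j = q i div 2 ^ j}"
      then show "k \<in> inv q ` {k. k < 2 ^ L \<and> k div 2 ^ j = q i div 2 ^ j}"
        using permutes_in_image[OF qp, of k] permutes_inverses[OF qp] by (intro image_eqI[of _ _ "q k"]) auto
    next
      fix k assume "k \<in> inv q ` {k. k < 2 ^ L \<and> k div 2 ^ j = q i div 2 ^ j}"
      then show "k \<in> {k \<in> {..<2 ^ L}. q k div 2 ^ j = q i div 2 ^ j}"
        using permutes_in_image[OF permutes_inv[OF qp]] permutes_inverses[OF qp] by auto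
    qed
    moreover have "inj (inv q)" using permutes_inj[OF permutes_inv[OF qp]] .
    ultimately have "card {k \<in> {..<2 ^ L}. q k div 2 ^ j = q i div 2 ^ j} = card {k. k < 2 ^ L \<and> k div 2 ^ j = q i div 2 ^ j}"
      by (simp add: card_image inj_on_subset)
    also have "\<dots> = 2 ^ j"
    proof (rule card_block[OF j])
      have "q i < 2 ^ L" using permutes_in_image[OF qp, of i] i by simp
      also have "(2::nat) ^ L = 2 ^ (L - j) * 2 ^ j" using j by (simp flip: power_add)
      finally show "q i div 2 ^ j < 2 ^ (L - j)" by (simp add: div_less_iff_less_mult)
    qed
    finally have "card {k \<in> {..<2 ^ L}. q k div 2 ^ j = q i div 2 ^ j} = 2 ^ j" .
    moreover have "{k \<in> {..<2 ^ L} - {i}. q k div 2 ^ j = q i div 2 ^ j} = {k \<in> {..<2 ^ L}. q k div 2 ^ j = q i div 2 ^ j} - {i}"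
      by auto
    ultimately show ?thesis using i by (simp add: card_Diff_singleton)
  qed
  have "(2 ^ L - 1) * f i' = (\<Sum>k\<in>{..<2 ^ L} - {i}. f i')" using i by simp
  also have "\<dots> = (\<Sum>k\<in>{..<2 ^ L} - {i}. f k)" by (rule sum.cong[OF refl same[symmetric]])
  also have "\<dots> = (\<Sum>k\<in>{..<2 ^ L} - {i}. \<Sum>q\<in>Q. of_bool (q k div 2 ^ j = q i div 2 ^ j))"
    unfolding f_def using fQ by (simp add: sum_of_bool_eq Int_def conj_commute)
  also have "\<dots> = (\<Sum>q\<in>Q. \<Sum>k\<in>{..<2 ^ L} - {i}. of_bool (q k div 2 ^ j = q i div 2 ^ j))"
    by (rule sum.swap)
  also have "\<dots> = (\<Sum>q\<in>Q. 2 ^ j - 1)"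
  proof (rule sum.cong[OF refl])
    fix q assume "q \<in> Q"
    have "(\<Sum>k\<in>{..<2 ^ L} - {i}. of_bool (q k div 2 ^ j = q i div 2 ^ j)) =
        card {k \<in> {..<2 ^ L} - {i}. q k div 2 ^ j = q i div 2 ^ j}"
      by (simp add: sum_of_bool_eq Int_def Collect_conj_eq[symmetric])
    then show "(\<Sum>k\<in>{..<2 ^ L} - {i}. of_bool (q k div 2 ^ j = q i div 2 ^ j)) = (2 ^ j - 1 :: nat)"
      using blk[OF \<open>q \<in> Q\<close>] by simp
  qed
  also have "\<dots> = card Q * (2 ^ j - 1)" by simp
  finally have "(2 ^ L - 1) * f i' = card Q * (2 ^ j - 1)" .
  then have "real ((2 ^ L - 1) * f i') = real (card Q * (2 ^ j - 1))" by (rule arg_cong)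
  then have e: "(2 ^ L - 1) * real (f i') = real (card Q) * (2 ^ j - 1)"
    by (simp add: of_nat_diff)
  have L1: "1 < (2::real) ^ L"
  proof -
    have "L \<noteq> 0" using i by (metis less_one power_0 less_irrefl)
    then show ?thesis by simp
  qed
  have "(2::real) ^ j \<le> 2 ^ L" using j by simp
  then have "(2 ^ j - 1) * 2 ^ L \<le> (2::real) ^ j * (2 ^ L - 1)" by (simp add: algebra_simps)
  then have "real (card Q) * ((2 ^ j - 1) * 2 ^ L) \<le> real (card Q) * (2 ^ j * (2 ^ L - 1))"
    by (intro mult_left_mono) auto
  moreover have "(2 ^ L - 1) * (real (f i') * 2 ^ L) = real (card Q) * ((2 ^ j - 1) * 2 ^ L)"
    unfolding mult.assoc[symmetric] e ..
  moreover have "real (card Q) * (2 ^ j * (2 ^ L - 1)) = (2 ^ L - 1) * (real (card Q) * 2 ^ j)"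
    by (simp only: mult_ac)
  ultimately have "(2 ^ L - 1) * (real (f i') * 2 ^ L) \<le> (2 ^ L - 1) * (real (card Q) * 2 ^ j)"
    by linarith
  then have "real (f i') * 2 ^ L \<le> real (card Q) * 2 ^ j"
    using L1 by (simp add: mult_le_cancel_left_pos)
  then show ?thesis unfolding c by (simp add: Q_def)
qed

section \<open>The algorithm for a fixed placement\<close>

lemma sd_image: "finite A \<Longrightarrow> finite B \<Longrightarrow> sd (f ` A) (f ` B) \<le> sd A B"
proof -
  assume "finite A" "finite B"
  then have "card (sym_diff (f ` A) (f ` B)) \<le> card (f ` sym_diff A B)" by (intro card_mono) auto
  also have "\<dots> \<le> card (sym_diff A B)" using \<open>finite A\<close> \<open>finite B\<close> by (intro card_image_le) auto
  finally show ?thesis by (simp add: sd_def)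
qed

context placement
begin

lemma spread_tree:
  assumes "\<theta> \<le> 1" "\<And>v. 0 < u v" "\<And>v. u v < 1" "\<And>i. i \<in> {1..n} \<Longrightarrow> 0 \<le> x i" "\<And>i. i \<in> {1..n} \<Longrightarrow> x i \<le> 1"
  shows "sampling_tree \<theta> (spread L n p \<tau> x) u"
  using assms spread_range[of x] by unfold_locales auto

lemma algo_mem:
  assumes tree: "sampling_tree \<theta> (spread L n p \<tau> x) u" and i: "i \<in> {1..n}"
  shows "i \<in> algo L n p \<tau> \<theta> u x \<longleftrightarrow> leaf L p (\<tau> \<le> x i) i \<in> sample M \<theta> (spread L n p \<tau> x) u"
proof
  assume "i \<in> algo L n p \<tau> \<theta> u x"
  then obtain v where v: "v \<in> sample M \<theta> (spread L n p \<tau> x) u" "label L p v = i" by (auto simp: algo_def)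
  then have "0 < spread L n p \<tau> x v" using sampling_tree.sel_pos[OF tree] by (auto simp: sample_def)
  then obtain i' where "i' \<in> {1..n}" "v = leaf L p (\<tau> \<le> x i') i'" using spread_nonzero[of \<tau> x v] by auto
  then show "leaf L p (\<tau> \<le> x i) i \<in> sample M \<theta> (spread L n p \<tau> x) u" using v leaf_simps(3)[of i'] by auto
next
  assume "leaf L p (\<tau> \<le> x i) i \<in> sample M \<theta> (spread L n p \<tau> x) u"
  then show "i \<in> algo L n p \<tau> \<theta> u x" unfolding algo_def using leaf_simps(3)[OF i] by (metis image_eqI)
qed

lemma algo_subset:
  assumes tree: "sampling_tree \<theta> (spread L n p \<tau> x) u"
  shows "algo L n p \<tau> \<theta> u x \<subseteq> {1..n}"
proof
  fix i assume "i \<in> algo L n p \<tau> \<theta> u x"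
  then obtain v where v: "v \<in> sample M \<theta> (spread L n p \<tau> x) u" "label L p v = i" by (auto simp: algo_def)
  then have "0 < spread L n p \<tau> x v" using sampling_tree.sel_pos[OF tree] by (auto simp: sample_def)
  then show "i \<in> {1..n}" using v(2) by (auto simp: spread_def split: if_splits)
qed

lemma algo_card:
  assumes tree: "sampling_tree \<theta> (spread L n p \<tau> x) u"
  shows "int (card (algo L n p \<tau> \<theta> u x)) \<in> {\<lfloor>sum x {1..n}\<rfloor>, \<lceil>sum x {1..n}\<rceil>}"
proof -
  have "inj_on (label L p) (sample M \<theta> (spread L n p \<tau> x) u)"
  proof (rule inj_onI)
    fix v w assume vw: "v \<in> sample M \<theta> (spread L n p \<tau> x) u" "w \<in> sample M \<theta> (spread L n p \<tau> x) u"
      "label L p v = label L p w"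
    then have "spread L n p \<tau> x v \<noteq> 0" "spread L n p \<tau> x w \<noteq> 0"
      using sampling_tree.sel_pos[OF tree] by (fastforce simp: sample_def)+
    then obtain i i' where "i \<in> {1..n}" "v = leaf L p (\<tau> \<le> x i) i" "i' \<in> {1..n}" "w = leaf L p (\<tau> \<le> x i') i'"
      using spread_nonzero by metis
    then show "v = w" using vw(3) leaf_simps(3) by metis
  qed
  then have "card (algo L n p \<tau> \<theta> u x) = card (sample M \<theta> (spread L n p \<tau> x) u)"
    unfolding algo_def by (rule card_image)
  then show ?thesis using sampling_tree.card_sample[OF tree, of M] sum_spread by simp
qed

lemma algo_marginal:
  assumes x: "\<And>i. i \<in> {1..n} \<Longrightarrow> 0 \<le> x i" "\<And>i. i \<in> {1..n} \<Longrightarrow> x i \<le> 1" and theta: "\<theta> \<le> 1" and i: "i \<in> {1..n}"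
  shows "measure coins {\<omega> \<in> space coins. i \<in> algo L n p \<tau> \<theta> \<omega> x} = x i"
proof -
  let ?l = "leaf L p (\<tau> \<le> x i) i"
  interpret static_tree M \<theta> "spread L n p \<tau> x" ?l
    using theta spread_range[OF x] leaf_simps(4,5)[OF i] by unfold_locales auto
  have "{\<omega> \<in> space coins. i \<in> algo L n p \<tau> \<theta> \<omega> x} = {\<omega> \<in> space coins. ?l \<in> sample M \<theta> (spread L n p \<tau> x) \<omega>}"
    using algo_mem[OF tree i] by auto
  then show ?thesis using sample_marginal[OF leaf_simps(6)[OF i]] spread_leaf[OF i] by simp
qed

text \<open>The levels that may contribute to the stretch; \<open>Suc L\<close> is the root.\<close>

definition counted :: "(nat \<Rightarrow> real) \<Rightarrow> nat \<Rightarrow> nat set" where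
  "counted x i = insert (Suc L) {j. j \<le> L \<and> 1 / 8 \<le> block_mass n p x i j}"

lemma finite_counted [simp]: "finite (counted x i)"
  by (simp add: counted_def)

text \<open>The halves make a level count for different reasons. A light leaf holds at most 3/4, so
  reaching \<open>\<theta> \<ge> 7 / 8\<close> takes 1/8 from the others; in the heavy half any
  other mass is already at least \<open>\<tau> \<ge> 1 / 2\<close>.\<close>

lemma move_bound:
  assumes x: "\<And>i. i \<in> {1..n} \<Longrightarrow> 0 \<le> x i" "\<And>i. i \<in> {1..n} \<Longrightarrow> x i \<le> 1" and i: "i \<in> {1..n}"
    and ab: "0 \<le> a" "a \<le> b" "b \<le> 1" "\<not> h \<longrightarrow> b \<le> 3 / 4"
    and \<tau>: "1 / 2 \<le> \<tau>" and \<theta>: "7 / 8 \<le> \<theta>" "\<theta> \<le> 1"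
  defines "z \<equiv> spread L n p \<tau> (x(i := 0))" and "l \<equiv> leaf L p h i"
  shows "(\<integral>\<omega>. sd (sample M \<theta> (z(l := a)) \<omega>) (sample M \<theta> (z(l := b)) \<omega>) \<partial>coins) \<le>
    (b - a) * (3 + 4 * real (card (counted x i))) +
    2 * real (card {j \<in> counted x i. sm M z (l div 2 ^ j) + a < \<theta> \<and> \<theta> \<le> sm M z (l div 2 ^ j) + b})"
proof -
  have tau0: "0 < \<tau>" using \<tau> by simp
  have z0: "z(l := 0) = z" unfolding z_def l_def by (rule spread_update(2)[OF i tau0])
  have zr: "0 \<le> z j" "z j \<le> 1" for j
    using spread_range[of "x(i := 0)"] x by (auto simp: z_def)
  have "j \<in> counted x i" if j: "j \<le> Suc L" "0 < sm M z (l div 2 ^ j)" "\<theta> \<le> sm M z (l div 2 ^ j) + b" for j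
  proof (cases "j = Suc L")
    case False
    then have jL: "j \<le> L" using j by simp
    have "1 / 8 \<le> sm M z (l div 2 ^ j)"
    proof (cases h)
      case True
      then show ?thesis using heavy_block[where x = x, OF i jL x(1) tau0] j(2) \<tau> by (simp add: z_def l_def)
    next
      case False
      then show ?thesis using ab(4) \<theta>(1) j(3) by simp
    qed
    also have "\<dots> \<le> block_mass n p x i j"
      unfolding z_def l_def by (rule block_sum_le[OF i jL x(1) tau0])
    finally show ?thesis using jL by (simp add: counted_def)
  qed (simp add: counted_def)
  then have B: "j \<in> counted x i" if "j \<le> Suc L" "0 < sm M (z(l := 0)) (l div 2 ^ j)"
      "\<theta> \<le> sm M (z(l := 0)) (l div 2 ^ j) + b" for j
    using that unfolding z0 by blast
  have BH: "counted x i \<subseteq> {..Suc L}" by (auto simp: counted_def)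
  have lr: "M \<le> l" "l < 2 * M" "l div 2 ^ Suc L = 1" using leaf_simps(4,5,6)[OF i, of h] by (simp_all add: l_def)
  from sample_lipschitz[where y = z, OF \<theta>(2) zr lr ab(1-3) BH finite_counted B] show ?thesis
    unfolding z0 by simp
qed

section \<open>Averaging over the mass threshold\<close>

lemma spread_measurable:
  assumes "T \<in> borel_measurable \<Omega>"
  shows "(\<lambda>w. spread L n p (T w) x v) \<in> borel_measurable \<Omega>"
proof -
  have [measurable]: "T \<in> borel_measurable \<Omega>" by fact
  have "(\<lambda>w. spread L n p (T w) x v) = (\<lambda>w. if T w \<le> x (label L p v)
      then (if label L p v \<in> {1..n} \<and> v div 2 ^ L = 3 then x (label L p v) else 0)
      else (if label L p v \<in> {1..n} \<and> v div 2 ^ L = 2 then x (label L p v) else 0))"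
    by (auto simp: spread_def)
  then show ?thesis by simp
qed

lemma sample_sub:
  assumes "\<omega> \<in> space coins" "\<theta> \<le> 1" "\<And>v. 0 \<le> y v" "\<And>v. y v \<le> 1"
  shows "sample M \<theta> y \<omega> \<subseteq> leaves M 1"
  using sampling_tree.sel_subset[OF coin_tree[OF assms(2-4,1)]] by (auto simp: sample_def)

text \<open>Permutation and \<tau> are still fixed. With values in \<open>ennreal\<close>, the
  triangle inequality needs measurability in \<open>\<beta>\<close> but no integrability.\<close>

definition dist_nn :: "(nat \<Rightarrow> real) \<Rightarrow> (nat \<Rightarrow> real) \<Rightarrow> ennreal" where
  "dist_nn y y' = (\<integral>\<^sup>+\<beta>. (\<integral>\<^sup>+\<omega>. ennreal (sd (sample M (7 / 8 + \<beta> / 8) y \<omega>) (sample M (7 / 8 + \<beta> / 8) y' \<omega>)) \<partial>coins) \<partial>U01)"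

lemma sample_sd_measurable:
  assumes "\<And>v. 0 \<le> y v" "\<And>v. y v \<le> 1" "\<And>v. 0 \<le> y' v" "\<And>v. y' v \<le> 1"
  shows "(\<lambda>w. sd (sample M (7 / 8 + fst w / 8) y (snd w)) (sample M (7 / 8 + fst w / 8) y' (snd w)))
    \<in> borel_measurable (U01 \<Otimes>\<^sub>M coins)"
proof (rule sd_measurable[OF finite_leaves[of M 1]])
  have b: "(\<lambda>w. 7 / 8 + fst w / 8) \<in> borel_measurable (U01 \<Otimes>\<^sub>M coins)"
    by (intro borel_measurable_add borel_measurable_divide borel_measurable_const
        measurable_compose[OF measurable_fst U01_in_borel])
  have c: "(\<lambda>w. snd w v) \<in> borel_measurable (U01 \<Otimes>\<^sub>M coins)" for v
    by (rule measurable_compose[OF measurable_snd coin_measurable])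
  show "Measurable.pred (U01 \<Otimes>\<^sub>M coins) (\<lambda>w. x \<in> sample M (7 / 8 + fst w / 8) y (snd w))"
    "Measurable.pred (U01 \<Otimes>\<^sub>M coins) (\<lambda>w. x \<in> sample M (7 / 8 + fst w / 8) y' (snd w))" for x
    by (intro sample_measurable b c borel_measurable_const)+
  fix w assume "w \<in> space (U01 \<Otimes>\<^sub>M coins)"
  then have w: "snd w \<in> space coins" "7 / 8 + fst w / 8 \<le> 1" by (auto simp: space_pair_measure)
  show "sample M (7 / 8 + fst w / 8) y (snd w) \<subseteq> leaves M 1"
    by (rule sample_sub[OF w assms(1,2)])
  show "sample M (7 / 8 + fst w / 8) y' (snd w) \<subseteq> leaves M 1"
    by (rule sample_sub[OF w assms(3,4)])
qed

lemma dist_nn_inner_measurable: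
  assumes "\<And>v. 0 \<le> y v" "\<And>v. y v \<le> 1" "\<And>v. 0 \<le> y' v" "\<And>v. y' v \<le> 1"
  shows "(\<lambda>\<beta>. \<integral>\<^sup>+\<omega>. ennreal (sd (sample M (7 / 8 + \<beta> / 8) y \<omega>) (sample M (7 / 8 + \<beta> / 8) y' \<omega>)) \<partial>coins)
    \<in> borel_measurable U01"
proof -
  have "(\<lambda>w. ennreal (sd (sample M (7 / 8 + fst w / 8) y (snd w)) (sample M (7 / 8 + fst w / 8) y' (snd w))))
    \<in> borel_measurable (U01 \<Otimes>\<^sub>M coins)"
    by (intro measurable_compose[OF sample_sd_measurable measurable_ennreal] assms)
  from coins.borel_measurable_nn_integral_fst[OF this] show ?thesis by simp
qed

lemma dist_nn_triangle:
  assumes "\<And>v. 0 \<le> y v" "\<And>v. y v \<le> 1" "\<And>v. 0 \<le> y' v" "\<And>v. y' v \<le> 1" "\<And>v. 0 \<le> y'' v" "\<And>v. y'' v \<le> 1"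
  shows "dist_nn y y'' \<le> dist_nn y y' + dist_nn y' y''"
proof -
  let ?s = "\<lambda>\<beta> y \<omega>. sample M (7 / 8 + \<beta> / 8) y \<omega>"
  have fin: "finite (?s \<beta> z \<omega>)" if "\<beta> \<in> space U01" "\<omega> \<in> space coins" "\<And>v. 0 \<le> z v" "\<And>v. z v \<le> 1" for \<beta> z \<omega>
  proof -
    have "sample M (7 / 8 + \<beta> / 8) z \<omega> \<subseteq> leaves M 1"
      by (rule sample_sub) (use that in auto)
    then show ?thesis using finite_subset finite_leaves by blast
  qed
  have m: "(\<lambda>\<omega>. ennreal (sd (?s \<beta> z \<omega>) (?s \<beta> z' \<omega>))) \<in> borel_measurable coins"
    if "\<beta> \<in> space U01" "\<And>v. 0 \<le> z v" "\<And>v. z v \<le> 1" "\<And>v. 0 \<le> z' v" "\<And>v. z' v \<le> 1" for \<beta> z z'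
    using borel_measurable_integrable[OF sample_measurable_coins[of "7 / 8 + \<beta> / 8" z z' M]] that by simp
  have "dist_nn y y'' \<le> (\<integral>\<^sup>+\<beta>. (\<integral>\<^sup>+\<omega>. ennreal (sd (?s \<beta> y \<omega>) (?s \<beta> y' \<omega>)) \<partial>coins) +
      (\<integral>\<^sup>+\<omega>. ennreal (sd (?s \<beta> y' \<omega>) (?s \<beta> y'' \<omega>)) \<partial>coins) \<partial>U01)"
    unfolding dist_nn_def
  proof (rule nn_integral_mono)
    fix \<beta> assume \<beta>: "\<beta> \<in> space U01"
    have "(\<integral>\<^sup>+\<omega>. ennreal (sd (?s \<beta> y \<omega>) (?s \<beta> y'' \<omega>)) \<partial>coins) \<le>
        (\<integral>\<^sup>+\<omega>. ennreal (sd (?s \<beta> y \<omega>) (?s \<beta> y' \<omega>)) + ennreal (sd (?s \<beta> y' \<omega>) (?s \<beta> y'' \<omega>)) \<partial>coins)"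
    proof (rule nn_integral_mono)
      fix \<omega> assume \<omega>: "\<omega> \<in> space coins"
      have "sd (?s \<beta> y \<omega>) (?s \<beta> y'' \<omega>) \<le> sd (?s \<beta> y \<omega>) (?s \<beta> y' \<omega>) + sd (?s \<beta> y' \<omega>) (?s \<beta> y'' \<omega>)"
        by (intro sd_triangle fin \<beta> \<omega> assms)
      then show "ennreal (sd (?s \<beta> y \<omega>) (?s \<beta> y'' \<omega>)) \<le> ennreal (sd (?s \<beta> y \<omega>) (?s \<beta> y' \<omega>)) + ennreal (sd (?s \<beta> y' \<omega>) (?s \<beta> y'' \<omega>))"
        by (simp add: ennreal_plus[symmetric] ennreal_leI del: ennreal_plus)
    qed
    also have "\<dots> = (\<integral>\<^sup>+\<omega>. ennreal (sd (?s \<beta> y \<omega>) (?s \<beta> y' \<omega>)) \<partial>coins) +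
      (\<integral>\<^sup>+\<omega>. ennreal (sd (?s \<beta> y' \<omega>) (?s \<beta> y'' \<omega>)) \<partial>coins)"
      by (intro nn_integral_add m \<beta> assms)
    finally show "(\<integral>\<^sup>+\<omega>. ennreal (sd (?s \<beta> y \<omega>) (?s \<beta> y'' \<omega>)) \<partial>coins) \<le> (\<integral>\<^sup>+\<omega>. ennreal (sd (?s \<beta> y \<omega>) (?s \<beta> y' \<omega>)) \<partial>coins) +
      (\<integral>\<^sup>+\<omega>. ennreal (sd (?s \<beta> y' \<omega>) (?s \<beta> y'' \<omega>)) \<partial>coins)" .
  qed
  also have "\<dots> = dist_nn y y' + dist_nn y' y''"
    unfolding dist_nn_def by (intro nn_integral_add dist_nn_inner_measurable assms)
  finally show ?thesis .
qed

text \<open>A level changes its rule iff \<theta> falls into an interval of length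
  \<open>b - a\<close>. As \<theta> is uniform on a range of length 1/8, this has probability at
  most \<open>8 * (b - a)\<close>; at cost 2 it adds 16 to the 4 per counted level.\<close>

lemma dist_nn_move:
  assumes x: "\<And>i. i \<in> {1..n} \<Longrightarrow> 0 \<le> x i" "\<And>i. i \<in> {1..n} \<Longrightarrow> x i \<le> 1" and i: "i \<in> {1..n}"
    and ab: "0 \<le> a" "a \<le> b" "b \<le> 1" "\<not> h \<longrightarrow> b \<le> 3 / 4"
    and \<tau>: "1 / 2 \<le> \<tau>"
  defines "z \<equiv> spread L n p \<tau> (x(i := 0))" and "l \<equiv> leaf L p h i"
  shows "dist_nn (z(l := a)) (z(l := b)) \<le> ennreal ((b - a) * (3 + 20 * real (card (counted x i))))"
proof -
  let ?C = "counted x i" and ?R = "\<lambda>j. sm M z (l div 2 ^ j)"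
  let ?I = "\<lambda>j. {\<beta> \<in> space U01. 8 * (?R j + a) - 7 < \<beta> \<and> \<beta> \<le> 8 * (?R j + b) - 7}"
  have zr: "0 \<le> z j" "z j \<le> 1" for j
    using spread_range[of "x(i := 0)"] x by (auto simp: z_def)
  have Im: "?I j \<in> sets U01" for j
    by (intro sets.sets_Collect_conj borel_measurable_less borel_measurable_le borel_measurable_const U01_in_borel)
  let ?f = "\<lambda>\<beta>. (b - a) * (3 + 4 * real (card ?C)) + 2 * (\<Sum>j\<in>?C. indicator (?I j) \<beta>)"
  have fi: "integrable U01 ?f"
    using Im by (intro Bochner_Integration.integrable_add integrable_mult_right Bochner_Integration.integrable_sum integrable_real_indicator)
      (auto simp: U01.emeasure_eq_measure)
  have "dist_nn (z(l := a)) (z(l := b)) \<le> (\<integral>\<^sup>+\<beta>. ennreal (?f \<beta>) \<partial>U01)"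
    unfolding dist_nn_def
  proof (rule nn_integral_mono)
    fix \<beta> assume \<beta>: "\<beta> \<in> space U01"
    let ?t = "7 / 8 + \<beta> / 8"
    have t: "7 / 8 \<le> ?t" "?t \<le> 1" using \<beta> by auto
    let ?D = "\<integral>\<omega>. sd (sample M ?t (z(l := a)) \<omega>) (sample M ?t (z(l := b)) \<omega>) \<partial>coins"
    have eq: "(\<integral>\<^sup>+\<omega>. ennreal (sd (sample M ?t (z(l := a)) \<omega>) (sample M ?t (z(l := b)) \<omega>)) \<partial>coins) = ennreal ?D"
      using t zr ab by (intro nn_integral_eq_integral sample_measurable_coins) auto
    have "real (card {j \<in> ?C. ?R j + a < ?t \<and> ?t \<le> ?R j + b}) = (\<Sum>j\<in>?C. indicator (?I j) \<beta>)"
    proof -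
      have "{j \<in> ?C. ?R j + a < ?t \<and> ?t \<le> ?R j + b} = ?C \<inter> {j. \<beta> \<in> ?I j}"
        using \<beta> by (auto simp: field_simps)
      moreover have "(\<Sum>j\<in>?C. indicator (?I j) \<beta>) = (\<Sum>j\<in>?C. of_bool (\<beta> \<in> ?I j) :: real)"
        by (intro sum.cong refl) (simp add: indicator_def)
      ultimately show ?thesis by (simp add: sum_of_bool_eq)
    qed
    moreover have "?D \<le> (b - a) * (3 + 4 * real (card ?C)) + 2 * real (card {j \<in> ?C. ?R j + a < ?t \<and> ?t \<le> ?R j + b})"
      using move_bound[where x = x, OF x i ab \<tau> t] unfolding z_def l_def .
    ultimately have "?D \<le> ?f \<beta>" by simp
    then show "(\<integral>\<^sup>+\<omega>. ennreal (sd (sample M ?t (z(l := a)) \<omega>) (sample M ?t (z(l := b)) \<omega>)) \<partial>coins) \<le> ennreal (?f \<beta>)"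
      unfolding eq by (rule ennreal_leI)
  qed
  also have "\<dots> = ennreal (\<integral>\<beta>. ?f \<beta> \<partial>U01)"
    using ab by (intro nn_integral_eq_integral fi AE_I2) (auto intro!: add_nonneg_nonneg sum_nonneg mult_nonneg_nonneg)
  finally have main: "dist_nn (z(l := a)) (z(l := b)) \<le> ennreal (\<integral>\<beta>. ?f \<beta> \<partial>U01)" .
  have "(\<integral>\<beta>. ?f \<beta> \<partial>U01) = (b - a) * (3 + 4 * real (card ?C)) + 2 * (\<Sum>j\<in>?C. measure U01 (?I j))"
  proof -
    have "integrable U01 (indicat_real (?I j))" for j using Im by (intro integrable_real_indicator) (auto simp: U01.emeasure_eq_measure)
    moreover have "(\<integral>\<beta>. indicat_real (?I j) \<beta> \<partial>U01) = measure U01 (?I j)" for j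
    proof -
      have "?I j \<inter> space U01 = ?I j" by auto
      then show ?thesis by (simp only: Bochner_Integration.integral_indicator)
    qed
    moreover have "measure U01 (space U01) = 1" by (rule U01.prob_space)
    ultimately show ?thesis by (subst Bochner_Integration.integral_add) auto
  qed
  also have "\<dots> \<le> (b - a) * (3 + 4 * real (card ?C)) + 2 * (\<Sum>j\<in>?C. 8 * (b - a))"
    using ab by (intro add_left_mono mult_left_mono sum_mono order_trans[OF U01_interval]) auto
  also have "\<dots> = (b - a) * (3 + 20 * real (card ?C))" by (simp add: algebra_simps)
  finally show ?thesis by (rule order_trans[OF main ennreal_leI])
qed

text \<open>A coordinate that passes \<tau> is routed through 0: its light leaf is emptied and its
  heavy leaf filled, at a cost proportional to \<open>a + b\<close>. This does not shrink with
  \<open>b - a\<close>, hence the extra 2 tied to the event of passing \<tau>.\<close>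

lemma dist_nn_coordinate:
  fixes a b :: real
  assumes x: "\<And>i. i \<in> {1..n} \<Longrightarrow> 0 \<le> x i" "\<And>i. i \<in> {1..n} \<Longrightarrow> x i \<le> 1" and i: "i \<in> {1..n}"
    and ab: "0 \<le> a" "a \<le> b" "b \<le> 1" and \<tau>: "1 / 2 \<le> \<tau>" "\<tau> \<le> 3 / 4"
  shows "dist_nn (spread L n p \<tau> (x(i := a))) (spread L n p \<tau> (x(i := b))) \<le>
    ennreal ((3 + 20 * real (card (counted x i))) * ((b - a) + 2 * of_bool (a < \<tau> \<and> \<tau> \<le> b)))"
proof -
  let ?z = "spread L n p \<tau> (x(i := 0))" and ?l = "\<lambda>h. leaf L p h i" and ?K = "3 + 20 * real (card (counted x i))"
  have tau0: "0 < \<tau>" using \<tau> by simp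
  note upd = spread_update[OF i tau0, of x]
  have zr: "0 \<le> (?z(?l h := t)) v" "(?z(?l h := t)) v \<le> 1" if "0 \<le> t" "t \<le> 1" for h t v
    using spread_range[of "x(i := 0)"] x that by auto
  show ?thesis
  proof (cases "a < \<tau> \<and> \<tau> \<le> b")
    case False
    then have same: "(\<tau> \<le> a) = (\<tau> \<le> b)" using ab by auto
    have *: "dist_nn (?z(?l (\<tau> \<le> b) := a)) (?z(?l (\<tau> \<le> b) := b)) \<le> ennreal ((b - a) * ?K)"
      using \<tau> by (intro dist_nn_move x i ab) auto
    have z: "of_bool (a < \<tau> \<and> \<tau> \<le> b) = (0 :: real)" using False by simp
    have e: "?K * ((b - a) + 2 * of_bool (a < \<tau> \<and> \<tau> \<le> b)) = (b - a) * ?K" unfolding z by simp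
    show ?thesis unfolding upd(1)[of a] upd(1)[of b] same e by (rule *)
  next
    case True
    have tri: "dist_nn (?z(?l False := a)) (?z(?l True := b)) \<le> dist_nn (?z(?l False := a)) ?z + dist_nn ?z (?z(?l True := b))"
      using zr[of a False] zr[of b True] zr[of 0 True] ab upd(2)[of True] by (intro dist_nn_triangle) auto
    have "dist_nn (?z(?l False := 0)) (?z(?l False := a)) \<le> ennreal ((a - 0) * ?K)"
      using \<tau> ab True by (intro dist_nn_move x i) auto
    moreover have "dist_nn (?z(?l False := a)) ?z = dist_nn (?z(?l False := 0)) (?z(?l False := a))"
      unfolding upd(2) dist_nn_def by (simp only: sd_commute)
    ultimately have 1: "dist_nn (?z(?l False := a)) ?z \<le> ennreal (a * ?K)" by simp
    have "dist_nn (?z(?l True := 0)) (?z(?l True := b)) \<le> ennreal ((b - 0) * ?K)"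
      using \<tau> ab True by (intro dist_nn_move x i) auto
    then have 2: "dist_nn ?z (?z(?l True := b)) \<le> ennreal (b * ?K)" unfolding upd(2) by simp
    have "dist_nn (?z(?l False := a)) (?z(?l True := b)) \<le> ennreal (a * ?K) + ennreal (b * ?K)"
      by (rule order_trans[OF tri add_mono[OF 1 2]])
    also have "\<dots> = ennreal ((a + b) * ?K)"
      using ab by (subst ennreal_plus[symmetric]) (auto simp: algebra_simps)
    also have "\<dots> \<le> ennreal (?K * (b - a + 2))"
      using ab by (intro ennreal_leI) (simp add: mult.commute mult_left_mono)
    finally show ?thesis unfolding upd(1)[of a] upd(1)[of b] using True by (simp add: not_le[symmetric])
  qed
qed

end

section \<open>The distribution over deterministic maps\<close>

definition perms :: "nat \<Rightarrow> (nat \<Rightarrow> nat) set" where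
  "perms L = {p. p permutes {..<2 ^ L}}"

lemma finite_perms [simp]: "finite (perms L)"
  unfolding perms_def by (rule finite_permutations) simp

lemma perms_nonempty: "perms L \<noteq> {}" "0 < card (perms L)"
proof -
  have "id \<in> perms L" by (simp add: perms_def permutes_id)
  then show "perms L \<noteq> {}" by blast
  then show "0 < card (perms L)" by (simp add: card_gt_0_iff)
qed

text \<open>The \<open>q\<close> levels next to the tops of the two halves, where a block may well
  hold much mass, are all counted; below them the expected masses form a geometric series. The 18
  consists of 1 for the root, 1 for rounding \<open>log 2 k\<close> up to \<open>q\<close>, and 16
  from the series, whose first terms are scaled by \<open>k / 2 ^ q \<le> 1\<close>.\<close>

lemma average_counted:
  fixes x :: "nat \<Rightarrow> real" and k :: nat
  assumes n: "n < 2 ^ L" and i: "i \<in> {1..n}" and x: "\<And>i. i \<in> {1..n} \<Longrightarrow> 0 \<le> x i"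
    and sum: "sum x ({1..n} - {i}) \<le> real k" and k: "1 \<le> k"
  shows "(\<Sum>p\<in>perms L. real (card (placement.counted L n p x i))) \<le> card (perms L) * (log 2 k + 18)"
proof -
  define q where "q = nat \<lceil>log 2 k\<rceil>"
  have l0: "0 \<le> log 2 (real k)" using k by simp
  have q: "real q < log 2 k + 1" "log 2 k \<le> real q" using l0 unfolding q_def by linarith+
  have kq: "real k \<le> 2 ^ q"
  proof -
    have "real k = 2 powr (log 2 k)" using k by simp
    also have "\<dots> \<le> 2 powr (real q)" using q(2) by simp
    finally show ?thesis by (simp add: powr_realpow)
  qed
  \<comment> \<open>The levels on which the expectation is used; the \<open>q\<close> levels with
    \<open>L - j < q\<close> are charged in full.\<close>
  let ?J = "{j. j \<le> L \<and> q \<le> L - j}"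
  have each: "real (card (placement.counted L n p x i)) \<le> 1 + real q + (\<Sum>j\<in>?J. 8 * block_mass n p x i j)"
    if p: "p \<in> perms L" for p
  proof -
    interpret placement L n p using n p by unfold_locales (auto simp: perms_def)
    have b0: "0 \<le> block_mass n p x i j" for j unfolding block_mass_def using x by (intro sum_nonneg) auto
    have "{j. j \<le> L \<and> 1 / 8 \<le> block_mass n p x i j} \<subseteq> (\<lambda>m. L - m) ` {..<q} \<union> {j \<in> ?J. 1 / 8 \<le> block_mass n p x i j}"
    proof
      fix j assume j: "j \<in> {j. j \<le> L \<and> 1 / 8 \<le> block_mass n p x i j}"
      show "j \<in> (\<lambda>m. L - m) ` {..<q} \<union> {j \<in> ?J. 1 / 8 \<le> block_mass n p x i j}"
      proof (cases "q \<le> L - j")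
        case False
        then have "j = L - (L - j)" "L - j \<in> {..<q}" using j by auto
        then show ?thesis by blast
      qed (use j in auto)
    qed
    then have "counted x i \<subseteq> insert (Suc L) ((\<lambda>m. L - m) ` {..<q} \<union> {j \<in> ?J. 1 / 8 \<le> block_mass n p x i j})"
      unfolding counted_def by blast
    then have "card (counted x i) \<le> card (insert (Suc L) ((\<lambda>m. L - m) ` {..<q} \<union> {j \<in> ?J. 1 / 8 \<le> block_mass n p x i j}))"
      by (intro card_mono) auto
    also have "\<dots> \<le> Suc (card ((\<lambda>m. L - m) ` {..<q} \<union> {j \<in> ?J. 1 / 8 \<le> block_mass n p x i j}))"
      by (rule card_insert_le_m1) (simp_all)
    also have "\<dots> \<le> Suc (card ((\<lambda>m. L - m) ` {..<q}) + card {j \<in> ?J. 1 / 8 \<le> block_mass n p x i j})"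
      using card_Un_le by simp
    also have "card ((\<lambda>m. L - m) ` {..<q}) \<le> q" using card_image_le[of "{..<q}"] by simp
    finally have "real (card (counted x i)) \<le> real (Suc (q + card {j \<in> ?J. 1 / 8 \<le> block_mass n p x i j}))"
      by simp
    also have "\<dots> = 1 + real q + real (card {j \<in> ?J. 1 / 8 \<le> block_mass n p x i j})" by simp
    also have "real (card {j \<in> ?J. 1 / 8 \<le> block_mass n p x i j}) = (\<Sum>j\<in>?J. of_bool (1 / 8 \<le> block_mass n p x i j))"
      by (simp add: sum_of_bool_eq Int_def)
    also have "\<dots> \<le> (\<Sum>j\<in>?J. 8 * block_mass n p x i j)"
      using b0 by (intro sum_mono) auto
    finally show ?thesis by simp
  qed
  have mass: "(\<Sum>p\<in>perms L. block_mass n p x i j) \<le> card (perms L) * real k * (1 / 2) ^ (L - j)" if j: "j \<le> L" for j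
  proof -
    have "(\<Sum>p\<in>perms L. block_mass n p x i j) =
        (\<Sum>p\<in>perms L. \<Sum>i'\<in>{1..n} - {i}. x i' * of_bool (inv p i' div 2 ^ j = inv p i div 2 ^ j))"
      unfolding block_mass_def by (intro sum.cong refl sum.mono_neutral_cong_left) auto
    also have "\<dots> = (\<Sum>i'\<in>{1..n} - {i}. x i' * (\<Sum>p\<in>perms L. of_bool (inv p i' div 2 ^ j = inv p i div 2 ^ j)))"
      unfolding sum_distrib_left by (rule sum.swap)
    also have "\<dots> \<le> (\<Sum>i'\<in>{1..n} - {i}. x i' * (card (perms L) * (1 / 2) ^ (L - j)))"
    proof (intro sum_mono mult_left_mono)
      fix i' assume i': "i' \<in> {1..n} - {i}"
      then show "0 \<le> x i'" using x by simp
      have lt: "i < 2 ^ L" "i' < 2 ^ L" "i \<noteq> i'" using i i' n by auto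
      have "(\<Sum>p\<in>perms L. of_bool (inv p i' div 2 ^ j = inv p i div 2 ^ j)) =
          real (card {p. p permutes {..<2 ^ L} \<and> inv p i' div 2 ^ j = inv p i div 2 ^ j})"
      proof -
        have "{p. p permutes {..<2 ^ L} \<and> inv p i' div 2 ^ j = inv p i div 2 ^ j} =
            perms L \<inter> {p. inv p i' div 2 ^ j = inv p i div 2 ^ j}" by (auto simp: perms_def)
        then show ?thesis by (simp add: sum_of_bool_eq)
      qed
      moreover have "real (card {p. p permutes {..<2 ^ L} \<and> inv p i' div 2 ^ j = inv p i div 2 ^ j}) * 2 ^ L \<le>
          real (card (perms L)) * 2 ^ j"
        using permutation_collisions[OF lt j] by (simp add: perms_def)
      moreover have "(2::real) ^ L = 2 ^ j * 2 ^ (L - j)" using j by (simp flip: power_add)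
      ultimately have "(\<Sum>p\<in>perms L. of_bool (inv p i' div 2 ^ j = inv p i div 2 ^ j)) * 2 ^ (L - j) \<le> real (card (perms L))"
        by (simp add: mult_ac)
      then show "(\<Sum>p\<in>perms L. of_bool (inv p i' div 2 ^ j = inv p i div 2 ^ j)) \<le> card (perms L) * (1 / 2) ^ (L - j)"
        by (simp add: power_divide field_simps)
    qed
    also have "\<dots> = sum x ({1..n} - {i}) * (card (perms L) * (1 / 2) ^ (L - j))" by (simp add: sum_distrib_right)
    also have "\<dots> \<le> real k * (card (perms L) * (1 / 2) ^ (L - j))" using sum by (intro mult_right_mono) auto
    finally show ?thesis by (simp add: mult_ac)
  qed
  have geo: "(\<Sum>j\<in>?J. (1 / 2 :: real) ^ (L - j)) \<le> 2 / 2 ^ q"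
  proof -
    have inj: "inj_on (\<lambda>j. L - j - q) ?J" by (rule inj_onI) auto
    have "(\<Sum>j\<in>?J. (1 / 2 :: real) ^ (L - j)) = (\<Sum>j\<in>?J. (1 / 2) ^ q * (1 / 2) ^ (L - j - q))"
    proof (rule sum.cong[OF refl])
      fix j assume "j \<in> ?J"
      then have "q \<le> L - j" by simp
      then have "q + (L - j - q) = L - j" by (rule le_add_diff_inverse)
      then show "(1 / 2 :: real) ^ (L - j) = (1 / 2) ^ q * (1 / 2) ^ (L - j - q)" by (metis power_add)
    qed
    also have "\<dots> = (1 / 2) ^ q * (\<Sum>m\<in>(\<lambda>j. L - j - q) ` ?J. (1 / 2) ^ m)"
      unfolding sum_distrib_left sum.reindex[OF inj] by simp
    also have "(\<Sum>m\<in>(\<lambda>j. L - j - q) ` ?J. (1 / 2 :: real) ^ m) \<le> (\<Sum>m<Suc L. (1 / 2) ^ m)"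
      by (intro sum_mono2) auto
    also have "(\<Sum>m<Suc L. (1 / 2 :: real) ^ m) \<le> 2"
    proof -
      have "(a - 1) / (1 / 2 - 1) \<le> 2" if "0 \<le> a" for a :: real using that by (simp add: field_simps)
      then show ?thesis by (subst geometric_sum) simp_all
    qed
    finally show ?thesis by (simp add: power_divide mult_left_mono field_simps)
  qed
  have "(\<Sum>p\<in>perms L. real (card (placement.counted L n p x i))) \<le>
      (\<Sum>p\<in>perms L. 1 + real q + (\<Sum>j\<in>?J. 8 * block_mass n p x i j))"
    by (intro sum_mono each)
  also have "\<dots> = card (perms L) * (1 + real q) + 8 * (\<Sum>j\<in>?J. \<Sum>p\<in>perms L. block_mass n p x i j)"
    unfolding sum.distrib sum_distrib_left by (subst (2) sum.swap) (simp add: distrib_left)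
  also have "\<dots> \<le> card (perms L) * (1 + real q) + 8 * (\<Sum>j\<in>?J. card (perms L) * real k * (1 / 2) ^ (L - j))"
    using mass by (intro add_left_mono mult_left_mono sum_mono) auto
  also have "\<dots> = card (perms L) * (1 + real q) + 8 * (card (perms L) * real k * (\<Sum>j\<in>?J. (1 / 2) ^ (L - j)))"
    by (simp add: sum_distrib_left)
  also have "\<dots> \<le> card (perms L) * (1 + real q) + 8 * (card (perms L) * real k * (2 / 2 ^ q))"
    using geo by (intro add_left_mono mult_left_mono) auto
  also have "\<dots> = card (perms L) * (1 + real q + 16 * (real k / 2 ^ q))" by (simp add: algebra_simps)
  also have "\<dots> \<le> card (perms L) * (log 2 k + 18)"
  proof (rule mult_left_mono)
    have "real k / 2 ^ q \<le> 1" using kq by simp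
    then show "1 + real q + 16 * (real k / 2 ^ q) \<le> log 2 k + 18" using q(1) by linarith
  qed simp
  finally show ?thesis .
qed

section \<open>Seeds: permutation, thresholds and coins\<close>

definition seeds :: "nat \<Rightarrow> ((nat \<Rightarrow> nat) \<times> real \<times> real \<times> (nat \<Rightarrow> real)) measure" where
  "seeds L = uniform_count_measure (perms L) \<Otimes>\<^sub>M (U01 \<Otimes>\<^sub>M (U01 \<Otimes>\<^sub>M coins))"

text \<open>The affine maps place \<tau> in (1/2, 3/4) and \<theta> in (7/8, 1).\<close>

definition run :: "nat \<Rightarrow> nat \<Rightarrow> (nat \<Rightarrow> nat) \<times> real \<times> real \<times> (nat \<Rightarrow> real) \<Rightarrow> (nat \<Rightarrow> real) \<Rightarrow> nat set" where
  "run L n s = (case s of (p, \<alpha>, \<beta>, \<omega>) \<Rightarrow> algo L n p (1 / 2 + \<alpha> / 4) (7 / 8 + \<beta> / 8) \<omega>)"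

abbreviation thresholds :: "(real \<times> real \<times> (nat \<Rightarrow> real)) measure" where
  "thresholds \<equiv> U01 \<Otimes>\<^sub>M (U01 \<Otimes>\<^sub>M coins)"

interpretation thr: pair_prob_space U01 "U01 \<Otimes>\<^sub>M coins"
  by unfold_locales

lemma prob_space_seeds: "prob_space (seeds L)"
proof -
  interpret p: prob_space "uniform_count_measure (perms L)"
    by (rule prob_space_uniform_count_measure) (simp_all add: perms_nonempty)
  interpret pair_prob_space "uniform_count_measure (perms L)" thresholds
    by unfold_locales
  show ?thesis unfolding seeds_def by (rule P.prob_space_axioms)
qed

lemma space_seeds: "s \<in> space (seeds L) \<longleftrightarrow> fst s \<in> perms L \<and> fst (snd s) \<in> space U01 \<and>
    fst (snd (snd s)) \<in> space U01 \<and> snd (snd (snd s)) \<in> space coins"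
  by (cases s) (auto simp: seeds_def space_pair_measure space_uniform_count_measure)

lemma seed_tree:
  assumes s: "(p, \<alpha>, \<beta>, \<omega>) \<in> space (seeds L)" and n: "n < 2 ^ L"
    and x: "\<And>i. i \<in> {1..n} \<Longrightarrow> 0 \<le> x i" "\<And>i. i \<in> {1..n} \<Longrightarrow> x i \<le> 1"
  shows "placement L n p" "sampling_tree (7 / 8 + \<beta> / 8) (spread L n p (1 / 2 + \<alpha> / 4) x) \<omega>"
proof -
  show "placement L n p" using s n by unfold_locales (auto simp: space_seeds perms_def)
  then interpret placement L n p .
  show "sampling_tree (7 / 8 + \<beta> / 8) (spread L n p (1 / 2 + \<alpha> / 4) x) \<omega>"
    using s by (intro spread_tree x) (auto simp: space_seeds space_coins)
qed

lemma run_props: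
  assumes s: "s \<in> space (seeds L)" and n: "n < 2 ^ L"
    and x: "\<And>i. i \<in> {1..n} \<Longrightarrow> 0 \<le> x i" "\<And>i. i \<in> {1..n} \<Longrightarrow> x i \<le> 1"
  shows "run L n s x \<subseteq> {1..n}" "int (card (run L n s x)) \<in> {\<lfloor>sum x {1..n}\<rfloor>, \<lceil>sum x {1..n}\<rceil>}"
proof -
  obtain p \<alpha> \<beta> \<omega> where [simp]: "s = (p, \<alpha>, \<beta>, \<omega>)" by (cases s)
  note t = seed_tree[OF s[simplified] n x]
  show "run L n s x \<subseteq> {1..n}" using placement.algo_subset[OF t] by (simp add: run_def)
  show "int (card (run L n s x)) \<in> {\<lfloor>sum x {1..n}\<rfloor>, \<lceil>sum x {1..n}\<rceil>}"
    using placement.algo_card[OF t] by (simp add: run_def)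
qed

text \<open>The permutations form a finite discrete factor, so it suffices to fix one of
  them.\<close>

lemma run_measurable:
  assumes n: "n < 2 ^ L" and x: "\<And>i. i \<in> {1..n} \<Longrightarrow> 0 \<le> x i" "\<And>i. i \<in> {1..n} \<Longrightarrow> x i \<le> 1"
  shows "Measurable.pred (seeds L) (\<lambda>s. i \<in> run L n s x)"
proof -
  have main: "Measurable.pred thresholds (\<lambda>r. i \<in> run L n (p, r) x)" if pp: "p \<in> perms L" for p
  proof -
    interpret placement L n p using n pp by unfold_locales (auto simp: perms_def)
    have a: "(\<lambda>r. 1 / 2 + fst r / 4) \<in> borel_measurable thresholds"
      by (intro borel_measurable_add borel_measurable_divide borel_measurable_const
          measurable_compose[OF measurable_fst U01_in_borel])
    have b: "(\<lambda>r. 7 / 8 + fst (snd r) / 8) \<in> borel_measurable thresholds"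
      by (intro borel_measurable_add borel_measurable_divide borel_measurable_const
          measurable_compose[OF measurable_compose[OF measurable_snd measurable_fst] U01_in_borel])
    have c: "(\<lambda>r. snd (snd r) v) \<in> borel_measurable thresholds" for v
      by (rule measurable_compose[OF measurable_compose[OF measurable_snd measurable_snd] coin_measurable])
    have m: "Measurable.pred thresholds (\<lambda>r. v \<in> sample M (7 / 8 + fst (snd r) / 8) (spread L n p (1 / 2 + fst r / 4) x) (snd (snd r)))" for v
      by (intro sample_measurable a b c spread_measurable)
    have "Measurable.pred thresholds (\<lambda>r. \<exists>v\<in>leaves M 1. label L p v = i \<and>
        v \<in> sample M (7 / 8 + fst (snd r) / 8) (spread L n p (1 / 2 + fst r / 4) x) (snd (snd r)))"
      using m by (intro pred_intros_finite finite_leaves pred_intros_logic measurable_const) auto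
    then show ?thesis
    proof (rule measurable_cong[THEN iffD1, rotated])
      fix r assume r: "r \<in> space thresholds"
      obtain \<alpha> \<beta> \<omega> where [simp]: "r = (\<alpha>, \<beta>, \<omega>)" by (cases r)
      have "(p, r) \<in> space (seeds L)" using r pp by (auto simp: space_seeds space_pair_measure)
      then have t: "sampling_tree (7 / 8 + \<beta> / 8) (spread L n p (1 / 2 + \<alpha> / 4) x) \<omega>"
        using seed_tree(2) n x by simp
      have "sample M (7 / 8 + \<beta> / 8) (spread L n p (1 / 2 + \<alpha> / 4) x) \<omega> \<subseteq> leaves M 1"
        using sampling_tree.sel_subset[OF t] by (simp add: sample_def)
      then show "(\<exists>v\<in>leaves M 1. label L p v = i \<and>
        v \<in> sample M (7 / 8 + fst (snd r) / 8) (spread L n p (1 / 2 + fst r / 4) x) (snd (snd r))) = (i \<in> run L n (p, r) x)"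
        by (auto simp: run_def algo_def)
    qed
  qed
  have "Measurable.pred (count_space (perms L) \<Otimes>\<^sub>M thresholds) (\<lambda>s. i \<in> run L n s x)"
    using main by (intro measurable_pair_measure_countable1 countable_finite) auto
  also have "measurable (count_space (perms L) \<Otimes>\<^sub>M thresholds) (count_space UNIV) = measurable (seeds L) (count_space UNIV :: bool measure)"
    unfolding seeds_def by (intro measurable_cong_sets sets_pair_measure_cong) (auto simp: sets_uniform_count_measure)
  finally show ?thesis .
qed

lemma run_sd_measurable:
  assumes n: "n < 2 ^ L" and x: "\<And>i. i \<in> {1..n} \<Longrightarrow> 0 \<le> x i" "\<And>i. i \<in> {1..n} \<Longrightarrow> x i \<le> 1"
    and y: "\<And>i. i \<in> {1..n} \<Longrightarrow> 0 \<le> y i" "\<And>i. i \<in> {1..n} \<Longrightarrow> y i \<le> 1"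
  shows "(\<lambda>s. sd (run L n s x) (run L n s y)) \<in> borel_measurable (seeds L)"
    and "integrable (seeds L) (\<lambda>s. sd (run L n s x) (run L n s y))"
proof -
  interpret prob_space "seeds L" by (rule prob_space_seeds)
  show m: "(\<lambda>s. sd (run L n s x) (run L n s y)) \<in> borel_measurable (seeds L)"
    using run_props(1)[OF _ n x] run_props(1)[OF _ n y] run_measurable[OF n x] run_measurable[OF n y]
    by (intro sd_measurable[of "{1..n}"]) auto
  show "integrable (seeds L) (\<lambda>s. sd (run L n s x) (run L n s y))"
  proof (rule integrable_const_bound[OF _ m, where B = "2 * real n"], rule AE_I2)
    fix s assume s: "s \<in> space (seeds L)"
    have sub: "run L n s x \<subseteq> {1..n}" "run L n s y \<subseteq> {1..n}"
      using run_props(1)[where x = x, OF s n x] run_props(1)[where x = y, OF s n y] by auto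
    then have "card (run L n s x) \<le> n" "card (run L n s y) \<le> n"
      using card_mono[OF _ sub(1)] card_mono[OF _ sub(2)] by auto
    moreover have "finite (run L n s x)" "finite (run L n s y)"
      using sub finite_subset[OF _ finite_atLeastAtMost] by blast+
    ultimately show "norm (sd (run L n s x) (run L n s y)) \<le> 2 * real n"
      using sd_le_card[of "run L n s x" "run L n s y"] by simp
  qed
qed

lemma nn_integral_seeds:
  assumes "f \<in> borel_measurable (seeds L)"
  shows "(\<integral>\<^sup>+s. f s \<partial>seeds L) =
    (\<Sum>p\<in>perms L. ennreal (1 / card (perms L)) * (\<integral>\<^sup>+\<alpha>. (\<integral>\<^sup>+\<beta>. (\<integral>\<^sup>+\<omega>. f (p, \<alpha>, \<beta>, \<omega>) \<partial>coins) \<partial>U01) \<partial>U01))"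
proof -
  have "(\<integral>\<^sup>+s. f s \<partial>seeds L) = (\<integral>\<^sup>+p. (\<integral>\<^sup>+r. f (p, r) \<partial>thresholds) \<partial>uniform_count_measure (perms L))"
    using thr.P.nn_integral_fst[of f "uniform_count_measure (perms L)"] assms by (simp add: seeds_def)
  also have "\<dots> = (\<Sum>p\<in>perms L. ennreal (1 / card (perms L)) * (\<integral>\<^sup>+r. f (p, r) \<partial>thresholds))"
    unfolding uniform_count_measure_def by (rule nn_integral_point_measure_finite) simp
  also have "\<dots> = (\<Sum>p\<in>perms L. ennreal (1 / card (perms L)) * (\<integral>\<^sup>+\<alpha>. (\<integral>\<^sup>+\<beta>. (\<integral>\<^sup>+\<omega>. f (p, \<alpha>, \<beta>, \<omega>) \<partial>coins) \<partial>U01) \<partial>U01))"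
  proof (intro sum.cong refl arg_cong[where f = "\<lambda>t. ennreal (1 / card (perms L)) * t"])
    fix p assume p: "p \<in> perms L"
    have "(\<lambda>r. (p, r)) \<in> measurable thresholds (seeds L)"
      unfolding seeds_def using p by (intro measurable_Pair1') (simp add: space_uniform_count_measure)
    from measurable_compose[OF this assms] have 1: "(\<lambda>r. f (p, r)) \<in> borel_measurable thresholds" .
    have 2: "(\<lambda>r. f (p, \<alpha>, r)) \<in> borel_measurable (U01 \<Otimes>\<^sub>M coins)" if "\<alpha> \<in> space U01" for \<alpha>
      using measurable_compose[OF measurable_Pair1'[OF that] 1] by simp
    have "(\<integral>\<^sup>+r. f (p, r) \<partial>thresholds) = (\<integral>\<^sup>+\<alpha>. (\<integral>\<^sup>+r. f (p, \<alpha>, r) \<partial>(U01 \<Otimes>\<^sub>M coins)) \<partial>U01)"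
      using U01_coins.P.nn_integral_fst[OF 1] by simp
    also have "\<dots> = (\<integral>\<^sup>+\<alpha>. (\<integral>\<^sup>+\<beta>. (\<integral>\<^sup>+\<omega>. f (p, \<alpha>, \<beta>, \<omega>) \<partial>coins) \<partial>U01) \<partial>U01)"
      using coins.nn_integral_fst[OF 2] by (intro nn_integral_cong) simp
    finally show "(\<integral>\<^sup>+r. f (p, r) \<partial>thresholds) = (\<integral>\<^sup>+\<alpha>. (\<integral>\<^sup>+\<beta>. (\<integral>\<^sup>+\<omega>. f (p, \<alpha>, \<beta>, \<omega>) \<partial>coins) \<partial>U01) \<partial>U01)" .
  qed
  finally show ?thesis .
qed

lemma run_marginal:
  assumes n: "n < 2 ^ L" and x: "\<And>i. i \<in> {1..n} \<Longrightarrow> 0 \<le> x i" "\<And>i. i \<in> {1..n} \<Longrightarrow> x i \<le> 1" and i: "i \<in> {1..n}"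
  shows "measure (seeds L) {s \<in> space (seeds L). i \<in> run L n s x} = x i"
proof -
  interpret prob_space "seeds L" by (rule prob_space_seeds)
  let ?E = "{s \<in> space (seeds L). i \<in> run L n s x}"
  have m: "?E \<in> sets (seeds L)" using run_measurable[OF n x] by simp
  have "emeasure (seeds L) ?E = (\<integral>\<^sup>+s. indicator ?E s \<partial>seeds L)" using m by simp
  also have "\<dots> = (\<Sum>p\<in>perms L. ennreal (1 / card (perms L)) * (\<integral>\<^sup>+\<alpha>. (\<integral>\<^sup>+\<beta>. (\<integral>\<^sup>+\<omega>. indicator ?E (p, \<alpha>, \<beta>, \<omega>) \<partial>coins) \<partial>U01) \<partial>U01))"
    using m by (intro nn_integral_seeds) simp
  also have "\<dots> = (\<Sum>p\<in>perms L. ennreal (1 / card (perms L)) * ennreal (x i))"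
  proof (intro sum.cong refl arg_cong[where f = "\<lambda>t. ennreal (1 / card (perms L)) * t"])
    fix p assume pp: "p \<in> perms L"
    interpret placement L n p using n pp by unfold_locales (auto simp: perms_def)
    have "(\<integral>\<^sup>+\<omega>. indicator ?E (p, \<alpha>, \<beta>, \<omega>) \<partial>coins) = ennreal (x i)"
      if ab: "\<alpha> \<in> space U01" "\<beta> \<in> space U01" for \<alpha> \<beta>
    proof -
      let ?F = "{\<omega> \<in> space coins. i \<in> algo L n p (1 / 2 + \<alpha> / 4) (7 / 8 + \<beta> / 8) \<omega> x}"
      have "(\<integral>\<^sup>+\<omega>. indicator ?E (p, \<alpha>, \<beta>, \<omega>) \<partial>coins) = (\<integral>\<^sup>+\<omega>. indicator ?F \<omega> \<partial>coins)"
        using pp ab by (intro nn_integral_cong) (auto simp: indicator_def run_def space_seeds)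
      also have "\<dots> = emeasure coins ?F"
      proof (rule nn_integral_indicator)
        have "?F = {\<omega> \<in> space coins. leaf L p (1 / 2 + \<alpha> / 4 \<le> x i) i \<in> sample M (7 / 8 + \<beta> / 8) (spread L n p (1 / 2 + \<alpha> / 4) x) \<omega>}"
          using algo_mem[OF seed_tree(2)[where x = x, OF _ n x] i] pp ab by (auto simp: space_seeds)
        then show "?F \<in> sets coins" using coins_measurable_sel(3) by simp
      qed
      also have "\<dots> = ennreal (x i)"
        using algo_marginal[where \<theta> = "7 / 8 + \<beta> / 8" and x = x, OF x _ i] ab by (simp add: coins.emeasure_eq_measure)
      finally show ?thesis .
    qed
    then have "(\<integral>\<^sup>+\<alpha>. (\<integral>\<^sup>+\<beta>. (\<integral>\<^sup>+\<omega>. indicator ?E (p, \<alpha>, \<beta>, \<omega>) \<partial>coins) \<partial>U01) \<partial>U01) =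
        (\<integral>\<^sup>+\<alpha>. (\<integral>\<^sup>+\<beta>. ennreal (x i) \<partial>U01) \<partial>U01)"
      by (intro nn_integral_cong) simp
    then show "(\<integral>\<^sup>+\<alpha>. (\<integral>\<^sup>+\<beta>. (\<integral>\<^sup>+\<omega>. indicator ?E (p, \<alpha>, \<beta>, \<omega>) \<partial>coins) \<partial>U01) \<partial>U01) = ennreal (x i)"
      by (simp only: nn_integral_const U01.emeasure_space_1 mult_1_right)
  qed
  also have "\<dots> = ennreal (x i)"
    using perms_nonempty[of L] x(1)[OF i]
    by (simp add: ennreal_of_nat_eq_real_of_nat ennreal_mult[symmetric])
  finally show ?thesis using x(1)[OF i] by (simp add: measure_def)
qed

text \<open>The 9 stems from the average over \<tau>, \<open>3 + 20 * _\<close> from moving a leaf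
  while \<tau> is fixed, and \<open>log 2 k + 18\<close> bounds the mean number of counted
  levels.\<close>

definition stretch :: "nat \<Rightarrow> real" where
  "stretch k = 9 * (3 + 20 * (log 2 k + 18))"

text \<open>\<tau> is uniform on a range of length 1/4, so it is passed with probability at most
  \<open>4 * (b - a)\<close>, and \<open>1 + 2 * 4 = 9\<close>.\<close>

lemma threshold_integral:
  fixes a b c :: real
  assumes "a \<le> b" "0 \<le> c"
  shows "(\<integral>\<^sup>+\<alpha>. ennreal (c * ((b - a) + 2 * of_bool (a < 1 / 2 + \<alpha> / 4 \<and> 1 / 2 + \<alpha> / 4 \<le> b))) \<partial>U01) \<le> ennreal (9 * c * (b - a))"
proof -
  let ?I = "{\<alpha> \<in> space U01. 4 * a - 2 < \<alpha> \<and> \<alpha> \<le> 4 * b - 2}"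
  have Im: "?I \<in> sets U01"
    by (intro sets.sets_Collect_conj borel_measurable_less borel_measurable_le borel_measurable_const U01_in_borel)
  have ii: "integrable U01 (indicat_real ?I)"
    using Im by (intro integrable_real_indicator) (auto simp: U01.emeasure_eq_measure)
  have "(\<integral>\<^sup>+\<alpha>. ennreal (c * ((b - a) + 2 * of_bool (a < 1 / 2 + \<alpha> / 4 \<and> 1 / 2 + \<alpha> / 4 \<le> b))) \<partial>U01) =
      (\<integral>\<^sup>+\<alpha>. ennreal (c * (b - a) + (2 * c) * indicator ?I \<alpha>) \<partial>U01)"
    by (intro nn_integral_cong arg_cong[where f = ennreal]) (auto simp: indicator_def algebra_simps)
  also have "\<dots> = ennreal (\<integral>\<alpha>. c * (b - a) + (2 * c) * indicator ?I \<alpha> \<partial>U01)"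
    using assms ii by (intro nn_integral_eq_integral Bochner_Integration.integrable_add integrable_mult_right AE_I2) auto
  finally have 1: "(\<integral>\<^sup>+\<alpha>. ennreal (c * ((b - a) + 2 * of_bool (a < 1 / 2 + \<alpha> / 4 \<and> 1 / 2 + \<alpha> / 4 \<le> b))) \<partial>U01) =
    ennreal (\<integral>\<alpha>. c * (b - a) + (2 * c) * indicator ?I \<alpha> \<partial>U01)" .
  have "?I \<inter> space U01 = ?I" by auto
  then have "(\<integral>\<alpha>. indicat_real ?I \<alpha> \<partial>U01) = measure U01 ?I" by (simp only: Bochner_Integration.integral_indicator)
  then have "(\<integral>\<alpha>. c * (b - a) + (2 * c) * indicator ?I \<alpha> \<partial>U01) = c * (b - a) + 2 * c * measure U01 ?I"
    using ii U01.prob_space by (subst Bochner_Integration.integral_add) auto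
  also have "\<dots> \<le> c * (b - a) + 2 * c * (4 * (b - a))"
    using assms U01_interval[of "4 * a - 2" "4 * b - 2"] by (intro add_left_mono mult_left_mono) auto
  also have "\<dots> = 9 * c * (b - a)" by (simp add: algebra_simps)
  finally show ?thesis unfolding 1 by (rule ennreal_leI)
qed

text \<open>Collects the averages over \<theta> (\<open>dist_nn\<close>), \<tau>
  (\<open>threshold_integral\<close>) and the placement (\<open>average_counted\<close>). The
  counted levels are determined by the permutation and the other coordinates, so the averages can be
  taken one after the other.\<close>

lemma run_coordinate:
  fixes x :: "nat \<Rightarrow> real" and k :: nat
  assumes n: "n < 2 ^ L" and k: "1 \<le> k" and i: "i \<in> {1..n}"
    and x: "\<And>i. i \<in> {1..n} \<Longrightarrow> 0 \<le> x i" "\<And>i. i \<in> {1..n} \<Longrightarrow> x i \<le> 1"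
    and sum: "sum x ({1..n} - {i}) \<le> real k"
    and ab: "0 \<le> a" "a \<le> b" "b \<le> 1"
  shows "(\<integral>s. sd (run L n s (x(i := a))) (run L n s (x(i := b))) \<partial>seeds L) \<le> stretch k * (b - a)"
proof -
  let ?C = "\<lambda>p. 3 + 20 * real (card (placement.counted L n p x i))"
  have xa: "0 \<le> (x(i := a)) j" "(x(i := a)) j \<le> 1" and xb: "0 \<le> (x(i := b)) j" "(x(i := b)) j \<le> 1"
    if "j \<in> {1..n}" for j using x[OF that] ab by auto
  note ms = run_sd_measurable[where x = "x(i := a)" and y = "x(i := b)", OF n xa xb]
  let ?P = "real (card (perms L))"
  have "(\<integral>\<^sup>+s. ennreal (sd (run L n s (x(i := a))) (run L n s (x(i := b)))) \<partial>seeds L) =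
    (\<Sum>p\<in>perms L. ennreal (1 / ?P) * (\<integral>\<^sup>+\<alpha>. (\<integral>\<^sup>+\<beta>. (\<integral>\<^sup>+\<omega>.
      ennreal (sd (run L n (p, \<alpha>, \<beta>, \<omega>) (x(i := a))) (run L n (p, \<alpha>, \<beta>, \<omega>) (x(i := b)))) \<partial>coins) \<partial>U01) \<partial>U01))"
    using ms(1) by (intro nn_integral_seeds) simp
  also have "\<dots> \<le> (\<Sum>p\<in>perms L. ennreal (1 / ?P) * ennreal (9 * ?C p * (b - a)))"
  proof (intro sum_mono mult_left_mono)
    fix p assume pp: "p \<in> perms L"
    interpret placement L n p using n pp by unfold_locales (auto simp: perms_def)
    have "(\<integral>\<^sup>+\<alpha>. (\<integral>\<^sup>+\<beta>. (\<integral>\<^sup>+\<omega>.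
      ennreal (sd (run L n (p, \<alpha>, \<beta>, \<omega>) (x(i := a))) (run L n (p, \<alpha>, \<beta>, \<omega>) (x(i := b)))) \<partial>coins) \<partial>U01) \<partial>U01)
      \<le> (\<integral>\<^sup>+\<alpha>. ennreal (?C p * ((b - a) + 2 * of_bool (a < 1 / 2 + \<alpha> / 4 \<and> 1 / 2 + \<alpha> / 4 \<le> b))) \<partial>U01)"
    proof (rule nn_integral_mono)
      fix \<alpha> assume \<alpha>: "\<alpha> \<in> space U01"
      let ?t = "1 / 2 + \<alpha> / 4"
      have "(\<integral>\<^sup>+\<beta>. (\<integral>\<^sup>+\<omega>. ennreal (sd (run L n (p, \<alpha>, \<beta>, \<omega>) (x(i := a))) (run L n (p, \<alpha>, \<beta>, \<omega>) (x(i := b)))) \<partial>coins) \<partial>U01)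
        \<le> dist_nn (spread L n p ?t (x(i := a))) (spread L n p ?t (x(i := b)))"
        unfolding dist_nn_def
      proof (intro nn_integral_mono ennreal_leI)
        fix \<beta> \<omega> assume \<beta>: "\<beta> \<in> space U01" and \<omega>: "\<omega> \<in> space coins"
        have "finite (sample M (7 / 8 + \<beta> / 8) (spread L n p ?t z) \<omega>)"
          if z: "\<And>j. j \<in> {1..n} \<Longrightarrow> 0 \<le> z j" "\<And>j. j \<in> {1..n} \<Longrightarrow> z j \<le> 1" for z
        proof -
          have "sample M (7 / 8 + \<beta> / 8) (spread L n p ?t z) \<omega> \<subseteq> leaves M 1"
            using \<beta> by (intro sample_sub \<omega> spread_range z) auto
          then show ?thesis using finite_subset finite_leaves by blast
        qed
        then show "sd (run L n (p, \<alpha>, \<beta>, \<omega>) (x(i := a))) (run L n (p, \<alpha>, \<beta>, \<omega>) (x(i := b))) \<le>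
          sd (sample M (7 / 8 + \<beta> / 8) (spread L n p ?t (x(i := a))) \<omega>) (sample M (7 / 8 + \<beta> / 8) (spread L n p ?t (x(i := b))) \<omega>)"
          using xa xb unfolding run_def algo_def by (simp, intro sd_image) simp_all
      qed
      also have "\<dots> \<le> ennreal (?C p * ((b - a) + 2 * of_bool (a < ?t \<and> ?t \<le> b)))"
        using \<alpha> by (intro dist_nn_coordinate x i ab) auto
      finally show "(\<integral>\<^sup>+\<beta>. (\<integral>\<^sup>+\<omega>. ennreal (sd (run L n (p, \<alpha>, \<beta>, \<omega>) (x(i := a))) (run L n (p, \<alpha>, \<beta>, \<omega>) (x(i := b)))) \<partial>coins) \<partial>U01)
        \<le> ennreal (?C p * ((b - a) + 2 * of_bool (a < ?t \<and> ?t \<le> b)))" .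
    qed
    also have "\<dots> \<le> ennreal (9 * ?C p * (b - a))"
      using ab by (intro threshold_integral) auto
    finally show "(\<integral>\<^sup>+\<alpha>. (\<integral>\<^sup>+\<beta>. (\<integral>\<^sup>+\<omega>.
      ennreal (sd (run L n (p, \<alpha>, \<beta>, \<omega>) (x(i := a))) (run L n (p, \<alpha>, \<beta>, \<omega>) (x(i := b)))) \<partial>coins) \<partial>U01) \<partial>U01)
      \<le> ennreal (9 * ?C p * (b - a))" .
  qed simp
  also have "\<dots> = ennreal (\<Sum>p\<in>perms L. 1 / ?P * (9 * ?C p * (b - a)))"
    using ab by (subst sum_ennreal[symmetric]) (auto simp: ennreal_mult[symmetric] intro!: sum.cong)
  also have "(\<Sum>p\<in>perms L. 1 / ?P * (9 * ?C p * (b - a))) = 9 * (b - a) / ?P * (\<Sum>p\<in>perms L. ?C p)"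
  proof -
    have "1 / P * (9 * C * d) = 9 * d / P * C" for P C d :: real by (simp add: mult_ac)
    then show ?thesis unfolding sum_distrib_left by (intro sum.cong refl)
  qed
  also have "(\<Sum>p\<in>perms L. ?C p) = 3 * ?P + 20 * (\<Sum>p\<in>perms L. real (card (placement.counted L n p x i)))"
    by (simp add: sum.distrib sum_distrib_left)
  finally have le: "(\<integral>\<^sup>+s. ennreal (sd (run L n s (x(i := a))) (run L n s (x(i := b)))) \<partial>seeds L) \<le>
    ennreal (9 * (b - a) / ?P * (3 * ?P + 20 * (\<Sum>p\<in>perms L. real (card (placement.counted L n p x i)))))" .
  have "9 * (b - a) / ?P * (3 * ?P + 20 * (\<Sum>p\<in>perms L. real (card (placement.counted L n p x i)))) \<le>
      9 * (b - a) / ?P * (3 * ?P + 20 * (?P * (log 2 k + 18)))"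
    using average_counted[OF n i x(1) sum k] ab by (intro mult_left_mono add_left_mono) auto
  also have "\<dots> = stretch k * (b - a)"
  proof -
    have "9 * d / P * (3 * P + 20 * (P * c)) = 9 * (3 + 20 * c) * d" if "0 < P" for P c d :: real
      using that by (simp add: field_simps)
    from this[of ?P] show ?thesis using perms_nonempty(2)[of L] unfolding stretch_def of_nat_0_less_iff by blast
  qed
  finally have "ennreal (\<integral>s. sd (run L n s (x(i := a))) (run L n s (x(i := b))) \<partial>seeds L) \<le> ennreal (stretch k * (b - a))"
    using nn_integral_eq_integral[OF ms(2)] le by (simp add: order_trans[OF _ ennreal_leI])
  moreover have "0 \<le> stretch k * (b - a)" using k ab by (simp add: stretch_def)
  ultimately show ?thesis by (simp add: ennreal_le_iff)
qed

text \<open>Coordinates are lowered one at a time. Masses only decrease, so the bound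
  \<open>k\<close> on the remaining coordinates is available at every stage.\<close>

lemma run_lower:
  fixes x w :: "nat \<Rightarrow> real" and k :: nat
  assumes n: "n < 2 ^ L" and k: "1 \<le> k"
    and x: "\<And>i. i \<in> {1..n} \<Longrightarrow> x i \<le> 1" and w: "\<And>i. i \<in> {1..n} \<Longrightarrow> 0 \<le> w i" "\<And>i. i \<in> {1..n} \<Longrightarrow> w i \<le> x i"
    and sum: "sum x {1..n} \<le> real k" and m: "m \<le> n"
  defines "z \<equiv> \<lambda>m i. if i \<in> {1..m} then w i else x i"
  shows "(\<integral>s. sd (run L n s x) (run L n s (z m)) \<partial>seeds L) \<le> stretch k * (\<Sum>i=1..m. x i - w i)"
  using m
proof (induction m)
  case 0
  have "z 0 = x" by (auto simp: z_def)
  then show ?case by simp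
next
  case (Suc m)
  let ?i = "Suc m"
  have i: "?i \<in> {1..n}" using Suc.prems by simp
  have x0: "0 \<le> x i" if "i \<in> {1..n}" for i using w[OF that] by simp
  have zr: "0 \<le> z m i" "z m i \<le> 1" if "i \<in> {1..n}" for m i using w[OF that] x[OF that] by (auto simp: z_def)
  have z: "z m = (z m)(?i := x ?i)" "z (Suc m) = (z m)(?i := w ?i)" by (auto simp: z_def)
  note int = run_sd_measurable(2)[OF n]
  have "(\<integral>s. sd (run L n s x) (run L n s (z (Suc m))) \<partial>seeds L) \<le>
      (\<integral>s. sd (run L n s x) (run L n s (z m)) + sd (run L n s (z m)) (run L n s (z (Suc m))) \<partial>seeds L)"
  proof (intro integral_mono Bochner_Integration.integrable_add int x0 x zr sd_triangle)
    fix s assume s: "s \<in> space (seeds L)"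
    have fin: "finite (run L n s y)" if "\<And>i. i \<in> {1..n} \<Longrightarrow> 0 \<le> y i" "\<And>i. i \<in> {1..n} \<Longrightarrow> y i \<le> 1" for y
      using finite_subset[OF run_props(1)[OF s n that]] by simp
    show "finite (run L n s x)" "finite (run L n s (z m))" "finite (run L n s (z (Suc m)))"
      by (intro fin x0 x zr; assumption)+
  qed
  also have "\<dots> = (\<integral>s. sd (run L n s x) (run L n s (z m)) \<partial>seeds L) + (\<integral>s. sd (run L n s (z m)) (run L n s (z (Suc m))) \<partial>seeds L)"
    by (intro Bochner_Integration.integral_add int x0 x zr)
  also have "(\<integral>s. sd (run L n s x) (run L n s (z m)) \<partial>seeds L) \<le> stretch k * (\<Sum>i=1..m. x i - w i)"
    using Suc by simp
  also have "(\<integral>s. sd (run L n s (z m)) (run L n s (z (Suc m))) \<partial>seeds L) =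
      (\<integral>s. sd (run L n s ((z m)(?i := w ?i))) (run L n s ((z m)(?i := x ?i))) \<partial>seeds L)"
    unfolding z(2) using z(1) by (simp add: sd_commute)
  also have "\<dots> \<le> stretch k * (x ?i - w ?i)"
  proof (rule run_coordinate[OF n k i zr])
    have "sum (z m) ({1..n} - {?i}) \<le> sum x ({1..n} - {?i})" using w by (intro sum_mono) (auto simp: z_def)
    also have "\<dots> \<le> sum x {1..n}" using x0 by (intro sum_mono2) auto
    finally show "sum (z m) ({1..n} - {?i}) \<le> real k" using sum by simp
  qed (use w[OF i] x[OF i] in auto)
  finally show ?case by (simp add: algebra_simps)
qed

text \<open>The route through the coordinatewise minimum keeps every intermediate vector below
  \<open>x\<close> or below \<open>y\<close>, hence of norm at most \<open>k\<close>; exchanging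
  coordinates of \<open>x\<close> for those of \<open>y\<close> directly could exceed it. The two
  legs together are exactly as long as the distance.\<close>

lemma run_stretch:
  fixes x y :: "nat \<Rightarrow> real" and k :: nat
  assumes n: "n < 2 ^ L" and k: "1 \<le> k" and xy: "x \<in> Delta n k" "y \<in> Delta n k"
  shows "(\<integral>s. sd (run L n s x) (run L n s y) \<partial>seeds L) \<le> stretch k * l1_norm n (\<lambda>i. x i - y i)"
proof -
  define w where "w = (\<lambda>i. min (x i) (y i))"
  have r: "0 \<le> z i" "z i \<le> 1" if "z \<in> Delta n k" "i \<in> {1..n}" for z i
    using that by (auto simp: Delta_def PiE_iff)
  have s: "sum z {1..n} \<le> real k" if "z \<in> Delta n k" for z
  proof -
    have "sum z {1..n} = l1_norm n z" unfolding l1_norm_def using r(1)[OF that] by (intro sum.cong) auto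
    then show ?thesis using that by (simp add: Delta_def)
  qed
  have u: "x i = y i" if "i \<notin> {1..n}" for i
    using xy that by (auto simp: Delta_def PiE_iff extensional_def)
  have w: "0 \<le> w i" "w i \<le> x i" "w i \<le> y i" "w i \<le> 1" if "i \<in> {1..n}" for i
    using r[OF xy(1) that] r[OF xy(2) that] by (auto simp: w_def)
  have z: "(\<lambda>i. if i \<in> {1..n} then w i else x i) = w" "(\<lambda>i. if i \<in> {1..n} then w i else y i) = w"
    using u by (auto simp: w_def)
  have 1: "(\<integral>s. sd (run L n s x) (run L n s w) \<partial>seeds L) \<le> stretch k * (\<Sum>i=1..n. x i - w i)"
    using run_lower[where x = x and w = w and m = n, OF n k r(2)[OF xy(1)] w(1,2) s[OF xy(1)]] unfolding z by simp
  have 2: "(\<integral>s. sd (run L n s y) (run L n s w) \<partial>seeds L) \<le> stretch k * (\<Sum>i=1..n. y i - w i)"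
    using run_lower[where x = y and w = w and m = n, OF n k r(2)[OF xy(2)] w(1,3) s[OF xy(2)]] unfolding z by simp
  note int = run_sd_measurable(2)[OF n]
  have "(\<integral>s. sd (run L n s x) (run L n s y) \<partial>seeds L) \<le>
      (\<integral>s. sd (run L n s x) (run L n s w) + sd (run L n s w) (run L n s y) \<partial>seeds L)"
  proof (intro integral_mono Bochner_Integration.integrable_add int r[OF xy(1)] r[OF xy(2)] w sd_triangle)
    fix s' assume s': "s' \<in> space (seeds L)"
    have fin: "finite (run L n s' y)" if "\<And>i. i \<in> {1..n} \<Longrightarrow> 0 \<le> y i" "\<And>i. i \<in> {1..n} \<Longrightarrow> y i \<le> 1" for y
      using finite_subset[OF run_props(1)[OF s' n that]] by simp
    show "finite (run L n s' x)" "finite (run L n s' w)" "finite (run L n s' y)"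
      by (intro fin r[OF xy(1)] r[OF xy(2)] w; assumption)+
  qed
  also have "\<dots> = (\<integral>s. sd (run L n s x) (run L n s w) \<partial>seeds L) + (\<integral>s. sd (run L n s w) (run L n s y) \<partial>seeds L)"
    by (intro Bochner_Integration.integral_add int r[OF xy(1)] r[OF xy(2)] w)
  also have "(\<integral>s. sd (run L n s w) (run L n s y) \<partial>seeds L) = (\<integral>s. sd (run L n s y) (run L n s w) \<partial>seeds L)"
    by (simp only: sd_commute)
  also have "(\<integral>s. sd (run L n s x) (run L n s w) \<partial>seeds L) + (\<integral>s. sd (run L n s y) (run L n s w) \<partial>seeds L) \<le>
      stretch k * ((\<Sum>i=1..n. x i - w i) + (\<Sum>i=1..n. y i - w i))"
    using 1 2 by (simp add: distrib_left)
  also have "(\<Sum>i=1..n. x i - w i) + (\<Sum>i=1..n. y i - w i) = l1_norm n (\<lambda>i. x i - y i)"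
    unfolding l1_norm_def sum.distrib[symmetric] by (intro sum.cong) (auto simp: w_def)
  finally show ?thesis .
qed

section \<open>Transfer from seeds to a distribution over maps\<close>

definition sampler :: "nat \<Rightarrow> nat \<Rightarrow> nat \<Rightarrow> (nat \<Rightarrow> nat) \<times> real \<times> real \<times> (nat \<Rightarrow> real) \<Rightarrow> (nat \<Rightarrow> real) \<Rightarrow> nat set" where
  "sampler L n k s = restrict (run L n s) (Delta n k)"

text \<open>The \<sigma>-algebra is generated by the sets of maps whose preimage is measurable, so
  that measurability is inherited from the seeds. The space is the exact image, so a property of all
  seeds is one of the whole support.\<close>

definition sampler_dist :: "nat \<Rightarrow> nat \<Rightarrow> nat \<Rightarrow> ((nat \<Rightarrow> real) \<Rightarrow> nat set) measure" where
  "sampler_dist L n k = distr (seeds L) (sigma (sampler L n k ` space (seeds L))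
     {S. S \<subseteq> sampler L n k ` space (seeds L) \<and> sampler L n k -` S \<inter> space (seeds L) \<in> sets (seeds L)}) (sampler L n k)"

lemma space_sampler_dist: "space (sampler_dist L n k) = sampler L n k ` space (seeds L)"
  unfolding sampler_dist_def space_distr by (rule space_measure_of) auto

lemma sampler_measurable:
  "sampler L n k \<in> measurable (seeds L) (sigma (sampler L n k ` space (seeds L))
     {S. S \<subseteq> sampler L n k ` space (seeds L) \<and> sampler L n k -` S \<inter> space (seeds L) \<in> sets (seeds L)})"
  by (rule measurable_measure_of) auto

lemma sampler_event:
  assumes n: "n < 2 ^ L" and x: "x \<in> Delta n k"
  shows "{A \<in> space (sampler_dist L n k). i \<in> A x} \<in> sets (sampler_dist L n k)"
    and "sampler L n k -` {A \<in> space (sampler_dist L n k). i \<in> A x} \<inter> space (seeds L) = {s \<in> space (seeds L). i \<in> run L n s x}"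
proof -
  have r: "0 \<le> x i" "x i \<le> 1" if "i \<in> {1..n}" for i using x that by (auto simp: Delta_def PiE_iff)
  show e: "sampler L n k -` {A \<in> space (sampler_dist L n k). i \<in> A x} \<inter> space (seeds L) = {s \<in> space (seeds L). i \<in> run L n s x}"
    using x by (auto simp: space_sampler_dist sampler_def)
  have "{s \<in> space (seeds L). i \<in> run L n s x} \<in> sets (seeds L)" using run_measurable[OF n r] by simp
  then have "{A \<in> space (sampler_dist L n k). i \<in> A x} \<in> {S. S \<subseteq> sampler L n k ` space (seeds L) \<and> sampler L n k -` S \<inter> space (seeds L) \<in> sets (seeds L)}"
    using e by (auto simp: space_sampler_dist)
  then show "{A \<in> space (sampler_dist L n k). i \<in> A x} \<in> sets (sampler_dist L n k)"
    unfolding sampler_dist_def sets_distr by (subst sets_measure_of) (auto intro!: sigma_sets.Basic)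
qed

lemma sampler_correlated:
  assumes n: "n < 2 ^ L"
  shows "correlated_sampling_algorithm n k (sampler_dist L n k)"
  unfolding correlated_sampling_algorithm_def
proof (intro conjI ballI)
  interpret prob_space "seeds L" by (rule prob_space_seeds)
  show "prob_space (sampler_dist L n k)"
    unfolding sampler_dist_def by (rule prob_space_distr[OF sampler_measurable])
  show "space (sampler_dist L n k) \<subseteq> Delta n k \<rightarrow>\<^sub>E Pow {1..n}"
  proof
    fix A assume "A \<in> space (sampler_dist L n k)"
    then obtain s where s: "s \<in> space (seeds L)" "A = sampler L n k s" by (auto simp: space_sampler_dist)
    have "run L n s x \<subseteq> {1..n}" if "x \<in> Delta n k" for x
      using that by (intro run_props(1)[OF s(1) n]) (auto simp: Delta_def PiE_iff)
    then show "A \<in> Delta n k \<rightarrow>\<^sub>E Pow {1..n}" by (auto simp: s sampler_def)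
  qed
  show "{A \<in> space (sampler_dist L n k). i \<in> A x} \<in> sets (sampler_dist L n k)" if "x \<in> Delta n k" for x i
    using sampler_event(1)[OF n that] .
qed

lemma sampler_stretch:
  assumes n: "n < 2 ^ L" and k: "1 \<le> k"
  shows "has_stretch n k (sampler_dist L n k) (stretch k)"
  unfolding has_stretch_def
proof (intro ballI conjI)
  interpret prob_space "seeds L" by (rule prob_space_seeds)
  fix x y assume xy: "x \<in> Delta n k" "y \<in> Delta n k"
  have r: "0 \<le> z i" "z i \<le> 1" if "z \<in> Delta n k" "i \<in> {1..n}" for z i
    using that by (auto simp: Delta_def PiE_iff)
  show "int (card (A x)) \<in> {\<lfloor>l1_norm n x\<rfloor>, \<lceil>l1_norm n x\<rceil>}" if "A \<in> space (sampler_dist L n k)" for A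
  proof -
    from that obtain s where s: "s \<in> space (seeds L)" "A = sampler L n k s" unfolding space_sampler_dist by blast
    have "sum x {1..n} = l1_norm n x" unfolding l1_norm_def using r(1)[OF xy(1)] by (intro sum.cong) auto
    then show ?thesis using run_props(2)[where x = x, OF s(1) n r[OF xy(1)]] xy by (simp add: s sampler_def)
  qed
  show "measure (sampler_dist L n k) {A \<in> space (sampler_dist L n k). i \<in> A x} = x i" if i: "i \<in> {1..n}" for i
  proof -
    have "measure (sampler_dist L n k) {A \<in> space (sampler_dist L n k). i \<in> A x} =
        measure (seeds L) (sampler L n k -` {A \<in> space (sampler_dist L n k). i \<in> A x} \<inter> space (seeds L))"
      using sampler_event(1)[OF n xy(1), of i] unfolding sampler_dist_def
      by (intro measure_distr[OF sampler_measurable]) simp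
    then show ?thesis unfolding sampler_event(2)[OF n xy(1)] using run_marginal[OF n r[OF xy(1)] i] by simp
  qed
  have sdm: "(\<lambda>A. sd (A x) (A y)) \<in> borel_measurable (sampler_dist L n k)"
  proof (rule sd_measurable[of "{1..n}"])
    show "A x \<subseteq> {1..n}" "A y \<subseteq> {1..n}" if "A \<in> space (sampler_dist L n k)" for A
      using that sampler_correlated[OF n, of k] xy by (auto simp: correlated_sampling_algorithm_def PiE_iff subset_iff)
    show "Measurable.pred (sampler_dist L n k) (\<lambda>A. i \<in> A x)" "Measurable.pred (sampler_dist L n k) (\<lambda>A. i \<in> A y)" for i
      using sampler_event(1)[OF n xy(1), of i] sampler_event(1)[OF n xy(2), of i] by (auto simp: pred_def)
  qed simp
  have "(\<integral>A. real (card (sym_diff (A x) (A y))) \<partial>sampler_dist L n k) = (\<integral>A. sd (A x) (A y) \<partial>sampler_dist L n k)"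
    by (simp add: sd_def)
  also have "\<dots> = (\<integral>s. sd (sampler L n k s x) (sampler L n k s y) \<partial>seeds L)"
    using sdm unfolding sampler_dist_def by (intro integral_distr[OF sampler_measurable]) simp
  also have "\<dots> = (\<integral>s. sd (run L n s x) (run L n s y) \<partial>seeds L)" using xy by (simp add: sampler_def)
  also have "\<dots> \<le> stretch k * l1_norm n (\<lambda>i. x i - y i)" by (rule run_stretch[OF n k xy])
  finally show "(\<integral>A. real (card (sym_diff (A x) (A y))) \<partial>sampler_dist L n k) \<le> stretch k * l1_norm n (\<lambda>i. x i - y i)" .
qed

text \<open>The constant is the value at \<open>log 2 k = 1\<close>:
  \<open>9 * (3 + 20 * 19) = 3447\<close>.\<close>

lemma stretch_le: "1 \<le> k \<Longrightarrow> stretch k \<le> 3447 * max 1 (log 2 (real k))"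
  unfolding stretch_def by (simp add: max_def)

section \<open>The update program\<close>

definition runs :: "nat \<Rightarrow> program \<Rightarrow> nat \<Rightarrow> state \<Rightarrow> (state \<Rightarrow> bool) \<Rightarrow> bool" where
  "runs w P T s Q \<longleftrightarrow> (\<exists>t s'. exec w P s t s' \<and> t \<le> T \<and> Q s')"

lemma runs_mono: "runs w P T s Q \<Longrightarrow> T \<le> T' \<Longrightarrow> (\<And>s'. Q s' \<Longrightarrow> Q' s') \<Longrightarrow> runs w P T' s Q'"
  unfolding runs_def by (meson le_trans)

lemma runs_Seq: "runs w P T s (\<lambda>s'. runs w P' T' s' Q) \<Longrightarrow> runs w (Seq P P') (T + T') s Q"
  unfolding runs_def by (metis exec.Seq add_mono)

lemma runs_SeqI:
  assumes "runs w P T s R" "\<And>s'. R s' \<Longrightarrow> runs w P' T' s' Q"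
  shows "runs w (Seq P P') (T + T') s Q"
  by (rule runs_Seq) (rule runs_mono[OF assms(1) order_refl assms(2)])

lemma runs_Instr: "Q (step w c s) \<Longrightarrow> runs w (Instr c) 1 s Q"
  unfolding runs_def by (metis exec.Instr order_refl)

lemma runs_Cond:
  assumes "holds b s \<Longrightarrow> runs w P T s Q" "\<not> holds b s \<Longrightarrow> runs w P' T s Q"
  shows "runs w (Cond b P P') (Suc T) s Q"
  using assms exec.CondTrue exec.CondFalse unfolding runs_def
  by (cases "holds b s") (metis Suc_le_mono plus_1_eq_Suc)+

lemma runs_While_False: "\<not> holds b s \<Longrightarrow> Q s \<Longrightarrow> runs w (While b P) (Suc T) s Q"
  unfolding runs_def by (metis exec.WhileFalse Suc_le_mono zero_le One_nat_def)

lemma runs_While_True: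
  assumes "holds b s" "runs w P T s (\<lambda>s'. runs w (While b P) T' s' Q)"
  shows "runs w (While b P) (Suc (T + T')) s Q"
proof -
  obtain t s' u s'' where "exec w P s t s'" "t \<le> T" "exec w (While b P) s' u s''" "u \<le> T'" "Q s''"
    using assms(2) unfolding runs_def by blast
  moreover from this have "exec w (While b P) s (1 + t + u) s''"
    using exec.WhileTrue[OF assms(1)] by blast
  ultimately show ?thesis unfolding runs_def by (metis Suc_le_mono add_mono plus_1_eq_Suc add.assoc)
qed

primrec block :: "instr list \<Rightarrow> program" where
  "block [] = Skip"
| "block (c # cs) = Seq (Instr c) (block cs)"

lemma runs_block: "Q (fold (step w) cs s) \<Longrightarrow> runs w (block cs) (Suc (length cs)) s Q"
proof (induction cs arbitrary: s)
  case Nil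
  then show ?case unfolding runs_def using exec.Skip by fastforce
next
  case (Cons c cs)
  have "runs w (Seq (Instr c) (block cs)) (1 + Suc (length cs)) s Q"
    using Cons by (intro runs_Seq runs_Instr) simp
  then show ?case by simp
qed

text \<open>Memory layout. Words 1 to 6 and reals 1 to 5 hold constants, see \<open>machine_ok\<close> below. For a node \<open>v\<close>, word
  \<open>4 * v + 64\<close> is the label of its representative (0 if there is none), reals \<open>4 * v + 64\<close> to
  \<open>4 * v + 66\<close> are its mass, the fractional part of the mass, and its key, and real \<open>4 * v + 67\<close> is its coin, for
  a leaf already in the form \<open>- 1 / ln u\<close>. Word \<open>4 * i + 65\<close> is the light leaf of coordinate \<open>i\<close>. The
  addresses from 10 to 63 are scratch space; word 10 is the current node.\<close>

definition load_children :: program where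
  "load_children = block
    [WArith 11 Divide 10 2, WArith 15 Times 3 11, WArith 14 Plus 15 4, WArith 12 Plus 14 15, WArith 13 Plus 12 3,
     RLoad 20 12, RLoad 21 13, WLoad 16 12, WLoad 17 13,
     WArith 12 Plus 12 1, WArith 13 Plus 13 1, RLoad 22 12, RLoad 23 13,
     WArith 12 Plus 12 1, WArith 13 Plus 13 1, RLoad 24 12, RLoad 25 13,
     WArith 15 Plus 14 3, WArith 15 Minus 15 1, RLoad 26 15,
     RArith 27 RPlus 20 21, RArith 28 RPlus 22 23]"

definition keep_left :: program where
  "keep_left = block [WArith 18 Plus 16 6, WArith 19 Plus 17 6]"

definition keep_right :: program where
  "keep_right = block [WArith 18 Plus 17 6, WArith 19 Plus 16 6]"

text \<open>The three cases of \<open>left_first\<close>, with products in place of quotients. Word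
  18 receives the label of the surviving representative and word 19 that of the loser, whose fate is
  fixed here: inserted at a crossing, deleted otherwise. Deleting the label 0 of an empty child is
  harmless.\<close>

definition merge_children :: program where
  "merge_children = Cond (RLess 27 3)
     (Seq (Cond (RLess 25 24) keep_left keep_right) (Instr (OutDelete 19)))
     (Cond (RLess 2 28)
       (Seq (block [RArith 29 RMinus 5 22, RArith 29 RMinus 29 23, RArith 29 RTimes 26 29, RArith 30 RMinus 2 23,
           RArith 28 RMinus 28 2])
         (Seq (Cond (RLess 29 30) keep_right keep_left) (Instr (OutInsert 19))))
       (Seq (Instr (RArith 29 RTimes 26 28))
         (Seq (Cond (RLess 29 22) keep_left keep_right) (Instr (OutDelete 19)))))"

definition store_node :: program where
  "store_node = Seq (Cond (RLess 24 25) (Instr (RArith 31 RPlus 25 1)) (Instr (RArith 31 RPlus 24 1)))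
     (block [RStore 14 27, WStore 14 18, WArith 14 Plus 14 1, RStore 14 28, WArith 14 Plus 14 1, RStore 14 31,
       WArith 10 Plus 11 6])"

definition climb :: program where
  "climb = Seq load_children (Seq merge_children store_node)"

text \<open>The label stored so far is removed from the output, because the leaf becomes undecided
  or empty. Mass and fractional part coincide for a value in [0, 1], so the value is stored
  twice.\<close>

definition write_leaf :: program where
  "write_leaf = Seq (block [WArith 14 Times 3 10, WArith 14 Plus 14 4, WLoad 16 14, OutDelete 16,
       RStore 14 10, WArith 15 Plus 14 1, RStore 15 10, WArith 15 Plus 15 1, WArith 17 Plus 15 1,
       RLoad 11 17, RArith 12 RTimes 10 11, RStore 15 12])
     (Seq (Cond (RLess 1 10) (Instr (WArith 16 Plus 0 6)) (Instr (WArith 16 Plus 6 6)))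
       (Instr (WStore 14 16)))"

text \<open>Real 67 is the coin of node 0; real 69 and word 68 are the fractional part and the
  representative of node 1.\<close>

definition settle_root :: program where
  "settle_root = Cond (RLess 67 69) (Instr (OutInsert 68)) (Instr (OutDelete 68))"

definition update_leaf :: program where
  "update_leaf = Seq write_leaf (Seq (While (WLess 1 10) climb) settle_root)"

text \<open>The coordinate moves between its two leaves, so the leaf on the other side is cleared first.\<close>

definition update :: program where
  "update = Seq (block [WArith 20 Times 3 0, WArith 20 Plus 20 4, WArith 20 Plus 20 1, WLoad 21 20, WArith 22 Plus 21 5,
       RArith 32 RPlus 0 1])
     (Seq (Cond (RLess 0 4) (block [WArith 10 Plus 22 6, WArith 23 Plus 21 6]) (block [WArith 10 Plus 21 6, WArith 23 Plus 22 6]))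
     (Seq (block [RArith 10 RPlus 1 1]) (Seq update_leaf
     (Seq (block [WArith 10 Plus 23 6, RArith 10 RPlus 32 1]) update_leaf))))"

section \<open>Specifications of the program fragments\<close>

definition machine_ok :: "nat \<Rightarrow> real \<Rightarrow> real \<Rightarrow> nat \<Rightarrow> state \<Rightarrow> bool" where
  "machine_ok w \<theta> \<tau> K s \<longleftrightarrow> words s 1 = 1 \<and> words s 2 = 2 \<and> words s 3 = 4 \<and> words s 4 = 64 \<and> words s 5 = K \<and> words s 6 = 0 \<and>
    reals s 1 = 0 \<and> reals s 2 = 1 \<and> reals s 3 = \<theta> \<and> reals s 4 = \<tau> \<and> reals s 5 = 2 \<and> (\<forall>a. words s a < 2 ^ w)"

text \<open>Besides the cells below 10 these are word 23 and real 32, in which \<open>update\<close>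
  keeps the second leaf and the new value across its first call of
  \<open>update_leaf\<close>.\<close>

definition kept :: "state \<Rightarrow> state \<Rightarrow> bool" where
  "kept s s' \<longleftrightarrow> (\<forall>a \<in> {0..<10} \<union> {23}. words s' a = words s a) \<and> (\<forall>a \<in> {0..<10} \<union> {32}. reals s' a = reals s a)"

lemma machine_ok_simps:
  assumes "machine_ok w \<theta> \<tau> K s"
  shows "words s (Suc 0) = 1" "words s 2 = 2" "words s 3 = 4" "words s 4 = 64" "words s 5 = K" "words s 6 = 0"
    "reals s (Suc 0) = 0" "reals s 2 = 1" "reals s 3 = \<theta>" "reals s 4 = \<tau>" "reals s 5 = 2" "words s a < 2 ^ w"
  using assms by (auto simp: machine_ok_def)

lemma machine_ok_upd:
  assumes "machine_ok w \<theta> \<tau> K s" "\<And>a. a < 10 \<Longrightarrow> words s' a = words s a" "\<And>a. a < 10 \<Longrightarrow> reals s' a = reals s a"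
    "\<And>a. words s' a < 2 ^ w"
  shows "machine_ok w \<theta> \<tau> K s'"
  using assms by (auto simp: machine_ok_def)

text \<open>The cells of node \<open>2 * u\<close> begin at \<open>8 * u + 64\<close>, those of
  \<open>2 * u + 1\<close> at \<open>8 * u + 68\<close>; the coin of \<open>u\<close> is real
  \<open>4 * u + 67\<close>.\<close>

definition children_loaded :: "nat \<Rightarrow> state \<Rightarrow> state \<Rightarrow> bool" where
  "children_loaded u s s' \<longleftrightarrow>
    words s' 11 = u \<and> words s' 14 = 4 * u + 64 \<and>
    words s' 16 = words s (8 * u + 64) \<and> words s' 17 = words s (8 * u + 68) \<and>
    reals s' 22 = reals s (8 * u + 65) \<and> reals s' 23 = reals s (8 * u + 69) \<and>
    reals s' 24 = reals s (8 * u + 66) \<and> reals s' 25 = reals s (8 * u + 70) \<and>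
    reals s' 26 = reals s (4 * u + 67) \<and>
    reals s' 27 = reals s (8 * u + 64) + reals s (8 * u + 68) \<and>
    reals s' 28 = reals s (8 * u + 65) + reals s (8 * u + 69)"

definition high :: "state \<Rightarrow> state \<Rightarrow> bool" where
  "high s s' \<longleftrightarrow> (\<forall>a\<ge>64. words s' a = words s a) \<and> (\<forall>a\<ge>64. reals s' a = reals s a)"

text \<open>The bound on \<open>8 * u\<close> keeps every computed address below
  \<open>2 ^ w\<close>, so reduction modulo the word size has no effect on it.\<close>

lemma load_children_spec:
  assumes ok: "machine_ok w \<theta> \<tau> K s" and u: "u = words s 10 div 2" and lt: "8 * u + 100 < 2 ^ w"
  shows "runs w load_children 23 s (\<lambda>s'. machine_ok w \<theta> \<tau> K s' \<and> kept s s' \<and> high s s' \<and> outset s' = outset s \<and>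
    children_loaded u s s')"
proof -
  have ud: "words s 10 div 2 mod 2 ^ w = u" using u lt by simp
  let ?s = "s\<lparr>words := (words s)
       (11 := u, 14 := 4 * u + 64, 16 := words s (8 * u + 64),
        17 := words s (68 + 8 * u), 12 := 66 + 8 * u, 13 := 70 + 8 * u, 15 := 67 + 4 * u),
     reals := (reals s)
       (20 := reals s (8 * u + 64), 21 := reals s (68 + 8 * u), 22 := reals s (65 + 8 * u), 23 := reals s (69 + 8 * u),
        24 := reals s (66 + 8 * u), 25 := reals s (70 + 8 * u), 26 := reals s (67 + 4 * u),
        27 := reals s (8 * u + 64) + reals s (68 + 8 * u), 28 := reals s (65 + 8 * u) + reals s (69 + 8 * u))\<rparr>"
  have "machine_ok w \<theta> \<tau> K ?s"
    by (rule machine_ok_upd[OF ok]) (use lt machine_ok_simps[OF ok] in auto)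
  moreover have "kept s ?s" by (auto simp: kept_def)
  moreover have "high s ?s" by (simp add: high_def)
  moreover have "children_loaded u s ?s" by (simp add: children_loaded_def add.commute)
  ultimately have "runs w load_children (Suc 22) s (\<lambda>s'. machine_ok w \<theta> \<tau> K s' \<and> kept s s' \<and> high s s' \<and> outset s' = outset s \<and>
    children_loaded u s s')"
    unfolding load_children_def
    by (intro runs_mono[OF runs_block[where Q = "\<lambda>s'. s' = ?s"]])
      (use lt in \<open>simp_all add: machine_ok_simps[OF ok] ud\<close>)
  then show ?thesis by simp
qed

definition chosen :: "state \<Rightarrow> bool \<Rightarrow> state \<Rightarrow> bool" where
  "chosen s left s' \<longleftrightarrow> words s' 18 = (if left then words s 16 else words s 17) \<and>
    words s' 19 = (if left then words s 17 else words s 16) \<and> outset s' = outset s \<and> reals s' = reals s \<and>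
    (\<forall>a. a \<notin> {18, 19} \<longrightarrow> words s' a = words s a)"

lemma keep_spec:
  assumes ok: "machine_ok w \<theta> \<tau> K s"
  shows "runs w keep_left 3 s (chosen s True)" "runs w keep_right 3 s (chosen s False)"
proof -
  have "runs w keep_left (Suc 2) s (chosen s True)"
    unfolding keep_left_def
    by (intro runs_mono[OF runs_block[where Q = "chosen s True"]])
      (simp_all add: machine_ok_simps[OF ok] chosen_def)
  then show "runs w keep_left 3 s (chosen s True)" by simp
  have "runs w keep_right (Suc 2) s (chosen s False)"
    unfolding keep_right_def
    by (intro runs_mono[OF runs_block[where Q = "chosen s False"]])
      (simp_all add: machine_ok_simps[OF ok] chosen_def)
  then show "runs w keep_right 3 s (chosen s False)" by simp
qed

definition merged :: "state \<Rightarrow> bool \<Rightarrow> bool \<Rightarrow> state \<Rightarrow> bool" where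
  "merged s left cross s' \<longleftrightarrow>
    words s' 18 = (if left \<noteq> cross then words s 16 else words s 17) \<and>
    words s' 19 = (if left \<noteq> cross then words s 17 else words s 16) \<and>
    outset s' = (if cross then insert (if left then words s 16 else words s 17) (outset s)
      else outset s - {if left then words s 17 else words s 16}) \<and>
    reals s' 28 = (if cross then reals s 28 - 1 else reals s 28) \<and>
    (\<forall>a. a \<notin> {18, 19} \<longrightarrow> words s' a = words s a) \<and> (\<forall>a. a \<notin> {28, 29, 30} \<longrightarrow> reals s' a = reals s a)"

text \<open>At a light node the program deletes the loser without testing for a crossing, which is
  correct because light nodes do not cross.\<close>

lemma merge_children_spec:
  assumes ok: "machine_ok w \<theta> \<tau> K s"
    and light: "reals s 27 < \<theta> \<Longrightarrow> reals s 28 \<le> 1" and f: "reals s 28 = reals s 22 + reals s 23"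
  shows "runs w merge_children 20 s (merged s
    (if reals s 27 < \<theta> then reals s 25 < reals s 24
     else if 1 < reals s 28 then reals s 26 * (2 - reals s 22 - reals s 23) < 1 - reals s 23
     else reals s 26 * (reals s 22 + reals s 23) < reals s 22) (1 < reals s 28))" (is "runs _ _ _ _ (merged s ?left ?cross)")
proof -
  note simps = machine_ok_simps[OF ok]
  let ?s2 = "s\<lparr>reals := (reals s)(29 := reals s 26 * (2 - reals s 22 - reals s 23), 30 := 1 - reals s 23, 28 := reals s 28 - 1)\<rparr>"
  let ?s3 = "s\<lparr>reals := (reals s)(29 := reals s 26 * reals s 28)\<rparr>"
  have ok2: "machine_ok w \<theta> \<tau> K ?s2" and ok3: "machine_ok w \<theta> \<tau> K ?s3"
    using ok by (simp_all add: machine_ok_def)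
  have a: "runs w (Seq (Cond (RLess 25 24) keep_left keep_right) (Instr (OutDelete 19))) (Suc 3 + 1) s (merged s ?left ?cross)"
    if "holds (RLess 27 3) s"
  proof (intro runs_Seq runs_Cond)
    have t: "reals s 27 < \<theta>" "\<not> 1 < reals s 28" using that simps light by auto
    show "runs w keep_left 3 s (\<lambda>s'. runs w (Instr (OutDelete 19)) 1 s' (merged s ?left ?cross))" if "holds (RLess 25 24) s"
      using that t by (intro runs_mono[OF keep_spec(1)[OF ok]] runs_Instr) (auto simp: chosen_def merged_def)
    show "runs w keep_right 3 s (\<lambda>s'. runs w (Instr (OutDelete 19)) 1 s' (merged s ?left ?cross))" if "\<not> holds (RLess 25 24) s"
      using that t by (intro runs_mono[OF keep_spec(2)[OF ok]] runs_Instr) (auto simp: chosen_def merged_def)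
  qed
  have b: "runs w (Seq (block [RArith 29 RMinus 5 22, RArith 29 RMinus 29 23, RArith 29 RTimes 26 29, RArith 30 RMinus 2 23,
           RArith 28 RMinus 28 2])
         (Seq (Cond (RLess 29 30) keep_right keep_left) (Instr (OutInsert 19)))) (Suc 5 + (Suc 3 + 1)) s (merged s ?left ?cross)"
    if "\<not> holds (RLess 27 3) s" "holds (RLess 2 28) s"
  proof -
    have t: "\<not> reals s 27 < \<theta>" "1 < reals s 28" using that simps by auto
    have r: "runs w (Cond (RLess 29 30) keep_right keep_left) (Suc 3) ?s2 (\<lambda>s'. runs w (Instr (OutInsert 19)) 1 s' (merged s ?left ?cross))"
    proof (intro runs_Cond)
      show "runs w keep_right 3 ?s2 (\<lambda>s'. runs w (Instr (OutInsert 19)) 1 s' (merged s ?left ?cross))" if "holds (RLess 29 30) ?s2"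
        using that t by (intro runs_mono[OF keep_spec(2)[OF ok2]] runs_Instr) (auto simp: chosen_def merged_def)
      show "runs w keep_left 3 ?s2 (\<lambda>s'. runs w (Instr (OutInsert 19)) 1 s' (merged s ?left ?cross))" if "\<not> holds (RLess 29 30) ?s2"
        using that t by (intro runs_mono[OF keep_spec(1)[OF ok2]] runs_Instr) (auto simp: chosen_def merged_def)
    qed
    have "runs w (block [RArith 29 RMinus 5 22, RArith 29 RMinus 29 23, RArith 29 RTimes 26 29, RArith 30 RMinus 2 23,
           RArith 28 RMinus 28 2]) (Suc 5) s (\<lambda>s'. s' = ?s2)"
      by (rule runs_mono[OF runs_block[where Q = "\<lambda>s'. s' = ?s2"]]) (simp_all add: simps)
    then show ?thesis by (rule runs_SeqI) (simp only: runs_Seq[OF r])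
  qed
  have c: "runs w (Seq (Instr (RArith 29 RTimes 26 28))
         (Seq (Cond (RLess 29 22) keep_left keep_right) (Instr (OutDelete 19)))) (1 + (Suc 3 + 1)) s (merged s ?left ?cross)"
    if "\<not> holds (RLess 27 3) s" "\<not> holds (RLess 2 28) s"
  proof -
    have t: "\<not> reals s 27 < \<theta>" "\<not> 1 < reals s 28" using that simps by auto
    have "runs w (Cond (RLess 29 22) keep_left keep_right) (Suc 3) ?s3 (\<lambda>s'. runs w (Instr (OutDelete 19)) 1 s' (merged s ?left ?cross))"
    proof (intro runs_Cond)
      show "runs w keep_left 3 ?s3 (\<lambda>s'. runs w (Instr (OutDelete 19)) 1 s' (merged s ?left ?cross))" if "holds (RLess 29 22) ?s3"
        using that t f by (intro runs_mono[OF keep_spec(1)[OF ok3]] runs_Instr) (auto simp: chosen_def merged_def)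
      show "runs w keep_right 3 ?s3 (\<lambda>s'. runs w (Instr (OutDelete 19)) 1 s' (merged s ?left ?cross))" if "\<not> holds (RLess 29 22) ?s3"
        using that t f by (intro runs_mono[OF keep_spec(2)[OF ok3]] runs_Instr) (auto simp: chosen_def merged_def)
    qed
    then show ?thesis by (intro runs_Seq runs_Instr) simp
  qed
  have "runs w merge_children (Suc 15) s (merged s ?left ?cross)"
    unfolding merge_children_def
  proof (rule runs_Cond)
    show "runs w (Seq (Cond (RLess 25 24) keep_left keep_right) (Instr (OutDelete 19))) 15 s (merged s ?left ?cross)"
      if "holds (RLess 27 3) s" using runs_mono[OF a[OF that]] by simp
    assume n: "\<not> holds (RLess 27 3) s"
    show "runs w (Cond (RLess 2 28)
       (Seq (block [RArith 29 RMinus 5 22, RArith 29 RMinus 29 23, RArith 29 RTimes 26 29, RArith 30 RMinus 2 23,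
           RArith 28 RMinus 28 2])
         (Seq (Cond (RLess 29 30) keep_right keep_left) (Instr (OutInsert 19))))
       (Seq (Instr (RArith 29 RTimes 26 28))
         (Seq (Cond (RLess 29 22) keep_left keep_right) (Instr (OutDelete 19))))) 15 s (merged s ?left ?cross)"
      by (rule runs_mono[OF runs_Cond[where T = 14]]) (use runs_mono[OF b[OF n]] runs_mono[OF c[OF n]] in simp_all)
  qed
  then show ?thesis by (rule runs_mono) simp_all
qed

definition stored :: "state \<Rightarrow> nat \<Rightarrow> state \<Rightarrow> bool" where
  "stored s u s' \<longleftrightarrow> words s' 10 = u \<and> outset s' = outset s \<and>
    (\<forall>a\<ge>64. words s' a = (if a = 4 * u + 64 then words s 18 else words s a)) \<and>
    (\<forall>a\<ge>64. reals s' a = (if a = 4 * u + 64 then reals s 27 else if a = 4 * u + 65 then reals s 28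
      else if a = 4 * u + 66 then max (reals s 24) (reals s 25) else reals s a))"

lemma store_node_spec:
  assumes ok: "machine_ok w \<theta> \<tau> K s" and u: "words s 11 = u" "words s 14 = 4 * u + 64" and lt: "8 * u + 100 < 2 ^ w"
  shows "runs w store_node 10 s (\<lambda>s'. machine_ok w \<theta> \<tau> K s' \<and> kept s s' \<and> stored s u s')"
proof -
  note simps = machine_ok_simps[OF ok]
  let ?m = "max (reals s 24) (reals s 25)"
  let ?s1 = "s\<lparr>reals := (reals s)(31 := ?m)\<rparr>"
  let ?s2 = "s\<lparr>words := (words s)(4 * u + 64 := words s 18, 14 := 4 * u + 66, 10 := u),
    reals := (reals s)(31 := ?m, 4 * u + 64 := reals s 27, 4 * u + 65 := reals s 28, 4 * u + 66 := ?m)\<rparr>"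
  have fin: "machine_ok w \<theta> \<tau> K ?s2 \<and> kept s ?s2 \<and> stored s u ?s2"
  proof (intro conjI)
    show "machine_ok w \<theta> \<tau> K ?s2"
      by (rule machine_ok_upd[OF ok]) (use lt simps in auto)
    show "kept s ?s2" by (auto simp: kept_def)
    show "stored s u ?s2" by (auto simp: stored_def)
  qed
  have 1: "runs w (Cond (RLess 24 25) (Instr (RArith 31 RPlus 25 1)) (Instr (RArith 31 RPlus 24 1))) (Suc 1) s (\<lambda>s'. s' = ?s1)"
    by (intro runs_Cond runs_Instr) (auto simp: simps max_def)
  have 2: "runs w (block [RStore 14 27, WStore 14 18, WArith 14 Plus 14 1, RStore 14 28, WArith 14 Plus 14 1, RStore 14 31,
       WArith 10 Plus 11 6]) (Suc 7) ?s1 (\<lambda>s'. s' = ?s2)"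
    by (rule runs_mono[OF runs_block[where Q = "\<lambda>s'. s' = ?s2"]])
      (use lt in \<open>simp_all add: simps u fun_upd_twist add.commute\<close>)
  have "runs w store_node (Suc 1 + Suc 7) s (\<lambda>s'. s' = ?s2)"
    unfolding store_node_def by (rule runs_SeqI[OF 1]) (simp only: 2)
  then show ?thesis by (rule runs_mono) (use fin in simp_all)
qed

text \<open>\<open>left_first\<close> in terms of memory cells, so that the program can be verified
  before the cells are tied to a tree.\<close>

definition goes_left :: "real \<Rightarrow> state \<Rightarrow> nat \<Rightarrow> bool" where
  "goes_left \<theta> s u \<longleftrightarrow>
    (if reals s (8 * u + 64) + reals s (8 * u + 68) < \<theta> then reals s (8 * u + 70) < reals s (8 * u + 66)
     else if 1 < reals s (8 * u + 65) + reals s (8 * u + 69)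
     then reals s (4 * u + 67) * (2 - reals s (8 * u + 65) - reals s (8 * u + 69)) < 1 - reals s (8 * u + 69)
     else reals s (4 * u + 67) * (reals s (8 * u + 65) + reals s (8 * u + 69)) < reals s (8 * u + 65))"

definition climbed :: "state \<Rightarrow> nat \<Rightarrow> bool \<Rightarrow> bool \<Rightarrow> state \<Rightarrow> bool" where
  "climbed s u left cross s' \<longleftrightarrow> words s' 10 = u \<and>
    outset s' = (if cross then insert (if left then words s (8 * u + 64) else words s (8 * u + 68)) (outset s)
      else outset s - {if left then words s (8 * u + 68) else words s (8 * u + 64)}) \<and>
    (\<forall>a\<ge>64. words s' a = (if a = 4 * u + 64 then if left \<noteq> cross then words s (8 * u + 64) else words s (8 * u + 68)
      else words s a)) \<and>
    (\<forall>a\<ge>64. reals s' a = (if a = 4 * u + 64 then reals s (8 * u + 64) + reals s (8 * u + 68)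
      else if a = 4 * u + 65 then reals s (8 * u + 65) + reals s (8 * u + 69) - of_bool cross
      else if a = 4 * u + 66 then max (reals s (8 * u + 66)) (reals s (8 * u + 70)) else reals s a))"

lemma kept_trans: "kept s s' \<Longrightarrow> kept s' s'' \<Longrightarrow> kept s s''"
  by (simp add: kept_def)

lemma climb_spec:
  assumes ok: "machine_ok w \<theta> \<tau> K s" and u: "u = words s 10 div 2" and lt: "8 * u + 100 < 2 ^ w"
    and light: "reals s (8 * u + 64) + reals s (8 * u + 68) < \<theta> \<Longrightarrow> reals s (8 * u + 65) + reals s (8 * u + 69) \<le> 1"
  defines "cross \<equiv> 1 < reals s (8 * u + 65) + reals s (8 * u + 69)"
  shows "runs w climb 53 s (\<lambda>s'. machine_ok w \<theta> \<tau> K s' \<and> kept s s' \<and> climbed s u (goes_left \<theta> s u) cross s')"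
proof -
  let ?Q = "\<lambda>s'. machine_ok w \<theta> \<tau> K s' \<and> kept s s' \<and> climbed s u (goes_left \<theta> s u) cross s'"
  have "runs w climb (23 + (20 + 10)) s ?Q"
    unfolding climb_def
  proof (rule runs_SeqI[OF load_children_spec[OF ok u lt]])
    fix s1 assume 1: "machine_ok w \<theta> \<tau> K s1 \<and> kept s s1 \<and> high s s1 \<and> outset s1 = outset s \<and> children_loaded u s s1"
    then have ok1: "machine_ok w \<theta> \<tau> K s1" and c1: "children_loaded u s s1" by auto
    let ?left = "if reals s1 27 < \<theta> then reals s1 25 < reals s1 24
         else if 1 < reals s1 28 then reals s1 26 * (2 - reals s1 22 - reals s1 23) < 1 - reals s1 23
         else reals s1 26 * (reals s1 22 + reals s1 23) < reals s1 22"
    have left: "?left = goes_left \<theta> s u" and cross: "(1 < reals s1 28) = cross"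
      using c1 unfolding children_loaded_def goes_left_def cross_def by auto
    have m: "runs w merge_children 20 s1 (merged s1 (goes_left \<theta> s u) cross)"
      unfolding left[symmetric] cross[symmetric]
    proof (rule merge_children_spec[OF ok1])
      show "reals s1 28 \<le> 1" if "reals s1 27 < \<theta>" using that light c1 by (simp add: children_loaded_def)
      show "reals s1 28 = reals s1 22 + reals s1 23" using c1 by (simp add: children_loaded_def)
    qed
    show "runs w (Seq merge_children store_node) (20 + 10) s1 ?Q"
    proof (rule runs_SeqI[OF m])
      fix s2 assume m: "merged s1 (goes_left \<theta> s u) cross s2"
      have "words s2 a < 2 ^ w" for a
      proof (cases "a \<in> {18, 19}")
        case False
        then show ?thesis using m machine_ok_simps(12)[OF ok1] by (simp add: merged_def)
      next
        case True
        then show ?thesis using m machine_ok_simps(12)[OF ok1] by (auto simp: merged_def)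
      qed
      then have ok2: "machine_ok w \<theta> \<tau> K s2"
        by (intro machine_ok_upd[OF ok1]) (use m in \<open>auto simp: merged_def\<close>)
      have k2: "kept s1 s2" using m by (auto simp: kept_def merged_def)
      have u2: "words s2 11 = u" "words s2 14 = 4 * u + 64" using m c1 by (auto simp: merged_def children_loaded_def)
      show "runs w store_node 10 s2 ?Q"
      proof (rule runs_mono[OF store_node_spec[OF ok2 u2 lt]])
        fix s3 assume 3: "machine_ok w \<theta> \<tau> K s3 \<and> kept s2 s3 \<and> stored s2 u s3"
        then have st: "stored s2 u s3" by blast
        have "kept s s3" using 1 3 k2 kept_trans by blast
        moreover have "climbed s u (goes_left \<theta> s u) cross s3"
          unfolding climbed_def
        proof (intro conjI allI impI)
          show "words s3 10 = u" using st by (simp add: stored_def)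
          show "outset s3 = (if cross then insert (if goes_left \<theta> s u then words s (8 * u + 64) else words s (8 * u + 68)) (outset s)
              else outset s - {if goes_left \<theta> s u then words s (8 * u + 68) else words s (8 * u + 64)})"
            using st m c1 1 by (simp add: stored_def merged_def children_loaded_def)
          fix a :: nat assume a: "64 \<le> a"
          have "words s2 18 = (if goes_left \<theta> s u \<noteq> cross then words s (8 * u + 64) else words s (8 * u + 68))"
            using m c1 by (simp add: merged_def children_loaded_def)
          moreover have "words s2 a = words s a" using m 1 a by (auto simp: merged_def high_def)
          ultimately show "words s3 a = (if a = 4 * u + 64 then if goes_left \<theta> s u \<noteq> cross then words s (8 * u + 64) else words s (8 * u + 68)
              else words s a)" using st a by (simp add: stored_def)
          have "reals s2 a = reals s a" using m 1 a by (auto simp: merged_def high_def)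
          moreover have "reals s2 27 = reals s (8 * u + 64) + reals s (8 * u + 68)"
            "reals s2 28 = reals s (8 * u + 65) + reals s (8 * u + 69) - of_bool cross"
            "reals s2 24 = reals s (8 * u + 66)" "reals s2 25 = reals s (8 * u + 70)"
            using m c1 by (simp_all add: merged_def children_loaded_def)
          ultimately show "reals s3 a = (if a = 4 * u + 64 then reals s (8 * u + 64) + reals s (8 * u + 68)
              else if a = 4 * u + 65 then reals s (8 * u + 65) + reals s (8 * u + 69) - of_bool cross
              else if a = 4 * u + 66 then max (reals s (8 * u + 66)) (reals s (8 * u + 70)) else reals s a)"
            using st a by (simp add: stored_def)
        qed
        ultimately show "?Q s3" using 3 by blast
      qed simp
    qed
  qed
  then show ?thesis by simp
qed

definition leaf_written :: "state \<Rightarrow> nat \<Rightarrow> state \<Rightarrow> bool" where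
  "leaf_written s l s' \<longleftrightarrow> words s' 10 = l \<and> outset s' = outset s - {words s (4 * l + 64)} \<and>
    (\<forall>a\<ge>64. words s' a = (if a = 4 * l + 64 then if 0 < reals s 10 then words s 0 else 0 else words s a)) \<and>
    (\<forall>a\<ge>64. reals s' a = (if a = 4 * l + 64 \<or> a = 4 * l + 65 then reals s 10
      else if a = 4 * l + 66 then reals s 10 * reals s (4 * l + 67) else reals s a))"

lemma write_leaf_spec:
  assumes ok: "machine_ok w \<theta> \<tau> K s" and l: "words s 10 = l" and lt: "4 * l + 100 < 2 ^ w"
  shows "runs w write_leaf 16 s (\<lambda>s'. machine_ok w \<theta> \<tau> K s' \<and> kept s s' \<and> leaf_written s l s')"
proof -
  note simps = machine_ok_simps[OF ok]
  let ?r = "(reals s)(4 * l + 64 := reals s 10, 4 * l + 65 := reals s 10, 11 := reals s (4 * l + 67),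
      12 := reals s 10 * reals s (4 * l + 67), 4 * l + 66 := reals s 10 * reals s (4 * l + 67))"
  let ?w = "(words s)(14 := 4 * l + 64, 16 := words s (4 * l + 64), 15 := 4 * l + 66, 17 := 4 * l + 67)"
  let ?s1 = "s\<lparr>words := ?w, outset := outset s - {words s (4 * l + 64)}, reals := ?r\<rparr>"
  let ?x = "if 0 < reals s 10 then words s 0 else 0"
  let ?s2 = "s\<lparr>words := ?w(16 := ?x), outset := outset s - {words s (4 * l + 64)}, reals := ?r\<rparr>"
  let ?s3 = "s\<lparr>words := ?w(16 := ?x, 4 * l + 64 := ?x), outset := outset s - {words s (4 * l + 64)}, reals := ?r\<rparr>"
  have fin: "machine_ok w \<theta> \<tau> K ?s3 \<and> kept s ?s3 \<and> leaf_written s l ?s3"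
  proof (intro conjI)
    show "machine_ok w \<theta> \<tau> K ?s3"
      by (rule machine_ok_upd[OF ok]) (use lt simps in auto)
    show "kept s ?s3" by (auto simp: kept_def)
    show "leaf_written s l ?s3" using l by (auto simp: leaf_written_def)
  qed
  have 1: "runs w (block [WArith 14 Times 3 10, WArith 14 Plus 14 4, WLoad 16 14, OutDelete 16,
       RStore 14 10, WArith 15 Plus 14 1, RStore 15 10, WArith 15 Plus 15 1, WArith 17 Plus 15 1,
       RLoad 11 17, RArith 12 RTimes 10 11, RStore 15 12]) (Suc 12) s (\<lambda>s'. s' = ?s1)"
    by (rule runs_mono[OF runs_block[where Q = "\<lambda>s'. s' = ?s1"]])
      (use lt in \<open>simp_all add: simps l fun_upd_twist add.commute\<close>)
  have 2: "runs w (Cond (RLess 1 10) (Instr (WArith 16 Plus 0 6)) (Instr (WArith 16 Plus 6 6))) (Suc 1) ?s1 (\<lambda>s'. s' = ?s2)"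
    by (intro runs_Cond runs_Instr) (use simps in \<open>auto simp: fun_upd_twist\<close>)
  have 3: "runs w (Instr (WStore 14 16)) 1 ?s2 (\<lambda>s'. s' = ?s3)"
    by (intro runs_Instr) simp
  have "runs w write_leaf (Suc 12 + (Suc 1 + 1)) s (\<lambda>s'. s' = ?s3)"
    unfolding write_leaf_def
  proof (rule runs_SeqI[OF 1])
    show "runs w (Seq (Cond (RLess 1 10) (Instr (WArith 16 Plus 0 6)) (Instr (WArith 16 Plus 6 6))) (Instr (WStore 14 16)))
        (Suc 1 + 1) s' (\<lambda>s'. s' = ?s3)" if "s' = ?s1" for s'
      unfolding that by (rule runs_SeqI[OF 2]) (simp only: 3)
  qed
  then show ?thesis by (rule runs_mono) (use fin in simp_all)
qed

lemma settle_root_spec: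
  "runs w settle_root 2 s (\<lambda>s'. words s' = words s \<and> reals s' = reals s \<and>
    outset s' = (if reals s 67 < reals s 69 then insert (words s 68) (outset s) else outset s - {words s 68}))"
proof -
  have "runs w settle_root (Suc 1) s (\<lambda>s'. words s' = words s \<and> reals s' = reals s \<and>
    outset s' = (if reals s 67 < reals s 69 then insert (words s 68) (outset s) else outset s - {words s 68}))"
    unfolding settle_root_def by (intro runs_Cond runs_Instr) auto
  then show ?thesis by (rule runs_mono) simp_all
qed

section \<open>What a subtree determines about the sample\<close>

context sampling_tree
begin

lemma rep_not_settled: "0 < v \<Longrightarrow> rep M \<theta> y u v \<notin> settled M \<theta> y u v"
proof (induction v rule: heap_induct[of M])
  case (inner v)
  have a: "rep M \<theta> y u (2 * v) \<in> leaves M (2 * v)" "settled M \<theta> y u (2 * v) \<subseteq> leaves M (2 * v)"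
    and b: "rep M \<theta> y u (2 * v + 1) \<in> leaves M (2 * v + 1)" "settled M \<theta> y u (2 * v + 1) \<subseteq> leaves M (2 * v + 1)"
    using rep_in_leaves settled_subset by auto
  have "rep M \<theta> y u (2 * v) \<notin> settled M \<theta> y u (2 * v)" "rep M \<theta> y u (2 * v + 1) \<notin> settled M \<theta> y u (2 * v + 1)"
    using inner by auto
  then show ?case using a b leaves_disjoint[OF inner(1), of M]
    unfolding tree_inner(4,5)[OF inner(1,2)] loser_def by (auto split: if_splits)
qed (simp add: tree_leaf)

text \<open>Unrolls \<open>sel_rec\<close> from the root down to \<open>q\<close>; the two children
  always select from disjoint sets of leaves.\<close>

lemma sample_restrict:
  assumes "0 < q" "q < 2 * M"
  shows "\<exists>N. valid N (sm M y q) \<and> sample M \<theta> y u \<inter> leaves M q = sel M \<theta> y u q N"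
  using assms
proof (induction q rule: less_induct)
  case (less q)
  show ?case
  proof (cases "q = 1")
    case True
    have "sample M \<theta> y u \<inter> leaves M 1 = sel M \<theta> y u 1 \<lceil>sm M y 1 - u 0\<rceil>"
      using sel_subset by (auto simp: sample_def)
    then show ?thesis using True valid_root by blast
  next
    case False
    define v where "v = q div 2"
    have v: "0 < v" "v < M" "v < q" using False less.prems by (auto simp: v_def)
    obtain N where N: "valid N (sm M y v)" "sample M \<theta> y u \<inter> leaves M v = sel M \<theta> y u v N"
      using less.IH[OF v(3,1)] v(2) by auto
    note r = sel_rec[OF v(1,2) N(1)]
    have qv: "q = 2 * v \<or> q = 2 * v + 1" by (auto simp: v_def)
    then have "leaves M q \<subseteq> leaves M v" using tree_inner(2)[OF v(1,2)] by auto
    then have eq: "sample M \<theta> y u \<inter> leaves M q = sel M \<theta> y u v N \<inter> leaves M q" using N(2) by blast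
    have s: "sel M \<theta> y u (2 * v) m \<subseteq> leaves M (2 * v)" "sel M \<theta> y u (2 * v + 1) m \<subseteq> leaves M (2 * v + 1)" for m
      by (rule sel_subset)+
    note d = leaves_disjoint[OF v(1), of M]
    from qv show ?thesis
    proof
      assume "q = 2 * v"
      then have "sel M \<theta> y u v N \<inter> leaves M q = sel M \<theta> y u q (nl M \<theta> y u v N)" unfolding r(3) using s d by blast
      then show ?thesis using r(1) eq \<open>q = 2 * v\<close> by auto
    next
      assume "q = 2 * v + 1"
      then have "sel M \<theta> y u v N \<inter> leaves M q = sel M \<theta> y u q (N - nl M \<theta> y u v N)" unfolding r(3) using s d by blast
      then show ?thesis using r(2) eq \<open>q = 2 * v + 1\<close> by auto
    qed
  qed
qed

text \<open>The count handed to a subtree decides the fate of its representative alone; all other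
  leaves are settled inside. This is why an update may leave the output off its path untouched, up
  to representatives.\<close>

lemma sample_settled:
  assumes "0 < q" "q < 2 * M" "x \<in> leaves M q" "\<not> (0 < sm M y q \<and> x = rep M \<theta> y u q)"
  shows "x \<in> sample M \<theta> y u \<longleftrightarrow> x \<in> settled M \<theta> y u q"
proof -
  obtain N where "sample M \<theta> y u \<inter> leaves M q = sel M \<theta> y u q N" using sample_restrict[OF assms(1,2)] by blast
  then have "x \<in> sample M \<theta> y u \<longleftrightarrow> x \<in> sel M \<theta> y u q N" using assms(3) by blast
  then show ?thesis using assms(4) by (auto simp: sel_def)
qed

end

definition tree_node :: "nat \<Rightarrow> real \<Rightarrow> (nat \<Rightarrow> real) \<Rightarrow> (nat \<Rightarrow> nat) \<Rightarrow> (nat \<Rightarrow> real) \<Rightarrow> state \<Rightarrow> nat \<Rightarrow> bool" where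
  "tree_node M \<theta> u lab z s v \<longleftrightarrow> reals s (4 * v + 64) = sm M z v \<and> reals s (4 * v + 65) = lofrac (sm M z v) \<and>
    reals s (4 * v + 66) = key M z u v \<and> words s (4 * v + 64) = (if 0 < sm M z v then lab (rep M \<theta> z u v) else 0)"

text \<open>The part of the memory that no update changes: constants, coins and the positions of the
  coordinates.\<close>

definition tree_tables :: "nat \<Rightarrow> real \<Rightarrow> real \<Rightarrow> (nat \<Rightarrow> real) \<Rightarrow> nat \<Rightarrow> nat \<Rightarrow> (nat \<Rightarrow> nat) \<Rightarrow> nat \<Rightarrow> state \<Rightarrow> bool" where
  "tree_tables M \<theta> \<tau> u w K T n s \<longleftrightarrow> machine_ok w \<theta> \<tau> K s \<and>
    (\<forall>v<2 * M. reals s (4 * v + 67) = (if v < M then u v else gain (u v))) \<and>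
    (\<forall>i\<in>{1..n}. words s (4 * i + 65) = T i)"

definition tree_state :: "nat \<Rightarrow> real \<Rightarrow> real \<Rightarrow> (nat \<Rightarrow> real) \<Rightarrow> (nat \<Rightarrow> nat) \<Rightarrow> nat \<Rightarrow> nat \<Rightarrow> (nat \<Rightarrow> nat) \<Rightarrow> nat \<Rightarrow>
    (nat \<Rightarrow> real) \<Rightarrow> state \<Rightarrow> bool" where
  "tree_state M \<theta> \<tau> u lab w K T n z s \<longleftrightarrow> tree_tables M \<theta> \<tau> u w K T n s \<and>
    (\<forall>v\<in>{1..<2 * M}. tree_node M \<theta> u lab z s v) \<and> outset s = lab ` sample M \<theta> z u"

section \<open>Correctness of the update program\<close>

text \<open>A coordinate owns two leaves with the same label, so \<open>lab\<close> can be injective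
  only on the leaves that carry mass before or after the change. For the same reason a coordinate is
  moved in two changes of this kind.\<close>

locale leaf_update =
  fixes M :: nat and \<theta> \<tau> :: real and u y :: "nat \<Rightarrow> real" and lab :: "nat \<Rightarrow> nat" and w K :: nat
    and T :: "nat \<Rightarrow> nat" and n l :: nat and t :: real
  assumes theta: "\<theta> \<le> 1"
    and u01: "\<And>v. 0 < u v" "\<And>v. u v < 1"
    and y01: "\<And>v. 0 \<le> y v" "\<And>v. y v \<le> 1"
    and t01: "0 \<le> t" "t \<le> 1"
    and l: "M \<le> l" "l < 2 * M"
    and lt: "8 * M + 100 < 2 ^ w"
    and P: "\<And>v. y v \<noteq> 0 \<Longrightarrow> v \<in> {M..<2 * M}"
    and inj: "inj_on lab {v. y v \<noteq> 0 \<or> (y(l := t)) v \<noteq> 0}"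
    and lab0: "\<And>v. y v \<noteq> 0 \<or> (y(l := t)) v \<noteq> 0 \<Longrightarrow> lab v \<noteq> 0"
    and root: "leaves M 1 = {M..<2 * M}"
begin

abbreviation "y' \<equiv> y(l := t)"

abbreviation "node_ok \<equiv> tree_node M \<theta> u lab"
abbreviation "tables_ok \<equiv> tree_tables M \<theta> \<tau> u w K T n"
abbreviation "represents \<equiv> tree_state M \<theta> \<tau> u lab w K T n"

definition PP :: "nat set" where
  "PP = {v. y v \<noteq> 0 \<or> y' v \<noteq> 0}"

lemma PP: "PP \<subseteq> {M..<2 * M}" "inj_on lab PP" "\<And>v. v \<in> PP \<Longrightarrow> lab v \<noteq> 0"
proof -
  show "PP \<subseteq> {M..<2 * M}" using P l by (auto simp: PP_def split: if_splits)
  show "inj_on lab PP" unfolding PP_def by (rule inj)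
  show "\<And>v. v \<in> PP \<Longrightarrow> lab v \<noteq> 0" unfolding PP_def by (rule lab0) simp
qed

sublocale old: sampling_tree M \<theta> y u
  using theta u01 y01 by unfold_locales auto

sublocale new: sampling_tree M \<theta> y' u
  using theta u01 y01 t01 by unfold_locales auto

text \<open>State of the loop at node \<open>v\<close>: outside the subtree of \<open>v\<close> the output is still the old sample,
  inside it is the new one, except that the representative of \<open>v\<close> is undecided.\<close>

definition inv :: "state \<Rightarrow> nat \<Rightarrow> state \<Rightarrow> bool" where
  "inv s0 v s \<longleftrightarrow> tables_ok s \<and> kept s0 s \<and> words s 10 = v \<and> 0 < v \<and> v < 2 * M \<and> l \<in> leaves M v \<and>
    (\<forall>q\<in>{1..<2 * M}. (\<forall>j. v div 2 ^ Suc j \<noteq> q) \<longrightarrow> node_ok y' s q) \<and>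
    outset s \<subseteq> lab ` PP \<and>
    (\<forall>x\<in>PP. x \<notin> leaves M v \<longrightarrow> (lab x \<in> outset s \<longleftrightarrow> x \<in> sample M \<theta> y u)) \<and>
    (\<forall>x\<in>PP. x \<in> leaves M v \<longrightarrow> \<not> (0 < sm M y' v \<and> x = rep M \<theta> y' u v) \<longrightarrow>
      (lab x \<in> outset s \<longleftrightarrow> x \<in> settled M \<theta> y' u v))"

lemma off_path:
  assumes "l \<notin> leaves M q" "0 < q"
  shows "sm M y' q = sm M y q" "key M y' u q = key M y u q" "rep M \<theta> y' u q = rep M \<theta> y u q"
    "settled M \<theta> y' u q = settled M \<theta> y u q"
proof -
  have "sm M y' q = sm M y q \<and> key M y' u q = key M y u q \<and> rep M \<theta> y' u q = rep M \<theta> y u q \<and>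
    settled M \<theta> y' u q = settled M \<theta> y u q"
    using assms by (intro tree_cong) auto
  then show "sm M y' q = sm M y q" "key M y' u q = key M y u q" "rep M \<theta> y' u q = rep M \<theta> y u q"
    "settled M \<theta> y' u q = settled M \<theta> y u q" by auto
qed

lemma tables_ok_upd:
  assumes "tables_ok s" "machine_ok w \<theta> \<tau> K s'"
    and "\<And>a. 64 \<le> a \<Longrightarrow> a \<noteq> 4 * v + 64 \<Longrightarrow> words s' a = words s a"
    and "\<And>a. 64 \<le> a \<Longrightarrow> a \<noteq> 4 * v + 64 \<Longrightarrow> a \<noteq> 4 * v + 65 \<Longrightarrow> a \<noteq> 4 * v + 66 \<Longrightarrow> reals s' a = reals s a"
  shows "tables_ok s'"
proof -
  have "words s' (4 * i + 65) = words s (4 * i + 65)" for i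
    by (rule assms(3); presburger)
  moreover have "reals s' (4 * i + 67) = reals s (4 * i + 67)" for i
    by (rule assms(4); presburger)
  ultimately show ?thesis using assms(1,2) by (simp add: tree_tables_def)
qed

lemma node_ok_upd:
  assumes "node_ok z s q" "q \<noteq> v"
    and "\<And>a. 64 \<le> a \<Longrightarrow> a \<noteq> 4 * v + 64 \<Longrightarrow> words s' a = words s a"
    and "\<And>a. 64 \<le> a \<Longrightarrow> a \<noteq> 4 * v + 64 \<Longrightarrow> a \<noteq> 4 * v + 65 \<Longrightarrow> a \<noteq> 4 * v + 66 \<Longrightarrow> reals s' a = reals s a"
  shows "node_ok z s' q"
proof -
  have "words s' (4 * q + 64) = words s (4 * q + 64)"
    by (rule assms(3)) (use assms(2) in presburger)+
  moreover have "reals s' (4 * q + 64) = reals s (4 * q + 64)" "reals s' (4 * q + 65) = reals s (4 * q + 65)"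
    "reals s' (4 * q + 66) = reals s (4 * q + 66)"
    by (rule assms(4); use assms(2) in presburger)+
  ultimately show ?thesis using assms(1) by (simp add: tree_node_def)
qed

text \<open>After its old label has been deleted, \<open>l\<close> is either the undecided
  representative of its own subtree or, with value 0, correctly absent.\<close>

lemma leaf_step:
  assumes s: "represents y s" and c: "words s 10 = l" "reals s 10 = t" "words s 0 = lab l"
  shows "runs w write_leaf 16 s (inv s l)"
proof (rule runs_mono[OF write_leaf_spec])
  show ok: "machine_ok w \<theta> \<tau> K s" using s by (simp add: tree_state_def tree_tables_def)
  show "4 * l + 100 < 2 ^ w" using l lt by simp
  fix s' assume s': "machine_ok w \<theta> \<tau> K s' \<and> kept s s' \<and> leaf_written s l s'"
  then have lw: "leaf_written s l s'" by blast
  have l0: "0 < l" "0 < M" using l by auto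
  have nl: "\<not> (0 < l \<and> l < M)" using l by simp
  have ll: "leaves M l = {l}" by (simp add: tree_leaf[OF nl])
  have up: "\<And>a. 64 \<le> a \<Longrightarrow> a \<noteq> 4 * l + 64 \<Longrightarrow> words s' a = words s a"
    "\<And>a. 64 \<le> a \<Longrightarrow> a \<noteq> 4 * l + 64 \<Longrightarrow> a \<noteq> 4 * l + 65 \<Longrightarrow> a \<noteq> 4 * l + 66 \<Longrightarrow> reals s' a = reals s a"
    using lw by (auto simp: leaf_written_def)
  have tok: "tables_ok s" and nok: "\<And>v. v \<in> {1..<2 * M} \<Longrightarrow> node_ok y s v" and out: "outset s = lab ` sample M \<theta> y u"
    using s by (auto simp: tree_state_def)
  have samp: "x \<in> sample M \<theta> y u \<Longrightarrow> x \<in> PP" for x using old.sel_pos by (fastforce simp: sample_def PP_def)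
  have mem: "lab x \<in> outset s \<longleftrightarrow> x \<in> sample M \<theta> y u" if "x \<in> PP" for x
    unfolding out using that samp PP(2) by (auto dest: inj_onD)
  have cell: "words s (4 * l + 64) = (if 0 < y l then lab l else 0)"
    using nok[of l] l l0 by (simp add: tree_node_def tree_leaf[OF nl])
  have out': "outset s' = outset s - {if 0 < y l then lab l else 0}" using lw cell by (simp add: leaf_written_def)
  show "inv s l s'"
    unfolding inv_def
  proof (intro conjI ballI impI)
    show "tables_ok s'" using tables_ok_upd[OF tok _ up] s' by blast
    show "kept s s'" using s' by blast
    show "words s' 10 = l" using lw by (simp add: leaf_written_def)
    show "0 < l" "l < 2 * M" "l \<in> leaves M l" using l l0 ll by auto
    show "node_ok y' s' q" if q: "q \<in> {1..<2 * M}" "\<forall>j. l div 2 ^ Suc j \<noteq> q" for q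
    proof (cases "q = l")
      case True
      have "reals s (4 * l + 67) = gain (u l)" using tok l by (simp add: tree_tables_def)
      moreover have "lofrac t = t" using lofrac_small t01 by blast
      ultimately show ?thesis
        using lw c True by (simp add: tree_node_def tree_leaf[OF nl] leaf_written_def)
    next
      case False
      have "l \<notin> leaves M q"
      proof
        assume "l \<in> leaves M q"
        then obtain j where j: "l div 2 ^ j = q" using leaves_imp_div by blast
        then show False using False q(2) by (cases j) auto
      qed
      then have "node_ok y' s q" using nok[OF q(1)] off_path[of q] q(1) by (simp add: tree_node_def)
      then show ?thesis using node_ok_upd[OF _ False up] by blast
    qed
    show "outset s' \<subseteq> lab ` PP" using out' out samp by auto
    fix x assume x: "x \<in> PP"
    show "lab x \<in> outset s' \<longleftrightarrow> x \<in> sample M \<theta> y u" if xl: "x \<notin> leaves M l"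
    proof -
      have "lab x \<noteq> (if 0 < y l then lab l else 0)"
      proof (cases "0 < y l")
        case True
        then have "l \<in> PP" by (simp add: PP_def)
        then show ?thesis using True x xl ll PP(2) by (auto dest: inj_onD)
      qed (use PP(3)[OF x] in simp)
      then show ?thesis using out' mem[OF x] by simp
    qed
    show "lab x \<in> outset s' \<longleftrightarrow> x \<in> settled M \<theta> y' u l"
      if "x \<in> leaves M l" "\<not> (0 < sm M y' l \<and> x = rep M \<theta> y' u l)"
    proof -
      have xl: "x = l" "t = 0" using that ll t01 by (auto simp: tree_leaf[OF nl])
      then have "y l \<noteq> 0" using x unfolding PP_def by auto
      then have "0 < y l" using y01(1)[of l] by simp
      then show ?thesis using out' xl by (simp add: tree_leaf[OF nl])
    qed
  qed
qed (simp_all add: c)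

text \<open>One level decides one label. The representative of \<open>v\<close> is open, and that of
  its sibling may be in a wrong state; of the two, the loser is now set correctly and the winner
  becomes the open one of the parent.\<close>

lemma climb_step:
  assumes i: "inv s0 v s" and v1: "1 < v"
  shows "runs w climb 53 s (inv s0 (v div 2))"
proof -
  define q where "q = v div 2"
  have tok: "tables_ok s" and ok: "machine_ok w \<theta> \<tau> K s" and v10: "words s 10 = v" and v0: "0 < v" "v < 2 * M"
    and lv: "l \<in> leaves M v" and k0: "kept s0 s"
    and nok: "\<And>x. x \<in> {1..<2 * M} \<Longrightarrow> (\<And>j. v div 2 ^ Suc j \<noteq> x) \<Longrightarrow> node_ok y' s x"
    and sub: "outset s \<subseteq> lab ` PP"
    and outer: "\<And>x. x \<in> PP \<Longrightarrow> x \<notin> leaves M v \<Longrightarrow> lab x \<in> outset s \<longleftrightarrow> x \<in> sample M \<theta> y u"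
    and within: "\<And>x. x \<in> PP \<Longrightarrow> x \<in> leaves M v \<Longrightarrow> \<not> (0 < sm M y' v \<and> x = rep M \<theta> y' u v) \<Longrightarrow>
      lab x \<in> outset s \<longleftrightarrow> x \<in> settled M \<theta> y' u v"
    using i by (auto simp: inv_def tree_tables_def)
  have q: "0 < q" "q < M" "v = 2 * q \<or> v = 2 * q + 1" using v1 v0 by (auto simp: q_def)
  have anc: "v div 2 ^ Suc j \<le> q" for j
  proof -
    have "v div 2 ^ Suc j = q div 2 ^ j" by (simp add: q_def div_mult2_eq)
    then show ?thesis by (simp add: div_le_dividend)
  qed
  have ne: "v div 2 ^ Suc j \<noteq> 2 * q" "v div 2 ^ Suc j \<noteq> 2 * q + 1" for j
    using anc[of j] q(1) by linarith+
  have na: "node_ok y' s (2 * q)" and nb: "node_ok y' s (2 * q + 1)"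
    using q ne by (auto intro!: nok)
  let ?a = "2 * q" and ?b = "2 * q + 1"
  let ?sa = "sm M y' ?a" and ?sb = "sm M y' ?b"
  have A: "reals s (8 * q + 64) = ?sa" "reals s (8 * q + 65) = lofrac ?sa" "reals s (8 * q + 66) = key M y' u ?a"
    "words s (8 * q + 64) = (if 0 < ?sa then lab (rep M \<theta> y' u ?a) else 0)"
    using na by (simp_all add: tree_node_def)
  have e: "4 * (2 * q + 1) + 64 = 8 * q + 68" "4 * (2 * q + 1) + 65 = 8 * q + 69" "4 * (2 * q + 1) + 66 = 8 * q + 70"
    by simp_all
  have B: "reals s (8 * q + 68) = ?sb" "reals s (8 * q + 69) = lofrac ?sb" "reals s (8 * q + 70) = key M y' u ?b"
    "words s (8 * q + 68) = (if 0 < ?sb then lab (rep M \<theta> y' u ?b) else 0)"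
    using nb unfolding tree_node_def e by simp_all
  have R: "reals s (4 * q + 67) = u q" using tok q by (simp add: tree_tables_def)
  let ?l = "left_first M \<theta> y' u q" and ?c = "crossing M y' q"
  have sq: "sm M y' q = ?sa + ?sb" using tree_inner(1)[OF q(1,2)] .
  have s0: "0 \<le> ?sa" "0 \<le> ?sb" by (rule new.sm_ge0)+
  have cr: "(1 < reals s (8 * q + 65) + reals s (8 * q + 69)) = ?c" by (simp add: crossing_def A B)
  have gl: "goes_left \<theta> s q = ?l"
    unfolding goes_left_def left_first_def A B R sq crossing_def by simp
  have light: "reals s (8 * q + 65) + reals s (8 * q + 69) \<le> 1" if "reals s (8 * q + 64) + reals s (8 * q + 68) < \<theta>"
    using new.light_not_crossing[OF q(1,2)] that sq cr A B by simp
  have rin: "rep M \<theta> y' u ?a \<in> leaves M ?a" "rep M \<theta> y' u ?b \<in> leaves M ?b" by (rule new.rep_in_leaves)+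
  have dis: "leaves M ?a \<inter> leaves M ?b = {}" by (rule leaves_disjoint[OF q(1)])
  have lq: "leaves M q = leaves M ?a \<union> leaves M ?b" by (rule tree_inner(2)[OF q(1,2)])
  have rpos: "rep M \<theta> y' u ?a \<in> PP" if "0 < ?sa"
    using new.rep_pos[OF that] by (auto simp: PP_def)
  have rposb: "rep M \<theta> y' u ?b \<in> PP" if "0 < ?sb"
    using new.rep_pos[OF that] by (auto simp: PP_def)
  have cpos: "0 < ?sa \<and> 0 < ?sb" if ?c
  proof -
    have "lofrac ?sa \<le> 1" "lofrac ?sb \<le> 1" using lofrac_range s0 by auto
    then have "lofrac ?sa \<noteq> 0" "lofrac ?sb \<noteq> 0" using that by (auto simp: crossing_def)
    then show ?thesis using s0 by (auto simp: lofrac_def less_le)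
  qed
  \<comment> \<open>Below the sibling the output is still the old sample. The change does not reach
    that subtree, so by \<open>sample_settled\<close> the old sample agrees there with the new
    \<open>settled\<close>, apart from the representative.\<close>
  have child: "lab x \<in> outset s \<longleftrightarrow> x \<in> settled M \<theta> y' u r"
    if r: "r = ?a \<or> r = ?b" and x: "x \<in> PP" "x \<in> leaves M r" "\<not> (0 < sm M y' r \<and> x = rep M \<theta> y' u r)" for r x
  proof (cases "r = v")
    case True
    then show ?thesis using within x by blast
  next
    case False
    then have lr: "l \<notin> leaves M r" "x \<notin> leaves M v" using lv dis r q(3) x(2) by auto
    have r0: "0 < r" "r < 2 * M" using r q by auto
    note o = off_path[OF lr(1) r0(1)]
    have "x \<in> sample M \<theta> y u \<longleftrightarrow> x \<in> settled M \<theta> y u r"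
      using old.sample_settled[OF r0 x(2)] x(3) o by simp
    then show ?thesis using outer[OF x(1) lr(2)] o by simp
  qed
  have lt': "8 * q + 100 < 2 ^ w" using q(2) lt by simp
  show ?thesis
    unfolding q_def[symmetric]
  proof (rule runs_mono[OF climb_spec[OF ok _ lt' light]])
    show "q = words s 10 div 2" by (simp add: v10 q_def)
    fix s' assume "machine_ok w \<theta> \<tau> K s' \<and> kept s s' \<and>
      climbed s q (goes_left \<theta> s q) (1 < reals s (8 * q + 65) + reals s (8 * q + 69)) s'"
    then have s': "machine_ok w \<theta> \<tau> K s'" "kept s s'" "climbed s q ?l ?c s'" using gl cr by auto
    have up: "\<And>a. 64 \<le> a \<Longrightarrow> a \<noteq> 4 * q + 64 \<Longrightarrow> words s' a = words s a"
      "\<And>a. 64 \<le> a \<Longrightarrow> a \<noteq> 4 * q + 64 \<Longrightarrow> a \<noteq> 4 * q + 65 \<Longrightarrow> a \<noteq> 4 * q + 66 \<Longrightarrow> reals s' a = reals s a"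
      using s'(3) by (auto simp: climbed_def)
    \<comment> \<open>This label is 0 if the losing child is empty. No leaf in use has label 0, so
      deleting it then changes nothing.\<close>
    define lo where "lo = (if ?l = ?c then words s (8 * q + 64) else words s (8 * q + 68))"
    have out': "outset s' = (if ?c then insert lo (outset s) else outset s - {lo})"
      using s'(3) by (auto simp: climbed_def lo_def)
    let ?lr = "loser M \<theta> y' u q" and ?lc = "if ?l = ?c then ?a else ?b" and ?wc = "if ?l = ?c then ?b else ?a"
    have lo: "lo = (if 0 < sm M y' ?lc then lab ?lr else 0)"
      using A B by (auto simp: lo_def loser_def)
    have lr: "?lr = rep M \<theta> y' u ?lc" by (simp add: loser_def)
    have wr: "rep M \<theta> y' u q = rep M \<theta> y' u ?wc" using tree_inner(4)[OF q(1,2)] by simp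
    have lrP: "?lr \<in> PP" if "0 < sm M y' ?lc" using that rpos rposb lr by (auto split: if_splits)
    \<comment> \<open>The representative of a nonempty node has positive mass and lies below the
      winning child, which is thus nonempty.\<close>
    have wpos: "0 < sm M y' ?wc" if "0 < sm M y' q"
    proof (rule ccontr)
      assume "\<not> ?thesis"
      then have "sm M y' ?wc = 0" using s0 by (auto split: if_splits)
      moreover have "rep M \<theta> y' u q \<in> leaves M ?wc" using wr rin by (auto split: if_splits)
      ultimately have "y' (rep M \<theta> y' u q) = 0"
        using new.y01(1) by (simp add: sm_eq_sum sum_nonneg_eq_0_iff)
      then show False using new.rep_pos[OF that] by simp
    qed
    have st: "settled M \<theta> y' u q = settled M \<theta> y' u ?a \<union> settled M \<theta> y' u ?b \<union> (if ?c then {?lr} else {})"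
      by (rule tree_inner(5)[OF q(1,2)])
    have labne: "lab x \<noteq> lo" if "x \<in> PP" "0 < sm M y' ?lc \<Longrightarrow> x \<noteq> ?lr" for x
      using that PP(2,3) lrP unfolding lo by (auto dest: inj_onD)
    have keep: "lab x \<in> outset s' \<longleftrightarrow> lab x \<in> outset s" if "x \<in> PP" "0 < sm M y' ?lc \<Longrightarrow> x \<noteq> ?lr" for x
      using labne[OF that] out' by auto
    show "inv s0 q s'"
      unfolding inv_def
    proof (intro conjI ballI impI)
      show "tables_ok s'" using tables_ok_upd[OF tok s'(1) up] by blast
      show "kept s0 s'" using k0 s'(2) kept_trans by blast
      show "words s' 10 = q" using s'(3) by (simp add: climbed_def)
      show "0 < q" "q < 2 * M" using q by auto
      show "l \<in> leaves M q" using lv lq q(3) by auto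
      show "node_ok y' s' x" if x: "x \<in> {1..<2 * M}" "\<forall>j. q div 2 ^ Suc j \<noteq> x" for x
      proof (cases "x = q")
        case True
        have "words s' (4 * q + 64) = (if ?l \<noteq> ?c then words s (8 * q + 64) else words s (8 * q + 68))"
          using s'(3) by (simp add: climbed_def)
        also have "\<dots> = (if 0 < sm M y' ?wc then lab (rep M \<theta> y' u q) else 0)"
          unfolding wr using A B by auto
        also have "\<dots> = (if 0 < sm M y' q then lab (rep M \<theta> y' u q) else 0)"
        proof -
          have "0 < sm M y' q" if "0 < sm M y' ?wc" using that sq s0 by (auto split: if_splits)
          then show ?thesis using wpos by auto
        qed
        finally have W: "words s' (4 * q + 64) = (if 0 < sm M y' q then lab (rep M \<theta> y' u q) else 0)" .
        have "reals s' (4 * q + 64) = sm M y' q" "reals s' (4 * q + 66) = key M y' u q"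
          using s'(3) A B sq tree_inner(3)[OF q(1,2)] by (simp_all add: climbed_def)
        moreover have "reals s' (4 * q + 65) = lofrac (sm M y' q)"
        proof -
          have "reals s' (4 * q + 65) = lofrac ?sa + lofrac ?sb - of_bool ?c"
            using s'(3) A B by (simp add: climbed_def)
          then show ?thesis unfolding sq lofrac_add[OF s0] by (auto simp: crossing_def)
        qed
        ultimately show ?thesis using W True by (simp add: tree_node_def)
      next
        case False
        have "v div 2 ^ Suc j \<noteq> x" for j
        proof (cases j)
          case 0
          then show ?thesis using False by (simp add: q_def)
        next
          case (Suc j')
          have "v div 2 ^ Suc j = q div 2 ^ Suc j'" 
            unfolding Suc q_def by (simp only: power_Suc[of _ "Suc j'"] div_mult2_eq)
          then show ?thesis using x(2) by simp
        qed
        then have "node_ok y' s x" using nok x(1) by blast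
        then show ?thesis using node_ok_upd[OF _ False up] by blast
      qed
      show "outset s' \<subseteq> lab ` PP"
      proof (cases ?c)
        case True
        then have "0 < sm M y' ?lc" using cpos by auto
        then show ?thesis using out' True sub lo lrP by auto
      next
        case False
        then show ?thesis using out' sub by auto
      qed
      fix x assume x: "x \<in> PP"
      show "lab x \<in> outset s' \<longleftrightarrow> x \<in> sample M \<theta> y u" if "x \<notin> leaves M q"
      proof -
        have "x \<notin> leaves M v" using that lq q(3) by auto
        moreover have "x \<noteq> ?lr" using that lq lr rin by (auto split: if_splits)
        ultimately show ?thesis using keep[OF x] outer[OF x] by blast
      qed
      assume xq: "x \<in> leaves M q" and xr: "\<not> (0 < sm M y' q \<and> x = rep M \<theta> y' u q)"
      show "lab x \<in> outset s' \<longleftrightarrow> x \<in> settled M \<theta> y' u q"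
      proof (cases "0 < sm M y' ?lc \<and> x = ?lr")
        case True
        have lo': "lo = lab x" using True lo by simp
        have "x \<notin> settled M \<theta> y' u ?lc" using True lr new.rep_not_settled[of ?lc] q(1) by simp
        moreover have "x \<notin> settled M \<theta> y' u ?wc"
        proof -
          have "x \<in> leaves M ?lc" using True lr rin by (auto split: if_splits)
          moreover have "settled M \<theta> y' u ?wc \<subseteq> leaves M ?wc" by (rule new.settled_subset)
          ultimately show ?thesis using dis by (auto split: if_splits)
        qed
        ultimately have "x \<in> settled M \<theta> y' u q \<longleftrightarrow> ?c" using st True by (auto split: if_splits)
        then show ?thesis using out' lo' by auto
      next
        case False
        have k: "lab x \<in> outset s' \<longleftrightarrow> lab x \<in> outset s" using False by (intro keep x) auto
        obtain r where r: "r = ?a \<or> r = ?b" "x \<in> leaves M r" using xq lq by auto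
        have xr': "\<not> (0 < sm M y' r \<and> x = rep M \<theta> y' u r)"
        proof
          assume h: "0 < sm M y' r \<and> x = rep M \<theta> y' u r"
          have "r = ?lc \<or> r = ?wc" using r(1) by auto
          then show False
          proof
            assume "r = ?lc"
            then show False using h False lr by auto
          next
            assume "r = ?wc"
            then have "x = rep M \<theta> y' u q" using h wr by simp
            moreover have "0 < sm M y' q" using h r(1) sq s0 by auto
            ultimately show False using xr by blast
          qed
        qed
        have o: "x \<in> settled M \<theta> y' u q \<longleftrightarrow> x \<in> settled M \<theta> y' u r"
        proof -
          have "x \<noteq> ?lr" if ?c using that False cpos by auto
          moreover have "settled M \<theta> y' u ?a \<subseteq> leaves M ?a" "settled M \<theta> y' u ?b \<subseteq> leaves M ?b"
            by (rule new.settled_subset)+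
          ultimately show ?thesis using st r dis by auto
        qed
        show ?thesis unfolding k o by (rule child[OF r(1) x r(2) xr'])
      qed
    qed
  qed simp_all
qed

text \<open>\<open>j\<close> bounds the depth of \<open>v\<close>. Each round costs 53 steps and a
  test, and the final test costs one more.\<close>

lemma climb_loop: "inv s0 v s \<Longrightarrow> v < 2 ^ Suc j \<Longrightarrow> runs w (While (WLess 1 10) climb) (54 * j + 1) s (inv s0 1)"
proof (induction j arbitrary: v s)
  case 0
  then have "v = 1" by (simp add: inv_def)
  moreover have "\<not> holds (WLess 1 10) s" using 0 \<open>v = 1\<close> by (simp add: inv_def tree_tables_def machine_ok_def)
  ultimately have "runs w (While (WLess 1 10) climb) (Suc 0) s (inv s0 1)" using 0 by (intro runs_While_False) auto
  then show ?case by simp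
next
  case (Suc j)
  have h: "holds (WLess 1 10) s \<longleftrightarrow> 1 < v" using Suc.prems by (auto simp: inv_def tree_tables_def machine_ok_def)
  show ?case
  proof (cases "1 < v")
    case False
    then have "v = 1" using Suc.prems by (simp add: inv_def)
    then have "runs w (While (WLess 1 10) climb) (Suc 0) s (inv s0 1)"
      using h Suc.prems by (intro runs_While_False) auto
    then show ?thesis by (rule runs_mono) auto
  next
    case True
    have "v div 2 < 2 ^ Suc j" using Suc.prems(2) by (simp add: div_less_iff_less_mult mult.commute)
    then have "runs w (While (WLess 1 10) climb) (Suc (53 + (54 * j + 1))) s (inv s0 1)"
      using True h by (intro runs_While_True runs_mono[OF climb_step[OF Suc.prems(1) True]] Suc.IH) auto
    then show ?thesis by (rule runs_mono) auto
  qed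
qed

text \<open>At the root only its representative is open, and the comparison of
  \<open>sample_eq\<close> decides it.\<close>

lemma update_leaf_spec:
  assumes s: "represents y s" and c: "words s 10 = l" "reals s 10 = t" "words s 0 = lab l" and H: "2 * M \<le> 2 ^ Suc H"
  shows "runs w update_leaf (54 * H + 19) s (\<lambda>s'. represents y' s' \<and> kept s s')"
proof -
  have "runs w update_leaf (16 + ((54 * H + 1) + 2)) s (\<lambda>s'. represents y' s' \<and> kept s s')"
    unfolding update_leaf_def
  proof (rule runs_SeqI[OF leaf_step[OF s c]], rule runs_SeqI[OF climb_loop])
    show "l < 2 ^ Suc H" using l H by simp
    fix s1 s2 :: state assume "inv s l s1" and i: "inv s 1 s2"
    show "runs w settle_root 2 s2 (\<lambda>s'. represents y' s' \<and> kept s s')"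
    proof (rule runs_mono[OF settle_root_spec])
      fix s3 :: state assume s3: "words s3 = words s2 \<and> reals s3 = reals s2 \<and>
        outset s3 = (if reals s2 67 < reals s2 69 then insert (words s2 68) (outset s2) else outset s2 - {words s2 68})"
      have M0: "0 < M" using l by simp
      have tok: "tables_ok s2" "kept s s2" using i by (auto simp: inv_def)
      have nok: "node_ok y' s2 q" if "q \<in> {1..<2 * M}" for q
      proof -
        have "1 div 2 ^ Suc j \<noteq> q" for j
        proof -
          have "(1::nat) div 2 ^ Suc j = 0" by (intro div_less one_less_power) auto
          then show ?thesis using that by auto
        qed
        then show ?thesis using i that by (auto simp: inv_def)
      qed
      let ?r = "rep M \<theta> y' u 1" and ?s = "sm M y' 1"
      have n1: "reals s2 69 = lofrac ?s" "words s2 68 = (if 0 < ?s then lab ?r else 0)"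
        using nok[of 1] M0 by (simp_all add: tree_node_def)
      have u0: "reals s2 67 = u 0"
      proof -
        have "reals s2 (4 * 0 + 67) = (if 0 < M then u 0 else gain (u 0))" 
        proof -
          have "\<forall>v<2 * M. reals s2 (4 * v + 67) = (if v < M then u v else gain (u v))"
            using tok(1) by (simp add: tree_tables_def)
          then show ?thesis using M0 by (metis mult_pos_pos zero_less_numeral)
        qed
        then show ?thesis using M0 by simp
      qed
      have f: "lofrac ?s = 0 \<longleftrightarrow> \<not> 0 < ?s" using lofrac_pos[of ?s] new.sm_ge0[of 1] by (auto simp: lofrac_def)
      have rP: "?r \<in> PP" if "0 < ?s" using new.rep_pos[OF that] by (auto simp: PP_def)
      have samp: "sample M \<theta> y' u = settled M \<theta> y' u 1 \<union> (if u 0 < lofrac ?s then {?r} else {})" by (rule new.sample_eq)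
      have sampP: "x \<in> sample M \<theta> y' u \<Longrightarrow> x \<in> PP" for x using new.sel_pos by (fastforce simp: sample_def PP_def)
      have pos: "0 < ?s" if "u 0 < lofrac ?s" using that f u01(1)[of 0] by force
      have out3: "outset s3 = (if u 0 < lofrac ?s then insert (lab ?r) (outset s2)
          else outset s2 - {if 0 < ?s then lab ?r else 0})"
        using s3 n1 u0 pos by auto
      have sub: "outset s2 \<subseteq> lab ` PP" using i by (simp add: inv_def)
      have sub3: "outset s3 \<subseteq> lab ` PP" using out3 sub rP pos by (auto split: if_splits)
      have mem: "lab x \<in> outset s3 \<longleftrightarrow> x \<in> sample M \<theta> y' u" if x: "x \<in> PP" for x
      proof (cases "0 < ?s \<and> x = ?r")
        case True
        have "?r \<notin> settled M \<theta> y' u 1" by (rule new.rep_not_settled) simp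
        then show ?thesis using True out3 samp by auto
      next
        case False
        have "x \<in> leaves M 1" using x PP(1) root by auto
        then have "lab x \<in> outset s2 \<longleftrightarrow> x \<in> settled M \<theta> y' u 1" using i x False by (auto simp: inv_def)
        moreover have "lab x \<noteq> (if 0 < ?s then lab ?r else 0)"
          using False x PP(2,3) rP by (auto dest: inj_onD)
        moreover have "x \<noteq> ?r" if "u 0 < lofrac ?s" using False pos[OF that] by auto
        ultimately show ?thesis using out3 samp pos by (auto split: if_splits)
      qed
      have "outset s3 = lab ` sample M \<theta> y' u"
      proof
        show "outset s3 \<subseteq> lab ` sample M \<theta> y' u" using sub3 mem by blast
        show "lab ` sample M \<theta> y' u \<subseteq> outset s3" using mem sampP by blast
      qed
      moreover have "tables_ok s3" using tok s3 by (simp add: tree_tables_def machine_ok_def)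
      moreover have "kept s s3" using tok s3 by (simp add: kept_def)
      moreover have "node_ok y' s3 q" if "q \<in> {1..<2 * M}" for q using nok[OF that] s3 by (simp add: tree_node_def)
      ultimately show "represents y' s3 \<and> kept s s3" by (simp add: tree_state_def)
    qed simp
  qed
  then show ?thesis by (rule runs_mono) simp_all
qed

end

section \<open>Moving a coordinate between its two leaves\<close>

lemma tree_state_scratch:
  assumes s: "tree_state M \<theta> \<tau> u lab w K T n z s"
    and a: "\<And>a. a \<notin> {0} \<union> {10..<64} \<Longrightarrow> words s' a = words s a" "\<And>a. a \<notin> {0} \<union> {10..<64} \<Longrightarrow> reals s' a = reals s a"
    and w: "\<And>a. words s' a < 2 ^ w" and out: "outset s' = outset s"
  shows "tree_state M \<theta> \<tau> u lab w K T n z s'"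
proof -
  have "machine_ok w \<theta> \<tau> K s'" using s w by (simp add: tree_state_def tree_tables_def machine_ok_def a)
  then show ?thesis using s by (simp add: tree_state_def tree_tables_def tree_node_def a out)
qed

lemma tree_state_words: "tree_state M \<theta> \<tau> u lab w K T n z s \<Longrightarrow> words s a < 2 ^ w"
  by (simp add: tree_state_def tree_tables_def machine_ok_def)

context placement
begin

text \<open>Every coordinate other than \<open>i\<close> occupies at most one leaf, so labels
  separate the leaves in use as long as only one of the two leaves of \<open>i\<close> is among
  them.\<close>

lemma spread_support:
  fixes x :: "nat \<Rightarrow> real" and \<tau> :: real and h :: bool
  assumes i: "i \<in> {1..n}"
  defines "S \<equiv> insert (leaf L p h i) {v. spread L n p \<tau> (x(i := 0)) v \<noteq> 0}"
  shows "inj_on (label L p) S" "\<And>v. v \<in> S \<Longrightarrow> label L p v \<noteq> 0" "\<And>v. v \<in> S \<Longrightarrow> v \<in> {M..<2 * M}"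
proof -
  define g where "g = (\<lambda>j. leaf L p (if j = i then h else \<tau> \<le> x j) j)"
  have S: "label L p v \<in> {1..n} \<and> v = g (label L p v)" if v: "v \<in> S" for v
  proof (cases "v = leaf L p h i")
    case True
    then show ?thesis using i by (simp add: g_def leaf_simps(3))
  next
    case False
    then have "spread L n p \<tau> (x(i := 0)) v \<noteq> 0" using v by (simp add: S_def)
    then obtain j where j: "j \<in> {1..n}" "v = leaf L p (\<tau> \<le> (x(i := 0)) j) j" "(x(i := 0)) j \<noteq> 0"
      by (metis spread_nonzero)
    then have "j \<noteq> i" by auto
    then show ?thesis using j leaf_simps(3)[OF j(1)] by (simp add: g_def)
  qed
  show "inj_on (label L p) S" by (rule inj_on_inverseI[where g = g]) (use S in metis)
  show "label L p v \<noteq> 0" if "v \<in> S" for v using S[OF that] by auto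
  show "v \<in> {M..<2 * M}" if "v \<in> S" for v
    using S[OF that] leaf_simps(4,5) unfolding g_def by (metis atLeastLessThan_iff)
qed

end

locale sampling_machine = placement +
  fixes \<theta> \<tau> :: real and u :: "nat \<Rightarrow> real" and w :: nat
  assumes \<theta>: "\<theta> \<le> 1" and \<tau>: "0 < \<tau>" and u01: "\<And>v. 0 < u v" "\<And>v. u v < 1" and lt: "16 * 2 ^ L + 100 < (2::nat) ^ w"
begin

abbreviation holds_input :: "(nat \<Rightarrow> real) \<Rightarrow> state \<Rightarrow> bool" where
  "holds_input \<equiv> tree_state M \<theta> \<tau> u (label L p) w (2 ^ L) (leaf L p False) n"

text \<open>Leaf numbers are below \<open>4 * 2 ^ L\<close>, so the path has \<open>Suc L\<close>
  levels above the leaf, and \<open>54 * Suc L + 19 = 54 * L + 73\<close>.\<close>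

lemma set_leaf_spec:
  assumes s: "holds_input y s" and y01: "\<And>v. 0 \<le> y v" "\<And>v. y v \<le> 1" and i: "i \<in> {1..n}" and t: "0 \<le> t" "t \<le> 1"
    and S: "\<And>v. y v \<noteq> 0 \<or> (y(leaf L p h i := t)) v \<noteq> 0 \<Longrightarrow> v \<in> insert (leaf L p h' i) {v. spread L n p \<tau> (x(i := 0)) v \<noteq> 0}"
    and c: "words s 10 = leaf L p h i" "reals s 10 = t" "words s 0 = i"
  shows "runs w update_leaf (54 * L + 73) s (\<lambda>s'. holds_input (y(leaf L p h i := t)) s' \<and> kept s s')"
proof -
  interpret lu: leaf_update M \<theta> \<tau> u y "label L p" w "2 ^ L" "leaf L p False" n "leaf L p h i" t
  proof
    show "M \<le> leaf L p h i" "leaf L p h i < 2 * M" using leaf_simps(4,5)[OF i] by auto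
    show "8 * M + 100 < 2 ^ w" using lt by simp
    show "v \<in> {M..<2 * M}" if "y v \<noteq> 0" for v
      by (rule spread_support(3)[OF i, of v h' \<tau> x]) (rule S, use that in simp)
    show "inj_on (label L p) {v. y v \<noteq> 0 \<or> (y(leaf L p h i := t)) v \<noteq> 0}"
      by (rule inj_on_subset[OF spread_support(1)[OF i, of h' \<tau> x]]) (use S in blast)
    show "label L p v \<noteq> 0" if "y v \<noteq> 0 \<or> (y(leaf L p h i := t)) v \<noteq> 0" for v
      by (rule spread_support(2)[OF i, of v h' \<tau> x]) (rule S[OF that])
  qed (use \<theta> u01 y01 t leaves_root in auto)
  have "runs w update_leaf (54 * Suc L + 19) s (\<lambda>s'. holds_input (y(leaf L p h i := t)) s' \<and> kept s s')"
    by (rule lu.update_leaf_spec[OF s c(1,2)]) (simp_all add: c(3) leaf_simps(3)[OF i])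
  then show ?thesis by (rule runs_mono) simp_all
qed

text \<open>Clearing the leaf on the other side first ensures that the two leaves of
  \<open>i\<close>, which share a label, are never in use together. If that leaf is empty already,
  the first pass reproduces the current state.\<close>

lemma update_spec:
  assumes s: "holds_input (spread L n p \<tau> x) s" and x: "\<And>i. i \<in> {1..n} \<Longrightarrow> 0 \<le> x i" "\<And>i. i \<in> {1..n} \<Longrightarrow> x i \<le> 1"
    and i: "i \<in> {1..n}" and t: "0 \<le> t" "t \<le> 1"
  shows "runs w update (108 * L + 162) (pass_change i t s) (holds_input (spread L n p \<tau> (x(i := t))))"
proof -
  define y where "y = spread L n p \<tau> x"
  define h where "h \<longleftrightarrow> \<tau> \<le> t"
  define y1 where "y1 = y(leaf L p (\<not> h) i := 0)"
  define z where "z = spread L n p \<tau> (x(i := 0))"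
  define q where "q = leaf L p False i"
  have y: "y = z(leaf L p (\<tau> \<le> x i) i := x i)"
    using spread_update(1)[OF i \<tau>, of x "x i"] by (simp add: y_def z_def)
  have z0: "z (leaf L p g i) = 0" for g
    using spread_update(2)[OF i \<tau>, of x g] unfolding z_def by (metis fun_upd_same)
  have ne: "leaf L p (\<not> h) i \<noteq> leaf L p h i" by (cases h) (simp_all add: leaf_def)
  have fin: "y1(leaf L p h i := t) = spread L n p \<tau> (x(i := t))"
  proof -
    have "y1(leaf L p h i := t) = z(leaf L p h i := t)"
    proof
      fix v show "(y1(leaf L p h i := t)) v = (z(leaf L p h i := t)) v"
        using z0 ne by (cases "(\<tau> \<le> x i) = h") (auto simp: y1_def y)
    qed
    then show ?thesis using spread_update(1)[OF i \<tau>, of x t] by (simp add: z_def h_def)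
  qed
  have y01: "0 \<le> y v" "y v \<le> 1" for v unfolding y_def by (intro spread_range x; assumption)+
  have y101: "0 \<le> y1 v" "y1 v \<le> 1" for v using y01 by (auto simp: y1_def)
  have sup1: "v \<in> insert (leaf L p (\<tau> \<le> x i) i) {v. spread L n p \<tau> (x(i := 0)) v \<noteq> 0}"
    if "y v \<noteq> 0 \<or> (y(leaf L p (\<not> h) i := 0)) v \<noteq> 0" for v
    using that by (auto simp: y simp flip: z_def split: if_splits)
  have sup2: "v \<in> insert (leaf L p h i) {v. spread L n p \<tau> (x(i := 0)) v \<noteq> 0}"
    if "y1 v \<noteq> 0 \<or> (y1(leaf L p h i := t)) v \<noteq> 0" for v
  proof (cases "v = leaf L p h i")
    case False
    then have "y1 v \<noteq> 0" using that by simp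
    then have "v \<noteq> leaf L p (\<not> h) i" "y v \<noteq> 0" by (auto simp: y1_def split: if_splits)
    then have "z v \<noteq> 0" using False by (cases "(\<tau> \<le> x i) = h") (auto simp: y split: if_splits)
    then show ?thesis by (simp add: z_def)
  qed simp
  have q4: "q < 4 * 2 ^ L" "q + 2 ^ L < 4 * 2 ^ L" "i < 2 ^ L"
    using leaf_simps(5)[OF i, of False] leaf_simps(5)[OF i, of True] i n by (auto simp: q_def leaf_def)
  then have wq: "q < 2 ^ w" "q + 2 ^ L < 2 ^ w" "i < 2 ^ w" "4 * i + 100 < 2 ^ w" using lt by linarith+
  have lf: "leaf L p g i = (if g then q + 2 ^ L else q)" for g by (simp add: q_def leaf_def)
  define s0 where "s0 = pass_change i t s"
  have h0: "holds_input y s0"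
    by (rule tree_state_scratch[OF s[folded y_def]]) (auto simp: s0_def pass_change_def wq tree_state_words[OF s])
  note m0 = h0[unfolded tree_state_def tree_tables_def, THEN conjunct1, THEN conjunct1]
  have T0: "words s0 (4 * i + 65) = q" "words s0 0 = i" "reals s0 0 = t"
    using h0 i by (auto simp: tree_state_def tree_tables_def q_def s0_def pass_change_def)
  define s1 where "s1 = s0\<lparr>words := (words s0)(20 := 4 * i + 65, 21 := q, 22 := q + 2 ^ L), reals := (reals s0)(32 := t)\<rparr>"
  have 1: "runs w (block [WArith 20 Times 3 0, WArith 20 Plus 20 4, WArith 20 Plus 20 1, WLoad 21 20, WArith 22 Plus 21 5,
       RArith 32 RPlus 0 1]) 7 s0 (\<lambda>s'. s' = s1)"
    by (rule runs_mono[OF runs_block[where Q = "\<lambda>s'. s' = s1"]])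
      (use wq T0 in \<open>simp_all add: machine_ok_simps[OF m0] s1_def add.commute\<close>)
  have h1: "holds_input y s1"
    by (rule tree_state_scratch[OF h0]) (use wq in \<open>auto simp: s1_def tree_state_words[OF h0]\<close>)
  note m1 = h1[unfolded tree_state_def tree_tables_def, THEN conjunct1, THEN conjunct1]
  have c1: "words s1 0 = i" "words s1 21 = q" "words s1 22 = q + 2 ^ L" "reals s1 32 = t" "reals s1 0 = t"
    using T0 by (simp_all add: s1_def)
  define s2 where "s2 = s1\<lparr>words := (words s1)(10 := leaf L p (\<not> h) i, 23 := leaf L p h i)\<rparr>"
  define s3 where "s3 = s2\<lparr>reals := (reals s2)(10 := 0)\<rparr>"
  have 2: "runs w (Cond (RLess 0 4) (block [WArith 10 Plus 22 6, WArith 23 Plus 21 6]) (block [WArith 10 Plus 21 6, WArith 23 Plus 22 6]))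
      (Suc 3) s1 (\<lambda>s'. s' = s2)"
  proof (rule runs_Cond)
    show "runs w (block [WArith 10 Plus 22 6, WArith 23 Plus 21 6]) 3 s1 (\<lambda>s'. s' = s2)" if "holds (RLess 0 4) s1"
      using that wq by (intro runs_mono[OF runs_block[where Q = "\<lambda>s'. s' = s2"]])
        (auto simp: machine_ok_simps[OF m1] c1 s2_def lf h_def)
    show "runs w (block [WArith 10 Plus 21 6, WArith 23 Plus 22 6]) 3 s1 (\<lambda>s'. s' = s2)" if "\<not> holds (RLess 0 4) s1"
      using that wq by (intro runs_mono[OF runs_block[where Q = "\<lambda>s'. s' = s2"]])
        (auto simp: machine_ok_simps[OF m1] c1 s2_def lf h_def)
  qed
  have 3: "runs w (block [RArith 10 RPlus 1 1]) 2 s2 (\<lambda>s'. s' = s3)"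
    by (rule runs_mono[OF runs_block[where Q = "\<lambda>s'. s' = s3"]]) (simp_all add: machine_ok_simps[OF m1] s2_def s3_def)
  have h3: "holds_input y s3"
    by (rule tree_state_scratch[OF h1]) (use wq in \<open>auto simp: s3_def s2_def lf tree_state_words[OF h1]\<close>)
  have c3: "words s3 10 = leaf L p (\<not> h) i" "reals s3 10 = 0" "words s3 0 = i" "words s3 23 = leaf L p h i" "reals s3 32 = t"
    using c1 by (simp_all add: s3_def s2_def)
  have 4: "runs w update_leaf (54 * L + 73) s3 (\<lambda>s'. holds_input y1 s' \<and> kept s3 s')"
    unfolding y1_def using sup1 by (intro set_leaf_spec[OF h3 y01 i _ _ _ c3(1-3)]) auto
  have 5: "runs w (Seq (block [WArith 10 Plus 23 6, RArith 10 RPlus 32 1]) update_leaf) (3 + (54 * L + 73)) s4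
      (holds_input (spread L n p \<tau> (x(i := t))))" if "holds_input y1 s4 \<and> kept s3 s4" for s4
  proof -
    have h4: "holds_input y1 s4" and k4: "kept s3 s4" using that by auto
    note m4 = h4[unfolded tree_state_def tree_tables_def, THEN conjunct1, THEN conjunct1]
    have c4: "words s4 0 = i" "words s4 23 = leaf L p h i" "reals s4 32 = t"
      using k4 c3 by (simp_all add: kept_def)
    define s5 where "s5 = s4\<lparr>words := (words s4)(10 := leaf L p h i), reals := (reals s4)(10 := t)\<rparr>"
    have 6: "runs w (block [WArith 10 Plus 23 6, RArith 10 RPlus 32 1]) 3 s4 (\<lambda>s'. s' = s5)"
      by (rule runs_mono[OF runs_block[where Q = "\<lambda>s'. s' = s5"]])
        (use wq in \<open>simp_all add: machine_ok_simps[OF m4] c4 s5_def lf\<close>)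
    have h5: "holds_input y1 s5"
      by (rule tree_state_scratch[OF h4]) (use wq in \<open>auto simp: s5_def lf tree_state_words[OF h4]\<close>)
    have c5: "words s5 10 = leaf L p h i" "reals s5 10 = t" "words s5 0 = i" using c4 by (simp_all add: s5_def)
    have "runs w update_leaf (54 * L + 73) s5 (\<lambda>s'. holds_input (y1(leaf L p h i := t)) s' \<and> kept s5 s')"
      by (rule set_leaf_spec[OF h5 y101 i t sup2 c5])
    then have "runs w update_leaf (54 * L + 73) s5 (holds_input (spread L n p \<tau> (x(i := t))))"
      unfolding fin by (rule runs_mono) auto
    then show ?thesis by (intro runs_SeqI[OF 6]) simp
  qed
  \<comment> \<open>Two passes of \<open>54 * L + 73\<close> steps each, and 16 steps around
    them.\<close>
  have "runs w update (7 + (Suc 3 + (2 + ((54 * L + 73) + (3 + (54 * L + 73)))))) s0 (holds_input (spread L n p \<tau> (x(i := t))))"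
    unfolding update_def
    by (rule runs_SeqI[OF 1], simp only:, rule runs_SeqI[OF 2], simp only:, rule runs_SeqI[OF 3], simp only:,
        rule runs_SeqI[OF 4], rule 5)
  then show ?thesis unfolding s0_def by (rule runs_mono) simp_all
qed

text \<open>The memory is written down address by address: from 64 on, the residue modulo 4 selects
  the field and the quotient the node.\<close>

lemma initial_state:
  fixes z :: "nat \<Rightarrow> real"
  obtains s where "holds_input z s"
proof -
  define W where "W = (\<lambda>a. if a < 64 then if a = 5 then 2 ^ L else if a = 4 then 64 else if a = 3 then 4 else if a = 2 then 2
      else if a = 1 then 1 else 0
    else if (a - 64) mod 4 = 0 then
      if 0 < sm M z ((a - 64) div 4) then label L p (rep M \<theta> z u ((a - 64) div 4)) else 0
    else if (a - 64) mod 4 = 1 \<and> (a - 64) div 4 \<in> {1..n} then leaf L p False ((a - 64) div 4) else 0)"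
  define R where "R = (\<lambda>a. if a < 64 then if a = 5 then 2 else if a = 4 then \<tau> else if a = 3 then \<theta> else if a = 2 then 1 else 0
    else if (a - 64) mod 4 = 0 then sm M z ((a - 64) div 4)
    else if (a - 64) mod 4 = 1 then lofrac (sm M z ((a - 64) div 4))
    else if (a - 64) mod 4 = 2 then key M z u ((a - 64) div 4)
    else if (a - 64) div 4 < M then u ((a - 64) div 4) else gain (u ((a - 64) div 4)))"
  have "label L p v < 2 ^ L" for v
    using permutes_in_image[OF p, of "v mod 2 ^ L"] by (simp add: label_def)
  moreover have "leaf L p False i < 4 * 2 ^ L" if "i \<in> {1..n}" for i
    using leaf_simps(5)[OF that, of False] by simp
  moreover have "(2::nat) ^ L \<ge> 1" by simp
  ultimately have W: "W a < 2 ^ w" for a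
  proof -
    assume *: "\<And>v. label L p v < 2 ^ L" "\<And>i. i \<in> {1..n} \<Longrightarrow> leaf L p False i < 4 * 2 ^ L" "(1::nat) \<le> 2 ^ L"
    have l: "label L p v < 2 ^ w" for v using *(1)[of v] lt by linarith
    have f: "leaf L p False i < 2 ^ w" if "i \<in> {1..n}" for i using *(2)[OF that] lt by linarith
    have "(2::nat) ^ L < 2 ^ w" "(64::nat) < 2 ^ w" "(4::nat) < 2 ^ w" "(2::nat) < 2 ^ w" "(1::nat) < 2 ^ w" "(0::nat) < 2 ^ w"
      using lt by linarith+
    note pw = this
    have br: "(if c then b else b') < m" if "c \<Longrightarrow> b < m" "\<not> c \<Longrightarrow> b' < m" for c and b b' m :: nat
      using that by simp
    show ?thesis unfolding W_def by (intro br pw l f; erule conjunct2)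
  qed
  have d: "(4 * v + 64 - 64) mod 4 = 0" "(4 * v + 64 - 64) div 4 = v" "(4 * v + 65 - 64) mod 4 = 1" "(4 * v + 65 - 64) div 4 = v"
    "(4 * v + 66 - 64) mod 4 = 2" "(4 * v + 66 - 64) div 4 = v" "(4 * v + 67 - 64) mod 4 = 3" "(4 * v + 67 - 64) div 4 = v"
    "\<not> 4 * v + 64 < 64" "\<not> 4 * v + 65 < 64" "\<not> 4 * v + 66 < 64" "\<not> 4 * v + 67 < 64" for v :: nat
    by (simp_all, presburger)
  have W4: "W (4 * v + 64) = (if 0 < sm M z v then label L p (rep M \<theta> z u v) else 0)"
    "W (4 * v + 65) = (if v \<in> {1..n} then leaf L p False v else 0)" for v
    unfolding W_def d by simp_all
  have R4: "R (4 * v + 64) = sm M z v" "R (4 * v + 65) = lofrac (sm M z v)" "R (4 * v + 66) = key M z u v"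
    "R (4 * v + 67) = (if v < M then u v else gain (u v))" for v
    unfolding R_def d by simp_all
  have "machine_ok w \<theta> \<tau> (2 ^ L) \<lparr>words = W, reals = R, outset = label L p ` sample M \<theta> z u\<rparr>"
    using W by (simp add: machine_ok_def) (simp add: W_def R_def)
  then have "holds_input z \<lparr>words = W, reals = R, outset = label L p ` sample M \<theta> z u\<rparr>"
    by (simp add: tree_state_def tree_tables_def tree_node_def W4 R4)
  then show ?thesis by (rule that)
qed

lemma maintains_algo:
  assumes s: "holds_input (spread L n p \<tau> x) s" "x \<in> Delta n k"
    and A: "\<And>x. x \<in> Delta n k \<Longrightarrow> A x = algo L n p \<tau> \<theta> u x" and T: "real (108 * L + 162) \<le> T"
  shows "maintains w update T n k A cs x s"
  using s
proof (induction cs arbitrary: x s)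
  case Nil
  then show ?case by (simp add: A algo_def tree_state_def)
next
  case (Cons c cs)
  obtain i v where c: "c = (i, v)" by (cases c)
  have "\<exists>t s'. exec w update (pass_change i v s) t s' \<and> real t \<le> T \<and> maintains w update T n k A cs (x(i := v)) s'"
    if i: "i \<in> {1..n}" and x': "x(i := v) \<in> Delta n k"
  proof -
    have d: "0 \<le> z j" "z j \<le> 1" if "z \<in> Delta n k" "j \<in> {1..n}" for z j
      using that by (auto simp: Delta_def PiE_iff)
    have "0 \<le> v" "v \<le> 1" using d[OF x' i] by auto
    then have "runs w update (108 * L + 162) (pass_change i v s) (holds_input (spread L n p \<tau> (x(i := v))))"
      using d[OF Cons.prems(2)] i by (intro update_spec[OF Cons.prems(1)]) auto
    then obtain t s' where "exec w update (pass_change i v s) t s'" "t \<le> 108 * L + 162"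
      "holds_input (spread L n p \<tau> (x(i := v))) s'" unfolding runs_def by blast
    moreover from this have "real t \<le> T" using T by linarith
    ultimately show ?thesis using Cons.IH x' by blast
  qed
  moreover have "outset s = A x" using Cons.prems by (simp add: A algo_def tree_state_def)
  ultimately show ?case by (simp add: c)
qed

end

section \<open>Word size, update time and the iterated logarithm\<close>

lemma sampler_update_time:
  assumes n: "n < 2 ^ L" and L: "1 \<le> L" and T: "real (108 * L + 162) \<le> T"
  shows "has_update_time (16 * L) update n k (sampler_dist L n k) T"
  unfolding has_update_time_def
proof (intro ballI)
  fix A x assume A: "A \<in> space (sampler_dist L n k)" and x: "x \<in> Delta n k"
  obtain p \<alpha> \<beta> \<omega> where sd: "(p, \<alpha>, \<beta>, \<omega>) \<in> space (seeds L)" "A = sampler L n k (p, \<alpha>, \<beta>, \<omega>)"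
    using A unfolding space_sampler_dist by auto
  have d: "0 \<le> x i" "x i \<le> 1" if "i \<in> {1..n}" for i using x that by (auto simp: Delta_def PiE_iff)
  interpret placement L n p by (rule seed_tree(1)[OF sd(1) n d])
  interpret tree: sampling_tree "2 * 2 ^ L" "7 / 8 + \<beta> / 8" "spread L n p (1 / 2 + \<alpha> / 4) x" \<omega>
    by (rule seed_tree(2)[OF sd(1) n d])
  interpret m: sampling_machine L n p "7 / 8 + \<beta> / 8" "1 / 2 + \<alpha> / 4" \<omega> "16 * L"
  proof
    show "0 < 1 / 2 + \<alpha> / 4" using sd(1) by (simp add: space_seeds)
    \<comment> \<open>Words of \<open>16 * L\<close> bits exceed \<open>16 * 2 ^ L + 100\<close>
      because \<open>2 ^ (16 * L)\<close> is at least \<open>2 ^ L * 2 ^ 15\<close>, already for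
      \<open>L = 1\<close>.\<close>
    have "(2::nat) ^ 1 \<le> 2 ^ L" by (rule power_increasing) (use L in simp_all)
    then have X: "(2::nat) \<le> 2 ^ L" by simp
    then have "(2::nat) ^ L * 2 ^ 15 \<le> 2 ^ L * (2 ^ L) ^ 15" by (intro mult_le_mono2 power_mono X) simp_all
    also have "\<dots> = 2 ^ (16 * L)" by (simp add: power_mult mult.commute flip: power_Suc)
    finally have "(2::nat) ^ L * 32768 \<le> 2 ^ (16 * L)" by simp
    then show "16 * 2 ^ L + 100 < (2::nat) ^ (16 * L)" using X by linarith
  qed (use tree.theta tree.u01 in auto)
  obtain s where s: "m.holds_input (spread L n p (1 / 2 + \<alpha> / 4) x) s" by (rule m.initial_state)
  have "A y = algo L n p (1 / 2 + \<alpha> / 4) (7 / 8 + \<beta> / 8) \<omega> y" if "y \<in> Delta n k" for y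
    using that by (simp add: sd(2) sampler_def run_def)
  then have "\<forall>cs. maintains (16 * L) update T n k A cs x s" using m.maintains_algo[OF s x _ T] by blast
  then show "\<exists>s. (\<forall>a. words s a < 2 ^ (16 * L)) \<and> (\<forall>cs. maintains (16 * L) update T n k A cs x s)"
    using tree_state_words[OF s] by blast
qed

text \<open>Ensures that the \<open>LEAST\<close> in \<open>log_star\<close> is attained: as
  \<open>Suc m \<le> 2 ^ m\<close>, one logarithm lowers an integral bound by 1.\<close>

lemma log_iterate_le: "x \<le> real m \<Longrightarrow> \<exists>i. (log 2 ^^ i) x \<le> 1"
proof (induction m arbitrary: x)
  case 0
  then have "(log 2 ^^ 0) x \<le> 1" by simp
  then show ?case by blast
next
  case (Suc m)
  show ?case
  proof (cases "x \<le> 1")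
    case True
    then have "(log 2 ^^ 0) x \<le> 1" by simp
    then show ?thesis by blast
  next
    case False
    have "Suc m \<le> 2 ^ m" by (simp add: Suc_le_eq)
    then have "real (Suc m) \<le> 2 ^ m" by (metis of_nat_le_iff of_nat_numeral of_nat_power)
    then have "x \<le> 2 powr real m" using Suc.prems by (simp add: powr_realpow)
    then have "log 2 x \<le> real m" using False by (subst log_le_iff) auto
    then obtain i where "(log 2 ^^ i) (log 2 x) \<le> 1" using Suc.IH by blast
    then have "(log 2 ^^ Suc i) x \<le> 1" by (simp only: funpow_Suc_right comp_apply)
    then show ?thesis by blast
  qed
qed

text \<open>An update takes O(log n) steps, so it fits the claimed time as soon as the second factor
  is at least 1.\<close>

lemma log_star_pos: "2 \<le> n \<Longrightarrow> 1 \<le> log_star n"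
proof (rule ccontr)
  assume n: "2 \<le> n" "\<not> 1 \<le> log_star n"
  have "(log 2 ^^ log_star n) (real n) \<le> 1"
    unfolding log_star_def by (rule LeastI_ex) (rule log_iterate_le[OF order_refl])
  moreover have "log_star n = 0" using n(2) by linarith
  ultimately show False using n(1) by simp
qed

text \<open>One program text serves all \<open>n\<close> and \<open>k\<close>: the size of the tree
  enters through the prepared memory, and the climb stops at node 1 whatever the depth. The constant
  3447 covers both stretch and time.\<close>

theorem theorem3p15:
  shows "\<exists>(C :: real) (c :: nat) (P :: program). \<forall>(n :: nat) (k :: nat).
    n \<ge> 1 \<longrightarrow> k \<ge> 1 \<longrightarrow>
    (\<exists>D. correlated_sampling_algorithm n k D \<and>
         has_stretch n k D (C * max 1 (log 2 (real k))) \<and>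
         has_update_time (word_size c n) P n k D
           (C * max 1 (log 2 (real n) * real (log_star n))))"
proof (intro exI allI impI)
  fix n k :: nat assume n: "1 \<le> n" and k: "1 \<le> k"
  \<comment> \<open>With this \<open>L\<close> the labels \<open>1..n\<close> and the spare label 0
    fit into \<open>2 ^ L\<close> positions, and \<open>word_size 16 n\<close> equals
    \<open>16 * L\<close>.\<close>
  define L where "L = nat \<lceil>log 2 (real n + 1)\<rceil>"
  have l1: "1 \<le> log 2 (real n + 1)" using n by simp
  then have L: "1 \<le> L" unfolding L_def by linarith
  have "real n + 1 = 2 powr log 2 (real n + 1)" by simp
  also have "\<dots> \<le> 2 powr real L" using l1 unfolding L_def by (intro powr_mono) linarith+
  also have "\<dots> = 2 ^ L" by (simp add: powr_realpow)
  finally have "real (Suc n) \<le> real (2 ^ L)" by (simp only: of_nat_Suc of_nat_power of_nat_numeral add.commute)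
  then have nL: "n < 2 ^ L" by (simp only: of_nat_le_iff Suc_le_eq)
  have T: "real (108 * L + 162) \<le> 3447 * max 1 (log 2 (real n) * real (log_star n))"
  proof (cases "n = 1")
    case True
    \<comment> \<open>For \<open>n = 1\<close> the logarithm vanishes, and the maximum with 1 covers
      the constant number of steps.\<close>
    then have "L = 1" by (simp add: L_def)
    then show ?thesis by (simp add: True)
  next
    case False
    then have n2: "2 \<le> n" using n by simp
    let ?l = "log 2 (real n)"
    have l: "1 \<le> ?l" using n2 by simp
    have "log 2 (real n + 1) \<le> log 2 (2 * real n)" using n2 by simp
    also have "\<dots> = 1 + ?l" using n2 by (subst log_mult) simp_all
    finally have "real L \<le> 2 + ?l" using l1 unfolding L_def by linarith
    then have "real (108 * L + 162) \<le> 3447 * ?l" using l by simp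
    also have "?l * 1 \<le> ?l * real (log_star n)" using l log_star_pos[OF n2] by (intro mult_left_mono) simp_all
    then have "3447 * ?l \<le> 3447 * max 1 (?l * real (log_star n))" by simp
    finally show ?thesis .
  qed
  have st: "has_stretch n k (sampler_dist L n k) (3447 * max 1 (log 2 (real k)))"
    unfolding has_stretch_def
  proof (intro ballI)
    fix x y assume xy: "x \<in> Delta n k" "y \<in> Delta n k"
    have "0 \<le> l1_norm n (\<lambda>i. x i - y i)" by (simp add: l1_norm_def sum_nonneg)
    then have "stretch k * l1_norm n (\<lambda>i. x i - y i) \<le> 3447 * max 1 (log 2 (real k)) * l1_norm n (\<lambda>i. x i - y i)"
      by (intro mult_right_mono stretch_le k)
    then show "(\<forall>A \<in> space (sampler_dist L n k). int (card (A x)) \<in> {\<lfloor>l1_norm n x\<rfloor>, \<lceil>l1_norm n x\<rceil>}) \<and>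
        (\<forall>i \<in> {1..n}. measure (sampler_dist L n k) {A \<in> space (sampler_dist L n k). i \<in> A x} = x i) \<and>
        (\<integral>A. real (card (sym_diff (A x) (A y))) \<partial>sampler_dist L n k) \<le> 3447 * max 1 (log 2 (real k)) * l1_norm n (\<lambda>i. x i - y i)"
      using sampler_stretch[OF nL k, unfolded has_stretch_def] xy by (meson order_trans)
  qed
  show "correlated_sampling_algorithm n k (sampler_dist L n k) \<and>
      has_stretch n k (sampler_dist L n k) (3447 * max 1 (log 2 (real k))) \<and>
      has_update_time (word_size 16 n) update n k (sampler_dist L n k) (3447 * max 1 (log 2 (real n) * real (log_star n)))"
    using sampler_correlated[OF nL] st sampler_update_time[OF nL L T] unfolding word_size_def L_def by blast
qed

end
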